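(* Let $q\in(0,1)$, let $n\ge1$, let $\lambda_2,\ldots,\lambda_n$ be complex numbers of modulus one, and let $\beta$ be a $*$-automorphism of $C(\partial B^{2n-1}_q)$ of one of the following two forms: (A) $\beta(t_1)=t_1$ and $\beta(t_j)=\lambda_jt_j$ for $j=2,\ldots,n$; or (B) $\beta(t_1)=-t_1$ and $\beta(t_j)=\lambda_jt_j$ for $j=2,\ldots,n$. Then there exists an isomorphism $$\phi:C(\partial B^{2n}_q)\to C(S^{2n-1}_{q,\beta})$$ such that $\phi(w_1)=f_0+\mathrm{i}f_1$ (with $\mathrm i=\sqrt{-1}$) and $\phi(w_k)=f_k$ for $k=2,\ldots,n$.
   Context: All universal $C^*$-algebras below are unital. Even balls: $C(B^{2n}_q)$ is the universal $C^*$-algebra generated by $z_1,\ldots,z_n$ subject to $z_iz_j=q^{1/2}z_jz_i$ and $z_iz_j^*=q^{-1/2}z_j^*z_i$ for $i<j$, and $z_i^*z_i-qz_iz_i^*=(1-q)(1-\sum_{j=i+1}^nz_jz_j^* )$ for $i=1,\ldots,n$. Let $J_{2n}$ be the closed two-sided ideal generated by $1-\sum_{j=1}^nz_jz_j^*$, $C(\partial B^{2n}_q)=C(B^{2n}_q)/J_{2n}$, and let $w_i$ be the image of $z_i$ in $C(\partial B^{2n}_q)$. Odd balls: $C(B^{2n-1}_q)$ is the universal $C^*$-algebra generated by $x_1,\ldots,x_n$ subject to $x_1=x_1^*$; $x_ix_j=q^{1/2}x_jx_i$ for $i<j$; $x_ix_j^*=q^{-1/2}x_j^*x_i$ for $2\le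 i<j$; $x_i^*x_i-qx_ix_i^*=(1-q)(1-\sum_{j=i+1}^nx_jx_j^* )$ for $i=2,\ldots,n$; and $x_1^2+\sum_{j=2}^nx_jx_j^*\le1$. Let $J_{2n-1}$ be the closed two-sided ideal generated by $1-x_1^2-\sum_{j=2}^nx_jx_j^*$, $C(\partial B^{2n-1}_q)=C(B^{2n-1}_q)/J_{2n-1}$, $\pi:C(B^{2n-1}_q)\to C(\partial B^{2n-1}_q)$ the quotient map, and $t_i=\pi(x_i)$. For any $\lambda_j$ of modulus one, $*$-automorphisms of both forms (A) and (B) exist. Glued sphere: $C(S^{2n-1}_{q,\beta})=\{(x,y)\in C(B^{2n-1}_q)\oplus C(B^{2n-1}_q):\pi(x)=\beta(\pi(y))\}$. Its elements $f_0,\ldots,f_n$ are $$f_0=\Bigl(\bigl(1-x_1^2-\sum_{j=2}^nx_jx_j^*\bigr)^{1/2},\,-\bigl(1-x_1^2-\sum_{j=2}^nx_jx_j^*\bigr)^{1/2}\Bigr),$$ $f_1=(x_1,x_1)$ if $\beta$ is of the form (A) and $f_1=(-x_1,x_1)$ if $\beta$ is of the form (B), and $f_i=(\lambda_ix_i,x_i)$ for $i=2,\ldots,n$. *)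

theory Defs
  imports Complex_Main "HOL-Algebra.QuotRing" "HOL-Algebra.Module"
begin

section \<open>Unital *-algebras and C*-algebras as records\<close>

text \<open>All algebras are complex and unital and live on an explicit carrier; the ring part is
  that of HOL-Algebra.\<close>

record 'a star_alg = "(complex, 'a) module" +
  star :: "'a \<Rightarrow> 'a"

record 'a cstar_alg = "'a star_alg" +
  nrm :: "'a \<Rightarrow> real"

definition star_hom :: "('a, 'c) star_alg_scheme \<Rightarrow> ('b, 'd) star_alg_scheme \<Rightarrow> ('a \<Rightarrow> 'b) \<Rightarrow> bool" where
  "star_hom A B f \<longleftrightarrow>
     f \<in> ring_hom A B \<and>
     (\<forall>c. \<forall>x \<in> carrier A. f (c \<odot>\<^bsub>A\<^esub> x) = c \<odot>\<^bsub>B\<^esub> f x) \<and>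
     (\<forall>x \<in> carrier A. f (star A x) = star B (f x))"

text \<open>Isomorphisms of C*-algebras are bijective unital *-homomorphisms (between C*-algebras
  these are automatically isometric); a *-automorphism of \<open>A\<close> is a \<open>star_iso A A\<close>.\<close>

definition star_iso :: "('a, 'c) star_alg_scheme \<Rightarrow> ('b, 'd) star_alg_scheme \<Rightarrow> ('a \<Rightarrow> 'b) \<Rightarrow> bool" where
  "star_iso A B f \<longleftrightarrow> star_hom A B f \<and> bij_betw f (carrier A) (carrier B)"

definition spectrum :: "('a, 'c) star_alg_scheme \<Rightarrow> 'a \<Rightarrow> complex set" where
  "spectrum A a = {z. z \<odot>\<^bsub>A\<^esub> \<one>\<^bsub>A\<^esub> \<ominus>\<^bsub>A\<^esub> a \<notin> Units A}"

definition positive :: "('a, 'c) star_alg_scheme \<Rightarrow> 'a \<Rightarrow> bool" where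
  "positive A a \<longleftrightarrow> a \<in> carrier A \<and> star A a = a \<and> spectrum A a \<subseteq> complex_of_real ` {0..}"

definition star_le :: "('a, 'c) star_alg_scheme \<Rightarrow> 'a \<Rightarrow> 'a \<Rightarrow> bool" where
  "star_le A a b \<longleftrightarrow> positive A (b \<ominus>\<^bsub>A\<^esub> a)"

text \<open>The square root of a positive element is its unique positive square root.\<close>

definition pos_sqrt :: "('a, 'c) star_alg_scheme \<Rightarrow> 'a \<Rightarrow> 'a" where
  "pos_sqrt A a = (THE b. positive A b \<and> b \<otimes>\<^bsub>A\<^esub> b = a)"


section \<open>Universal C*-algebras\<close>

text \<open>The free unital *-algebra on the set \<open>G\<close>: finitely supported complex-valued functions on
  the words in the letters \<open>(g, False)\<close>, standing for the generator \<open>g\<close>, and \<open>(g, True)\<close>,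
  standing for its adjoint. Multiplication is bilinear extension of concatenation.\<close>

type_synonym 'g free = "('g \<times> bool) list \<Rightarrow> complex"

definition free_alg :: "'g set \<Rightarrow> 'g free star_alg" where
  "free_alg G =
    \<lparr> carrier = {f. finite {w. f w \<noteq> 0} \<and> {w. f w \<noteq> 0} \<subseteq> lists (G \<times> UNIV)},
      mult = (\<lambda>f g w. \<Sum>k\<le>length w. f (take k w) * g (drop k w)),
      one = (\<lambda>w. if w = [] then 1 else 0),
      zero = (\<lambda>w. 0),
      add = (\<lambda>f g w. f w + g w),
      smult = (\<lambda>c f w. c * f w),
      star = (\<lambda>f w. cnj (f (rev (map (\<lambda>(g, b). (g, \<not> b)) w)))) \<rparr>"

definition free_gen :: "'g \<Rightarrow> 'g free" where
  "free_gen g = (\<lambda>w. if w = [(g, False)] then 1 else 0)"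

definition cstar_seminorm :: "('a, 'c) star_alg_scheme \<Rightarrow> ('a \<Rightarrow> real) \<Rightarrow> bool" where
  "cstar_seminorm A p \<longleftrightarrow>
     (\<forall>x \<in> carrier A. \<forall>y \<in> carrier A. p (x \<oplus>\<^bsub>A\<^esub> y) \<le> p x + p y \<and> p (x \<otimes>\<^bsub>A\<^esub> y) \<le> p x * p y) \<and>
     (\<forall>c. \<forall>x \<in> carrier A. p (c \<odot>\<^bsub>A\<^esub> x) = cmod c * p x) \<and>
     (\<forall>x \<in> carrier A. 0 \<le> p x \<and> p (star A x \<otimes>\<^bsub>A\<^esub> x) = (p x)\<^sup>2)"

text \<open>The separated completion of a *-algebra with respect to a seminorm \<open>p\<close>. Its elements are
  the classes of \<open>p\<close>-Cauchy sequences modulo \<open>p\<close>-null sequences; \<open>completion_emb\<close> is the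
  canonical map, given by the classes of constant sequences.\<close>

definition p_cauchy :: "('a, 'c) star_alg_scheme \<Rightarrow> ('a \<Rightarrow> real) \<Rightarrow> (nat \<Rightarrow> 'a) set" where
  "p_cauchy A p = {s. (\<forall>k. s k \<in> carrier A) \<and>
     (\<forall>e>0. \<exists>M. \<forall>k\<ge>M. \<forall>l\<ge>M. p (s k \<ominus>\<^bsub>A\<^esub> s l) < e)}"

definition p_class :: "('a, 'c) star_alg_scheme \<Rightarrow> ('a \<Rightarrow> real) \<Rightarrow> (nat \<Rightarrow> 'a) \<Rightarrow> (nat \<Rightarrow> 'a) set" where
  "p_class A p s = {t \<in> p_cauchy A p. (\<lambda>k. p (t k \<ominus>\<^bsub>A\<^esub> s k)) \<longlonglongrightarrow> 0}"

definition completion :: "('a, 'c) star_alg_scheme \<Rightarrow> ('a \<Rightarrow> real) \<Rightarrow> (nat \<Rightarrow> 'a) set cstar_alg" where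
  "completion A p =
    \<lparr> carrier = p_class A p ` p_cauchy A p,
      mult = (\<lambda>X Y. \<Union>s\<in>X. \<Union>t\<in>Y. p_class A p (\<lambda>k. s k \<otimes>\<^bsub>A\<^esub> t k)),
      one = p_class A p (\<lambda>k. \<one>\<^bsub>A\<^esub>),
      zero = p_class A p (\<lambda>k. \<zero>\<^bsub>A\<^esub>),
      add = (\<lambda>X Y. \<Union>s\<in>X. \<Union>t\<in>Y. p_class A p (\<lambda>k. s k \<oplus>\<^bsub>A\<^esub> t k)),
      smult = (\<lambda>c X. \<Union>s\<in>X. p_class A p (\<lambda>k. c \<odot>\<^bsub>A\<^esub> s k)),
      star = (\<lambda>X. \<Union>s\<in>X. p_class A p (\<lambda>k. star A (s k))),
      nrm = (\<lambda>X. THE r. \<forall>s\<in>X. (\<lambda>k. p (s k)) \<longlonglongrightarrow> r) \<rparr>"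

definition completion_emb :: "('a, 'c) star_alg_scheme \<Rightarrow> ('a \<Rightarrow> real) \<Rightarrow> 'a \<Rightarrow> (nat \<Rightarrow> 'a) set" where
  "completion_emb A p a = p_class A p (\<lambda>k. a)"

text \<open>Relations \<open>R\<close> on generators indexed by \<open>G\<close> are given as a predicate on a C*-algebra and a
  family of its elements. A C*-seminorm on the free *-algebra is admissible if the generators
  satisfy \<open>R\<close> in the C*-algebra obtained by separation and completion; these are the seminorms
  \<open>a \<mapsto> \<parallel>a(b)\<parallel>\<close> for families \<open>b\<close> satisfying \<open>R\<close> in some unital C*-algebra
  (the zero algebra included, so that \<open>0\<close> is admissible). The universal C*-algebra is
  the completion for the supremum of all admissible seminorms; the supremum is meaningful
  whenever \<open>R\<close> bounds the norms of the generators, as all the relations below do.\<close>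

type_synonym 'g univ_elem = "(nat \<Rightarrow> 'g free) set"

definition admissible ::
  "'g set \<Rightarrow> ('g univ_elem cstar_alg \<Rightarrow> ('g \<Rightarrow> 'g univ_elem) \<Rightarrow> bool) \<Rightarrow> ('g free \<Rightarrow> real) \<Rightarrow> bool" where
  "admissible G R p \<longleftrightarrow>
     cstar_seminorm (free_alg G) p \<and>
     R (completion (free_alg G) p) (\<lambda>g. completion_emb (free_alg G) p (free_gen g))"

definition univ_norm ::
  "'g set \<Rightarrow> ('g univ_elem cstar_alg \<Rightarrow> ('g \<Rightarrow> 'g univ_elem) \<Rightarrow> bool) \<Rightarrow> 'g free \<Rightarrow> real" where
  "univ_norm G R a = (SUP p \<in> {p. admissible G R p}. p a)"

definition univ_cstar ::
  "'g set \<Rightarrow> ('g univ_elem cstar_alg \<Rightarrow> ('g \<Rightarrow> 'g univ_elem) \<Rightarrow> bool) \<Rightarrow> 'g univ_elem cstar_alg" where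
  "univ_cstar G R = completion (free_alg G) (univ_norm G R)"

definition univ_gen ::
  "'g set \<Rightarrow> ('g univ_elem cstar_alg \<Rightarrow> ('g \<Rightarrow> 'g univ_elem) \<Rightarrow> bool) \<Rightarrow> 'g \<Rightarrow> 'g univ_elem" where
  "univ_gen G R g = completion_emb (free_alg G) (univ_norm G R) (free_gen g)"


section \<open>Closed ideals, quotients and direct sums\<close>

definition norm_closed :: "('a, 'c) cstar_alg_scheme \<Rightarrow> 'a set \<Rightarrow> bool" where
  "norm_closed A S \<longleftrightarrow>
     (\<forall>a \<in> carrier A. (\<forall>e>0. \<exists>b\<in>S. nrm A (a \<ominus>\<^bsub>A\<^esub> b) < e) \<longrightarrow> a \<in> S)"

definition closed_ideal_gen :: "('a, 'c) cstar_alg_scheme \<Rightarrow> 'a \<Rightarrow> 'a set" where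
  "closed_ideal_gen A a = \<Inter>{I. ideal I A \<and> norm_closed A I \<and> a \<in> I}"

text \<open>The quotient by a closed two-sided ideal (automatically a *-ideal), with the quotient
  norm. The quotient map is \<open>x \<mapsto> J +> x\<close>.\<close>

definition cstar_quot :: "('a, 'c) cstar_alg_scheme \<Rightarrow> 'a set \<Rightarrow> 'a set cstar_alg" where
  "cstar_quot A J =
    \<lparr> carrier = carrier (A Quot J),
      mult = mult (A Quot J),
      one = one (A Quot J),
      zero = zero (A Quot J),
      add = add (A Quot J),
      smult = (\<lambda>c X. \<Union>x\<in>X. J +>\<^bsub>A\<^esub> (c \<odot>\<^bsub>A\<^esub> x)),
      star = (\<lambda>X. star A ` X),
      nrm = (\<lambda>X. Inf (nrm A ` X)) \<rparr>"

definition cstar_sum :: "('a, 'c) cstar_alg_scheme \<Rightarrow> ('b, 'd) cstar_alg_scheme \<Rightarrow> ('a \<times> 'b) cstar_alg" where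
  "cstar_sum A B =
    \<lparr> carrier = carrier A \<times> carrier B,
      mult = (\<lambda>(a, b) (a', b'). (a \<otimes>\<^bsub>A\<^esub> a', b \<otimes>\<^bsub>B\<^esub> b')),
      one = (\<one>\<^bsub>A\<^esub>, \<one>\<^bsub>B\<^esub>),
      zero = (\<zero>\<^bsub>A\<^esub>, \<zero>\<^bsub>B\<^esub>),
      add = (\<lambda>(a, b) (a', b'). (a \<oplus>\<^bsub>A\<^esub> a', b \<oplus>\<^bsub>B\<^esub> b')),
      smult = (\<lambda>c (a, b). (c \<odot>\<^bsub>A\<^esub> a, c \<odot>\<^bsub>B\<^esub> b)),
      star = (\<lambda>(a, b). (star A a, star B b)),
      nrm = (\<lambda>(a, b). max (nrm A a) (nrm B b)) \<rparr>"


section \<open>Even quantum balls\<close>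

definition even_ball_rel :: "real \<Rightarrow> nat \<Rightarrow> 'a cstar_alg \<Rightarrow> (nat \<Rightarrow> 'a) \<Rightarrow> bool" where
  "even_ball_rel q n A z \<longleftrightarrow>
     (\<forall>i j. 1 \<le> i \<and> i < j \<and> j \<le> n \<longrightarrow>
        z i \<otimes>\<^bsub>A\<^esub> z j = complex_of_real (q powr (1/2)) \<odot>\<^bsub>A\<^esub> (z j \<otimes>\<^bsub>A\<^esub> z i) \<and>
        z i \<otimes>\<^bsub>A\<^esub> star A (z j) = complex_of_real (q powr (-1/2)) \<odot>\<^bsub>A\<^esub> (star A (z j) \<otimes>\<^bsub>A\<^esub> z i)) \<and>
     (\<forall>i \<in> {1..n}.
        star A (z i) \<otimes>\<^bsub>A\<^esub> z i \<ominus>\<^bsub>A\<^esub> complex_of_real q \<odot>\<^bsub>A\<^esub> (z i \<otimes>\<^bsub>A\<^esub> star A (z i)) =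
        complex_of_real (1 - q) \<odot>\<^bsub>A\<^esub>
          (\<one>\<^bsub>A\<^esub> \<ominus>\<^bsub>A\<^esub> (\<Oplus>\<^bsub>A\<^esub>j\<in>{i+1..n}. z j \<otimes>\<^bsub>A\<^esub> star A (z j))))"

definition even_ball :: "real \<Rightarrow> nat \<Rightarrow> nat univ_elem cstar_alg" where
  "even_ball q n = univ_cstar {1..n} (even_ball_rel q n)"

definition z_gen :: "real \<Rightarrow> nat \<Rightarrow> nat \<Rightarrow> nat univ_elem" where
  "z_gen q n = univ_gen {1..n} (even_ball_rel q n)"

definition even_ideal :: "real \<Rightarrow> nat \<Rightarrow> nat univ_elem set" where
  "even_ideal q n = (let A = even_ball q n; z = z_gen q n in
     closed_ideal_gen A (\<one>\<^bsub>A\<^esub> \<ominus>\<^bsub>A\<^esub> (\<Oplus>\<^bsub>A\<^esub>j\<in>{1..n}. z j \<otimes>\<^bsub>A\<^esub> star A (z j))))"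

definition even_boundary :: "real \<Rightarrow> nat \<Rightarrow> nat univ_elem set cstar_alg" where
  "even_boundary q n = cstar_quot (even_ball q n) (even_ideal q n)"

definition w_gen :: "real \<Rightarrow> nat \<Rightarrow> nat \<Rightarrow> nat univ_elem set" where
  "w_gen q n i = even_ideal q n +>\<^bsub>even_ball q n\<^esub> z_gen q n i"


section \<open>Odd quantum balls\<close>

definition odd_ball_rel :: "real \<Rightarrow> nat \<Rightarrow> 'a cstar_alg \<Rightarrow> (nat \<Rightarrow> 'a) \<Rightarrow> bool" where
  "odd_ball_rel q n A x \<longleftrightarrow>
     star A (x 1) = x 1 \<and>
     (\<forall>i j. 1 \<le> i \<and> i < j \<and> j \<le> n \<longrightarrow>
        x i \<otimes>\<^bsub>A\<^esub> x j = complex_of_real (q powr (1/2)) \<odot>\<^bsub>A\<^esub> (x j \<otimes>\<^bsub>A\<^esub> x i)) \<and>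
     (\<forall>i j. 2 \<le> i \<and> i < j \<and> j \<le> n \<longrightarrow>
        x i \<otimes>\<^bsub>A\<^esub> star A (x j) = complex_of_real (q powr (-1/2)) \<odot>\<^bsub>A\<^esub> (star A (x j) \<otimes>\<^bsub>A\<^esub> x i)) \<and>
     (\<forall>i \<in> {2..n}.
        star A (x i) \<otimes>\<^bsub>A\<^esub> x i \<ominus>\<^bsub>A\<^esub> complex_of_real q \<odot>\<^bsub>A\<^esub> (x i \<otimes>\<^bsub>A\<^esub> star A (x i)) =
        complex_of_real (1 - q) \<odot>\<^bsub>A\<^esub>
          (\<one>\<^bsub>A\<^esub> \<ominus>\<^bsub>A\<^esub> (\<Oplus>\<^bsub>A\<^esub>j\<in>{i+1..n}. x j \<otimes>\<^bsub>A\<^esub> star A (x j)))) \<and>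
     star_le A (x 1 \<otimes>\<^bsub>A\<^esub> x 1 \<oplus>\<^bsub>A\<^esub> (\<Oplus>\<^bsub>A\<^esub>j\<in>{2..n}. x j \<otimes>\<^bsub>A\<^esub> star A (x j))) \<one>\<^bsub>A\<^esub>"

definition odd_ball :: "real \<Rightarrow> nat \<Rightarrow> nat univ_elem cstar_alg" where
  "odd_ball q n = univ_cstar {1..n} (odd_ball_rel q n)"

definition x_gen :: "real \<Rightarrow> nat \<Rightarrow> nat \<Rightarrow> nat univ_elem" where
  "x_gen q n = univ_gen {1..n} (odd_ball_rel q n)"

definition odd_defect :: "real \<Rightarrow> nat \<Rightarrow> nat univ_elem" where
  "odd_defect q n = (let A = odd_ball q n; x = x_gen q n in
     \<one>\<^bsub>A\<^esub> \<ominus>\<^bsub>A\<^esub> x 1 \<otimes>\<^bsub>A\<^esub> x 1 \<ominus>\<^bsub>A\<^esub> (\<Oplus>\<^bsub>A\<^esub>j\<in>{2..n}. x j \<otimes>\<^bsub>A\<^esub> star A (x j)))"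

definition odd_ideal :: "real \<Rightarrow> nat \<Rightarrow> nat univ_elem set" where
  "odd_ideal q n = closed_ideal_gen (odd_ball q n) (odd_defect q n)"

definition odd_boundary :: "real \<Rightarrow> nat \<Rightarrow> nat univ_elem set cstar_alg" where
  "odd_boundary q n = cstar_quot (odd_ball q n) (odd_ideal q n)"

definition odd_proj :: "real \<Rightarrow> nat \<Rightarrow> nat univ_elem \<Rightarrow> nat univ_elem set" where
  "odd_proj q n x = odd_ideal q n +>\<^bsub>odd_ball q n\<^esub> x"

definition t_gen :: "real \<Rightarrow> nat \<Rightarrow> nat \<Rightarrow> nat univ_elem set" where
  "t_gen q n i = odd_proj q n (x_gen q n i)"


section \<open>Glued quantum spheres\<close>

definition form_A ::
  "real \<Rightarrow> nat \<Rightarrow> (nat \<Rightarrow> complex) \<Rightarrow> (nat univ_elem set \<Rightarrow> nat univ_elem set) \<Rightarrow> bool" where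
  "form_A q n l \<beta> \<longleftrightarrow>
     \<beta> (t_gen q n 1) = t_gen q n 1 \<and>
     (\<forall>j \<in> {2..n}. \<beta> (t_gen q n j) = l j \<odot>\<^bsub>odd_boundary q n\<^esub> t_gen q n j)"

definition form_B ::
  "real \<Rightarrow> nat \<Rightarrow> (nat \<Rightarrow> complex) \<Rightarrow> (nat univ_elem set \<Rightarrow> nat univ_elem set) \<Rightarrow> bool" where
  "form_B q n l \<beta> \<longleftrightarrow>
     \<beta> (t_gen q n 1) = \<ominus>\<^bsub>odd_boundary q n\<^esub> t_gen q n 1 \<and>
     (\<forall>j \<in> {2..n}. \<beta> (t_gen q n j) = l j \<odot>\<^bsub>odd_boundary q n\<^esub> t_gen q n j)"

definition glued_sphere ::
  "real \<Rightarrow> nat \<Rightarrow> (nat univ_elem set \<Rightarrow> nat univ_elem set) \<Rightarrow> (nat univ_elem \<times> nat univ_elem) cstar_alg" where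
  "glued_sphere q n \<beta> = (cstar_sum (odd_ball q n) (odd_ball q n))
     \<lparr> carrier := {(x, y). x \<in> carrier (odd_ball q n) \<and> y \<in> carrier (odd_ball q n) \<and>
                          odd_proj q n x = \<beta> (odd_proj q n y)} \<rparr>"

definition f_zero :: "real \<Rightarrow> nat \<Rightarrow> nat univ_elem \<times> nat univ_elem" where
  "f_zero q n = (let A = odd_ball q n; s = pos_sqrt A (odd_defect q n) in (s, \<ominus>\<^bsub>A\<^esub> s))"

definition f_one_A :: "real \<Rightarrow> nat \<Rightarrow> nat univ_elem \<times> nat univ_elem" where
  "f_one_A q n = (x_gen q n 1, x_gen q n 1)"

definition f_one_B :: "real \<Rightarrow> nat \<Rightarrow> nat univ_elem \<times> nat univ_elem" where
  "f_one_B q n = (\<ominus>\<^bsub>odd_ball q n\<^esub> x_gen q n 1, x_gen q n 1)"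

definition f_gen :: "real \<Rightarrow> nat \<Rightarrow> (nat \<Rightarrow> complex) \<Rightarrow> nat \<Rightarrow> nat univ_elem \<times> nat univ_elem" where
  "f_gen q n l i = (l i \<odot>\<^bsub>odd_ball q n\<^esub> x_gen q n i, x_gen q n i)"

end

theory Submission
  imports Defs
begin

text \<open>
The classical picture is this. The unit sphere in \<open>\<complex>\<^sup>n\<close> is the union of the hemispheres
\<open>Re w\<^sub>1 \<ge> 0\<close> and \<open>Re w\<^sub>1 \<le> 0\<close>. Forgetting \<open>Re w\<^sub>1\<close> identifies either of them with a ball of
dimension \<open>2n - 1\<close>, and the sphere is recovered by gluing the two balls along their boundary
\<open>Re w\<^sub>1 = 0\<close>. The proof expresses each step by generators and relations. Let \<open>E\<close> be the boundary
of the even ball, \<open>B\<close> the odd ball, \<open>a\<close> and \<open>b\<close> the real and imaginary part of \<open>w\<^sub>1\<close>, and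
\<open>s = \<surd>(1 - x\<^sub>1\<^sup>2 - \<Sum>x\<^sub>jx\<^sub>j\<^sup>*)\<close> in \<open>B\<close>.

In \<open>B\<close>, the elements \<open>\<plusminus>s \<plusminus> \<i>x\<^sub>1, l\<^sub>2x\<^sub>2, \<dots>, l\<^sub>nx\<^sub>n\<close> satisfy the relations of \<open>E\<close> (\<open>sphere_tuple_rel\<close>).
This gives homomorphisms \<open>F\<^sub>1, F\<^sub>2 : E \<rightarrow> B\<close>, the restrictions to the two hemispheres, and they are
the components of the isomorphism. Conversely \<open>b\<close> and \<open>w\<^sub>2, \<dots>, w\<^sub>n\<close> satisfy the relations of \<open>B\<close>, and
the defect \<open>1 - b\<^sup>2 - \<Sum>w\<^sub>jw\<^sub>j\<^sup>*\<close> is \<open>a\<^sup>2\<close> (\<open>ball_tuple_rel\<close>). Up to signs and phases this gives folding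
maps \<open>\<psi>\<^sub>i : B \<rightarrow> E\<close> with \<open>F\<^sub>i \<circ> \<psi>\<^sub>i = id\<close> (\<open>F_psi\<close>).

Injectivity. Up to a scalar, \<open>w\<^sub>1 - \<psi>\<^sub>i(F\<^sub>i(w\<^sub>1))\<close> is \<open>\<bar>a\<bar> - a\<close> for \<open>i = 1\<close> and \<open>\<bar>a\<bar> + a\<close> for \<open>i = 2\<close>, and the
other generators are fixed by \<open>\<psi>\<^sub>i \<circ> F\<^sub>i\<close>. So \<open>c - \<psi>\<^sub>i(F\<^sub>i(c))\<close> lies in the closed ideal generated by
that element (\<open>retract_ideal\<close>). All generators commute with \<open>\<bar>a\<bar> \<plusminus> a\<close> up to scalars, whence
\<open>(\<bar>a\<bar> - a) E (\<bar>a\<bar> + a) = 0\<close> (\<open>parts_annihilate\<close>). If \<open>F\<^sub>1(c) = F\<^sub>2(c) = 0\<close>, then \<open>c\<^sup>*c\<close> is a product of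
elements of the two ideals, and \<open>c = 0\<close>. An injective homomorphism of C*-algebras is isometric
(\<open>jointly_injective_isometric\<close>).

Image. Over the boundary \<open>s\<close> vanishes, and \<open>F\<^sub>1\<close> and \<open>F\<^sub>2\<close> then differ exactly by the sign and the
phases of \<open>\<beta>\<close> (\<open>boundary_agrees\<close>). Given a pair \<open>(y, y')\<close> that matches over the boundary,
\<open>y - F\<^sub>1(\<psi>\<^sub>2(y'))\<close> lies in the ideal of \<open>s\<^sup>2\<close>, which is the closure of \<open>B s\<^sup>2\<close> because \<open>s\<^sup>2\<close> commutes with
the generators up to scalars. For \<open>v = (\<bar>a\<bar> + a)/2\<close> one has \<open>F\<^sub>1(v) = s\<close> and \<open>F\<^sub>2(v) = 0\<close>, so \<open>b s\<^sup>2\<close> is the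
image of \<open>\<psi>\<^sub>1(b) v\<^sup>2\<close>; since the map is isometric, limits of such elements are also reached
(\<open>hemispheres_surjective\<close>).

The C*-algebra theory behind this is obtained without functional calculus and without
representations, from two facts. For \<open>\<parallel>y\<parallel> \<le> 1\<close> the iteration \<open>b \<mapsto> (y + b\<^sup>2)/2\<close> produces \<open>\<surd>(1 - y)\<close>,
with norm estimates and commutation properties (\<open>rt_square\<close>, \<open>rt_norm\<close>, \<open>rt_intertwine\<close>); and for
commuting self-adjoint \<open>a, b\<close> one has \<open>\<parallel>a\<parallel>\<^sup>2 \<le> \<parallel>a\<^sup>2 + b\<^sup>2\<parallel>\<close>, since \<open>a\<close> is the real part of the
normal element \<open>a + \<i>b\<close> (\<open>p_square_le_sum\<close>). They turn positivity into the norm condition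
\<open>\<parallel>M - a\<parallel> \<le> M\<close> (\<open>positive_norm_le\<close>, \<open>positive_iff_norm\<close>), and they give contractivity of
homomorphisms and the C*-identity of quotient norms. As positivity is a norm condition, the
universal algebras satisfy their defining relations, including the inequality for the odd ball,
and have the universal property (\<open>even_ball_universal\<close>, \<open>odd_ball_universal\<close>).\<close>

section \<open>Unital *-algebras and C*-seminorms\<close>

locale star_algebra = ring A for A :: "('a, 'm) star_alg_scheme" (structure) +
  assumes smult_closed [simp, intro]: "x \<in> carrier A \<Longrightarrow> c \<odot> x \<in> carrier A"
    and smult_add_left: "x \<in> carrier A \<Longrightarrow> (c + d) \<odot> x = c \<odot> x \<oplus> d \<odot> x"
    and smult_add_right: "\<lbrakk>x \<in> carrier A; y \<in> carrier A\<rbrakk> \<Longrightarrow> c \<odot> (x \<oplus> y) = c \<odot> x \<oplus> c \<odot> y"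
    and smult_smult [simp]: "x \<in> carrier A \<Longrightarrow> c \<odot> (d \<odot> x) = (c * d) \<odot> x"
    and smult_1 [simp]: "x \<in> carrier A \<Longrightarrow> 1 \<odot> x = x"
    and smult_mult_left [simp]:
      "\<lbrakk>x \<in> carrier A; y \<in> carrier A\<rbrakk> \<Longrightarrow> (c \<odot> x) \<otimes> y = c \<odot> (x \<otimes> y)"
    and smult_mult_right [simp]:
      "\<lbrakk>x \<in> carrier A; y \<in> carrier A\<rbrakk> \<Longrightarrow> x \<otimes> (c \<odot> y) = c \<odot> (x \<otimes> y)"
    and star_closed [simp, intro]: "x \<in> carrier A \<Longrightarrow> star A x \<in> carrier A"
    and star_star [simp]: "x \<in> carrier A \<Longrightarrow> star A (star A x) = x"
    and star_add [simp]:
      "\<lbrakk>x \<in> carrier A; y \<in> carrier A\<rbrakk> \<Longrightarrow> star A (x \<oplus> y) = star A x \<oplus> star A y"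
    and star_mult [simp]:
      "\<lbrakk>x \<in> carrier A; y \<in> carrier A\<rbrakk> \<Longrightarrow> star A (x \<otimes> y) = star A y \<otimes> star A x"
    and star_smult [simp]: "x \<in> carrier A \<Longrightarrow> star A (c \<odot> x) = cnj c \<odot> star A x"
begin

lemma smult_0 [simp]: "x \<in> carrier A \<Longrightarrow> 0 \<odot> x = \<zero>"
  using smult_add_left[of x 0 0] by (metis add.l_cancel_one' add_0 smult_closed)

lemma smult_zero [simp]: "c \<odot> \<zero> = \<zero>"
  using smult_add_right[of \<zero> \<zero> c] by (metis add.l_cancel_one' l_zero smult_closed zero_closed)

lemma minus_smult: "x \<in> carrier A \<Longrightarrow> \<ominus> x = (-1) \<odot> x"
  by (rule minus_equality) (use smult_add_left[of x "-1" 1] in simp_all)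

lemma diff_smult: "\<lbrakk>x \<in> carrier A; y \<in> carrier A\<rbrakk> \<Longrightarrow> x \<ominus> y = x \<oplus> (-1) \<odot> y"
  by (simp add: minus_eq minus_smult)

lemma smult_minus: "x \<in> carrier A \<Longrightarrow> c \<odot> (\<ominus> x) = \<ominus> (c \<odot> x)"
  by (simp add: minus_smult)

lemma minus_smult_left: "x \<in> carrier A \<Longrightarrow> (- c) \<odot> x = \<ominus> (c \<odot> x)"
  by (simp add: minus_smult)

lemma smult_diff: "\<lbrakk>x \<in> carrier A; y \<in> carrier A\<rbrakk> \<Longrightarrow> c \<odot> (x \<ominus> y) = c \<odot> x \<ominus> c \<odot> y"
  by (simp add: minus_eq smult_add_right smult_minus)

lemma smult_diff_left: "x \<in> carrier A \<Longrightarrow> (c - d) \<odot> x = c \<odot> x \<ominus> d \<odot> x"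
  using smult_add_left[of x c "- d"] by (simp add: minus_eq minus_smult_left)

lemma star_zero [simp]: "star A \<zero> = \<zero>"
  using star_smult[of \<zero> 0] by simp

lemma star_one [simp]: "star A \<one> = \<one>"
  using star_mult[of "star A \<one>" \<one>] by simp

lemma star_minus [simp]: "x \<in> carrier A \<Longrightarrow> star A (\<ominus> x) = \<ominus> star A x"
  by (simp add: minus_smult)

lemma star_diff [simp]:
  "\<lbrakk>x \<in> carrier A; y \<in> carrier A\<rbrakk> \<Longrightarrow> star A (x \<ominus> y) = star A x \<ominus> star A y"
  by (simp add: minus_eq)

lemma l_diff_distr:
  "\<lbrakk>x \<in> carrier A; y \<in> carrier A; z \<in> carrier A\<rbrakk> \<Longrightarrow> (x \<ominus> y) \<otimes> z = x \<otimes> z \<ominus> y \<otimes> z"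
  by (simp add: minus_eq l_distr l_minus)

lemma r_diff_distr:
  "\<lbrakk>x \<in> carrier A; y \<in> carrier A; z \<in> carrier A\<rbrakk> \<Longrightarrow> z \<otimes> (x \<ominus> y) = z \<otimes> x \<ominus> z \<otimes> y"
  by (simp add: minus_eq r_distr r_minus)

lemma diff_0_iff: "\<lbrakk>x \<in> carrier A; y \<in> carrier A\<rbrakk> \<Longrightarrow> x \<ominus> y = \<zero> \<longleftrightarrow> x = y"
  by (metis minus_eq r_neg minus_equality minus_minus a_inv_closed)

text \<open>With these rules the \<open>algebra\<close> method also normalises scalar multiples and adjoints.\<close>

lemmas star_algebra_simprules
  [algebra ring "zero A" "add A" "a_inv A" "a_minus A" "one A" "mult A"] =
  smult_closed star_closed smult_add_right smult_mult_left smult_mult_right smult_minus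
  minus_smult_left smult_smult smult_1 star_add star_mult star_minus star_star star_smult
  star_zero star_one r_one

lemmas expand_simps = l_distr r_distr minus_smult_left l_minus r_minus minus_eq minus_add smult_add_right
  smult_minus m_assoc

lemma star_finsum:
  "f \<in> I \<rightarrow> carrier A \<Longrightarrow> star A (\<Oplus>i\<in>I. f i) = (\<Oplus>i\<in>I. star A (f i))"
proof (induction I rule: infinite_finite_induct)
  case (insert i I)
  then show ?case by (simp add: finsum_insert Pi_iff)
qed auto

lemma smult_finsum:
  "f \<in> I \<rightarrow> carrier A \<Longrightarrow> c \<odot> (\<Oplus>i\<in>I. f i) = (\<Oplus>i\<in>I. c \<odot> f i)"
proof (induction I rule: infinite_finite_induct)
  case (insert i I)
  then show ?case by (simp add: finsum_insert Pi_iff smult_add_right)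
qed auto

text \<open>The mixed terms of \<open>(a \<mp> \<i>b)(a \<plusminus> \<i>b)\<close> cancel because \<open>a\<close> and \<open>b\<close> commute; so \<open>a + \<i>b\<close> is normal.\<close>

lemma normal_square:
  assumes [simp]: "a \<in> carrier A" "b \<in> carrier A" and "star A a = a" "star A b = b"
    and comm: "a \<otimes> b = b \<otimes> a"
  shows "star A (a \<oplus> \<i> \<odot> b) \<otimes> (a \<oplus> \<i> \<odot> b) = a \<otimes> a \<oplus> b \<otimes> b"
    and "(a \<oplus> \<i> \<odot> b) \<otimes> star A (a \<oplus> \<i> \<odot> b) = a \<otimes> a \<oplus> b \<otimes> b"
proof -
  have "(a \<oplus> \<i> \<odot> b) \<otimes> (a \<oplus> (- \<i>) \<odot> b) = a \<otimes> a \<oplus> \<i> \<odot> (b \<otimes> a) \<ominus> \<i> \<odot> (a \<otimes> b) \<oplus> b \<otimes> b"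
    "(a \<oplus> (- \<i>) \<odot> b) \<otimes> (a \<oplus> \<i> \<odot> b) = a \<otimes> a \<oplus> \<i> \<odot> (a \<otimes> b) \<ominus> \<i> \<odot> (b \<otimes> a) \<oplus> b \<otimes> b"
    by (simp_all add: expand_simps a_ac)
  then show "star A (a \<oplus> \<i> \<odot> b) \<otimes> (a \<oplus> \<i> \<odot> b) = a \<otimes> a \<oplus> b \<otimes> b"
    "(a \<oplus> \<i> \<odot> b) \<otimes> star A (a \<oplus> \<i> \<odot> b) = a \<otimes> a \<oplus> b \<otimes> b"
    by (simp_all add: assms(3,4) comm minus_eq a_assoc r_neg1 r_neg2)
qed

end

locale cstar_seminormed = star_algebra A for A :: "('a, 'm) star_alg_scheme" (structure) +
  fixes p :: "'a \<Rightarrow> real"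
  assumes seminorm: "cstar_seminorm A p"
begin

lemma p_add: "\<lbrakk>x \<in> carrier A; y \<in> carrier A\<rbrakk> \<Longrightarrow> p (x \<oplus> y) \<le> p x + p y"
  and p_mult: "\<lbrakk>x \<in> carrier A; y \<in> carrier A\<rbrakk> \<Longrightarrow> p (x \<otimes> y) \<le> p x * p y"
  and p_smult [simp]: "x \<in> carrier A \<Longrightarrow> p (c \<odot> x) = cmod c * p x"
  and p_nonneg [simp]: "x \<in> carrier A \<Longrightarrow> 0 \<le> p x"
  and p_star_mult: "x \<in> carrier A \<Longrightarrow> p (star A x \<otimes> x) = (p x)\<^sup>2"
  using seminorm unfolding cstar_seminorm_def by blast+

lemma p_zero [simp]: "p \<zero> = 0"
  using p_smult[of \<zero> 0] by simp

lemma p_minus [simp]: "x \<in> carrier A \<Longrightarrow> p (\<ominus> x) = p x"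
  by (simp add: minus_smult)

lemma p_diff: "\<lbrakk>x \<in> carrier A; y \<in> carrier A\<rbrakk> \<Longrightarrow> p (x \<ominus> y) \<le> p x + p y"
  using p_add[of x "\<ominus> y"] by (simp add: minus_eq)

lemma p_diff_commute: "\<lbrakk>x \<in> carrier A; y \<in> carrier A\<rbrakk> \<Longrightarrow> p (x \<ominus> y) = p (y \<ominus> x)"
proof -
  assume [simp]: "x \<in> carrier A" "y \<in> carrier A"
  have "x \<ominus> y = \<ominus> (y \<ominus> x)" using \<open>x \<in> carrier A\<close> \<open>y \<in> carrier A\<close> by algebra
  then show ?thesis by simp
qed

lemma p_triangle:
  assumes [simp]: "x \<in> carrier A" "y \<in> carrier A" "z \<in> carrier A"
  shows "p (x \<ominus> z) \<le> p (x \<ominus> y) + p (y \<ominus> z)"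
proof -
  have "x \<ominus> z = (x \<ominus> y) \<oplus> (y \<ominus> z)" using assms by algebra
  then show ?thesis using p_add[of "x \<ominus> y" "y \<ominus> z"] by simp
qed

lemma p_le_diff:
  assumes [simp]: "x \<in> carrier A" "y \<in> carrier A"
  shows "p x \<le> p (x \<ominus> y) + p y"
proof -
  have "x = (x \<ominus> y) \<oplus> y" using assms by algebra
  then show ?thesis using p_add[of "x \<ominus> y" y] by simp
qed

lemma p_abs_diff: "\<lbrakk>x \<in> carrier A; y \<in> carrier A\<rbrakk> \<Longrightarrow> \<bar>p x - p y\<bar> \<le> p (x \<ominus> y)"
  using p_le_diff[of x y] p_le_diff[of y x] p_diff_commute[of x y] by linarith

lemma p_mult_diff:
  assumes [simp]: "x \<in> carrier A" "y \<in> carrier A" "x' \<in> carrier A" "y' \<in> carrier A"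
  shows "p (x \<otimes> y \<ominus> x' \<otimes> y') \<le> p x * p (y \<ominus> y') + p (x \<ominus> x') * p y'"
proof -
  have "x \<otimes> y \<ominus> x' \<otimes> y' = x \<otimes> (y \<ominus> y') \<oplus> (x \<ominus> x') \<otimes> y'" using assms by algebra
  then have "p (x \<otimes> y \<ominus> x' \<otimes> y') \<le> p (x \<otimes> (y \<ominus> y')) + p ((x \<ominus> x') \<otimes> y')"
    by (simp add: p_add)
  then show ?thesis
    using p_mult[of x "y \<ominus> y'"] p_mult[of "x \<ominus> x'" y'] by simp
qed

lemma p_add_diff:
  assumes [simp]: "x \<in> carrier A" "y \<in> carrier A" "x' \<in> carrier A" "y' \<in> carrier A"
  shows "p (x \<oplus> y \<ominus> (x' \<oplus> y')) \<le> p (x \<ominus> x') + p (y \<ominus> y')"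
proof -
  have "x \<oplus> y \<ominus> (x' \<oplus> y') = (x \<ominus> x') \<oplus> (y \<ominus> y')" using assms by algebra
  then show ?thesis using p_add[of "x \<ominus> x'" "y \<ominus> y'"] by simp
qed

text \<open>Divide \<open>p(y)\<^sup>2 = p(y\<^sup>*y) \<le> p(y\<^sup>*) p(y)\<close> by \<open>p(y)\<close>.\<close>

lemma p_star [simp]: assumes [simp]: "x \<in> carrier A" shows "p (star A x) = p x"
proof -
  have le: "p y \<le> p (star A y)" if [simp]: "y \<in> carrier A" for y
  proof (cases "p y = 0")
    case False
    then have "0 < p y" using p_nonneg[OF that] by linarith
    moreover have "p y * p y \<le> p (star A y) * p y"
      using p_mult[of "star A y" y] p_star_mult[of y] by (simp add: power2_eq_square)
    ultimately show ?thesis by (simp add: mult_le_cancel_right)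
  qed simp
  show ?thesis using le[of x] le[of "star A x"] by simp
qed

lemma p_one_le: "p \<one> \<le> 1"
  using p_star_mult[of \<one>] p_nonneg[of \<one>] by (cases "p \<one> = 0") (simp_all add: power2_eq_square)

lemma p_square: "\<lbrakk>h \<in> carrier A; star A h = h\<rbrakk> \<Longrightarrow> p (h \<otimes> h) = (p h)\<^sup>2"
  using p_star_mult[of h] by simp

text \<open>A replacement for the monotonicity of the norm on positive elements: \<open>a\<close> is the real part
  of the normal element \<open>a + \<i>b\<close>, whose norm squared is that of \<open>a\<^sup>2 + b\<^sup>2\<close>.\<close>

lemma p_square_le_sum:
  assumes [simp]: "a \<in> carrier A" "b \<in> carrier A" and "star A a = a" "star A b = b"
    and comm: "a \<otimes> b = b \<otimes> a"
  shows "(p a)\<^sup>2 \<le> p (a \<otimes> a \<oplus> b \<otimes> b)"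
proof -
  define w where "w = a \<oplus> \<i> \<odot> b"
  have [simp]: "w \<in> carrier A" by (simp add: w_def)
  have "star A w = a \<ominus> \<i> \<odot> b" using assms(3,4) by (simp add: w_def minus_smult_left minus_eq)
  then have "w \<oplus> star A w = a \<oplus> a"
    by (simp add: w_def) (use assms(1,2) in algebra)
  also have "\<dots> = 2 \<odot> a" using smult_add_left[of a 1 1] by simp
  finally have "p (w \<oplus> star A w) = 2 * p a" by simp
  then have "p a \<le> p w" using p_add[of w "star A w"] by simp
  then have "(p a)\<^sup>2 \<le> (p w)\<^sup>2" by (simp add: power_mono)
  also have "\<dots> = p (a \<otimes> a \<oplus> b \<otimes> b)"
    using p_star_mult[of w] normal_square(1)[OF assms] by (simp add: w_def)
  finally show ?thesis .
qed

end

lemma tendsto_0_le: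
  fixes f g :: "nat \<Rightarrow> real"
  assumes "g \<longlonglongrightarrow> 0" "\<And>k. 0 \<le> f k" "\<And>k. f k \<le> g k"
  shows "f \<longlonglongrightarrow> 0"
  by (rule tendsto_sandwich[OF _ _ tendsto_const assms(1)]) (auto simp: assms)

text \<open>Completeness is required only of sequences whose steps decrease geometrically; this suffices, by
passing to a subsequence (\<open>conv_of_cauchy\<close>). The zero algebra is admitted, so that \<open>\<parallel>1\<parallel> \<le> 1\<close> is all that can be
said about the norm of the unit.\<close>

locale cstar_algebra = star_algebra A for A :: "('a, 'm) cstar_alg_scheme" (structure) +
  assumes nrm_seminorm: "cstar_seminorm A (nrm A)"
    and nrm_definite: "\<lbrakk>x \<in> carrier A; nrm A x = 0\<rbrakk> \<Longrightarrow> x = \<zero>"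
    and fast_complete: "\<lbrakk>\<And>k. s k \<in> carrier A; \<And>k. nrm A (s (Suc k) \<ominus> s k) \<le> (1/2) ^ k\<rbrakk>
      \<Longrightarrow> \<exists>x\<in>carrier A. (\<lambda>k. nrm A (s k \<ominus> x)) \<longlonglongrightarrow> 0"

sublocale cstar_algebra \<subseteq> cstar_seminormed A "nrm A"
  by unfold_locales (rule nrm_seminorm)

context cstar_algebra
begin

lemma nrm_0_iff: "x \<in> carrier A \<Longrightarrow> nrm A x = 0 \<longleftrightarrow> x = \<zero>"
  using nrm_definite by auto

lemma eqI_nrm: "\<lbrakk>x \<in> carrier A; y \<in> carrier A; nrm A (x \<ominus> y) = 0\<rbrakk> \<Longrightarrow> x = y"
  using nrm_definite[of "x \<ominus> y"] by (simp add: diff_0_iff)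

definition conv :: "(nat \<Rightarrow> 'a) \<Rightarrow> 'a \<Rightarrow> bool" where
  "conv s x \<longleftrightarrow> (\<forall>k. s k \<in> carrier A) \<and> x \<in> carrier A \<and> (\<lambda>k. nrm A (s k \<ominus> x)) \<longlonglongrightarrow> 0"

lemma convD: "conv s x \<Longrightarrow> s k \<in> carrier A" "conv s x \<Longrightarrow> x \<in> carrier A"
    "conv s x \<Longrightarrow> (\<lambda>k. nrm A (s k \<ominus> x)) \<longlonglongrightarrow> 0"
  by (auto simp: conv_def)

lemma conv_const: "x \<in> carrier A \<Longrightarrow> conv (\<lambda>k. x) x"
  by (simp add: conv_def minus_eq r_neg)

lemma conv_unique: assumes "conv s x" "conv s y" shows "x = y"
proof (rule eqI_nrm)
  show [simp]: "x \<in> carrier A" "y \<in> carrier A" using assms by (auto simp: conv_def)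
  have "(\<lambda>k. nrm A (s k \<ominus> x) + nrm A (s k \<ominus> y)) \<longlonglongrightarrow> 0 + 0"
    using assms by (intro tendsto_add) (auto simp: conv_def)
  moreover have "nrm A (x \<ominus> y) \<le> nrm A (s k \<ominus> x) + nrm A (s k \<ominus> y)" for k
    using p_triangle[of x "s k" y] p_diff_commute[of x "s k"] convD(1)[OF assms(1), of k] by simp
  ultimately have "nrm A (x \<ominus> y) \<le> 0 + 0" by (intro LIMSEQ_le_const) auto
  moreover have "0 \<le> nrm A (x \<ominus> y)" by simp
  ultimately show "nrm A (x \<ominus> y) = 0" by linarith
qed

lemma conv_nrm: assumes "conv s x" shows "(\<lambda>k. nrm A (s k)) \<longlonglongrightarrow> nrm A x"
proof -
  have "(\<lambda>k. nrm A (s k) - nrm A x) \<longlonglongrightarrow> 0"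
    by (rule tendsto_rabs_zero_cancel, rule tendsto_0_le[OF convD(3)[OF assms]])
      (use assms in \<open>auto simp: conv_def p_abs_diff\<close>)
  then show ?thesis by (simp add: LIM_zero_iff)
qed

lemma conv_add: assumes "conv s x" "conv t y" shows "conv (\<lambda>k. s k \<oplus> t k) (x \<oplus> y)"
proof -
  have "(\<lambda>k. nrm A (s k \<ominus> x) + nrm A (t k \<ominus> y)) \<longlonglongrightarrow> 0"
    using tendsto_add[OF convD(3)[OF assms(1)] convD(3)[OF assms(2)]] by simp
  then have "(\<lambda>k. nrm A (s k \<oplus> t k \<ominus> (x \<oplus> y))) \<longlonglongrightarrow> 0"
    by (rule tendsto_0_le) (use assms in \<open>auto simp: conv_def intro!: p_add_diff\<close>)
  then show ?thesis using assms by (auto simp: conv_def)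
qed

lemma conv_mult: assumes "conv s x" "conv t y" shows "conv (\<lambda>k. s k \<otimes> t k) (x \<otimes> y)"
proof -
  have "(\<lambda>k. nrm A (s k) * nrm A (t k \<ominus> y) + nrm A (s k \<ominus> x) * nrm A y) \<longlonglongrightarrow> nrm A x * 0 + 0 * nrm A y"
    using assms by (intro tendsto_intros conv_nrm) (auto simp: conv_def)
  then have "(\<lambda>k. nrm A (s k \<otimes> t k \<ominus> x \<otimes> y)) \<longlonglongrightarrow> 0"
    unfolding mult_zero_right mult_zero_left add_0
    by (rule tendsto_0_le) (use assms in \<open>auto simp: conv_def intro!: p_mult_diff\<close>)
  then show ?thesis using assms by (auto simp: conv_def)
qed

lemma conv_smult: assumes "conv s x" shows "conv (\<lambda>k. c \<odot> s k) (c \<odot> x)"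
proof -
  have "nrm A (c \<odot> s k \<ominus> c \<odot> x) = cmod c * nrm A (s k \<ominus> x)" for k
    using assms by (simp add: conv_def flip: smult_diff)
  moreover have "(\<lambda>k. cmod c * nrm A (s k \<ominus> x)) \<longlonglongrightarrow> cmod c * 0"
    using assms by (intro tendsto_intros) (auto simp: conv_def)
  ultimately show ?thesis using assms by (simp add: conv_def)
qed

lemma conv_minus: "conv s x \<Longrightarrow> conv (\<lambda>k. \<ominus> s k) (\<ominus> x)"
  using conv_smult[of s x "-1"] by (simp add: conv_def minus_smult)

lemma conv_diff: "\<lbrakk>conv s x; conv t y\<rbrakk> \<Longrightarrow> conv (\<lambda>k. s k \<ominus> t k) (x \<ominus> y)"
  unfolding minus_eq by (intro conv_add conv_minus)

lemma conv_star: assumes "conv s x" shows "conv (\<lambda>k. star A (s k)) (star A x)"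
proof -
  have "nrm A (star A (s k) \<ominus> star A x) = nrm A (s k \<ominus> x)" for k
    using assms by (simp add: conv_def flip: star_diff)
  then show ?thesis using assms by (simp add: conv_def)
qed

lemma conv_cong: "\<lbrakk>conv s x; \<And>k. s k = t k\<rbrakk> \<Longrightarrow> conv t x"
  by (simp add: conv_def)

lemma conv_Suc: "conv s x \<Longrightarrow> conv (\<lambda>k. s (Suc k)) x"
  using LIMSEQ_Suc by (auto simp: conv_def)

lemma conv_le: assumes "conv s x" "\<And>k. nrm A (s k) \<le> r" shows "nrm A x \<le> r"
  by (rule LIMSEQ_le_const2[OF conv_nrm[OF assms(1)]]) (use assms(2) in blast)

lemma conv_of_cauchy:
  assumes s: "\<And>k. s k \<in> carrier A"
    and cauchy: "\<And>e::real. 0 < e \<Longrightarrow> \<exists>M. \<forall>k\<ge>M. \<forall>l\<ge>M. nrm A (s k \<ominus> s l) < e"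
  shows "\<exists>x. conv s x"
proof -
  obtain M where M: "nrm A (s k \<ominus> s l) < (1/2) ^ m" if "M m \<le> k" "M m \<le> l" for k l and m :: nat
    using cauchy[of "(1/2) ^ m" for m] by (metis zero_less_divide_1_iff zero_less_numeral zero_less_power)
  \<comment> \<open>The subsequence \<open>s \<circ> N\<close> has steps of size at most \<open>(1/2)\<^sup>k\<close>.\<close>
  define N where "N = rec_nat (M 0) (\<lambda>m r. max (Suc r) (M (Suc m)))"
  have N0: "N 0 = M 0" and NS: "N (Suc m) = max (Suc (N m)) (M (Suc m))" for m
    by (simp_all add: N_def)
  have NM: "M m \<le> N m" for m by (cases m) (simp_all add: N0 NS)
  have mono: "N m \<le> N (Suc m)" for m by (simp add: NS)
  have Nge: "m \<le> N m" for m
  proof (induction m)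
    case (Suc m) then show ?case by (simp add: NS)
  qed simp
  have "nrm A (s (N (Suc k)) \<ominus> s (N k)) \<le> (1/2) ^ k" for k
    using M[of k "N (Suc k)" "N k"] NM[of k] mono[of k] by (simp add: less_imp_le)
  from fast_complete[of "\<lambda>k. s (N k)", OF s this]
  obtain x where [simp]: "x \<in> carrier A" and x: "(\<lambda>k. nrm A (s (N k) \<ominus> x)) \<longlonglongrightarrow> 0" by blast
  have "(\<lambda>k. nrm A (s k \<ominus> x)) \<longlonglongrightarrow> 0"
  proof (rule LIMSEQ_I)
    fix e :: real assume "0 < e"
    then obtain L where L: "\<And>k l. \<lbrakk>L \<le> k; L \<le> l\<rbrakk> \<Longrightarrow> nrm A (s k \<ominus> s l) < e / 2"
      using cauchy[of "e / 2"] by auto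
    obtain K where K: "\<And>k. K \<le> k \<Longrightarrow> nrm A (s (N k) \<ominus> x) < e / 2"
      using LIMSEQ_D[OF x, of "e / 2"] \<open>0 < e\<close> s by auto
    have "nrm A (s k \<ominus> x) < e" if "L \<le> k" for k
    proof -
      let ?m = "max K L"
      have "nrm A (s k \<ominus> s (N ?m)) < e / 2"
        using L[of k "N ?m"] that Nge[of ?m] by simp
      moreover have "nrm A (s (N ?m) \<ominus> x) < e / 2" using K by simp
      ultimately show ?thesis using p_triangle[of "s k" "s (N ?m)" x] s by simp
    qed
    then show "\<exists>no. \<forall>k\<ge>no. norm (nrm A (s k \<ominus> x) - 0) < e" using s by auto
  qed
  then show ?thesis unfolding conv_def using s \<open>x \<in> carrier A\<close> by blast
qed

text \<open>Comparison with a numerical sequence whose increments dominate the steps.\<close>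

lemma conv_of_bounded_steps:
  fixes r :: "nat \<Rightarrow> real"
  assumes s: "\<And>k. s k \<in> carrier A"
    and step: "\<And>k. nrm A (s (Suc k) \<ominus> s k) \<le> r (Suc k) - r k"
    and r: "convergent r"
  shows "\<exists>x. conv s x"
proof (rule conv_of_cauchy[OF s])
  have le: "nrm A (s (k + d) \<ominus> s k) \<le> r (k + d) - r k" for k d
  proof (induction d)
    case 0 then show ?case using s by (simp add: minus_eq r_neg)
  next
    case (Suc d)
    then show ?case using p_triangle[of "s (k + Suc d)" "s (k + d)" "s k"] step[of "k + d"] s by simp
  qed
  fix e :: real assume "0 < e"
  then obtain M where M: "\<And>k l. \<lbrakk>M \<le> k; M \<le> l\<rbrakk> \<Longrightarrow> \<bar>r k - r l\<bar> < e"
    using convergent_Cauchy[OF r] CauchyD[of r e] by (auto simp: real_norm_def)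
  have *: "nrm A (s k \<ominus> s l) < e" if "M \<le> l" "l \<le> k" for k l
    using le[of l "k - l"] M[of k l] that by simp
  have "nrm A (s k \<ominus> s l) < e" if "M \<le> l" "M \<le> k" for k l
    using *[of l k] *[of k l] p_diff_commute[OF s s, of k l] that by (cases "l \<le> k") simp_all
  then show "\<exists>M. \<forall>k\<ge>M. \<forall>l\<ge>M. nrm A (s k \<ominus> s l) < e" by blast
qed

end


section \<open>Square roots and positive elements\<close>

context star_algebra
begin

lemma diff_zero [simp]: "x \<in> carrier A \<Longrightarrow> x \<ominus> \<zero> = x"
  by (simp add: minus_eq)

lemma smult_Units: assumes "x \<in> Units A" "c \<noteq> 0" shows "c \<odot> x \<in> Units A"
proof -
  obtain y where y: "y \<in> carrier A" "y \<otimes> x = \<one>" "x \<otimes> y = \<one>" and [simp]: "x \<in> carrier A"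
    using assms(1) by (auto simp: Units_def)
  have "((1/c) \<odot> y) \<otimes> (c \<odot> x) = \<one>" "(c \<odot> x) \<otimes> ((1/c) \<odot> y) = \<one>"
    using y assms(2) by simp_all
  then show ?thesis using y(1) unfolding Units_def by (auto intro!: bexI[of _ "(1/c) \<odot> y"])
qed

end

context cstar_algebra
begin

text \<open>Partial sums of the geometric series of \<open>y\<close>.\<close>

primrec neumann :: "'a \<Rightarrow> nat \<Rightarrow> 'a" where
  "neumann y 0 = \<zero>"
| "neumann y (Suc k) = \<one> \<oplus> y \<otimes> neumann y k"

lemma neumann_closed [simp]: "y \<in> carrier A \<Longrightarrow> neumann y k \<in> carrier A"
  by (induction k) auto

lemma neumann_commute: "y \<in> carrier A \<Longrightarrow> neumann y k \<otimes> y = y \<otimes> neumann y k"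
  by (induction k) (simp_all add: r_distr l_distr m_assoc)

lemma one_minus_Units:
  assumes [simp]: "y \<in> carrier A" and y: "nrm A y < 1"
  shows "\<one> \<ominus> y \<in> Units A"
proof -
  define r where "r k = (\<Sum>i<k. nrm A y ^ i)" for k
  have step: "nrm A (neumann y (Suc k) \<ominus> neumann y k) \<le> r (Suc k) - r k" for k
  proof (induction k)
    case 0 show ?case using p_one_le by (simp add: r_def minus_eq)
  next
    case (Suc k)
    have "neumann y (Suc (Suc k)) \<ominus> neumann y (Suc k) = y \<otimes> (neumann y (Suc k) \<ominus> neumann y k)"
      by simp (use neumann_closed[OF assms(1), of k] assms(1) in algebra)
    then have "nrm A (neumann y (Suc (Suc k)) \<ominus> neumann y (Suc k))
        \<le> nrm A y * nrm A (neumann y (Suc k) \<ominus> neumann y k)"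
      by (simp add: p_mult del: neumann.simps)
    also have "\<dots> \<le> nrm A y * (r (Suc k) - r k)" by (rule mult_left_mono[OF Suc]) simp
    also have "\<dots> = r (Suc (Suc k)) - r (Suc k)" by (simp add: r_def)
    finally show ?case .
  qed
  have "convergent r"
    unfolding r_def using y summable_geometric[of "nrm A y"] by (simp add: summable_iff_convergent)
  from conv_of_bounded_steps[OF _ step this] obtain x where x: "conv (neumann y) x" by auto
  have [simp]: "x \<in> carrier A" using x by (simp add: conv_def)
  have "conv (\<lambda>k. \<one> \<oplus> y \<otimes> neumann y k) (\<one> \<oplus> y \<otimes> x)"
    by (intro conv_add conv_mult conv_const x) auto
  then have x1: "x = \<one> \<oplus> y \<otimes> x"
    using conv_Suc[OF x] conv_unique by simp
  have "conv (\<lambda>k. neumann y k \<otimes> y) (y \<otimes> x)"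
    using conv_mult[OF conv_const[of y] x] by (simp add: neumann_commute)
  then have xy: "y \<otimes> x = x \<otimes> y" using conv_unique[OF conv_mult[OF x conv_const[of y]]] by simp
  have "(\<one> \<ominus> y) \<otimes> x = x \<ominus> y \<otimes> x" "x \<otimes> (\<one> \<ominus> y) = x \<ominus> x \<otimes> y"
    by (simp_all add: l_diff_distr r_diff_distr)
  moreover have "x \<ominus> y \<otimes> x = \<one> \<oplus> y \<otimes> x \<ominus> y \<otimes> x" using x1 by simp
  moreover have "\<one> \<oplus> y \<otimes> x \<ominus> y \<otimes> x = \<one>" by (simp add: minus_eq a_assoc r_neg)
  ultimately show ?thesis unfolding Units_def using xy by (auto intro!: bexI[of _ x])
qed

text \<open>The limit \<open>b\<close> of this iteration satisfies \<open>2b = y + b\<^sup>2\<close>, that is \<open>(1 - b)\<^sup>2 = 1 - y\<close>. The iterates are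
polynomials in \<open>y\<close> with nonnegative coefficients, so for \<open>\<parallel>y\<parallel> \<le> 1\<close> their norms and their steps are
dominated by those of the same iteration for the number \<open>1\<close>, which is \<open>rt_major\<close> below and
increases to \<open>1\<close>.\<close>

primrec rt_iter :: "'a \<Rightarrow> nat \<Rightarrow> 'a" where
  "rt_iter y 0 = \<zero>"
| "rt_iter y (Suc k) = (1/2) \<odot> (y \<oplus> rt_iter y k \<otimes> rt_iter y k)"

definition rt :: "'a \<Rightarrow> 'a" where
  "rt y = \<one> \<ominus> (THE b. conv (rt_iter y) b)"

lemma rt_iter_closed [simp]: "y \<in> carrier A \<Longrightarrow> rt_iter y k \<in> carrier A"
  by (induction k) auto

text \<open>Taking \<open>y' = y\<close> gives commutation. The general form makes square roots pass through elements that commute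
with their argument only up to a scalar.\<close>

lemma rt_iter_intertwine:
  assumes [simp]: "y \<in> carrier A" "y' \<in> carrier A" "x \<in> carrier A" and c: "y \<otimes> x = x \<otimes> y'"
  shows "rt_iter y k \<otimes> x = x \<otimes> rt_iter y' k"
proof (induction k)
  case (Suc k)
  have "rt_iter y k \<otimes> rt_iter y k \<otimes> x = rt_iter y k \<otimes> (x \<otimes> rt_iter y' k)"
    by (simp add: m_assoc Suc)
  also have "\<dots> = rt_iter y k \<otimes> x \<otimes> rt_iter y' k" by (simp add: m_assoc)
  also have "\<dots> = x \<otimes> (rt_iter y' k \<otimes> rt_iter y' k)" by (simp add: m_assoc Suc)
  finally show ?case by (simp add: l_distr r_distr c)
qed simp

lemma rt_iter_commute:
  assumes [simp]: "y \<in> carrier A"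
  shows "rt_iter y k \<otimes> rt_iter y l = rt_iter y l \<otimes> rt_iter y k"
  by (rule rt_iter_intertwine) (simp_all add: rt_iter_intertwine[symmetric])

lemma rt_iter_star: "\<lbrakk>y \<in> carrier A; star A y = y\<rbrakk> \<Longrightarrow> star A (rt_iter y k) = rt_iter y k"
  by (induction k) simp_all

primrec rt_major :: "nat \<Rightarrow> real" where
  "rt_major 0 = 0"
| "rt_major (Suc k) = (1 + (rt_major k)\<^sup>2) / 2"

lemma rt_major_bounds: "0 \<le> rt_major k \<and> rt_major k \<le> 1"
proof (induction k)
  case (Suc k)
  then have "(rt_major k)\<^sup>2 \<le> 1" by (simp add: power_le_one)
  then show ?case by simp
qed simp

lemma rt_major_mono: "rt_major k \<le> rt_major (Suc k)"
proof -
  have "0 \<le> (rt_major k - 1)\<^sup>2" by simp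
  then show ?thesis by (simp add: power2_diff)
qed

lemma rt_major_convergent: "convergent rt_major"
proof -
  have "incseq rt_major" using rt_major_mono by (rule incseq_SucI)
  then obtain L where "rt_major \<longlonglongrightarrow> L"
    using incseq_convergent[of rt_major 1] rt_major_bounds by blast
  then show ?thesis by (auto simp: convergent_def)
qed

lemma rt_iter_norm:
  assumes [simp]: "y \<in> carrier A" and y: "nrm A y \<le> 1"
  shows "nrm A (rt_iter y k) \<le> rt_major k"
proof (induction k)
  case (Suc k)
  have "nrm A (y \<oplus> rt_iter y k \<otimes> rt_iter y k) \<le> nrm A y + nrm A (rt_iter y k \<otimes> rt_iter y k)"
    by (simp add: p_add)
  also have "\<dots> \<le> 1 + nrm A (rt_iter y k) * nrm A (rt_iter y k)"
    using y by (intro add_mono p_mult) auto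
  also have "\<dots> \<le> 1 + rt_major k * rt_major k"
    using Suc by (intro add_left_mono mult_mono) (auto simp: rt_major_bounds)
  finally show ?case by (simp add: power2_eq_square)
qed simp

lemma rt_iter_step:
  assumes [simp]: "y \<in> carrier A" and y: "nrm A y \<le> 1"
  shows "nrm A (rt_iter y (Suc k) \<ominus> rt_iter y k) \<le> rt_major (Suc k) - rt_major k"
proof (induction k)
  case 0 show ?case using y by (simp add: minus_eq)
next
  case (Suc k)
  let ?a = "rt_iter y (Suc k)" and ?b = "rt_iter y k"
  have [simp]: "?a \<in> carrier A" "?b \<in> carrier A" by (rule rt_iter_closed, simp)+
  have eq: "(y \<oplus> ?a \<otimes> ?a) \<ominus> (y \<oplus> ?b \<otimes> ?b) = (?a \<ominus> ?b) \<otimes> (?a \<oplus> ?b)"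
  proof -
    have "(?a \<ominus> ?b) \<otimes> (?a \<oplus> ?b) = ?a \<otimes> ?a \<oplus> ?a \<otimes> ?b \<ominus> ?b \<otimes> ?a \<ominus> ?b \<otimes> ?b"
      using \<open>?a \<in> carrier A\<close> \<open>?b \<in> carrier A\<close> by algebra
    also have "?b \<otimes> ?a = ?a \<otimes> ?b" by (rule rt_iter_commute) simp
    also have "?a \<otimes> ?a \<oplus> ?a \<otimes> ?b \<ominus> ?a \<otimes> ?b \<ominus> ?b \<otimes> ?b = (y \<oplus> ?a \<otimes> ?a) \<ominus> (y \<oplus> ?b \<otimes> ?b)"
      using assms(1) \<open>?a \<in> carrier A\<close> \<open>?b \<in> carrier A\<close> by algebra
    finally show ?thesis by simp
  qed
  have "rt_iter y (Suc (Suc k)) \<ominus> ?a = (1/2) \<odot> ((y \<oplus> ?a \<otimes> ?a) \<ominus> (y \<oplus> ?b \<otimes> ?b))"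
    by (subst rt_iter.simps(2)[of y "Suc k"], subst (3) rt_iter.simps(2)) (simp add: smult_diff del: rt_iter.simps)
  then have "nrm A (rt_iter y (Suc (Suc k)) \<ominus> ?a) = nrm A ((?a \<ominus> ?b) \<otimes> (?a \<oplus> ?b)) / 2"
    by (simp add: eq del: rt_iter.simps)
  also have "\<dots> \<le> nrm A (?a \<ominus> ?b) * (nrm A ?a + nrm A ?b) / 2"
    by (intro divide_right_mono order.trans[OF p_mult] mult_left_mono p_add) (simp_all del: rt_iter.simps)
  also have "\<dots> \<le> (rt_major (Suc k) - rt_major k) * (rt_major (Suc k) + rt_major k) / 2"
    by (intro divide_right_mono mult_mono add_mono Suc rt_iter_norm y add_nonneg_nonneg)
      (simp_all add: rt_major_mono del: rt_iter.simps rt_major.simps)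
  also have "\<dots> = rt_major (Suc (Suc k)) - rt_major (Suc k)"
  proof -
    have "(u - v) * (u + v) / 2 = w - u" if "w = (1 + u\<^sup>2) / 2" "u = (1 + v\<^sup>2) / 2" for u v w :: real
    proof -
      have "w - u = (1 + u\<^sup>2) / 2 - (1 + v\<^sup>2) / 2" by (metis that)
      then show ?thesis by (simp add: power2_eq_square field_simps)
    qed
    from this[OF rt_major.simps(2) rt_major.simps(2)] show ?thesis .
  qed
  finally show ?case .
qed

lemma rt_iter_conv:
  assumes "y \<in> carrier A" "nrm A y \<le> 1"
  shows "conv (rt_iter y) (\<one> \<ominus> rt y)"
proof -
  from conv_of_bounded_steps[OF _ rt_iter_step[OF assms] rt_major_convergent] assms
  obtain b where b: "conv (rt_iter y) b" by auto
  then have "(THE b. conv (rt_iter y) b) = b" using conv_unique by blast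
  moreover have "b = \<one> \<ominus> (\<one> \<ominus> b)" using convD(2)[OF b] by algebra
  ultimately show ?thesis using b by (simp add: rt_def)
qed

lemma rt_closed [simp]:
  assumes "y \<in> carrier A" "nrm A y \<le> 1" shows "rt y \<in> carrier A"
proof -
  from conv_of_bounded_steps[OF _ rt_iter_step[OF assms] rt_major_convergent] assms
  obtain b where b: "conv (rt_iter y) b" by auto
  then have "(THE b. conv (rt_iter y) b) = b" using conv_unique by blast
  then show ?thesis using b by (simp add: rt_def conv_def)
qed

lemma rt_square:
  assumes [simp]: "y \<in> carrier A" "nrm A y \<le> 1"
  shows "rt y \<otimes> rt y = \<one> \<ominus> y"
proof -
  define b where "b = \<one> \<ominus> rt y"
  have b: "conv (rt_iter y) b" using rt_iter_conv[OF assms] by (simp add: b_def)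
  have [simp]: "b \<in> carrier A" by (simp add: b_def)
  have "conv (\<lambda>k. (1/2) \<odot> (y \<oplus> rt_iter y k \<otimes> rt_iter y k)) ((1/2) \<odot> (y \<oplus> b \<otimes> b))"
    by (intro conv_smult conv_add conv_mult conv_const b) simp
  then have "b = (1/2) \<odot> (y \<oplus> b \<otimes> b)" using conv_Suc[OF b] conv_unique by simp
  then have "(2::complex) \<odot> b = 2 \<odot> ((1/2) \<odot> (y \<oplus> b \<otimes> b))" by simp
  then have 1: "b \<oplus> b = y \<oplus> b \<otimes> b" using smult_add_left[of b 1 1] by simp
  have "rt y = \<one> \<ominus> b" unfolding b_def using rt_closed[OF assms] by algebra
  then have "rt y \<otimes> rt y = \<one> \<ominus> (b \<oplus> b) \<oplus> b \<otimes> b"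
    by (simp only:) (use \<open>b \<in> carrier A\<close> in algebra)
  also have "\<dots> = \<one> \<ominus> y"
    unfolding 1 using \<open>b \<in> carrier A\<close> assms(1) by algebra
  finally show ?thesis .
qed

lemma rt_norm: assumes "y \<in> carrier A" "nrm A y \<le> 1" shows "nrm A (\<one> \<ominus> rt y) \<le> 1"
  by (rule conv_le[OF rt_iter_conv[OF assms]])
    (meson assms order.trans rt_iter_norm rt_major_bounds)

lemma rt_star: assumes "y \<in> carrier A" "nrm A y \<le> 1" "star A y = y" shows "star A (rt y) = rt y"
proof -
  have "star A (\<one> \<ominus> rt y) = \<one> \<ominus> rt y"
    using conv_star[OF rt_iter_conv[OF assms(1,2)]] rt_iter_star[OF assms(1,3)]
      conv_unique rt_iter_conv[OF assms(1,2)] by simp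
  moreover have "star A (rt y) = \<one> \<ominus> star A (\<one> \<ominus> rt y)" "rt y = \<one> \<ominus> (\<one> \<ominus> rt y)"
    using rt_closed[OF assms(1,2)] by algebra+
  ultimately show ?thesis by simp
qed

lemma rt_intertwine:
  assumes y: "y \<in> carrier A" "nrm A y \<le> 1" and y': "y' \<in> carrier A" "nrm A y' \<le> 1"
    and x: "x \<in> carrier A" and c: "y \<otimes> x = x \<otimes> y'"
  shows "rt y \<otimes> x = x \<otimes> rt y'"
proof -
  note [simp] = y y' x
  have "conv (\<lambda>k. rt_iter y k \<otimes> x) ((\<one> \<ominus> rt y) \<otimes> x)"
    by (intro conv_mult conv_const rt_iter_conv) auto
  moreover have "conv (\<lambda>k. x \<otimes> rt_iter y' k) (x \<otimes> (\<one> \<ominus> rt y'))"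
    by (intro conv_mult conv_const rt_iter_conv) auto
  ultimately have "(\<one> \<ominus> rt y) \<otimes> x = x \<otimes> (\<one> \<ominus> rt y')"
    using rt_iter_intertwine[OF y(1) y'(1) x c] conv_unique by simp
  moreover have "rt y \<otimes> x = x \<ominus> (\<one> \<ominus> rt y) \<otimes> x" "x \<otimes> rt y' = x \<ominus> x \<otimes> (\<one> \<ominus> rt y')"
    using rt_closed[OF y] rt_closed[OF y'] x by algebra+
  ultimately show ?thesis by simp
qed

text \<open>With \<open>c = \<surd>(1 - h\<^sup>2)\<close> the sum \<open>c\<^sup>2 + h\<^sup>2\<close> is \<open>1\<close>, which bounds \<open>\<parallel>c\<parallel>\<close> by \<open>p_square_le_sum\<close>.\<close>

lemma one_minus_square:
  assumes [simp]: "h \<in> carrier A" and h: "star A h = h" and n: "nrm A h \<le> 1"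
  shows "nrm A (\<one> \<ominus> h \<otimes> h) \<le> 1"
proof -
  have y: "nrm A (h \<otimes> h) \<le> 1" using n by (simp add: p_square[OF _ h] power_le_one)
  define c where "c = rt (h \<otimes> h)"
  have [simp]: "c \<in> carrier A" by (simp add: c_def y)
  have sc: "star A c = c" unfolding c_def by (rule rt_star) (simp_all add: y h)
  have cc: "c \<otimes> c = \<one> \<ominus> h \<otimes> h" unfolding c_def by (rule rt_square) (simp_all add: y)
  have "c \<otimes> h = h \<otimes> c" unfolding c_def by (rule rt_intertwine) (simp_all add: y m_assoc)
  then have "(nrm A c)\<^sup>2 \<le> nrm A (c \<otimes> c \<oplus> h \<otimes> h)" by (intro p_square_le_sum) (simp_all add: h sc)
  also have "c \<otimes> c \<oplus> h \<otimes> h = \<one>" unfolding cc using assms(1) by algebra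
  finally show ?thesis using p_one_le p_square[OF _ sc] by (simp flip: cc)
qed

lemma scaled_minus_square:
  assumes [simp]: "h \<in> carrier A" and h: "star A h = h" and n: "nrm A (h \<otimes> h) \<le> M"
  shows "nrm A (complex_of_real M \<odot> \<one> \<ominus> h \<otimes> h) \<le> M"
proof (cases "M = 0")
  case True
  then have "nrm A (h \<otimes> h) = 0" using n by (intro antisym) simp_all
  then have "h \<otimes> h = \<zero>" by (simp add: nrm_0_iff)
  then show ?thesis using True by (simp add: minus_eq)
next
  case False
  moreover have "0 \<le> nrm A (h \<otimes> h)" by simp
  ultimately have M: "0 < M" using n by linarith
  define g where "g = complex_of_real (1 / sqrt M) \<odot> h"
  have [simp]: "g \<in> carrier A" by (simp add: g_def)
  have gg: "g \<otimes> g = complex_of_real (1 / M) \<odot> (h \<otimes> h)" using M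
    by (simp add: g_def flip: of_real_mult)
  have sg: "star A g = g" by (simp add: g_def h)
  have "(nrm A g)\<^sup>2 \<le> 1" using n M by (simp add: gg norm_divide flip: p_square[OF _ sg])
  then have "nrm A g \<le> 1" by (simp add: power_le_one_iff)
  from one_minus_square[OF _ sg this] have "nrm A (complex_of_real M \<odot> (\<one> \<ominus> g \<otimes> g)) \<le> M"
    using M by simp
  then show ?thesis using M by (simp add: smult_diff gg flip: of_real_mult)
qed

text \<open>The scaled square root \<open>\<surd>M \<cdot> \<surd>(1 - (1 - a/M))\<close> of \<open>a\<close>. The norm condition on \<open>a\<close> reappears for its root, so
that taking roots can be iterated.\<close>

lemma sqrt_of_norm_le:
  assumes [simp]: "a \<in> carrier A" and a: "star A a = a" and M: "0 < M"
    and n: "nrm A (complex_of_real M \<odot> \<one> \<ominus> a) \<le> M"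
  defines "b \<equiv> complex_of_real (sqrt M) \<odot> rt (\<one> \<ominus> complex_of_real (1 / M) \<odot> a)"
  shows "b \<in> carrier A" "star A b = b" "b \<otimes> b = a"
    "nrm A (complex_of_real (sqrt M) \<odot> \<one> \<ominus> b) \<le> sqrt M"
    "\<And>x. \<lbrakk>x \<in> carrier A; a \<otimes> x = x \<otimes> a\<rbrakk> \<Longrightarrow> b \<otimes> x = x \<otimes> b"
    "nrm A (\<one> \<ominus> complex_of_real (1 / M) \<odot> a) \<le> 1"
proof -
  let ?y = "\<one> \<ominus> complex_of_real (1 / M) \<odot> a"
  have "?y = complex_of_real (1 / M) \<odot> (complex_of_real M \<odot> \<one> \<ominus> a)"
    using M by (simp add: smult_diff flip: of_real_mult)
  then have ny: "nrm A ?y = nrm A (complex_of_real M \<odot> \<one> \<ominus> a) / M" using M by (simp add: norm_divide)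
  show y: "nrm A ?y \<le> 1" unfolding ny using n M by simp
  note y' = y[unfolded of_real_divide of_real_1]
  have [simp]: "rt ?y \<in> carrier A" by (rule rt_closed) (simp_all add: y')
  note this[unfolded of_real_divide of_real_1, simp]
  show [simp]: "b \<in> carrier A" by (simp add: b_def)
  show "star A b = b" by (simp add: b_def rt_star y' a)
  have "b \<otimes> b = complex_of_real M \<odot> (\<one> \<ominus> ?y)"
    using M by (simp add: b_def rt_square y' flip: of_real_mult)
  also have "\<one> \<ominus> ?y = complex_of_real (1 / M) \<odot> a"
    using smult_closed[OF assms(1), of "complex_of_real (1 / M)"] by algebra
  finally show "b \<otimes> b = a" using M by (simp flip: of_real_mult)
  have "nrm A (complex_of_real (sqrt M) \<odot> \<one> \<ominus> b) = sqrt M * nrm A (\<one> \<ominus> rt ?y)"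
    using M by (simp add: b_def flip: smult_diff)
  also have "\<dots> \<le> sqrt M * 1" using M by (intro mult_left_mono rt_norm y) simp_all
  finally show "nrm A (complex_of_real (sqrt M) \<odot> \<one> \<ominus> b) \<le> sqrt M" by simp
  show "b \<otimes> x = x \<otimes> b" if [simp]: "x \<in> carrier A" and "a \<otimes> x = x \<otimes> a" for x
    using rt_intertwine[of ?y ?y x] that y by (simp add: b_def l_diff_distr r_diff_distr)
qed

lemma spectrum_norm_le:
  assumes [simp]: "a \<in> carrier A" and z: "z \<in> spectrum A a" shows "cmod z \<le> nrm A a"
proof (rule ccontr)
  assume "\<not> cmod z \<le> nrm A a"
  then have lt: "nrm A a < cmod z" by simp
  have "z \<noteq> 0" using lt p_nonneg[OF assms(1)] by (metis norm_zero not_less)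
  have "\<one> \<ominus> (1 / z) \<odot> a \<in> Units A"
    using lt \<open>z \<noteq> 0\<close> by (intro one_minus_Units) (simp_all add: norm_divide)
  from smult_Units[OF this \<open>z \<noteq> 0\<close>] have "z \<odot> \<one> \<ominus> a \<in> Units A"
    using \<open>z \<noteq> 0\<close> by (simp add: smult_diff)
  then show False using z by (simp add: spectrum_def)
qed

lemma spectrum_shift:
  assumes [simp]: "a \<in> carrier A" and "z \<in> spectrum A a" shows "z + w \<in> spectrum A (a \<oplus> w \<odot> \<one>)"
proof -
  have "(z + w) \<odot> \<one> \<ominus> (a \<oplus> w \<odot> \<one>) = z \<odot> \<one> \<ominus> a"
    by (simp add: smult_add_left) (use smult_closed[OF one_closed] assms(1) in algebra)
  then show ?thesis using assms(2) by (simp add: spectrum_def)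
qed

text \<open>If \<open>z\<close> is in the spectrum of \<open>a\<close>, then \<open>z + \<i>t\<close> is in that of \<open>a + \<i>t\<close>, whose squared norm is at most
\<open>\<parallel>a\<parallel>\<^sup>2 + t\<^sup>2\<close>. If \<open>Im z \<noteq> 0\<close>, then \<open>\<bar>z + \<i>t\<bar>\<^sup>2\<close> exceeds this for suitable \<open>t\<close>.\<close>

lemma spectrum_real:
  assumes [simp]: "a \<in> carrier A" and a: "star A a = a" and z: "z \<in> spectrum A a"
  shows "Im z = 0"
proof (rule ccontr)
  assume ne: "Im z \<noteq> 0"
  let ?N = "nrm A a"
  \<comment> \<open>This makes \<open>2t Im z\<close> exceed \<open>\<parallel>a\<parallel>\<^sup>2\<close>.\<close>
  define t where "t = (?N\<^sup>2 + 1) / (2 * Im z)"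
  let ?w = "a \<oplus> \<i> \<odot> (complex_of_real t \<odot> \<one>)"
  have "(nrm A ?w)\<^sup>2 = nrm A (a \<otimes> a \<oplus> (complex_of_real t \<odot> \<one>) \<otimes> (complex_of_real t \<odot> \<one>))"
    by (subst p_star_mult[symmetric], simp, subst normal_square) (simp_all add: a)
  also have "\<dots> \<le> nrm A (a \<otimes> a) + nrm A ((complex_of_real t \<odot> \<one>) \<otimes> (complex_of_real t \<odot> \<one>))"
    by (rule p_add) simp_all
  also have "\<dots> \<le> ?N\<^sup>2 + t\<^sup>2 * 1"
    using mult_left_mono[OF p_one_le, of "t\<^sup>2"] by (simp add: p_square a power2_eq_square norm_mult)
  finally have w: "(nrm A ?w)\<^sup>2 \<le> ?N\<^sup>2 + t\<^sup>2" by simp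
  have "cmod (z + \<i> * complex_of_real t) \<le> nrm A ?w"
    using spectrum_norm_le[OF _ spectrum_shift[OF assms(1) z, of "\<i> * complex_of_real t"]] by simp
  then have "(cmod (z + \<i> * complex_of_real t))\<^sup>2 \<le> (nrm A ?w)\<^sup>2" by (simp add: power_mono)
  then have "(Re z)\<^sup>2 + (Im z + t)\<^sup>2 \<le> ?N\<^sup>2 + t\<^sup>2" using w by (simp add: cmod_power2)
  then have "(Re z)\<^sup>2 + (Im z)\<^sup>2 + 2 * Im z * t \<le> ?N\<^sup>2" by (simp add: power2_sum)
  moreover have "2 * Im z * t = ?N\<^sup>2 + 1" using ne by (simp add: t_def)
  moreover have "0 \<le> (Re z)\<^sup>2 + (Im z)\<^sup>2" by simp
  ultimately show False by linarith
qed

text \<open>By \<open>scaled_minus_square\<close> the spectrum lies in the disc of radius \<open>M = \<parallel>b\<^sup>2\<parallel>\<close> about \<open>M\<close>, and it is real.\<close>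

lemma positive_square:
  assumes [simp]: "b \<in> carrier A" and b: "star A b = b" shows "positive A (b \<otimes> b)"
proof -
  define M where "M = nrm A (b \<otimes> b)"
  have n: "nrm A (complex_of_real M \<odot> \<one> \<ominus> b \<otimes> b) \<le> M"
    by (rule scaled_minus_square) (simp_all add: b M_def)
  have "z \<in> complex_of_real ` {0..}" if z: "z \<in> spectrum A (b \<otimes> b)" for z
  proof -
    have im: "Im z = 0" using spectrum_real[OF _ _ z] by (simp add: b)
    have "z + complex_of_real (- M) \<in> spectrum A (b \<otimes> b \<oplus> complex_of_real (- M) \<odot> \<one>)"
      by (rule spectrum_shift[OF _ z]) simp
    then have "cmod (z + complex_of_real (- M)) \<le> nrm A (b \<otimes> b \<oplus> complex_of_real (- M) \<odot> \<one>)"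
      by (rule spectrum_norm_le[rotated]) simp
    also have "b \<otimes> b \<oplus> complex_of_real (- M) \<odot> \<one> = b \<otimes> b \<ominus> complex_of_real M \<odot> \<one>"
      by (simp add: minus_eq minus_smult_left)
    also have "nrm A \<dots> \<le> M" using n by (simp add: p_diff_commute)
    finally have "\<bar>Re z - M\<bar> \<le> M"
      using abs_Re_le_cmod[of "z + complex_of_real (- M)"] by simp
    then have "0 \<le> Re z" by linarith
    moreover have "z = complex_of_real (Re z)" using im by (simp add: complex_eq_iff)
    ultimately show ?thesis by blast
  qed
  then show ?thesis by (auto simp: positive_def b)
qed

text \<open>The spectral definition of positivity yields the norm condition by a continuity argument. Let
\<open>M = 2(\<parallel>a\<parallel> + 1)\<close> and let \<open>L\<close> be the set of all \<open>t\<close> for which \<open>t + a\<close> satisfies \<open>\<parallel>M - (t + a)\<parallel> \<le> M\<close>. It is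
closed and contains \<open>M/2\<close>. Suppose its infimum \<open>t\<^sub>0\<close> is positive. Then \<open>c\<^sub>0 = t\<^sub>0 + a\<close> is a square and,
as \<open>-t\<^sub>0\<close> is not in the spectrum of \<open>a\<close>, it has an inverse \<open>v\<close>. For large \<open>N\<close> also \<open>N - v\<close> is a
square, and therefore so is \<open>(N - v)c\<^sub>0/N = c\<^sub>0 - 1/N = (t\<^sub>0 - 1/N) + a\<close>, which puts the smaller number
\<open>t\<^sub>0 - 1/N\<close> into \<open>L\<close>.\<close>

lemma positive_norm_le:
  assumes pos: "positive A a"
  shows "\<exists>M>0. nrm A (complex_of_real M \<odot> \<one> \<ominus> a) \<le> M"
proof -
  have [simp]: "a \<in> carrier A" and a: "star A a = a"
    and sp: "spectrum A a \<subseteq> complex_of_real ` {0..}"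
    using pos by (auto simp: positive_def)
  define m where "m = nrm A a + 1"
  define M where "M = 2 * m"
  have m: "0 < m" unfolding m_def using p_nonneg[OF \<open>a \<in> carrier A\<close>] by linarith
  then have M: "0 < M" by (simp add: M_def)
  define g where "g t = nrm A (complex_of_real (M - t) \<odot> \<one> \<ominus> a)" for t
  define L where "L = {t \<in> {0..m}. g t \<le> M}"
  have g_eq: "complex_of_real (M - t) \<odot> \<one> \<ominus> a = complex_of_real M \<odot> \<one> \<ominus> (complex_of_real t \<odot> \<one> \<oplus> a)" for t
    by (simp add: smult_diff_left) (use smult_closed[OF one_closed] \<open>a \<in> carrier A\<close> in algebra)
  have g_diff: "g t \<le> g s + \<bar>t - s\<bar>" for t s
  proof -
    have "complex_of_real (M - t) \<odot> \<one> \<ominus> a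
        = (complex_of_real (M - s) \<odot> \<one> \<ominus> a) \<oplus> complex_of_real (s - t) \<odot> \<one>"
      by (simp add: smult_diff_left) (use smult_closed[OF one_closed] \<open>a \<in> carrier A\<close> in algebra)
    then have "g t \<le> g s + \<bar>s - t\<bar> * nrm A \<one>"
      unfolding g_def using p_add[of "complex_of_real (M - s) \<odot> \<one> \<ominus> a" "complex_of_real (s - t) \<odot> \<one>"]
      by (simp flip: of_real_diff)
    also have "\<dots> \<le> g s + \<bar>s - t\<bar> * 1" using p_one_le by (intro add_left_mono mult_left_mono) auto
    finally show ?thesis by (simp add: abs_minus_commute)
  qed
  have "g m \<le> m * nrm A \<one> + nrm A a"
    unfolding g_def M_def using p_diff[of "complex_of_real m \<odot> \<one>" a] m by simp
  also have "\<dots> \<le> m * 1 + nrm A a" using p_one_le m by (intro add_right_mono mult_left_mono) auto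
  finally have "m \<in> L" using m by (simp add: L_def M_def m_def)
  have bdd: "bdd_below L" by (auto simp: L_def bdd_below_def)
  define t0 where "t0 = Inf L"
  have t0: "0 \<le> t0" "t0 \<le> m"
    unfolding t0_def using \<open>m \<in> L\<close> by (auto intro!: cInf_greatest cInf_lower bdd simp: L_def)
  have gt0: "g t0 \<le> M"
  proof (rule field_le_epsilon)
    fix e :: real assume "0 < e"
    then obtain t where t: "t \<in> L" "t < t0 + e"
      using cInf_lessD[of L "t0 + e"] \<open>m \<in> L\<close> by (auto simp: t0_def)
    have "t0 \<le> t" unfolding t0_def using t(1) bdd by (rule cInf_lower)
    then show "g t0 \<le> M + e" using g_diff[of t0 t] t by (simp add: L_def)
  qed
  have "t0 = 0"
  proof (rule ccontr)
    assume "t0 \<noteq> 0"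
    then have t0pos: "0 < t0" using t0 by simp
    define c0 where "c0 = complex_of_real t0 \<odot> \<one> \<oplus> a"
    have [simp]: "c0 \<in> carrier A" and c0: "star A c0 = c0" by (simp_all add: c0_def a)
    have n0: "nrm A (complex_of_real M \<odot> \<one> \<ominus> c0) \<le> M"
      using gt0 unfolding g_def g_eq c0_def .
    have "complex_of_real (- t0) \<notin> spectrum A a"
      using sp t0pos by (auto simp: complex_eq_iff)
    then have "complex_of_real (- t0) \<odot> \<one> \<ominus> a \<in> Units A" by (simp add: spectrum_def)
    from smult_Units[OF this, of "-1"] have "c0 \<in> Units A"
      by (simp add: smult_diff c0_def minus_eq minus_smult_left minus_add)
    then obtain v where [simp]: "v \<in> carrier A" and v: "v \<otimes> c0 = \<one>" "c0 \<otimes> v = \<one>"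
      by (auto simp: Units_def)
    obtain b where [simp]: "b \<in> carrier A" and b: "star A b = b" "b \<otimes> b = c0"
      using sqrt_of_norm_le(1-3)[OF _ c0 M n0] by auto
    have sv: "star A v = v"
    proof -
      have "c0 \<otimes> star A v = \<one>" using star_mult[of v c0] v c0 by simp
      then have "v \<otimes> (c0 \<otimes> star A v) = v" by simp
      then show ?thesis by (simp add: v flip: m_assoc)
    qed
    have bv: "b \<otimes> v = v \<otimes> b"
    proof -
      have "v \<otimes> b = v \<otimes> b \<otimes> (c0 \<otimes> v)" by (simp add: v)
      also have "\<dots> = v \<otimes> (b \<otimes> b \<otimes> b) \<otimes> v" by (simp add: m_assoc flip: b(2))
      also have "\<dots> = (v \<otimes> c0) \<otimes> b \<otimes> v" by (simp add: m_assoc flip: b(2))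
      finally show ?thesis by (simp add: v)
    qed
    \<comment> \<open>\<open>N \<ge> \<parallel>v\<parallel>\<close> makes \<open>N - v\<close> a square, and \<open>N \<ge> 1/t\<^sub>0\<close> keeps \<open>t\<^sub>0 - 1/N\<close> nonnegative.\<close>
    define N where "N = max (nrm A v) (1 / t0)"
    have N1: "1 / t0 \<le> N" "nrm A v \<le> N" by (simp_all add: N_def)
    have N0: "0 < N" by (rule less_le_trans[OF _ N1(1)]) (simp add: t0pos)
    have N: "0 < N" "nrm A v \<le> N" "1 / N \<le> t0"
      using t0pos N1 N0 by (simp_all add: field_simps)
    let ?w = "complex_of_real N \<odot> \<one> \<ominus> v"
    have "complex_of_real N \<odot> \<one> \<ominus> ?w = v"
      using smult_closed[OF one_closed] \<open>v \<in> carrier A\<close> by algebra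
    then have nw: "nrm A (complex_of_real N \<odot> \<one> \<ominus> ?w) \<le> N" using N by simp
    have w: "?w \<in> carrier A" "star A ?w = ?w" by (simp_all add: sv)
    have "?w \<otimes> b = b \<otimes> ?w" by (simp add: l_diff_distr r_diff_distr bv)
    with sqrt_of_norm_le(1-3,5)[OF w N(1) nw] obtain c where [simp]: "c \<in> carrier A"
      and c: "star A c = c" "c \<otimes> c = ?w" "c \<otimes> b = b \<otimes> c" by (metis \<open>b \<in> carrier A\<close>)
    \<comment> \<open>\<open>d\<^sup>2 = (N - v)c\<^sub>0/N\<close>\<close>
    define d where "d = complex_of_real (1 / sqrt N) \<odot> (c \<otimes> b)"
    have [simp]: "d \<in> carrier A" and d: "star A d = d" by (simp_all add: d_def b c)
    define t1 where "t1 = t0 - 1 / N"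
    have "0 < 1 / N" using N by simp
    then have t1: "0 \<le> t1" "t1 < t0" "t1 \<le> m" unfolding t1_def using N t0 by linarith+
    have "c \<otimes> b \<otimes> (c \<otimes> b) = c \<otimes> (b \<otimes> c) \<otimes> b" by (simp add: m_assoc)
    also have "\<dots> = (complex_of_real N \<odot> \<one> \<ominus> v) \<otimes> c0"
      by (simp add: m_assoc flip: b(2) c(2,3))
    also have "\<dots> = complex_of_real N \<odot> c0 \<ominus> \<one>" by (simp add: l_diff_distr v)
    finally have "d \<otimes> d = complex_of_real (1 / N) \<odot> (complex_of_real N \<odot> c0 \<ominus> \<one>)"
      using N by (simp add: d_def flip: of_real_mult)
    also have "\<dots> = c0 \<ominus> complex_of_real (1 / N) \<odot> \<one>"
      using N by (simp add: smult_diff)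
    also have "\<dots> = complex_of_real t1 \<odot> \<one> \<oplus> a"
      unfolding c0_def t1_def of_real_diff smult_diff_left[OF one_closed]
      using smult_closed[OF one_closed] \<open>a \<in> carrier A\<close> by algebra
    finally have dd: "d \<otimes> d = complex_of_real t1 \<odot> \<one> \<oplus> a" .
    have "nrm A (d \<otimes> d) \<le> t1 * nrm A \<one> + nrm A a"
      unfolding dd using p_add[of "complex_of_real t1 \<odot> \<one>" a] t1 by simp
    also have "\<dots> \<le> t1 * 1 + nrm A a" using p_one_le t1 by (intro add_right_mono mult_left_mono) auto
    also have "\<dots> \<le> M" using t1 m by (simp add: M_def m_def)
    finally have "nrm A (complex_of_real M \<odot> \<one> \<ominus> d \<otimes> d) \<le> M"
      by (rule scaled_minus_square[OF _ d, rotated]) simp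
    then have "g t1 \<le> M" unfolding g_def g_eq dd .
    then have "t1 \<in> L" using t1 by (simp add: L_def)
    then have "t0 \<le> t1" unfolding t0_def using bdd by (rule cInf_lower)
    then show False using t1 by simp
  qed
  then show ?thesis using gt0 M by (auto simp: g_def)
qed

text \<open>A second square root shows that the first one is positive.\<close>

lemma positive_sqrt_ex:
  assumes "positive A a"
  shows "\<exists>b. positive A b \<and> b \<otimes> b = a \<and> (\<forall>x\<in>carrier A. a \<otimes> x = x \<otimes> a \<longrightarrow> b \<otimes> x = x \<otimes> b)"
proof -
  have a: "a \<in> carrier A" "star A a = a" using assms by (auto simp: positive_def)
  obtain M where M: "0 < M" "nrm A (complex_of_real M \<odot> \<one> \<ominus> a) \<le> M"
    using positive_norm_le[OF assms] by blast
  from sqrt_of_norm_le[OF a M] obtain b where [simp]: "b \<in> carrier A"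
    and b: "star A b = b" "b \<otimes> b = a" "nrm A (complex_of_real (sqrt M) \<odot> \<one> \<ominus> b) \<le> sqrt M"
      "\<And>x. \<lbrakk>x \<in> carrier A; a \<otimes> x = x \<otimes> a\<rbrakk> \<Longrightarrow> b \<otimes> x = x \<otimes> b" by blast
  from sqrt_of_norm_le(1-3)[OF _ b(1) _ b(3)] M obtain c where
    "c \<in> carrier A" "star A c = c" "c \<otimes> c = b" by auto
  then have "positive A b" using positive_square by auto
  then show ?thesis using b by blast
qed

text \<open>For commuting positive \<open>x, y\<close> with \<open>x\<^sup>2 = y\<^sup>2\<close> and \<open>e = x - y\<close>, the element \<open>e\<^sup>2(x + y) = 0\<close> is the sum of the
squares of \<open>\<surd>x e\<close> and \<open>\<surd>y e\<close>, which therefore vanish; so \<open>e\<^sup>2 = xe - ye = 0\<close>. The general case follows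
because the square root constructed above commutes with both \<open>b\<close> and \<open>b'\<close>.\<close>

lemma positive_sqrt_unique:
  assumes pos: "positive A b" "positive A b'" and eq: "b \<otimes> b = b' \<otimes> b'"
  shows "b = b'"
proof -
  have key: "x = y" if x: "positive A x" and y: "positive A y" and xy: "x \<otimes> y = y \<otimes> x"
    and eq: "x \<otimes> x = y \<otimes> y" for x y
  proof -
    have [simp]: "x \<in> carrier A" "y \<in> carrier A" and st: "star A x = x" "star A y = y"
      using x y by (auto simp: positive_def)
    obtain c where "positive A c" and c: "c \<otimes> c = x"
      and cc: "\<And>z. \<lbrakk>z \<in> carrier A; x \<otimes> z = z \<otimes> x\<rbrakk> \<Longrightarrow> c \<otimes> z = z \<otimes> c"
      using positive_sqrt_ex[OF x] by blast
    obtain d where "positive A d" and d: "d \<otimes> d = y"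
      and dc: "\<And>z. \<lbrakk>z \<in> carrier A; y \<otimes> z = z \<otimes> y\<rbrakk> \<Longrightarrow> d \<otimes> z = z \<otimes> d"
      using positive_sqrt_ex[OF y] by blast
    have [simp]: "c \<in> carrier A" "d \<in> carrier A" and st': "star A c = c" "star A d = d"
      using \<open>positive A c\<close> \<open>positive A d\<close> by (auto simp: positive_def)
    define e where "e = x \<ominus> y"
    have [simp]: "e \<in> carrier A" and e: "star A e = e" by (simp_all add: e_def st)
    have ex: "x \<otimes> e = e \<otimes> x" and ey: "y \<otimes> e = e \<otimes> y"
      by (simp_all add: e_def l_diff_distr r_diff_distr xy)
    have ce: "c \<otimes> e = e \<otimes> c" using cc ex by simp
    have de: "d \<otimes> e = e \<otimes> d" using dc ey by simp
    have "c \<otimes> d = d \<otimes> c" using cc[of d] dc[of x] xy by simp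
    then have comm: "c \<otimes> e \<otimes> (d \<otimes> e) = d \<otimes> e \<otimes> (c \<otimes> e)"
      by (metis \<open>c \<in> carrier A\<close> \<open>d \<in> carrier A\<close> \<open>e \<in> carrier A\<close> ce de m_assoc m_closed)
    have "e \<otimes> (x \<oplus> y) = x \<otimes> x \<oplus> x \<otimes> y \<ominus> y \<otimes> x \<ominus> y \<otimes> y"
      unfolding e_def using \<open>x \<in> carrier A\<close> \<open>y \<in> carrier A\<close> by algebra
    also have "\<dots> = \<zero>" using eq by (simp add: xy minus_eq a_assoc r_neg2 r_neg)
    finally have "e \<otimes> (e \<otimes> (x \<oplus> y)) = \<zero>" by simp
    moreover have "c \<otimes> e \<otimes> (c \<otimes> e) = e \<otimes> (e \<otimes> x)"
      by (metis \<open>c \<in> carrier A\<close> \<open>e \<in> carrier A\<close> c ce m_assoc m_closed)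
    moreover have "d \<otimes> e \<otimes> (d \<otimes> e) = e \<otimes> (e \<otimes> y)"
      by (metis \<open>d \<in> carrier A\<close> \<open>e \<in> carrier A\<close> d de m_assoc m_closed)
    ultimately have z: "c \<otimes> e \<otimes> (c \<otimes> e) \<oplus> d \<otimes> e \<otimes> (d \<otimes> e) = \<zero>"
      by (simp add: r_distr)
    then have z': "d \<otimes> e \<otimes> (d \<otimes> e) \<oplus> c \<otimes> e \<otimes> (c \<otimes> e) = \<zero>" by (simp add: a_comm)
    have "(nrm A (c \<otimes> e))\<^sup>2 \<le> 0" "(nrm A (d \<otimes> e))\<^sup>2 \<le> 0"
      using p_square_le_sum[of "c \<otimes> e" "d \<otimes> e"] p_square_le_sum[of "d \<otimes> e" "c \<otimes> e"] comm z z'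
      by (simp_all add: e st' ce de)
    then have "c \<otimes> e = \<zero>" "d \<otimes> e = \<zero>" by (simp_all add: nrm_0_iff)
    then have "x \<otimes> e = \<zero>" "y \<otimes> e = \<zero>" by (simp_all add: m_assoc flip: c d)
    then have "e \<otimes> e = \<zero>" by (subst (1) e_def) (simp add: l_diff_distr)
    then have "(nrm A e)\<^sup>2 = 0" using p_square[OF _ e] by simp
    then have "e = \<zero>" by (simp add: nrm_0_iff)
    then show "x = y" by (simp add: e_def diff_0_iff)
  qed
  have b: "b \<in> carrier A" "star A b = b" "b' \<in> carrier A" "star A b' = b'"
    using pos by (auto simp: positive_def)
  have "positive A (b \<otimes> b)" using positive_square b by simp
  from positive_sqrt_ex[OF this] obtain r where r: "positive A r" "r \<otimes> r = b \<otimes> b"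
    and rc: "\<And>x. \<lbrakk>x \<in> carrier A; b \<otimes> b \<otimes> x = x \<otimes> (b \<otimes> b)\<rbrakk> \<Longrightarrow> r \<otimes> x = x \<otimes> r" by blast
  have "r = b" using key[OF r(1) pos(1)] rc[of b] r b by (simp add: m_assoc)
  moreover have "r = b'" using key[OF r(1) pos(2)] rc[of b'] r b by (simp add: eq m_assoc)
  ultimately show ?thesis by simp
qed

lemma pos_sqrt:
  assumes "positive A a"
  shows "positive A (pos_sqrt A a)" "pos_sqrt A a \<otimes> pos_sqrt A a = a"
proof -
  obtain b where b: "positive A b" "b \<otimes> b = a" using positive_sqrt_ex[OF assms] by blast
  then have "pos_sqrt A a = b"
    unfolding pos_sqrt_def using positive_sqrt_unique by (intro the_equality) auto
  with b show "positive A (pos_sqrt A a)" "pos_sqrt A a \<otimes> pos_sqrt A a = a" by simp_all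
qed

lemma pos_sqrt_eq: "\<lbrakk>positive A b; b \<otimes> b = a\<rbrakk> \<Longrightarrow> pos_sqrt A a = b"
  unfolding pos_sqrt_def using positive_sqrt_unique by (intro the_equality) auto

lemma positiveD: "positive A a \<Longrightarrow> a \<in> carrier A" "positive A a \<Longrightarrow> star A a = a"
  by (auto simp: positive_def)

lemma positive_norm_bound:
  assumes "positive A a" "nrm A a \<le> M"
  shows "nrm A (complex_of_real M \<odot> \<one> \<ominus> a) \<le> M"
  using scaled_minus_square[OF positiveD[OF pos_sqrt(1)[OF assms(1)]], of M] pos_sqrt(2)[OF assms(1)] assms(2)
  by simp

lemma positive_iff_norm:
  assumes "a \<in> carrier A" "star A a = a" "nrm A a \<le> M"
  shows "positive A a \<longleftrightarrow> nrm A (complex_of_real M \<odot> \<one> \<ominus> a) \<le> M"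
proof
  assume n: "nrm A (complex_of_real M \<odot> \<one> \<ominus> a) \<le> M"
  show "positive A a"
  proof (cases "M = 0")
    case True
    then have "nrm A a = 0" using assms by (intro antisym) simp_all
    then have "a = \<zero>" using assms by (simp add: nrm_0_iff)
    then show ?thesis using positive_square[of \<zero>] by simp
  next
    case False
    moreover have "0 \<le> M" using assms by (intro order.trans[OF p_nonneg]) auto
    ultimately have "0 < M" by simp
    from sqrt_of_norm_le(1-3)[OF assms(1,2) this n] show ?thesis using positive_square by metis
  qed
qed (use positive_norm_bound assms in blast)

lemma positive_smult:
  assumes "positive A a" "0 \<le> r" shows "positive A (complex_of_real r \<odot> a)"
proof -
  note s = pos_sqrt[OF assms(1)]
  note [simp] = positiveD[OF s(1)] positiveD[OF assms(1)]
  have "positive A ((complex_of_real (sqrt r) \<odot> pos_sqrt A a) \<otimes> (complex_of_real (sqrt r) \<odot> pos_sqrt A a))"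
    by (rule positive_square) simp_all
  then show ?thesis using assms(2) s(2) by (simp flip: of_real_mult)
qed

text \<open>If \<open>a\<close> and \<open>x\<close> commute up to a positive factor, then so do \<open>\<surd>a\<close> and \<open>x\<close>, because the
  approximating polynomials of the square roots of \<open>a\<close> and of \<open>r a\<close> are intertwined by \<open>x\<close>.\<close>

lemma pos_sqrt_intertwine:
  assumes pos: "positive A a" and [simp]: "x \<in> carrier A" and r: "0 < r"
    and c: "a \<otimes> x = complex_of_real r \<odot> (x \<otimes> a)"
  shows "pos_sqrt A a \<otimes> x = complex_of_real (sqrt r) \<odot> (x \<otimes> pos_sqrt A a)"
proof -
  let ?r = "complex_of_real r"
  note [simp] = positiveD[OF pos]
  define M where "M = nrm A a + r * nrm A a + 1"
  have na: "0 \<le> nrm A a" "0 \<le> r * nrm A a" using r by simp_all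
  then have M: "0 < M" "nrm A a \<le> M" "r * nrm A a \<le> M" unfolding M_def by linarith+
  have pos': "positive A (?r \<odot> a)" using pos r by (simp add: positive_smult)
  note n = positive_norm_bound[OF pos M(2)]
  have n': "nrm A (complex_of_real M \<odot> \<one> \<ominus> ?r \<odot> a) \<le> M"
    using positive_norm_bound[OF pos'] M r by simp
  let ?y = "\<one> \<ominus> complex_of_real (1 / M) \<odot> a" and ?y' = "\<one> \<ominus> complex_of_real (1 / M) \<odot> (?r \<odot> a)"
  define b where "b = complex_of_real (sqrt M) \<odot> rt ?y"
  define b' where "b' = complex_of_real (sqrt M) \<odot> rt ?y'"
  have b: "b \<in> carrier A" "star A b = b" "b \<otimes> b = a" "nrm A (complex_of_real (sqrt M) \<odot> \<one> \<ominus> b) \<le> sqrt M"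
    and y: "nrm A ?y \<le> 1"
    using sqrt_of_norm_le[OF _ _ M(1) n] by (simp_all add: b_def)
  have b': "b' \<in> carrier A" "star A b' = b'" "b' \<otimes> b' = ?r \<odot> a" "nrm A (complex_of_real (sqrt M) \<odot> \<one> \<ominus> b') \<le> sqrt M"
    and y': "nrm A ?y' \<le> 1"
    using sqrt_of_norm_le[OF _ _ M(1) n'] by (simp_all add: b'_def)
  have sM: "0 < sqrt M" using M by simp
  have posb: "positive A b" if "b \<in> carrier A" "star A b = b" "nrm A (complex_of_real (sqrt M) \<odot> \<one> \<ominus> b) \<le> sqrt M" for b
    using sqrt_of_norm_le(1-3)[OF that(1,2) sM that(3)] positive_square by metis
  have eb: "pos_sqrt A a = b" using posb[OF b(1,2,4)] b(3) by (rule pos_sqrt_eq)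
  have "positive A (complex_of_real (sqrt r) \<odot> b)" using posb[OF b(1,2,4)] r by (simp add: positive_smult)
  then have eb': "b' = complex_of_real (sqrt r) \<odot> b"
    by (rule positive_sqrt_unique[OF posb[OF b'(1,2,4)]]) (use r b b' in \<open>simp flip: of_real_mult\<close>)
  have "?y \<otimes> x = x \<otimes> ?y'" by (simp add: l_diff_distr r_diff_distr c)
  then have "rt ?y \<otimes> x = x \<otimes> rt ?y'" by (intro rt_intertwine y y') simp_all
  then have "b \<otimes> x = x \<otimes> b'" using y y' by (simp add: b_def b'_def)
  then show ?thesis using b by (simp add: eb eb')
qed

lemma pos_sqrt_commute:
  assumes "positive A a" "x \<in> carrier A" "a \<otimes> x = x \<otimes> a"
  shows "pos_sqrt A a \<otimes> x = x \<otimes> pos_sqrt A a"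
  using pos_sqrt_intertwine[OF assms(1,2), of 1] assms positiveD[OF assms(1)]
    positiveD[OF pos_sqrt(1)[OF assms(1)]] by simp

end


section \<open>Approximate units and *-homomorphisms\<close>

text \<open>Take \<open>u = (1 + g\<^sup>2)\<^sup>-\<^sup>1\<close> with \<open>g = d/e\<close>. From \<open>u = u\<^sup>2 + (gu)\<^sup>2\<close> and \<open>p_square_le_sum\<close> both \<open>\<parallel>u\<parallel> \<le> 1\<close> and
\<open>\<parallel>gu\<parallel> \<le> 1\<close> follow.\<close>

lemma (in cstar_algebra) approximate_unit:
  assumes [simp]: "d \<in> carrier A" and d: "star A d = d" and e: "0 < e"
  shows "\<exists>u\<in>carrier A. star A u = u \<and> nrm A u \<le> 1 \<and> nrm A (d \<otimes> u) \<le> e \<and> (\<exists>y\<in>carrier A. \<one> \<ominus> u = y \<otimes> d)"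
proof -
  define g where "g = complex_of_real (1 / e) \<odot> d"
  have [simp]: "g \<in> carrier A" and g: "star A g = g" by (simp_all add: g_def d)
  define c where "c = \<one> \<oplus> g \<otimes> g"
  have [simp]: "c \<in> carrier A" and c: "star A c = c" by (simp_all add: c_def g)
  have "positive A (g \<otimes> g)" by (rule positive_square) (simp_all add: g)
  then have "-1 \<notin> spectrum A (g \<otimes> g)"
    by (auto simp: positive_def complex_eq_iff)
  then have "(-1) \<odot> \<one> \<ominus> g \<otimes> g \<in> Units A" by (simp add: spectrum_def)
  from smult_Units[OF this, of "-1"] have "c \<in> Units A"
    by (simp add: c_def smult_diff minus_eq minus_smult_left minus_add)
  then obtain u where [simp]: "u \<in> carrier A" and u: "u \<otimes> c = \<one>" "c \<otimes> u = \<one>"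
    by (auto simp: Units_def)
  have su: "star A u = u"
  proof -
    have "c \<otimes> star A u = \<one>" using star_mult[of u c] u c by simp
    then have "u \<otimes> (c \<otimes> star A u) = u" by simp
    then show ?thesis by (simp add: u flip: m_assoc)
  qed
  have cg: "c \<otimes> g = g \<otimes> c" by (simp add: c_def l_distr r_distr m_assoc)
  have ug: "u \<otimes> g = g \<otimes> u"
  proof -
    have "u \<otimes> g = u \<otimes> (g \<otimes> c) \<otimes> u" by (simp add: m_assoc u)
    also have "\<dots> = (u \<otimes> c) \<otimes> g \<otimes> u" by (simp add: m_assoc flip: cg)
    finally show ?thesis by (simp add: u)
  qed
  define h where "h = g \<otimes> u"
  have [simp]: "h \<in> carrier A" and h: "star A h = h" by (simp_all add: h_def su g ug)
  have uh: "u \<otimes> h = h \<otimes> u" by (simp add: h_def m_assoc flip: ug)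
  have "u = u \<otimes> c \<otimes> u" by (simp add: u)
  also have "\<dots> = u \<otimes> u \<oplus> h \<otimes> h"
  proof -
    have "u \<otimes> c \<otimes> u = u \<otimes> u \<oplus> (u \<otimes> g) \<otimes> (g \<otimes> u)"
      by (simp add: c_def l_distr r_distr m_assoc)
    then show ?thesis by (simp only: ug h_def)
  qed
  finally have eq: "u = u \<otimes> u \<oplus> h \<otimes> h" .
  have "(nrm A u)\<^sup>2 \<le> nrm A (u \<otimes> u \<oplus> h \<otimes> h)"
    by (rule p_square_le_sum) (simp_all add: su h uh)
  then have u2: "(nrm A u)\<^sup>2 \<le> nrm A u" by (simp flip: eq)
  have u1: "nrm A u \<le> 1"
  proof (rule ccontr)
    assume "\<not> nrm A u \<le> 1"
    then have "nrm A u * 1 < nrm A u * nrm A u" by (intro mult_strict_left_mono) auto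
    then show False using u2 by (simp add: power2_eq_square)
  qed
  have "(nrm A h)\<^sup>2 \<le> nrm A (h \<otimes> h \<oplus> u \<otimes> u)"
    by (rule p_square_le_sum) (simp_all add: su h uh)
  also have "\<dots> = nrm A u" using eq by (simp add: a_comm)
  finally have "(nrm A h)\<^sup>2 \<le> 1" using u1 by simp
  then have h1: "nrm A h \<le> 1" by (simp add: power_le_one_iff)
  have "nrm A (d \<otimes> u) = e * nrm A h"
    using e by (simp add: h_def g_def norm_divide)
  then have "nrm A (d \<otimes> u) \<le> e" using h1 e by simp
  moreover have "\<one> \<ominus> u = (complex_of_real (1 / e) \<odot> (u \<otimes> g)) \<otimes> d"
  proof -
    have "\<one> \<ominus> u = u \<otimes> c \<ominus> u" by (simp add: u)
    also have "\<dots> = u \<otimes> g \<otimes> g"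
      unfolding c_def using \<open>u \<in> carrier A\<close> \<open>g \<in> carrier A\<close> by algebra
    also have "\<dots> = (complex_of_real (1 / e) \<odot> (u \<otimes> g)) \<otimes> d"
      by (subst (2) g_def) simp
    finally show ?thesis .
  qed
  ultimately show ?thesis using su u1
    by (intro bexI[of _ u]) (auto intro!: bexI[of _ "complex_of_real (1 / e) \<odot> (u \<otimes> g)"])
qed

locale star_morphism = dom: star_algebra A + cod: star_algebra B
  for A :: "('a, 'm) star_alg_scheme" and B :: "('b, 'n) star_alg_scheme" +
  fixes f :: "'a \<Rightarrow> 'b"
  assumes hom: "star_hom A B f"
begin

lemma ring_hom: "f \<in> ring_hom A B"
  using hom by (simp add: star_hom_def)

sublocale ring_hom_ring A B f
  by unfold_locales (rule ring_hom)

lemma hom_smult [simp]: "x \<in> carrier A \<Longrightarrow> f (c \<odot>\<^bsub>A\<^esub> x) = c \<odot>\<^bsub>B\<^esub> f x"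
  and hom_star [simp]: "x \<in> carrier A \<Longrightarrow> f (star A x) = star B (f x)"
  using hom by (simp_all add: star_hom_def)

lemma hom_minus [simp]:
  "\<lbrakk>x \<in> carrier A; y \<in> carrier A\<rbrakk> \<Longrightarrow> f (x \<ominus>\<^bsub>A\<^esub> y) = f x \<ominus>\<^bsub>B\<^esub> f y"
  by (simp add: dom.minus_eq cod.minus_eq)

lemma hom_sum: "g \<in> I \<rightarrow> carrier A \<Longrightarrow> f (\<Oplus>\<^bsub>A\<^esub>i\<in>I. g i) = (\<Oplus>\<^bsub>B\<^esub>i\<in>I. f (g i))"
proof (induction I rule: infinite_finite_induct)
  case (insert i I)
  then show ?case by (simp add: dom.finsum_insert cod.finsum_insert Pi_iff)
qed simp_all

end

text \<open>For self-adjoint \<open>h\<close> of norm at most one there is \<open>c\<close> with \<open>h\<^sup>2 + c\<^sup>2 = 1\<close> that commutes with \<open>h\<close>. A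
homomorphism preserves this equation, so \<open>p_square_le_sum\<close> bounds the image of \<open>h\<close>.\<close>

lemma star_hom_contractive:
  assumes "cstar_algebra A" "cstar_seminormed B p" "star_hom A B f" and a: "a \<in> carrier A"
  shows "p (f a) \<le> nrm A a"
proof -
  interpret A: cstar_algebra A by fact
  interpret B: cstar_seminormed B p by fact
  interpret star_morphism A B f
    by unfold_locales fact
  note [simp] = a
  have unit: "p (f h) \<le> 1" if h [simp]: "h \<in> carrier A" and sh: "star A h = h" and n: "nrm A h \<le> 1" for h
  proof -
    have y: "nrm A (h \<otimes>\<^bsub>A\<^esub> h) \<le> 1" using n by (simp add: A.p_square[OF _ sh] power_le_one)
    define c where "c = A.rt (h \<otimes>\<^bsub>A\<^esub> h)"
    have [simp]: "c \<in> carrier A" by (simp add: c_def y)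
    have sc: "star A c = c" unfolding c_def by (rule A.rt_star) (simp_all add: y sh)
    have cc: "c \<otimes>\<^bsub>A\<^esub> c = \<one>\<^bsub>A\<^esub> \<ominus>\<^bsub>A\<^esub> h \<otimes>\<^bsub>A\<^esub> h"
      unfolding c_def by (rule A.rt_square) (simp_all add: y)
    have ch: "c \<otimes>\<^bsub>A\<^esub> h = h \<otimes>\<^bsub>A\<^esub> c"
      unfolding c_def by (rule A.rt_intertwine) (simp_all add: y A.m_assoc)
    have "(p (f h))\<^sup>2 \<le> p (f h \<otimes>\<^bsub>B\<^esub> f h \<oplus>\<^bsub>B\<^esub> f c \<otimes>\<^bsub>B\<^esub> f c)"
      using hom_star[of h] hom_star[of c] hom_mult[of c h] hom_mult[of h c]
      by (intro B.p_square_le_sum) (simp_all add: sh sc ch)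
    also have "f h \<otimes>\<^bsub>B\<^esub> f h \<oplus>\<^bsub>B\<^esub> f c \<otimes>\<^bsub>B\<^esub> f c = f (h \<otimes>\<^bsub>A\<^esub> h \<oplus>\<^bsub>A\<^esub> c \<otimes>\<^bsub>A\<^esub> c)"
      by simp
    also have "h \<otimes>\<^bsub>A\<^esub> h \<oplus>\<^bsub>A\<^esub> c \<otimes>\<^bsub>A\<^esub> c = \<one>\<^bsub>A\<^esub>"
      unfolding cc using h by algebra
    finally have "(p (f h))\<^sup>2 \<le> 1" using B.p_one_le by simp
    then show ?thesis by (simp add: power_le_one_iff)
  qed
  have sa: "p (f h) \<le> nrm A h" if h [simp]: "h \<in> carrier A" and sh: "star A h = h" for h
  proof (cases "nrm A h = 0")
    case True
    then show ?thesis by (simp add: A.nrm_0_iff)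
  next
    case False
    moreover have "0 \<le> nrm A h" by simp
    ultimately have pos: "0 < nrm A h" by linarith
    have "p (f (complex_of_real (1 / nrm A h) \<odot>\<^bsub>A\<^esub> h)) \<le> 1"
      using pos by (intro unit) (simp_all add: sh norm_divide)
    then show ?thesis using pos by (simp add: norm_divide divide_le_eq_1)
  qed
  have "(p (f a))\<^sup>2 = p (f (star A a \<otimes>\<^bsub>A\<^esub> a))" by (simp add: B.p_star_mult)
  also have "\<dots> \<le> nrm A (star A a \<otimes>\<^bsub>A\<^esub> a)" by (rule sa) simp_all
  also have "\<dots> = (nrm A a)\<^sup>2" by (simp add: A.p_star_mult)
  finally show ?thesis by (rule power2_le_imp_le) simp
qed

text \<open>Let \<open>k = a\<^sup>*a\<close> and \<open>u = k\<^sup>2 - r\<^sup>4\<close>. If all \<open>f\<^sub>i(a)\<close> have norm at most \<open>r\<close>, then all \<open>-f\<^sub>i(u)\<close> are positive, so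
every \<open>f\<^sub>i\<close> annihilates \<open>\<bar>u\<bar> + u\<close>. Hence \<open>-u\<close> is positive, and \<open>k\<^sup>2\<close> and the square \<open>-u\<close> add up to
\<open>r\<^sup>4\<close>, which bounds \<open>\<parallel>k\<parallel>\<close>.\<close>

lemma jointly_injective_isometric:
  assumes "cstar_algebra A" "cstar_algebra B" and hom: "\<And>i. i \<in> I \<Longrightarrow> star_hom A B (f i)"
    and inj: "\<And>a. \<lbrakk>a \<in> carrier A; \<And>i. i \<in> I \<Longrightarrow> f i a = \<zero>\<^bsub>B\<^esub>\<rbrakk> \<Longrightarrow> a = \<zero>\<^bsub>A\<^esub>"
    and a: "a \<in> carrier A" and r: "\<And>i. i \<in> I \<Longrightarrow> nrm B (f i a) \<le> r" and "0 \<le> r"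
  shows "nrm A a \<le> r"
proof -
  interpret A: cstar_algebra A by fact
  interpret B: cstar_algebra B by fact
  note [simp] = a
  define k where "k = star A a \<otimes>\<^bsub>A\<^esub> a"
  have [simp]: "k \<in> carrier A" and k: "star A k = k" by (simp_all add: k_def)
  \<comment> \<open>Squaring \<open>k\<close> makes \<open>u\<close> a difference of squares, for which \<open>scaled_minus_square\<close> gives positivity.\<close>
  define u where "u = k \<otimes>\<^bsub>A\<^esub> k \<ominus>\<^bsub>A\<^esub> complex_of_real (r ^ 4) \<odot>\<^bsub>A\<^esub> \<one>\<^bsub>A\<^esub>"
  have [simp]: "u \<in> carrier A" and u: "star A u = u" by (simp_all add: u_def k)
  have "positive A (u \<otimes>\<^bsub>A\<^esub> u)" by (rule A.positive_square) (simp_all add: u)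
  from A.positive_sqrt_ex[OF this] obtain v where v: "positive A v" "v \<otimes>\<^bsub>A\<^esub> v = u \<otimes>\<^bsub>A\<^esub> u" by blast
  note [simp] = A.positiveD[OF v(1)]
  have "v \<oplus>\<^bsub>A\<^esub> u = \<zero>\<^bsub>A\<^esub>"
  proof (rule inj)
    fix i assume i: "i \<in> I"
    interpret F: star_morphism A B "f i" by unfold_locales (rule hom[OF i])
    have fk: "star B (f i k) = f i k" using F.hom_star[of k] k by simp
    have "nrm B (f i k) = (nrm B (f i a))\<^sup>2" by (simp add: k_def B.p_star_mult)
    also have "\<dots> \<le> r\<^sup>2" using r[OF i] by (simp add: power_mono)
    finally have "(nrm B (f i k))\<^sup>2 \<le> (r\<^sup>2)\<^sup>2" by (rule power_mono) simp
    then have nk: "nrm B (f i k \<otimes>\<^bsub>B\<^esub> f i k) \<le> r ^ 4" by (simp add: B.p_square fk)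
    have "nrm B (complex_of_real (r ^ 4) \<odot>\<^bsub>B\<^esub> \<one>\<^bsub>B\<^esub> \<ominus>\<^bsub>B\<^esub> f i k \<otimes>\<^bsub>B\<^esub> f i k) \<le> r ^ 4"
      by (rule B.scaled_minus_square[OF _ fk nk]) simp
    moreover have "complex_of_real (r ^ 4) \<odot>\<^bsub>B\<^esub> \<one>\<^bsub>B\<^esub> \<ominus>\<^bsub>B\<^esub> (complex_of_real (r ^ 4) \<odot>\<^bsub>B\<^esub> \<one>\<^bsub>B\<^esub> \<ominus>\<^bsub>B\<^esub> f i k \<otimes>\<^bsub>B\<^esub> f i k)
        = f i k \<otimes>\<^bsub>B\<^esub> f i k"
      using B.smult_closed[OF B.one_closed] F.hom_closed[OF \<open>k \<in> carrier A\<close>] by algebra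
    ultimately have "positive B (complex_of_real (r ^ 4) \<odot>\<^bsub>B\<^esub> \<one>\<^bsub>B\<^esub> \<ominus>\<^bsub>B\<^esub> f i k \<otimes>\<^bsub>B\<^esub> f i k)"
      using nk by (subst B.positive_iff_norm[where M = "r ^ 4"]) (simp_all add: fk del: of_real_power)
    also have "complex_of_real (r ^ 4) \<odot>\<^bsub>B\<^esub> \<one>\<^bsub>B\<^esub> \<ominus>\<^bsub>B\<^esub> f i k \<otimes>\<^bsub>B\<^esub> f i k = \<ominus>\<^bsub>B\<^esub> f i u"
    proof -
      have "f i u = f i k \<otimes>\<^bsub>B\<^esub> f i k \<ominus>\<^bsub>B\<^esub> complex_of_real (r ^ 4) \<odot>\<^bsub>B\<^esub> \<one>\<^bsub>B\<^esub>" by (simp add: u_def)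
      then show ?thesis
        by (simp only:) (use B.smult_closed[OF B.one_closed] F.hom_closed[OF \<open>k \<in> carrier A\<close>] in algebra)
    qed
    finally have pu: "positive B (\<ominus>\<^bsub>B\<^esub> f i u)" .
    obtain w where w: "positive A w" "w \<otimes>\<^bsub>A\<^esub> w = v" using A.positive_sqrt_ex[OF v(1)] by blast
    have "positive B (f i v)"
      using B.positive_square[of "f i w"] F.hom_star[of w] F.hom_mult[of w w] A.positiveD[OF w(1)] w(2)
      by simp
    moreover have "f i v \<otimes>\<^bsub>B\<^esub> f i v = (\<ominus>\<^bsub>B\<^esub> f i u) \<otimes>\<^bsub>B\<^esub> (\<ominus>\<^bsub>B\<^esub> f i u)"
      using F.hom_mult[of v v] F.hom_mult[of u u] v(2) by (simp add: B.l_minus B.r_minus)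
    ultimately have "f i v = \<ominus>\<^bsub>B\<^esub> f i u" by (rule B.positive_sqrt_unique[OF _ pu])
    then show "f i (v \<oplus>\<^bsub>A\<^esub> u) = \<zero>\<^bsub>B\<^esub>" by (simp add: B.l_neg)
  qed simp
  then have vu: "v = \<ominus>\<^bsub>A\<^esub> u" by (simp add: A.minus_equality[symmetric])
  obtain d where d: "positive A d" "d \<otimes>\<^bsub>A\<^esub> d = v" and dc: "\<And>x. \<lbrakk>x \<in> carrier A; v \<otimes>\<^bsub>A\<^esub> x = x \<otimes>\<^bsub>A\<^esub> v\<rbrakk> \<Longrightarrow> d \<otimes>\<^bsub>A\<^esub> x = x \<otimes>\<^bsub>A\<^esub> d"
    using A.positive_sqrt_ex[OF v(1)] by blast
  note [simp] = A.positiveD[OF d(1)]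
  have "u \<otimes>\<^bsub>A\<^esub> k = k \<otimes>\<^bsub>A\<^esub> u" by (simp add: u_def A.l_diff_distr A.r_diff_distr A.m_assoc)
  then have "d \<otimes>\<^bsub>A\<^esub> k = k \<otimes>\<^bsub>A\<^esub> d" using dc[of k] vu by (simp add: A.l_minus A.r_minus)
  then have "(nrm A k)\<^sup>2 \<le> nrm A (k \<otimes>\<^bsub>A\<^esub> k \<oplus>\<^bsub>A\<^esub> d \<otimes>\<^bsub>A\<^esub> d)" by (intro A.p_square_le_sum) (simp_all add: k)
  also have "k \<otimes>\<^bsub>A\<^esub> k \<oplus>\<^bsub>A\<^esub> d \<otimes>\<^bsub>A\<^esub> d = complex_of_real (r ^ 4) \<odot>\<^bsub>A\<^esub> \<one>\<^bsub>A\<^esub>"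
    unfolding d(2) vu u_def using A.smult_closed[OF A.one_closed] \<open>k \<in> carrier A\<close> by algebra
  also have "nrm A \<dots> \<le> r ^ 4 * 1"
    using A.p_one_le mult_left_mono[OF A.p_one_le, of "r ^ 4"] by (simp add: norm_power)
  finally have "(nrm A a) ^ 4 \<le> r ^ 4" by (simp add: k_def A.p_star_mult)
  then show ?thesis using \<open>0 \<le> r\<close> by (rule power_le_imp_le_base[of _ 3, simplified])
qed


section \<open>Closed ideals and quotients\<close>

text \<open>Transport of structure along a surjection \<open>h\<close>. Quotients and completions have operations given on
representatives, and this is how they inherit the laws.\<close>

lemma star_algebra_image:
  fixes A :: "('a, 'm) star_alg_scheme" and B :: "('b, 'n) star_alg_scheme"
  assumes "star_algebra A"
    and carr: "carrier B = h ` carrier A"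
    and mult: "\<And>x y. \<lbrakk>x \<in> carrier A; y \<in> carrier A\<rbrakk> \<Longrightarrow> h x \<otimes>\<^bsub>B\<^esub> h y = h (x \<otimes>\<^bsub>A\<^esub> y)"
    and add: "\<And>x y. \<lbrakk>x \<in> carrier A; y \<in> carrier A\<rbrakk> \<Longrightarrow> h x \<oplus>\<^bsub>B\<^esub> h y = h (x \<oplus>\<^bsub>A\<^esub> y)"
    and one: "\<one>\<^bsub>B\<^esub> = h \<one>\<^bsub>A\<^esub>" and zero: "\<zero>\<^bsub>B\<^esub> = h \<zero>\<^bsub>A\<^esub>"
    and smult: "\<And>c x. x \<in> carrier A \<Longrightarrow> c \<odot>\<^bsub>B\<^esub> h x = h (c \<odot>\<^bsub>A\<^esub> x)"
    and star: "\<And>x. x \<in> carrier A \<Longrightarrow> star B (h x) = h (star A x)"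
  shows "star_algebra B" "star_hom A B h"
proof -
  interpret A: star_algebra A by fact
  note simps = carr mult add one zero smult star
  interpret B: ring B
  proof (intro ringI abelian_groupI monoidI)
    fix x assume "x \<in> carrier B"
    then obtain a where a: "a \<in> carrier A" "x = h a" using carr by auto
    have "h (\<ominus>\<^bsub>A\<^esub> a) \<oplus>\<^bsub>B\<^esub> x = \<zero>\<^bsub>B\<^esub>" using a by (simp add: add zero A.l_neg)
    then show "\<exists>y\<in>carrier B. y \<oplus>\<^bsub>B\<^esub> x = \<zero>\<^bsub>B\<^esub>" using a carr by blast
  qed (auto simp: simps A.a_assoc A.m_assoc A.l_distr A.r_distr, metis A.a_comm)
  show "star_algebra B"
    by unfold_locales
      (auto simp: simps A.smult_add_left A.smult_add_right intro: arg_cong[where f = h])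
  show "star_hom A B h"
    using simps by (auto simp: star_hom_def ring_hom_def)
qed

lemma (in ring) ideal_of_closed:
  assumes "I \<subseteq> carrier R" "\<zero> \<in> I" "\<And>x y. \<lbrakk>x \<in> I; y \<in> I\<rbrakk> \<Longrightarrow> x \<oplus> y \<in> I"
    and l: "\<And>x y. \<lbrakk>x \<in> I; y \<in> carrier R\<rbrakk> \<Longrightarrow> y \<otimes> x \<in> I"
    and r: "\<And>x y. \<lbrakk>x \<in> I; y \<in> carrier R\<rbrakk> \<Longrightarrow> x \<otimes> y \<in> I"
  shows "ideal I R"
proof (rule idealI)
  show "subgroup I (add_monoid R)"
  proof (rule add.subgroupI)
    show "\<ominus> x \<in> I" if "x \<in> I" for x
    proof -
      have "\<ominus> x = (\<ominus> \<one>) \<otimes> x" using that assms(1) by (auto simp: l_minus)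
      then show ?thesis using l[OF that, of "\<ominus> \<one>"] by simp
    qed
  qed (use assms in auto)
qed (use assms ring_axioms in auto)

context cstar_algebra
begin

lemma closed_ideal_gen_props:
  assumes "d \<in> carrier A"
  shows "ideal (closed_ideal_gen A d) A" "norm_closed A (closed_ideal_gen A d)" "d \<in> closed_ideal_gen A d"
proof -
  have "ideal (carrier A) A" by (rule ideal_of_closed) auto
  then have ne: "carrier A \<in> {I. ideal I A \<and> norm_closed A I \<and> d \<in> I}"
    using assms by (auto simp: norm_closed_def)
  show "ideal (closed_ideal_gen A d) A"
    unfolding closed_ideal_gen_def by (rule i_Intersect) (use ne in auto)
  show "d \<in> closed_ideal_gen A d" by (auto simp: closed_ideal_gen_def)
  show "norm_closed A (closed_ideal_gen A d)"
    unfolding norm_closed_def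
  proof (intro ballI impI)
    fix a assume a: "a \<in> carrier A" and ap: "\<forall>e>0. \<exists>b\<in>closed_ideal_gen A d. nrm A (a \<ominus> b) < e"
    have "a \<in> I" if I: "ideal I A" "norm_closed A I" "d \<in> I" for I
    proof -
      have "\<forall>e>0. \<exists>b\<in>I. nrm A (a \<ominus> b) < e" using ap I unfolding closed_ideal_gen_def by blast
      then show ?thesis using I(2) a by (auto simp: norm_closed_def)
    qed
    then show "a \<in> closed_ideal_gen A d" by (auto simp: closed_ideal_gen_def)
  qed
qed

lemma closed_ideal_gen_least:
  "\<lbrakk>ideal I A; norm_closed A I; d \<in> I\<rbrakk> \<Longrightarrow> closed_ideal_gen A d \<subseteq> I"
  by (auto simp: closed_ideal_gen_def)

lemma ideal_smult: "\<lbrakk>ideal I A; x \<in> I\<rbrakk> \<Longrightarrow> c \<odot> x \<in> I"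
  using ideal.I_l_closed[of I A x "c \<odot> \<one>"] ideal.Icarr[of I A x] by simp

text \<open>The adjoints of the elements of the ideal form a closed ideal that contains \<open>d\<close>.\<close>

lemma closed_ideal_gen_star:
  assumes d: "d \<in> carrier A" "star A d = d" and x: "x \<in> closed_ideal_gen A d"
  shows "star A x \<in> closed_ideal_gen A d"
proof -
  let ?J = "closed_ideal_gen A d"
  interpret J: ideal ?J A using closed_ideal_gen_props[OF d(1)] by blast
  let ?I = "{y \<in> carrier A. star A y \<in> ?J}"
  have "ideal ?I A"
    by (rule ideal_of_closed) (auto simp: J.I_l_closed J.I_r_closed)
  moreover have "norm_closed A ?I"
  proof -
    have "star A a \<in> ?J" if a: "a \<in> carrier A" and ap: "\<And>e. 0 < e \<Longrightarrow> \<exists>b\<in>?I. nrm A (a \<ominus> b) < e" for a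
    proof -
      have "\<exists>b\<in>?J. nrm A (star A a \<ominus> b) < e" if e: "0 < e" for e
      proof -
        obtain b where b: "b \<in> ?I" "nrm A (a \<ominus> b) < e" using ap[OF e] by blast
        then have "nrm A (star A a \<ominus> star A b) < e" using a by (simp flip: star_diff)
        then show ?thesis using b by blast
      qed
      then show ?thesis using closed_ideal_gen_props(2)[OF d(1)] a by (auto simp: norm_closed_def)
    qed
    then show ?thesis by (auto simp: norm_closed_def)
  qed
  moreover have "d \<in> ?I" using d closed_ideal_gen_props(3) by simp
  ultimately have "?J \<subseteq> ?I" by (rule closed_ideal_gen_least)
  then show ?thesis using x by auto
qed

end

text \<open>The closure of the left ideal \<open>Ad\<close>.\<close>

definition (in cstar_algebra) left_span :: "'a \<Rightarrow> 'a set" where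
  "left_span d = {c \<in> carrier A. \<forall>e>0. \<exists>b\<in>carrier A. nrm A (c \<ominus> b \<otimes> d) < e}"

context cstar_algebra
begin

lemma left_span_closed: "c \<in> left_span d \<Longrightarrow> c \<in> carrier A"
  by (simp add: left_span_def)

lemma left_span_approx: "\<lbrakk>c \<in> left_span d; 0 < e\<rbrakk> \<Longrightarrow> \<exists>b\<in>carrier A. nrm A (c \<ominus> b \<otimes> d) < e"
  by (simp add: left_span_def)

lemma left_span_mult_self: "\<lbrakk>b \<in> carrier A; d \<in> carrier A\<rbrakk> \<Longrightarrow> b \<otimes> d \<in> left_span d"
  unfolding left_span_def by (auto intro!: bexI[of _ b] simp: minus_eq r_neg)

lemma left_span_limit:
  assumes d [simp]: "d \<in> carrier A" and a [simp]: "a \<in> carrier A"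
    and ap: "\<And>e. 0 < e \<Longrightarrow> \<exists>b\<in>left_span d. nrm A (a \<ominus> b) < e"
  shows "a \<in> left_span d"
proof -
  have "\<exists>b\<in>carrier A. nrm A (a \<ominus> b \<otimes> d) < e" if "0 < e" for e
  proof -
    obtain k where k: "k \<in> left_span d" "nrm A (a \<ominus> k) < e / 2" using ap[of "e / 2"] \<open>0 < e\<close> by auto
    then obtain b where b: "b \<in> carrier A" "nrm A (k \<ominus> b \<otimes> d) < e / 2"
      using left_span_approx[of k d "e / 2"] \<open>0 < e\<close> by auto
    then show ?thesis using k left_span_closed p_triangle[of a k "b \<otimes> d"] by (intro bexI[of _ b]) auto
  qed
  then show ?thesis by (simp add: left_span_def)
qed

lemma left_span_add:
  assumes d [simp]: "d \<in> carrier A" and x: "x \<in> left_span d" and y: "y \<in> left_span d"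
  shows "x \<oplus> y \<in> left_span d"
proof -
  have [simp]: "x \<in> carrier A" "y \<in> carrier A" using x y left_span_closed by auto
  have "\<exists>b\<in>carrier A. nrm A (x \<oplus> y \<ominus> b \<otimes> d) < e" if "0 < e" for e
  proof -
    obtain b c where bc: "b \<in> carrier A" "nrm A (x \<ominus> b \<otimes> d) < e / 2"
      "c \<in> carrier A" "nrm A (y \<ominus> c \<otimes> d) < e / 2"
      using left_span_approx[OF x, of "e / 2"] left_span_approx[OF y, of "e / 2"] \<open>0 < e\<close> by auto
    then have "nrm A (x \<oplus> y \<ominus> (b \<oplus> c) \<otimes> d) < e"
      using p_add_diff[of x y "b \<otimes> d" "c \<otimes> d"] by (simp add: l_distr)
    then show ?thesis using bc by (intro bexI[of _ "b \<oplus> c"]) auto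
  qed
  then show ?thesis by (simp add: left_span_def)
qed

lemma left_span_left_mult:
  assumes d [simp]: "d \<in> carrier A" and x: "x \<in> left_span d" and y [simp]: "y \<in> carrier A"
  shows "y \<otimes> x \<in> left_span d"
proof -
  have [simp]: "x \<in> carrier A" using x left_span_closed by auto
  have "\<exists>b\<in>carrier A. nrm A (y \<otimes> x \<ominus> b \<otimes> d) < e" if "0 < e" for e
  proof -
    have N: "0 < nrm A y + 1" using p_nonneg[of y] by (simp add: add_nonneg_pos)
    then obtain b where b: "b \<in> carrier A" "nrm A (x \<ominus> b \<otimes> d) < e / (nrm A y + 1)"
      using left_span_approx[OF x, of "e / (nrm A y + 1)"] \<open>0 < e\<close> by auto
    have "nrm A (y \<otimes> x \<ominus> (y \<otimes> b) \<otimes> d) = nrm A (y \<otimes> (x \<ominus> b \<otimes> d))"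
      using b by (simp add: r_diff_distr m_assoc)
    also have "\<dots> \<le> nrm A y * nrm A (x \<ominus> b \<otimes> d)" using b by (intro p_mult) auto
    also have "\<dots> \<le> (nrm A y + 1) * nrm A (x \<ominus> b \<otimes> d)" using b by (intro mult_right_mono) auto
    also have "\<dots> < e" using b(2) N by (simp add: pos_less_divide_eq mult.commute)
    finally show ?thesis using b by (intro bexI[of _ "y \<otimes> b"]) auto
  qed
  then show ?thesis by (simp add: left_span_def)
qed

text \<open>The closure of \<open>Ad\<close> is a left ideal; it is two-sided as soon as it absorbs \<open>dA\<close>.\<close>

lemma left_span_right_mult:
  assumes d [simp]: "d \<in> carrier A" and x: "x \<in> left_span d" and y [simp]: "y \<in> carrier A"
    and dy: "d \<otimes> y \<in> left_span d"
  shows "x \<otimes> y \<in> left_span d"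
proof (rule left_span_limit)
  have [simp]: "x \<in> carrier A" using x left_span_closed by auto
  show "x \<otimes> y \<in> carrier A" by simp
  fix e :: real assume "0 < e"
  have N: "0 < nrm A y + 1" using p_nonneg[of y] by (simp add: add_nonneg_pos)
  then obtain b where b: "b \<in> carrier A" "nrm A (x \<ominus> b \<otimes> d) < e / (nrm A y + 1)"
    using left_span_approx[OF x, of "e / (nrm A y + 1)"] \<open>0 < e\<close> by auto
  have "nrm A (x \<otimes> y \<ominus> b \<otimes> (d \<otimes> y)) = nrm A ((x \<ominus> b \<otimes> d) \<otimes> y)"
    using b by (simp add: l_diff_distr m_assoc)
  also have "\<dots> \<le> nrm A (x \<ominus> b \<otimes> d) * nrm A y" using b by (intro p_mult) auto
  also have "\<dots> \<le> nrm A (x \<ominus> b \<otimes> d) * (nrm A y + 1)" using b by (intro mult_left_mono) auto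
  also have "\<dots> < e" using b(2) by (simp only: pos_less_divide_eq[OF N])
  finally show "\<exists>c\<in>left_span d. nrm A (x \<otimes> y \<ominus> c) < e"
    using left_span_left_mult[OF d dy b(1)] by blast
qed simp

end

text \<open>Under the last assumption the closed ideal generated by \<open>d\<close> is approximated by the elements \<open>bd\<close>
(\<open>J_approx\<close>), and \<open>approximate_unit\<close> provides an approximate unit of this ideal. For such ideals this
proves that the quotient is a C*-algebra without the theory of approximate units of general ideals.\<close>

locale normal_generator = cstar_algebra A for A :: "('a, 'm) cstar_alg_scheme" (structure) +
  fixes d
  assumes d_closed [simp]: "d \<in> carrier A" and d_star: "star A d = d"
    and normal: "b \<in> carrier A \<Longrightarrow> d \<otimes> b \<in> left_span d"
begin

abbreviation "J \<equiv> closed_ideal_gen A d"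

sublocale J: ideal J A
  by (rule closed_ideal_gen_props) simp

lemma J_subset_left_span: "J \<subseteq> left_span d"
proof (rule closed_ideal_gen_least)
  show "ideal (left_span d) A"
  proof (rule ideal_of_closed)
    show "left_span d \<subseteq> carrier A" using left_span_closed by blast
    show "\<zero> \<in> left_span d" using left_span_mult_self[of \<zero> d] by simp
    show "x \<otimes> y \<in> left_span d" if "x \<in> left_span d" "y \<in> carrier A" for x y
      using left_span_right_mult[OF d_closed that normal[OF that(2)]] .
  qed (rule left_span_add[OF d_closed] left_span_left_mult[OF d_closed]; assumption)+
  show "norm_closed A (left_span d)"
    unfolding norm_closed_def by (intro ballI impI left_span_limit) auto
  show "d \<in> left_span d" using left_span_mult_self[of \<one> d] by simp
qed

lemma J_approx: "\<lbrakk>j \<in> J; 0 < e\<rbrakk> \<Longrightarrow> \<exists>b\<in>carrier A. nrm A (j \<ominus> b \<otimes> d) < e"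
  using J_subset_left_span left_span_approx by blast

lemma J_star: "j \<in> J \<Longrightarrow> star A j \<in> J"
  using closed_ideal_gen_star d_star by simp

abbreviation "Q \<equiv> cstar_quot A J"
abbreviation "\<pi> x \<equiv> J +> x"

lemma J_carrier: "j \<in> J \<Longrightarrow> j \<in> carrier A"
  by (rule J.Icarr)

lemma pi_eq_iff: "\<lbrakk>x \<in> carrier A; y \<in> carrier A\<rbrakk> \<Longrightarrow> \<pi> x = \<pi> y \<longleftrightarrow> x \<ominus> y \<in> J"
  using quotient_eq_iff_same_a_r_cos[OF J.is_ideal] by simp

lemma mem_pi: "y \<in> \<pi> x \<longleftrightarrow> (\<exists>j\<in>J. y = j \<oplus> x)"
  by (auto simp: a_r_coset_def')

lemma pi_add_J: "\<lbrakk>x \<in> carrier A; j \<in> J\<rbrakk> \<Longrightarrow> \<pi> (j \<oplus> x) = \<pi> x"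
  by (subst pi_eq_iff) (auto simp: J_carrier minus_eq a_assoc r_neg)

lemma quot_simps:
  shows "carrier Q = \<pi> ` carrier A"
    and "\<lbrakk>x \<in> carrier A; y \<in> carrier A\<rbrakk> \<Longrightarrow> \<pi> x \<otimes>\<^bsub>Q\<^esub> \<pi> y = \<pi> (x \<otimes> y)"
    and "\<lbrakk>x \<in> carrier A; y \<in> carrier A\<rbrakk> \<Longrightarrow> \<pi> x \<oplus>\<^bsub>Q\<^esub> \<pi> y = \<pi> (x \<oplus> y)"
    and "\<one>\<^bsub>Q\<^esub> = \<pi> \<one>" and "\<zero>\<^bsub>Q\<^esub> = \<pi> \<zero>"
    and "x \<in> carrier A \<Longrightarrow> c \<odot>\<^bsub>Q\<^esub> \<pi> x = \<pi> (c \<odot> x)"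
    and "x \<in> carrier A \<Longrightarrow> star Q (\<pi> x) = \<pi> (star A x)"
proof -
  show "carrier Q = \<pi> ` carrier A" by (auto simp: cstar_quot_def FactRing_def A_RCOSETS_def')
  show "\<one>\<^bsub>Q\<^esub> = \<pi> \<one>" by (simp add: cstar_quot_def FactRing_def)
  show "\<zero>\<^bsub>Q\<^esub> = \<pi> \<zero>" 
    using J.a_subset by (auto simp: cstar_quot_def FactRing_def a_r_coset_def' intro!: bexI)
  show "\<pi> x \<otimes>\<^bsub>Q\<^esub> \<pi> y = \<pi> (x \<otimes> y)" "\<pi> x \<oplus>\<^bsub>Q\<^esub> \<pi> y = \<pi> (x \<oplus> y)"
    if "x \<in> carrier A" "y \<in> carrier A"
    using that by (simp_all add: cstar_quot_def FactRing_def J.rcoset_mult_add J.a_rcos_sum)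
  show "c \<odot>\<^bsub>Q\<^esub> \<pi> x = \<pi> (c \<odot> x)" if [simp]: "x \<in> carrier A"
  proof -
    have "\<pi> (c \<odot> y) = \<pi> (c \<odot> x)" if y: "y \<in> \<pi> x" for y
    proof -
      obtain j where j: "j \<in> J" "y = j \<oplus> x" using y mem_pi by auto
      then show ?thesis
        using ideal_smult[OF J.is_ideal j(1)] by (simp add: smult_add_right J_carrier pi_add_J)
    qed
    moreover have "x \<in> \<pi> x" by (rule J.a_rcos_self) simp
    ultimately have "(\<Union>y\<in>\<pi> x. \<pi> (c \<odot> y)) = \<pi> (c \<odot> x)" by blast
    then show ?thesis by (simp add: cstar_quot_def)
  qed
  show "star Q (\<pi> x) = \<pi> (star A x)" if [simp]: "x \<in> carrier A"
  proof -
    have "star A ` \<pi> x = \<pi> (star A x)"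
    proof (intro equalityI subsetI)
      fix y assume "y \<in> \<pi> (star A x)"
      then obtain j where j: "j \<in> J" "y = j \<oplus> star A x" using mem_pi by auto
      then have "y = star A (star A j \<oplus> x)" by (simp add: J_carrier)
      moreover have "star A j \<oplus> x \<in> \<pi> x" using j J_star mem_pi by auto
      ultimately show "y \<in> star A ` \<pi> x" by blast
    next
      fix y assume "y \<in> star A ` \<pi> x"
      then obtain j where j: "j \<in> J" "y = star A (j \<oplus> x)" using mem_pi by auto
      then show "y \<in> \<pi> (star A x)" using J_star[OF j(1)] mem_pi by (auto simp: J_carrier)
    qed
    then show ?thesis by (simp add: cstar_quot_def)
  qed
qed

lemma quot_star_algebra: "star_algebra Q" and pi_hom: "star_hom A Q \<pi>"
  using star_algebra_image[OF star_algebra_axioms quot_simps] by blast+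

lemma nrm_pi: "nrm Q (\<pi> x) = Inf (nrm A ` \<pi> x)"
  by (simp add: cstar_quot_def)

lemma nrm_pi_le: assumes "x \<in> carrier A" "j \<in> J" shows "nrm Q (\<pi> x) \<le> nrm A (j \<oplus> x)"
proof -
  have "bdd_below (nrm A ` \<pi> x)" using assms
    by (intro bdd_belowI[of _ 0]) (auto simp: mem_pi J_carrier)
  then show ?thesis unfolding nrm_pi by (rule cInf_lower[rotated]) (use assms mem_pi in auto)
qed

lemma nrm_pi_le': "x \<in> carrier A \<Longrightarrow> nrm Q (\<pi> x) \<le> nrm A x"
  using nrm_pi_le[of x \<zero>] by simp

lemma nrm_pi_ge: assumes "x \<in> carrier A" "0 < e" shows "\<exists>j\<in>J. nrm A (j \<oplus> x) < nrm Q (\<pi> x) + e"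
proof -
  have "nrm A ` \<pi> x \<noteq> {}" using J.a_rcos_self[OF assms(1)] by blast
  then obtain y where "y \<in> nrm A ` \<pi> x" "y < nrm Q (\<pi> x) + e"
    using cInf_lessD[of "nrm A ` \<pi> x" "nrm Q (\<pi> x) + e"] assms(2) by (auto simp: nrm_pi)
  then show ?thesis using mem_pi by auto
qed

lemma nrm_pi_nonneg: assumes "x \<in> carrier A" shows "0 \<le> nrm Q (\<pi> x)"
proof -
  have "nrm A ` \<pi> x \<noteq> {}" using J.a_rcos_self[OF assms] by blast
  then show ?thesis unfolding nrm_pi by (rule cInf_greatest) (auto simp: mem_pi J_carrier assms)
qed

lemma nrm_pi_star: assumes [simp]: "x \<in> carrier A" shows "nrm Q (\<pi> (star A x)) \<le> nrm Q (\<pi> x)"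
proof (rule field_le_epsilon)
  fix e :: real assume "0 < e"
  from nrm_pi_ge[OF assms this] obtain j where j: "j \<in> J" "nrm A (j \<oplus> x) < nrm Q (\<pi> x) + e" by blast
  have "nrm Q (\<pi> (star A x)) \<le> nrm A (star A j \<oplus> star A x)" using j J_star by (intro nrm_pi_le) auto
  also have "\<dots> = nrm A (j \<oplus> x)" using j by (simp add: J_carrier flip: star_add)
  finally show "nrm Q (\<pi> (star A x)) \<le> nrm Q (\<pi> x) + e" using j by simp
qed

lemma nrm_pi_mult:
  assumes [simp]: "x \<in> carrier A" "y \<in> carrier A"
  shows "nrm Q (\<pi> (x \<otimes> y)) \<le> nrm Q (\<pi> x) * nrm Q (\<pi> y)"
proof -
  let ?X = "nrm Q (\<pi> x)" and ?Y = "nrm Q (\<pi> y)"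
  have le: "nrm Q (\<pi> (x \<otimes> y)) \<le> (?X + e) * (?Y + e)" if e: "0 < e" for e
  proof -
    obtain j where j: "j \<in> J" "nrm A (j \<oplus> x) < ?X + e" using nrm_pi_ge[OF assms(1) e] by blast
    obtain k where k: "k \<in> J" "nrm A (k \<oplus> y) < ?Y + e" using nrm_pi_ge[OF assms(2) e] by blast
    have [simp]: "j \<in> carrier A" "k \<in> carrier A" using j k J_carrier by auto
    have "j \<otimes> (k \<oplus> y) \<oplus> x \<otimes> k \<in> J" using j k by (intro J.a_closed) (simp_all add: J.I_l_closed J.I_r_closed)
    then have "nrm Q (\<pi> (x \<otimes> y)) \<le> nrm A (j \<otimes> (k \<oplus> y) \<oplus> x \<otimes> k \<oplus> x \<otimes> y)" by (rule nrm_pi_le[rotated]) simp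
    also have "j \<otimes> (k \<oplus> y) \<oplus> x \<otimes> k \<oplus> x \<otimes> y = (j \<oplus> x) \<otimes> (k \<oplus> y)"
      by (simp add: l_distr r_distr a_ac)
    also have "nrm A \<dots> \<le> nrm A (j \<oplus> x) * nrm A (k \<oplus> y)" by (rule p_mult) simp_all
    also have "\<dots> \<le> (?X + e) * (?Y + e)" using j k nrm_pi_nonneg[OF assms(1)] e by (intro mult_mono) auto
    finally show ?thesis .
  qed
  have "((\<lambda>e. (?X + e) * (?Y + e)) \<longlongrightarrow> (?X + 0) * (?Y + 0)) (at_right 0)"
    by (intro tendsto_intros)
  then have "nrm Q (\<pi> (x \<otimes> y)) \<le> (?X + 0) * (?Y + 0)"
    by (rule tendsto_lowerbound) (auto intro!: eventually_at_right_less[THEN eventually_mono] le)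
  then show ?thesis by simp
qed

text \<open>Let \<open>j + x\<^sup>*x\<close> almost attain the norm of \<open>\<pi>(x\<^sup>*x)\<close>, and choose \<open>u\<close> with \<open>1 - u \<in> J\<close>, \<open>\<parallel>u\<parallel> \<le> 1\<close> and \<open>ju\<close> small. Then
\<open>xu\<close> represents \<open>\<pi>(x)\<close>, and \<open>\<parallel>xu\<parallel>\<^sup>2 = \<parallel>ux\<^sup>*xu\<parallel>\<close> differs from \<open>\<parallel>u(j + x\<^sup>*x)u\<parallel>\<close> by a small amount.\<close>

lemma nrm_pi_square:
  assumes [simp]: "x \<in> carrier A"
  shows "(nrm Q (\<pi> x))\<^sup>2 \<le> nrm Q (\<pi> (star A x \<otimes> x))"
proof (rule field_le_epsilon)
  let ?N = "nrm Q (\<pi> (star A x \<otimes> x))"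
  fix e' :: real assume "0 < e'"
  define e where "e = e' / 3"
  have e: "0 < e" using \<open>0 < e'\<close> by (simp add: e_def)
  obtain j where j: "j \<in> J" "nrm A (j \<oplus> star A x \<otimes> x) < ?N + e"
    using nrm_pi_ge[OF _ e, of "star A x \<otimes> x"] by auto
  obtain b where b: "b \<in> carrier A" "nrm A (j \<ominus> b \<otimes> d) < e" using J_approx[OF j(1) e] by blast
  have [simp]: "j \<in> carrier A" "b \<in> carrier A" using j b J_carrier by auto
  have Nb: "0 < nrm A b + 1" using p_nonneg[OF b(1)] by (simp add: add_nonneg_pos)
  obtain u y where [simp]: "u \<in> carrier A" "y \<in> carrier A" and u: "star A u = u" "nrm A u \<le> 1"
    "nrm A (d \<otimes> u) \<le> e / (nrm A b + 1)" "\<one> \<ominus> u = y \<otimes> d"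
    using approximate_unit[OF d_closed d_star, of "e / (nrm A b + 1)"] e Nb by auto
  have "nrm A (j \<otimes> u) \<le> nrm A ((j \<ominus> b \<otimes> d) \<otimes> u) + nrm A (b \<otimes> (d \<otimes> u))"
  proof -
    have "j \<otimes> u = (j \<ominus> b \<otimes> d) \<otimes> u \<oplus> b \<otimes> (d \<otimes> u)"
      using \<open>j \<in> carrier A\<close> b(1) \<open>u \<in> carrier A\<close> d_closed by algebra
    then show ?thesis using p_add[of "(j \<ominus> b \<otimes> d) \<otimes> u" "b \<otimes> (d \<otimes> u)"] by simp
  qed
  also have "\<dots> \<le> nrm A (j \<ominus> b \<otimes> d) * nrm A u + nrm A b * nrm A (d \<otimes> u)"
    by (intro add_mono p_mult) simp_all
  also have "\<dots> \<le> e * 1 + (nrm A b + 1) * (e / (nrm A b + 1))"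
    using b u e by (intro add_mono mult_mono) auto
  also have "\<dots> = 2 * e" using Nb by simp
  finally have ju: "nrm A (j \<otimes> u) \<le> 2 * e" .
  have "\<ominus> (x \<otimes> (\<one> \<ominus> u)) \<in> J"
    unfolding u(4) using closed_ideal_gen_props(3)[OF d_closed] by (simp add: J.I_l_closed flip: m_assoc)
  then have "nrm Q (\<pi> x) \<le> nrm A (\<ominus> (x \<otimes> (\<one> \<ominus> u)) \<oplus> x)" by (rule nrm_pi_le[rotated]) simp
  also have "\<ominus> (x \<otimes> (\<one> \<ominus> u)) \<oplus> x = x \<otimes> u"
    using \<open>u \<in> carrier A\<close> assms by algebra
  finally have "(nrm Q (\<pi> x))\<^sup>2 \<le> (nrm A (x \<otimes> u))\<^sup>2" by (rule power_mono) (simp add: nrm_pi_nonneg)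
  also have "\<dots> = nrm A (u \<otimes> (star A x \<otimes> x) \<otimes> u)"
    using p_star_mult[of "x \<otimes> u"] by (simp add: u m_assoc)
  also have "u \<otimes> (star A x \<otimes> x) \<otimes> u = u \<otimes> (j \<oplus> star A x \<otimes> x) \<otimes> u \<ominus> u \<otimes> (j \<otimes> u)"
    using \<open>u \<in> carrier A\<close> \<open>j \<in> carrier A\<close> assms by algebra
  also have "nrm A \<dots> \<le> nrm A (u \<otimes> (j \<oplus> star A x \<otimes> x) \<otimes> u) + nrm A (u \<otimes> (j \<otimes> u))"
    by (rule p_diff) simp_all
  also have "\<dots> \<le> nrm A u * nrm A (j \<oplus> star A x \<otimes> x) * nrm A u + nrm A u * nrm A (j \<otimes> u)"
    by (intro add_mono order.trans[OF p_mult] mult_right_mono p_mult) simp_all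
  also have "\<dots> \<le> 1 * (?N + e) * 1 + 1 * (2 * e)"
    using u j ju e nrm_pi_nonneg[of "star A x \<otimes> x"] by (intro add_mono mult_mono) auto
  also have "\<dots> = ?N + e'" by (simp add: e_def)
  finally show "(nrm Q (\<pi> x))\<^sup>2 \<le> ?N + e'" .
qed

lemma quot_seminorm: "cstar_seminorm Q (nrm Q)"
proof -
  have add: "nrm Q (\<pi> (x \<oplus> y)) \<le> nrm Q (\<pi> x) + nrm Q (\<pi> y)"
    if [simp]: "x \<in> carrier A" "y \<in> carrier A" for x y
  proof (rule field_le_epsilon)
    fix e :: real assume "0 < e"
    then have e: "0 < e / 2" by simp
    obtain j where j: "j \<in> J" "nrm A (j \<oplus> x) < nrm Q (\<pi> x) + e / 2" using nrm_pi_ge[OF \<open>x \<in> carrier A\<close> e] by blast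
    obtain k where k: "k \<in> J" "nrm A (k \<oplus> y) < nrm Q (\<pi> y) + e / 2" using nrm_pi_ge[OF \<open>y \<in> carrier A\<close> e] by blast
    have [simp]: "j \<in> carrier A" "k \<in> carrier A" using j k J_carrier by auto
    have "nrm Q (\<pi> (x \<oplus> y)) \<le> nrm A (j \<oplus> k \<oplus> (x \<oplus> y))"
      using j k by (intro nrm_pi_le) (auto intro: J.a_closed)
    also have "j \<oplus> k \<oplus> (x \<oplus> y) = (j \<oplus> x) \<oplus> (k \<oplus> y)" by (simp add: a_ac)
    also have "nrm A \<dots> \<le> nrm A (j \<oplus> x) + nrm A (k \<oplus> y)" by (rule p_add) simp_all
    finally show "nrm Q (\<pi> (x \<oplus> y)) \<le> nrm Q (\<pi> x) + nrm Q (\<pi> y) + e" using j k by simp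
  qed
  have smult: "nrm Q (\<pi> (c \<odot> x)) \<le> cmod c * nrm Q (\<pi> x)" if [simp]: "x \<in> carrier A" for c x
  proof (rule field_le_epsilon)
    fix e :: real assume "0 < e"
    then have e: "0 < e / (cmod c + 1)" by (simp add: add_nonneg_pos)
    obtain j where j: "j \<in> J" "nrm A (j \<oplus> x) < nrm Q (\<pi> x) + e / (cmod c + 1)" using nrm_pi_ge[OF \<open>x \<in> carrier A\<close> e] by blast
    have [simp]: "j \<in> carrier A" using j J_carrier by auto
    have "nrm Q (\<pi> (c \<odot> x)) \<le> nrm A (c \<odot> j \<oplus> c \<odot> x)"
      by (rule nrm_pi_le) (simp_all add: ideal_smult[OF J.is_ideal j(1)])
    also have "\<dots> = cmod c * nrm A (j \<oplus> x)" by (simp flip: smult_add_right)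
    also have "\<dots> \<le> cmod c * (nrm Q (\<pi> x) + e / (cmod c + 1))" using j by (intro mult_left_mono) auto
    also have "\<dots> \<le> cmod c * nrm Q (\<pi> x) + e"
      using \<open>0 < e\<close> by (simp add: distrib_left add_nonneg_pos pos_divide_le_eq)
    finally show "nrm Q (\<pi> (c \<odot> x)) \<le> cmod c * nrm Q (\<pi> x) + e" .
  qed
  have smult': "nrm Q (\<pi> (c \<odot> x)) = cmod c * nrm Q (\<pi> x)" if [simp]: "x \<in> carrier A" for c x
  proof (cases "c = 0")
    case True
    then show ?thesis using smult[of x 0] nrm_pi_nonneg[of "0 \<odot> x"] by (intro antisym) simp_all
  next
    case False
    have "cmod c * nrm Q (\<pi> ((1 / c) \<odot> (c \<odot> x))) \<le> cmod c * (cmod (1 / c) * nrm Q (\<pi> (c \<odot> x)))"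
      by (intro mult_left_mono smult) simp_all
    then have "cmod c * nrm Q (\<pi> x) \<le> nrm Q (\<pi> (c \<odot> x))" using False by (simp add: norm_divide)
    then show ?thesis using smult[of x c] by simp
  qed
  have sq: "nrm Q (\<pi> (star A x \<otimes> x)) = (nrm Q (\<pi> x))\<^sup>2" if [simp]: "x \<in> carrier A" for x
  proof (rule antisym)
    have "nrm Q (\<pi> (star A x \<otimes> x)) \<le> nrm Q (\<pi> (star A x)) * nrm Q (\<pi> x)" by (rule nrm_pi_mult) simp_all
    also have "\<dots> \<le> nrm Q (\<pi> x) * nrm Q (\<pi> x)" by (intro mult_right_mono nrm_pi_star nrm_pi_nonneg) simp_all
    finally show "nrm Q (\<pi> (star A x \<otimes> x)) \<le> (nrm Q (\<pi> x))\<^sup>2" by (simp add: power2_eq_square)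
  qed (rule nrm_pi_square, simp)
  show ?thesis
    unfolding cstar_seminorm_def
    by (auto simp: quot_simps add smult' sq nrm_pi_mult nrm_pi_nonneg)
qed

lemma J_closed: "\<lbrakk>a \<in> carrier A; \<And>e. 0 < e \<Longrightarrow> \<exists>b\<in>J. nrm A (a \<ominus> b) < e\<rbrakk> \<Longrightarrow> a \<in> J"
  using closed_ideal_gen_props(2)[OF d_closed] by (auto simp: norm_closed_def)

lemma pi_zero_iff: "x \<in> carrier A \<Longrightarrow> \<pi> x = \<zero>\<^bsub>Q\<^esub> \<longleftrightarrow> x \<in> J"
  by (simp add: quot_simps pi_eq_iff)

theorem quot_cstar: "cstar_algebra Q"
proof -
  interpret Q: star_algebra Q by (rule quot_star_algebra)
  interpret pi: star_morphism A Q \<pi> by unfold_locales (rule pi_hom)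
  interpret QN: cstar_seminormed Q "nrm Q" by unfold_locales (rule quot_seminorm)
  show ?thesis
  proof
    show "cstar_seminorm Q (nrm Q)" by (rule quot_seminorm)
    fix X assume "X \<in> carrier Q" and X0: "nrm Q X = 0"
    then obtain x where [simp]: "x \<in> carrier A" and X: "X = \<pi> x" by (auto simp: quot_simps)
    have "x \<in> J"
    proof (rule J_closed)
      fix e :: real assume "0 < e"
      then obtain j where j: "j \<in> J" "nrm A (j \<oplus> x) < e"
        using nrm_pi_ge[of x e] X0 X by auto
      then show "\<exists>b\<in>J. nrm A (x \<ominus> b) < e"
        by (intro bexI[of _ "\<ominus> j"]) (auto simp: minus_eq J_carrier a_comm)
    qed simp
    then show "X = \<zero>\<^bsub>Q\<^esub>" by (simp add: X pi_zero_iff)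
  next
    fix S assume S: "\<And>k. S k \<in> carrier Q" and step: "\<And>k. nrm Q (S (Suc k) \<ominus>\<^bsub>Q\<^esub> S k) \<le> (1/2) ^ k"
    \<comment> \<open>Lift the sequence step by step so that the lifts have steps of comparable size.\<close>
    have "\<exists>x. \<forall>k. (x k \<in> carrier A \<and> \<pi> (x k) = S k) \<and> nrm A (x (Suc k) \<ominus> x k) \<le> 2 * (1/2) ^ k"
    proof (rule dependent_nat_choice)
      show "\<exists>x. x \<in> carrier A \<and> \<pi> x = S 0" using S[of 0] by (auto simp: quot_simps)
      fix x k assume x: "x \<in> carrier A \<and> \<pi> x = S k"
      obtain y where y: "y \<in> carrier A" "\<pi> y = S (Suc k)" using S[of "Suc k"] by (auto simp: quot_simps)
      have "nrm Q (\<pi> (y \<ominus> x)) \<le> (1/2) ^ k" using step[of k] x y by simp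
      moreover obtain j where j: "j \<in> J" "nrm A (j \<oplus> (y \<ominus> x)) < nrm Q (\<pi> (y \<ominus> x)) + (1/2) ^ k"
        using nrm_pi_ge[of "y \<ominus> x" "(1/2) ^ k"] x y by auto
      ultimately have jk: "nrm A (j \<oplus> (y \<ominus> x)) \<le> 2 * (1/2) ^ k" by linarith
      have "j \<oplus> y \<ominus> x = j \<oplus> (y \<ominus> x)" using x y J_carrier[OF j(1)] by (simp add: minus_eq a_assoc)
      moreover have "\<pi> (j \<oplus> y) = S (Suc k)" unfolding pi_add_J[OF y(1) j(1)] by (rule y(2))
      moreover have "j \<oplus> y \<in> carrier A" using y J_carrier[OF j(1)] by simp
      ultimately show "\<exists>z. (z \<in> carrier A \<and> \<pi> z = S (Suc k)) \<and> nrm A (z \<ominus> x) \<le> 2 * (1/2) ^ k"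
        using jk by (intro exI[of _ "j \<oplus> y"]) simp
    qed
    then obtain x where x: "\<And>k. x k \<in> carrier A" "\<And>k. \<pi> (x k) = S k"
      and xs: "\<And>k. nrm A (x (Suc k) \<ominus> x k) \<le> 2 * (1/2) ^ k" by blast
    have "(\<lambda>k. - 4 * (1/2::real) ^ k) \<longlonglongrightarrow> - 4 * 0"
      by (intro tendsto_intros LIMSEQ_power_zero) auto
    then have "convergent (\<lambda>k. - 4 * (1/2::real) ^ k)" by (rule convergentI)
    moreover have "nrm A (x (Suc k) \<ominus> x k) \<le> - 4 * (1/2) ^ Suc k - (- 4 * (1/2) ^ k)" for k
      using xs[of k] by simp
    ultimately obtain l where l: "conv x l" using conv_of_bounded_steps[of x "\<lambda>k. - 4 * (1/2) ^ k"] x(1) by auto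
    have "nrm Q (S k \<ominus>\<^bsub>Q\<^esub> \<pi> l) \<le> nrm A (x k \<ominus> l)" for k
    proof -
      have "\<pi> (x k \<ominus> l) = S k \<ominus>\<^bsub>Q\<^esub> \<pi> l"
        using pi.hom_minus[OF x(1) convD(2)[OF l], of k] unfolding x(2) .
      moreover have "x k \<ominus> l \<in> carrier A" using x(1) convD(2)[OF l] by simp
      ultimately show ?thesis using nrm_pi_le' by metis
    qed
    then have "(\<lambda>k. nrm Q (S k \<ominus>\<^bsub>Q\<^esub> \<pi> l)) \<longlonglongrightarrow> 0"
      by (intro tendsto_0_le[OF convD(3)[OF l]] QN.p_nonneg) (use S convD(2)[OF l] in auto)
    then show "\<exists>x\<in>carrier Q. (\<lambda>k. nrm Q (S k \<ominus>\<^bsub>Q\<^esub> x)) \<longlonglongrightarrow> 0"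
      using convD(2)[OF l] pi.hom_closed by blast
  qed
qed

end


section \<open>Completions\<close>

context cstar_seminormed
begin

lemma p_cauchyI:
  assumes "\<And>k. s k \<in> carrier A" "\<And>e. 0 < e \<Longrightarrow> \<exists>M. \<forall>k\<ge>M. \<forall>l\<ge>M. p (s k \<ominus> s l) < e"
  shows "s \<in> p_cauchy A p"
  using assms by (auto simp: p_cauchy_def)

lemma p_cauchy_carrier [simp]: "s \<in> p_cauchy A p \<Longrightarrow> s k \<in> carrier A"
  by (simp add: p_cauchy_def)

lemma p_cauchyD:
  assumes "s \<in> p_cauchy A p" "0 < e" obtains M where "\<And>k l. \<lbrakk>M \<le> k; M \<le> l\<rbrakk> \<Longrightarrow> p (s k \<ominus> s l) < e"
  using assms unfolding p_cauchy_def by blast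

lemma p_cauchy_bounded:
  assumes "s \<in> p_cauchy A p" obtains K where "0 < K" "\<And>k. p (s k) \<le> K"
proof -
  obtain M where M: "\<And>k l. \<lbrakk>M \<le> k; M \<le> l\<rbrakk> \<Longrightarrow> p (s k \<ominus> s l) < 1" using p_cauchyD[OF assms, of 1] by auto
  define K where "K = (\<Sum>k<M. p (s k)) + p (s M) + 1"
  have sum_nn: "0 \<le> (\<Sum>k<M. p (s k))" using assms by (intro sum_nonneg) auto
  have "p (s k) \<le> K" for k
  proof (cases "M \<le> k")
    case True
    then show ?thesis using M[of k M] p_le_diff[of "s k" "s M"] assms sum_nn by (simp add: K_def)
  next
    case False
    then have "p (s k) \<le> (\<Sum>k<M. p (s k))" using assms by (intro member_le_sum) auto
    moreover have "0 \<le> p (s M)" using assms by simp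
    ultimately show ?thesis unfolding K_def by linarith
  qed
  moreover have "0 < K"
  proof -
    have "0 \<le> p (s M)" using assms by simp
    then show ?thesis unfolding K_def using sum_nn by linarith
  qed
  ultimately show ?thesis using that by blast
qed

text \<open>The *-algebra of Cauchy sequences, of which the completion is the image under \<open>p_class A p\<close>.\<close>

definition seqs :: "(nat \<Rightarrow> 'a) star_alg" where
  "seqs = \<lparr> carrier = p_cauchy A p, mult = (\<lambda>s t k. s k \<otimes> t k), one = (\<lambda>k. \<one>), zero = (\<lambda>k. \<zero>),
     add = (\<lambda>s t k. s k \<oplus> t k), smult = (\<lambda>c s k. c \<odot> s k), star = (\<lambda>s k. star A (s k)) \<rparr>"

lemma const_cauchy [simp]: "x \<in> carrier A \<Longrightarrow> (\<lambda>k. x) \<in> p_cauchy A p"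
  by (rule p_cauchyI) (simp_all add: minus_eq r_neg)

lemma add_cauchy: assumes s: "s \<in> p_cauchy A p" and t: "t \<in> p_cauchy A p"
  shows "(\<lambda>k. s k \<oplus> t k) \<in> p_cauchy A p"
proof (rule p_cauchyI)
  fix e :: real assume "0 < e"
  obtain M where M: "\<And>k l. \<lbrakk>M \<le> k; M \<le> l\<rbrakk> \<Longrightarrow> p (s k \<ominus> s l) < e / 2"
    using p_cauchyD[OF s, of "e / 2"] \<open>0 < e\<close> by auto
  obtain N where N: "\<And>k l. \<lbrakk>N \<le> k; N \<le> l\<rbrakk> \<Longrightarrow> p (t k \<ominus> t l) < e / 2"
    using p_cauchyD[OF t, of "e / 2"] \<open>0 < e\<close> by auto
  have "p (s k \<oplus> t k \<ominus> (s l \<oplus> t l)) < e" if "max M N \<le> k" "max M N \<le> l" for k l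
    using M[of k l] N[of k l] p_add_diff[of "s k" "t k" "s l" "t l"] s t that by simp
  then show "\<exists>M. \<forall>k\<ge>M. \<forall>l\<ge>M. p (s k \<oplus> t k \<ominus> (s l \<oplus> t l)) < e" by blast
qed (use s t in simp)

lemma mult_cauchy: assumes s: "s \<in> p_cauchy A p" and t: "t \<in> p_cauchy A p"
  shows "(\<lambda>k. s k \<otimes> t k) \<in> p_cauchy A p"
proof (rule p_cauchyI)
  fix e :: real assume "0 < e"
  obtain K where K: "0 < K" "\<And>k. p (s k) \<le> K" using p_cauchy_bounded[OF s] by blast
  obtain L where L: "0 < L" "\<And>k. p (t k) \<le> L" using p_cauchy_bounded[OF t] by blast
  obtain M where M: "\<And>k l. \<lbrakk>M \<le> k; M \<le> l\<rbrakk> \<Longrightarrow> p (s k \<ominus> s l) < e / 2 / L"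
    using p_cauchyD[OF s, of "e / 2 / L"] \<open>0 < e\<close> L by auto
  obtain N where N: "\<And>k l. \<lbrakk>N \<le> k; N \<le> l\<rbrakk> \<Longrightarrow> p (t k \<ominus> t l) < e / 2 / K"
    using p_cauchyD[OF t, of "e / 2 / K"] \<open>0 < e\<close> K by auto
  have "p (s k \<otimes> t k \<ominus> s l \<otimes> t l) < e" if "max M N \<le> k" "max M N \<le> l" for k l
  proof -
    have "p (s k \<otimes> t k \<ominus> s l \<otimes> t l) \<le> p (s k) * p (t k \<ominus> t l) + p (s k \<ominus> s l) * p (t l)"
      using s t by (intro p_mult_diff) auto
    also have "\<dots> \<le> K * p (t k \<ominus> t l) + p (s k \<ominus> s l) * L"
      using s t K L by (intro add_mono mult_mono) auto
    also have "\<dots> < K * (e / 2 / K) + e / 2 / L * L"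
      using M[of k l] N[of k l] that K L
      by (intro add_strict_mono mult_strict_left_mono mult_strict_right_mono) auto
    also have "\<dots> = e" using K L by simp
    finally show ?thesis .
  qed
  then show "\<exists>M. \<forall>k\<ge>M. \<forall>l\<ge>M. p (s k \<otimes> t k \<ominus> s l \<otimes> t l) < e" by blast
qed (use s t in simp)

lemma star_cauchy: assumes s: "s \<in> p_cauchy A p" shows "(\<lambda>k. star A (s k)) \<in> p_cauchy A p"
proof (rule p_cauchyI)
  fix e :: real assume "0 < e"
  then obtain M where M: "\<And>k l. \<lbrakk>M \<le> k; M \<le> l\<rbrakk> \<Longrightarrow> p (s k \<ominus> s l) < e" using p_cauchyD[OF s] by blast
  have "p (star A (s k) \<ominus> star A (s l)) < e" if "M \<le> k" "M \<le> l" for k l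
    using M[OF that] s by (simp flip: star_diff)
  then show "\<exists>M. \<forall>k\<ge>M. \<forall>l\<ge>M. p (star A (s k) \<ominus> star A (s l)) < e" by blast
qed (use s in simp)

lemma smult_cauchy: assumes s: "s \<in> p_cauchy A p" shows "(\<lambda>k. c \<odot> s k) \<in> p_cauchy A p"
  using mult_cauchy[OF const_cauchy[of "c \<odot> \<one>"] s] s by simp

lemma minus_cauchy: "s \<in> p_cauchy A p \<Longrightarrow> (\<lambda>k. \<ominus> s k) \<in> p_cauchy A p"
  using smult_cauchy[of s "-1"] by (simp add: minus_smult)

lemma diff_cauchy: "\<lbrakk>s \<in> p_cauchy A p; t \<in> p_cauchy A p\<rbrakk> \<Longrightarrow> (\<lambda>k. s k \<ominus> t k) \<in> p_cauchy A p"
  unfolding minus_eq by (intro add_cauchy minus_cauchy)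

lemmas cauchy_intros = const_cauchy add_cauchy mult_cauchy star_cauchy smult_cauchy diff_cauchy

lemma seqs_star_algebra: "star_algebra seqs"
proof -
  interpret S: ring seqs
  proof (intro ringI abelian_groupI monoidI)
    fix s assume s: "s \<in> carrier seqs"
    then have "(\<lambda>k. \<ominus> s k) \<in> carrier seqs" "(\<lambda>k. \<ominus> s k) \<oplus>\<^bsub>seqs\<^esub> s = \<zero>\<^bsub>seqs\<^esub>"
      by (auto simp: seqs_def minus_cauchy l_neg)
    then show "\<exists>t\<in>carrier seqs. t \<oplus>\<^bsub>seqs\<^esub> s = \<zero>\<^bsub>seqs\<^esub>" by blast
  qed (auto simp: seqs_def a_ac m_assoc l_distr r_distr intro!: cauchy_intros)
  show ?thesis
    by unfold_locales (auto simp: seqs_def smult_add_left smult_add_right intro!: cauchy_intros)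
qed

definition null_diff :: "(nat \<Rightarrow> 'a) \<Rightarrow> (nat \<Rightarrow> 'a) \<Rightarrow> bool" where
  "null_diff s t \<longleftrightarrow> (\<lambda>k. p (s k \<ominus> t k)) \<longlonglongrightarrow> 0"

lemma null_diff_refl: "s \<in> p_cauchy A p \<Longrightarrow> null_diff s s"
  by (simp add: null_diff_def minus_eq r_neg)

lemma null_diff_sym: "\<lbrakk>s \<in> p_cauchy A p; t \<in> p_cauchy A p; null_diff s t\<rbrakk> \<Longrightarrow> null_diff t s"
  by (simp add: null_diff_def p_diff_commute)

lemma null_diff_trans:
  assumes [simp]: "s \<in> p_cauchy A p" "t \<in> p_cauchy A p" "u \<in> p_cauchy A p" and "null_diff s t" "null_diff t u"
  shows "null_diff s u"
proof -
  have "(\<lambda>k. p (s k \<ominus> t k) + p (t k \<ominus> u k)) \<longlonglongrightarrow> 0"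
    using tendsto_add[of _ 0 _ _ 0] assms(4,5) by (simp add: null_diff_def)
  then show ?thesis unfolding null_diff_def by (rule tendsto_0_le) (simp_all add: p_triangle)
qed

lemma null_diff_add:
  assumes [simp]: "s \<in> p_cauchy A p" "t \<in> p_cauchy A p" "s' \<in> p_cauchy A p" "t' \<in> p_cauchy A p"
    and "null_diff s s'" "null_diff t t'"
  shows "null_diff (\<lambda>k. s k \<oplus> t k) (\<lambda>k. s' k \<oplus> t' k)"
proof -
  have "(\<lambda>k. p (s k \<ominus> s' k) + p (t k \<ominus> t' k)) \<longlonglongrightarrow> 0"
    using tendsto_add[of _ 0 _ _ 0] assms(5,6) by (simp add: null_diff_def)
  then show ?thesis unfolding null_diff_def by (rule tendsto_0_le) (simp_all add: p_add_diff)
qed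

lemma null_diff_mult:
  assumes [simp]: "s \<in> p_cauchy A p" "t \<in> p_cauchy A p" "s' \<in> p_cauchy A p" "t' \<in> p_cauchy A p"
    and "null_diff s s'" "null_diff t t'"
  shows "null_diff (\<lambda>k. s k \<otimes> t k) (\<lambda>k. s' k \<otimes> t' k)"
proof -
  obtain K where K: "0 < K" "\<And>k. p (s k) \<le> K" using p_cauchy_bounded[OF assms(1)] by blast
  obtain L where L: "0 < L" "\<And>k. p (t' k) \<le> L" using p_cauchy_bounded[OF assms(4)] by blast
  have "(\<lambda>k. K * p (t k \<ominus> t' k) + p (s k \<ominus> s' k) * L) \<longlonglongrightarrow> K * 0 + 0 * L"
    by (intro tendsto_intros) (use assms(5,6) in \<open>simp_all add: null_diff_def\<close>)
  then have lim: "(\<lambda>k. K * p (t k \<ominus> t' k) + p (s k \<ominus> s' k) * L) \<longlonglongrightarrow> 0" by simp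
  show ?thesis unfolding null_diff_def
  proof (rule tendsto_0_le[OF lim])
    fix k
    have "p (s k \<otimes> t k \<ominus> s' k \<otimes> t' k) \<le> p (s k) * p (t k \<ominus> t' k) + p (s k \<ominus> s' k) * p (t' k)"
      by (intro p_mult_diff) auto
    also have "\<dots> \<le> K * p (t k \<ominus> t' k) + p (s k \<ominus> s' k) * L"
      using K L by (intro add_mono mult_mono) auto
    finally show "p (s k \<otimes> t k \<ominus> s' k \<otimes> t' k) \<le> K * p (t k \<ominus> t' k) + p (s k \<ominus> s' k) * L" .
  qed simp
qed

lemma null_diff_smult:
  assumes "s \<in> p_cauchy A p" "s' \<in> p_cauchy A p" "null_diff s s'"
  shows "null_diff (\<lambda>k. c \<odot> s k) (\<lambda>k. c \<odot> s' k)"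
proof -
  have "(\<lambda>k. cmod c * p (s k \<ominus> s' k)) \<longlonglongrightarrow> cmod c * 0"
    by (intro tendsto_intros) (use assms in \<open>simp add: null_diff_def\<close>)
  then show ?thesis using assms by (simp add: null_diff_def flip: smult_diff)
qed

lemma null_diff_star:
  assumes "s \<in> p_cauchy A p" "s' \<in> p_cauchy A p" "null_diff s s'"
  shows "null_diff (\<lambda>k. star A (s k)) (\<lambda>k. star A (s' k))"
  using assms by (simp add: null_diff_def flip: star_diff)

abbreviation "cls \<equiv> p_class A p"

lemma mem_cls: "t \<in> cls s \<longleftrightarrow> t \<in> p_cauchy A p \<and> null_diff t s"
  by (simp add: p_class_def null_diff_def)

lemma cls_eq_iff: assumes "s \<in> p_cauchy A p" "t \<in> p_cauchy A p" shows "cls s = cls t \<longleftrightarrow> null_diff s t"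
proof
  assume "cls s = cls t"
  then have "s \<in> cls t" using assms null_diff_refl mem_cls by blast
  then show "null_diff s t" by (simp add: mem_cls)
next
  assume st: "null_diff s t"
  have ts: "null_diff t s" by (rule null_diff_sym[OF assms st])
  show "cls s = cls t"
  proof (intro equalityI subsetI)
    fix u assume "u \<in> cls s"
    then have u: "u \<in> p_cauchy A p" "null_diff u s" by (simp_all add: mem_cls)
    then show "u \<in> cls t" using null_diff_trans[OF u(1) assms u(2) st] by (simp add: mem_cls)
  next
    fix u assume "u \<in> cls t"
    then have u: "u \<in> p_cauchy A p" "null_diff u t" by (simp_all add: mem_cls)
    then show "u \<in> cls s" using null_diff_trans[OF u(1) assms(2,1) u(2) ts] by (simp add: mem_cls)
  qed
qed

lemma UN_const: "\<lbrakk>x \<in> X; \<And>y. y \<in> X \<Longrightarrow> F y = C\<rbrakk> \<Longrightarrow> (\<Union>y\<in>X. F y) = C"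
  by auto

abbreviation "C \<equiv> completion A p"

lemma completion_simps:
  shows "carrier C = cls ` carrier seqs"
    and "\<lbrakk>s \<in> carrier seqs; t \<in> carrier seqs\<rbrakk> \<Longrightarrow> cls s \<otimes>\<^bsub>C\<^esub> cls t = cls (s \<otimes>\<^bsub>seqs\<^esub> t)"
    and "\<lbrakk>s \<in> carrier seqs; t \<in> carrier seqs\<rbrakk> \<Longrightarrow> cls s \<oplus>\<^bsub>C\<^esub> cls t = cls (s \<oplus>\<^bsub>seqs\<^esub> t)"
    and "\<one>\<^bsub>C\<^esub> = cls \<one>\<^bsub>seqs\<^esub>" and "\<zero>\<^bsub>C\<^esub> = cls \<zero>\<^bsub>seqs\<^esub>"
    and "s \<in> carrier seqs \<Longrightarrow> c \<odot>\<^bsub>C\<^esub> cls s = cls (c \<odot>\<^bsub>seqs\<^esub> s)"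
    and "s \<in> carrier seqs \<Longrightarrow> star C (cls s) = cls (star seqs s)"
proof -
  show "carrier C = cls ` carrier seqs" "\<one>\<^bsub>C\<^esub> = cls \<one>\<^bsub>seqs\<^esub>" "\<zero>\<^bsub>C\<^esub> = cls \<zero>\<^bsub>seqs\<^esub>"
    by (simp_all add: completion_def seqs_def)
  have self: "s \<in> cls s" if "s \<in> p_cauchy A p" for s
    using that by (simp add: mem_cls null_diff_refl)
  show "cls s \<otimes>\<^bsub>C\<^esub> cls t = cls (s \<otimes>\<^bsub>seqs\<^esub> t)" if "s \<in> carrier seqs" "t \<in> carrier seqs"
  proof -
    have st: "s \<in> p_cauchy A p" "t \<in> p_cauchy A p" using that by (simp_all add: seqs_def)
    have "(\<Union>s'\<in>cls s. \<Union>t'\<in>cls t. cls (\<lambda>k. s' k \<otimes> t' k)) = cls (\<lambda>k. s k \<otimes> t k)"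
      by (rule UN_const[OF self[OF st(1)]], rule UN_const[OF self[OF st(2)]], subst cls_eq_iff)
        (auto simp: mem_cls st intro!: mult_cauchy null_diff_mult)
    then show ?thesis by (simp add: completion_def seqs_def)
  qed
  show "cls s \<oplus>\<^bsub>C\<^esub> cls t = cls (s \<oplus>\<^bsub>seqs\<^esub> t)" if "s \<in> carrier seqs" "t \<in> carrier seqs"
  proof -
    have st: "s \<in> p_cauchy A p" "t \<in> p_cauchy A p" using that by (simp_all add: seqs_def)
    have "(\<Union>s'\<in>cls s. \<Union>t'\<in>cls t. cls (\<lambda>k. s' k \<oplus> t' k)) = cls (\<lambda>k. s k \<oplus> t k)"
      by (rule UN_const[OF self[OF st(1)]], rule UN_const[OF self[OF st(2)]], subst cls_eq_iff)
        (auto simp: mem_cls st intro!: add_cauchy null_diff_add)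
    then show ?thesis by (simp add: completion_def seqs_def)
  qed
  show "c \<odot>\<^bsub>C\<^esub> cls s = cls (c \<odot>\<^bsub>seqs\<^esub> s)" if "s \<in> carrier seqs"
  proof -
    have st: "s \<in> p_cauchy A p" using that by (simp add: seqs_def)
    have "(\<Union>s'\<in>cls s. cls (\<lambda>k. c \<odot> s' k)) = cls (\<lambda>k. c \<odot> s k)"
      by (rule UN_const[OF self[OF st]], subst cls_eq_iff)
        (auto simp: mem_cls st intro!: smult_cauchy null_diff_smult)
    then show ?thesis by (simp add: completion_def seqs_def)
  qed
  show "star C (cls s) = cls (star seqs s)" if "s \<in> carrier seqs"
  proof -
    have st: "s \<in> p_cauchy A p" using that by (simp add: seqs_def)
    have "(\<Union>s'\<in>cls s. cls (\<lambda>k. star A (s' k))) = cls (\<lambda>k. star A (s k))"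
      by (rule UN_const[OF self[OF st]], subst cls_eq_iff)
        (auto simp: mem_cls st intro!: star_cauchy null_diff_star)
    then show ?thesis by (simp add: completion_def seqs_def)
  qed
qed

lemma completion_star_algebra: "star_algebra C"
  by (rule star_algebra_image(1)[of seqs C cls];
      (rule seqs_star_algebra | rule completion_simps; assumption?))

lemma p_cauchy_lim: assumes s: "s \<in> p_cauchy A p" shows "convergent (\<lambda>k. p (s k))"
proof (rule Cauchy_convergent, rule CauchyI)
  fix e :: real assume "0 < e"
  then obtain M where M: "\<And>k l. \<lbrakk>M \<le> k; M \<le> l\<rbrakk> \<Longrightarrow> p (s k \<ominus> s l) < e" using p_cauchyD[OF s] by blast
  have "norm (p (s k) - p (s l)) < e" if "M \<le> k" "M \<le> l" for k l
    using M[OF that] p_abs_diff[of "s k" "s l"] s by simp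
  then show "\<exists>M. \<forall>m\<ge>M. \<forall>n\<ge>M. norm (p (s m) - p (s n)) < e" by blast
qed

lemma nrm_cls: assumes s: "s \<in> p_cauchy A p" shows "(\<lambda>k. p (s k)) \<longlonglongrightarrow> nrm C (cls s)"
proof -
  obtain r where r: "(\<lambda>k. p (s k)) \<longlonglongrightarrow> r" using p_cauchy_lim[OF s] by (auto simp: convergent_def)
  have all: "(\<lambda>k. p (t k)) \<longlonglongrightarrow> r" if t: "t \<in> cls s" for t
  proof -
    have t': "t \<in> p_cauchy A p" "null_diff t s" using t by (auto simp: mem_cls)
    have "(\<lambda>k. \<bar>p (t k) - p (s k)\<bar>) \<longlonglongrightarrow> 0"
      using t'(2) unfolding null_diff_def by (rule tendsto_0_le) (use s t' in \<open>auto simp: p_abs_diff\<close>)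
    then have "(\<lambda>k. p (t k) - p (s k)) \<longlonglongrightarrow> 0" by (rule tendsto_rabs_zero_cancel)
    from tendsto_add[OF this r] show ?thesis by simp
  qed
  have "s \<in> cls s" using s by (simp add: mem_cls null_diff_refl)
  then have "(THE r. \<forall>t\<in>cls s. (\<lambda>k. p (t k)) \<longlonglongrightarrow> r) = r"
    using all LIMSEQ_unique by (intro the_equality) blast+
  then show ?thesis using r by (simp add: completion_def)
qed

abbreviation "emb \<equiv> completion_emb A p"

lemma nrm_emb: "a \<in> carrier A \<Longrightarrow> nrm C (emb a) = p a"
  using nrm_cls[of "\<lambda>k. a"] LIMSEQ_unique[OF _ tendsto_const] by (simp add: completion_emb_def)

lemma cls_in_carrier [simp]: "s \<in> p_cauchy A p \<Longrightarrow> cls s \<in> carrier C"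
  by (simp add: completion_simps seqs_def)

lemma cls_ops:
  assumes "s \<in> p_cauchy A p" "t \<in> p_cauchy A p"
  shows "cls s \<otimes>\<^bsub>C\<^esub> cls t = cls (\<lambda>k. s k \<otimes> t k)" "cls s \<oplus>\<^bsub>C\<^esub> cls t = cls (\<lambda>k. s k \<oplus> t k)"
    "c \<odot>\<^bsub>C\<^esub> cls s = cls (\<lambda>k. c \<odot> s k)" "star C (cls s) = cls (\<lambda>k. star A (s k))"
    "cls s \<ominus>\<^bsub>C\<^esub> cls t = cls (\<lambda>k. s k \<ominus> t k)"
proof -
  note s = assms
  show o: "cls s \<otimes>\<^bsub>C\<^esub> cls t = cls (\<lambda>k. s k \<otimes> t k)" "cls s \<oplus>\<^bsub>C\<^esub> cls t = cls (\<lambda>k. s k \<oplus> t k)"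
    "c \<odot>\<^bsub>C\<^esub> cls s = cls (\<lambda>k. c \<odot> s k)" "star C (cls s) = cls (\<lambda>k. star A (s k))"
    using assms by (simp_all add: completion_simps(2,3,6,7) seqs_def)
  interpret C: star_algebra C by (rule completion_star_algebra)
  have "cls s \<ominus>\<^bsub>C\<^esub> cls t = cls s \<oplus>\<^bsub>C\<^esub> cls (\<lambda>k. (-1) \<odot> t k)"
    using assms completion_simps(6)[of t "-1"] by (simp add: C.diff_smult seqs_def)
  also have "\<dots> = cls (\<lambda>k. s k \<oplus> (-1) \<odot> t k)"
    using assms completion_simps(3)[of s "\<lambda>k. (-1) \<odot> t k"] by (simp add: seqs_def smult_cauchy)
  finally show "cls s \<ominus>\<^bsub>C\<^esub> cls t = cls (\<lambda>k. s k \<ominus> t k)" using assms by (simp add: diff_smult)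
qed

lemma emb_hom: "star_hom A C emb"
  using cls_ops[OF const_cauchy const_cauchy]
  by (auto simp: star_hom_def ring_hom_def completion_emb_def completion_simps(4) seqs_def)

lemma completion_cases:
  assumes "X \<in> carrier C" obtains s where "s \<in> p_cauchy A p" "X = cls s"
  using assms by (auto simp: completion_simps(1) seqs_def)

lemma completion_seminorm: "cstar_seminorm C (nrm C)"
proof -
  have add: "nrm C (cls s \<oplus>\<^bsub>C\<^esub> cls t) \<le> nrm C (cls s) + nrm C (cls t)"
    and mult: "nrm C (cls s \<otimes>\<^bsub>C\<^esub> cls t) \<le> nrm C (cls s) * nrm C (cls t)"
    if s: "s \<in> p_cauchy A p" and t: "t \<in> p_cauchy A p" for s t
  proof -
    show "nrm C (cls s \<oplus>\<^bsub>C\<^esub> cls t) \<le> nrm C (cls s) + nrm C (cls t)"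
      unfolding cls_ops[OF s t]
      by (rule LIMSEQ_le[OF nrm_cls[OF add_cauchy[OF s t]] tendsto_add[OF nrm_cls[OF s] nrm_cls[OF t]]])
        (use s t in \<open>auto intro!: exI[of _ 0] p_add\<close>)
    show "nrm C (cls s \<otimes>\<^bsub>C\<^esub> cls t) \<le> nrm C (cls s) * nrm C (cls t)"
      unfolding cls_ops[OF s t]
      by (rule LIMSEQ_le[OF nrm_cls[OF mult_cauchy[OF s t]] tendsto_mult[OF nrm_cls[OF s] nrm_cls[OF t]]])
        (use s t in \<open>auto intro!: exI[of _ 0] p_mult\<close>)
  qed
  have smult: "nrm C (c \<odot>\<^bsub>C\<^esub> cls s) = cmod c * nrm C (cls s)"
    and nonneg: "0 \<le> nrm C (cls s)"
    and sq: "nrm C (star C (cls s) \<otimes>\<^bsub>C\<^esub> cls s) = (nrm C (cls s))\<^sup>2" if s: "s \<in> p_cauchy A p" for c s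
  proof -
    have "(\<lambda>k. p (c \<odot> s k)) \<longlonglongrightarrow> cmod c * nrm C (cls s)"
      using tendsto_mult[OF tendsto_const nrm_cls[OF s], of "cmod c"] s by simp
    then show "nrm C (c \<odot>\<^bsub>C\<^esub> cls s) = cmod c * nrm C (cls s)"
      using LIMSEQ_unique[OF nrm_cls[OF smult_cauchy[OF s]]] by (simp add: cls_ops(3)[OF s s])
    show "0 \<le> nrm C (cls s)" by (rule LIMSEQ_le_const[OF nrm_cls[OF s]]) (use s in \<open>auto intro!: exI[of _ 0]\<close>)
    have "(\<lambda>k. p (star A (s k) \<otimes> s k)) \<longlonglongrightarrow> (nrm C (cls s))\<^sup>2"
      using tendsto_power[OF nrm_cls[OF s], of 2] s by (simp add: p_star_mult)
    then show "nrm C (star C (cls s) \<otimes>\<^bsub>C\<^esub> cls s) = (nrm C (cls s))\<^sup>2"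
      using LIMSEQ_unique[OF nrm_cls[OF mult_cauchy[OF star_cauchy[OF s] s]]]
      by (simp add: cls_ops(1)[OF star_cauchy[OF s] s] cls_ops(4)[OF s s])
  qed
  show ?thesis unfolding cstar_seminorm_def
    by (auto elim!: completion_cases simp: add mult smult nonneg sq)
qed

lemma emb_dense:
  assumes "X \<in> carrier C" "0 < e" shows "\<exists>a\<in>carrier A. nrm C (X \<ominus>\<^bsub>C\<^esub> emb a) < e"
proof -
  obtain s where s: "s \<in> p_cauchy A p" "X = cls s" using completion_cases[OF assms(1)] by blast
  obtain M where M: "\<And>k l. \<lbrakk>M \<le> k; M \<le> l\<rbrakk> \<Longrightarrow> p (s k \<ominus> s l) < e / 2"
    using p_cauchyD[OF s(1), of "e / 2"] assms(2) by auto
  have c: "(\<lambda>k. s M) \<in> p_cauchy A p" using s by simp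
  have "nrm C (X \<ominus>\<^bsub>C\<^esub> emb (s M)) \<le> e / 2"
    unfolding s(2) completion_emb_def cls_ops(5)[OF s(1) c]
    by (rule LIMSEQ_le_const2[OF nrm_cls[OF diff_cauchy[OF s(1) c]]])
      (use M[of _ M] in \<open>auto intro!: exI[of _ M] less_imp_le\<close>)
  then show ?thesis using s assms(2) by (intro bexI[of _ "s M"]) auto
qed

theorem completion_cstar: "cstar_algebra C"
proof -
  interpret C: star_algebra C by (rule completion_star_algebra)
  interpret CN: cstar_seminormed C "nrm C" by unfold_locales (rule completion_seminorm)
  interpret emb: star_morphism A C emb by unfold_locales (rule emb_hom)
  show ?thesis
  proof
    show "cstar_seminorm C (nrm C)" by (rule completion_seminorm)
    fix X assume X: "X \<in> carrier C" "nrm C X = 0"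
    obtain s where s: "s \<in> p_cauchy A p" "X = cls s" using completion_cases[OF X(1)] by blast
    have "null_diff s (\<lambda>k. \<zero>)" using nrm_cls[OF s(1)] X s by (simp add: null_diff_def)
    then show "X = \<zero>\<^bsub>C\<^esub>" using s by (simp add: completion_simps(5) seqs_def cls_eq_iff)
  next
    fix X assume X: "\<And>k. X k \<in> carrier C" and step: "\<And>k. nrm C (X (Suc k) \<ominus>\<^bsub>C\<^esub> X k) \<le> (1/2) ^ k"
    \<comment> \<open>Approximate \<open>X k\<close> within \<open>(1/2)\<^sup>k\<close> by an element of \<open>A\<close>; the class of these elements is the limit.\<close>
    have "\<exists>a\<in>carrier A. nrm C (X k \<ominus>\<^bsub>C\<^esub> emb a) < (1/2) ^ k" for k
      by (rule emb_dense[OF X]) simp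
    then obtain a where [simp]: "\<And>k. a k \<in> carrier A" and a: "\<And>k. nrm C (X k \<ominus>\<^bsub>C\<^esub> emb (a k)) < (1/2) ^ k"
      by metis
    have a_step: "p (a (Suc k) \<ominus> a k) \<le> 3 * (1/2) ^ k" for k
    proof -
      have "nrm C (emb (a (Suc k)) \<ominus>\<^bsub>C\<^esub> emb (a k))
          \<le> nrm C (emb (a (Suc k)) \<ominus>\<^bsub>C\<^esub> X (Suc k)) + nrm C (X (Suc k) \<ominus>\<^bsub>C\<^esub> emb (a k))"
        by (rule CN.p_triangle) (simp_all add: X)
      moreover have "nrm C (X (Suc k) \<ominus>\<^bsub>C\<^esub> emb (a k)) \<le> nrm C (X (Suc k) \<ominus>\<^bsub>C\<^esub> X k) + nrm C (X k \<ominus>\<^bsub>C\<^esub> emb (a k))"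
        by (rule CN.p_triangle) (simp_all add: X)
      moreover have "nrm C (emb (a (Suc k)) \<ominus>\<^bsub>C\<^esub> X (Suc k)) = nrm C (X (Suc k) \<ominus>\<^bsub>C\<^esub> emb (a (Suc k)))"
        by (rule CN.p_diff_commute) (simp_all add: X)
      moreover have "(1/2::real) ^ Suc k \<le> (1/2) ^ k" by simp
      ultimately have "nrm C (emb (a (Suc k)) \<ominus>\<^bsub>C\<^esub> emb (a k)) \<le> 3 * (1/2) ^ k"
        using a[of k] a[of "Suc k"] step[of k] by linarith
      then show ?thesis by (simp add: nrm_emb flip: emb.hom_minus)
    qed
    have tail: "p (a (k + i) \<ominus> a k) \<le> 6 * (1/2) ^ k - 6 * (1/2) ^ (k + i)" for k i
    proof (induction i)
      case (Suc i)
      have "p (a (k + Suc i) \<ominus> a k) \<le> p (a (Suc (k + i)) \<ominus> a (k + i)) + p (a (k + i) \<ominus> a k)"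
        using p_triangle[of "a (k + Suc i)" "a (k + i)" "a k"] by simp
      then show ?case using Suc a_step[of "k + i"] by simp
    qed (simp add: minus_eq r_neg)
    have tail': "p (a l \<ominus> a k) \<le> 6 * (1/2) ^ k" if "k \<le> l" for k l
    proof -
      have "p (a l \<ominus> a k) \<le> 6 * (1/2) ^ k - 6 * (1/2) ^ l" using tail[of k "l - k"] that by simp
      moreover have "0 \<le> 6 * (1/2::real) ^ l" by simp
      ultimately show ?thesis by linarith
    qed
    have ca: "a \<in> p_cauchy A p"
    proof (rule p_cauchyI)
      fix e :: real assume "0 < e"
      then obtain M :: nat where "(1/2) ^ M < e / 12"
        using real_arch_pow_inv[of "e / 12" "1/2"] by auto
      then have M: "6 * (1/2) ^ M < e / 2" by simp
      have "p (a k \<ominus> a l) < e" if "M \<le> k" "M \<le> l" for k l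
        using tail'[OF that(1)] tail'[OF that(2)] M p_triangle[of "a k" "a M" "a l"]
          p_diff_commute[of "a M" "a l"] by simp
      then show "\<exists>M. \<forall>k\<ge>M. \<forall>l\<ge>M. p (a k \<ominus> a l) < e" by blast
    qed simp
    have le: "nrm C (X k \<ominus>\<^bsub>C\<^esub> cls a) \<le> 7 * (1/2) ^ k" for k
    proof -
      have "nrm C (emb (a k) \<ominus>\<^bsub>C\<^esub> cls a) \<le> 6 * (1/2) ^ k"
        unfolding completion_emb_def cls_ops(5)[OF const_cauchy[OF \<open>a k \<in> carrier A\<close>] ca]
        by (rule LIMSEQ_le_const2[OF nrm_cls[OF diff_cauchy[OF const_cauchy[OF \<open>a k \<in> carrier A\<close>] ca]]])
          (use tail' in \<open>auto intro!: exI[of _ k] simp: p_diff_commute[of "a k"]\<close>)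
      then show ?thesis
        using CN.p_triangle[of "X k" "emb (a k)" "cls a"] X a[of k] ca by simp
    qed
    have "(\<lambda>k. 7 * (1/2::real) ^ k) \<longlonglongrightarrow> 7 * 0"
      by (intro tendsto_intros LIMSEQ_power_zero) auto
    then have lim: "(\<lambda>k. 7 * (1/2::real) ^ k) \<longlonglongrightarrow> 0" by simp
    have "(\<lambda>k. nrm C (X k \<ominus>\<^bsub>C\<^esub> cls a)) \<longlonglongrightarrow> 0"
    proof (rule tendsto_0_le[OF lim])
      show "0 \<le> nrm C (X k \<ominus>\<^bsub>C\<^esub> cls a)" for k using X ca by (intro CN.p_nonneg C.minus_closed) auto
    qed (rule le)
    then show "\<exists>x\<in>carrier C. (\<lambda>k. nrm C (X k \<ominus>\<^bsub>C\<^esub> x)) \<longlonglongrightarrow> 0" using ca cls_in_carrier by blast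
  qed
qed

end

lemma completion_extend:
  assumes "cstar_seminormed A p" "cstar_algebra B" "star_hom A B f"
    and contr: "\<And>a. a \<in> carrier A \<Longrightarrow> nrm B (f a) \<le> p a"
  shows "\<exists>g. star_hom (completion A p) B g \<and> (\<forall>a\<in>carrier A. g (completion_emb A p a) = f a)"
proof -
  interpret A: cstar_seminormed A p by fact
  interpret B: cstar_algebra B by fact
  interpret f: star_morphism A B f by unfold_locales fact
  interpret C: cstar_algebra A.C by (rule A.completion_cstar)
  have lim_ex: "\<exists>b. B.conv (\<lambda>k. f (s k)) b" if s: "s \<in> p_cauchy A p" for s
  proof (rule B.conv_of_cauchy)
    fix e :: real assume "0 < e"
    then obtain M where M: "\<And>k l. \<lbrakk>M \<le> k; M \<le> l\<rbrakk> \<Longrightarrow> p (s k \<ominus>\<^bsub>A\<^esub> s l) < e" using A.p_cauchyD[OF s] by blast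
    have "nrm B (f (s k) \<ominus>\<^bsub>B\<^esub> f (s l)) < e" if "M \<le> k" "M \<le> l" for k l
      using M[OF that] contr[of "s k \<ominus>\<^bsub>A\<^esub> s l"] s by simp
    then show "\<exists>M. \<forall>k\<ge>M. \<forall>l\<ge>M. nrm B (f (s k) \<ominus>\<^bsub>B\<^esub> f (s l)) < e" by blast
  qed (use s in simp)
  define g where "g X = (THE b. \<exists>s\<in>X. B.conv (\<lambda>k. f (s k)) b)" for X
  have g: "B.conv (\<lambda>k. f (s k)) (g (A.cls s))" if s: "s \<in> p_cauchy A p" for s
  proof -
    obtain b where b: "B.conv (\<lambda>k. f (s k)) b" using lim_ex[OF s] by blast
    have "c = b" if t: "t \<in> A.cls s" and c: "B.conv (\<lambda>k. f (t k)) c" for t c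
    proof -
      have t': "t \<in> p_cauchy A p" "A.null_diff t s" using t by (auto simp: A.mem_cls)
      have "(\<lambda>k. nrm B (f (t k) \<ominus>\<^bsub>B\<^esub> f (s k))) \<longlonglongrightarrow> 0"
        using t'(2) unfolding A.null_diff_def
        by (rule tendsto_0_le) (use s t' contr[of "t k \<ominus>\<^bsub>A\<^esub> s k" for k] in auto)
      moreover have "(\<lambda>k. nrm B (f (t k) \<ominus>\<^bsub>B\<^esub> f (s k))) \<longlonglongrightarrow> nrm B (c \<ominus>\<^bsub>B\<^esub> b)"
        by (rule B.conv_nrm[OF B.conv_diff[OF c b]])
      ultimately have "nrm B (c \<ominus>\<^bsub>B\<^esub> b) = 0" using LIMSEQ_unique by blast
      then show ?thesis using B.eqI_nrm B.convD(2) b c by blast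
    qed
    moreover have "s \<in> A.cls s" using s by (simp add: A.mem_cls A.null_diff_refl)
    ultimately have "g (A.cls s) = b" unfolding g_def using b by (intro the_equality) blast+
    then show ?thesis using b by simp
  qed
  have g_in: "g (A.cls s) \<in> carrier B" if "s \<in> p_cauchy A p" for s using B.convD(2)[OF g[OF that]] .
  have "star_hom A.C B g"
    unfolding star_hom_def ring_hom_def
  proof (safe elim!: A.completion_cases)
    fix s t assume s: "s \<in> p_cauchy A p" and t: "t \<in> p_cauchy A p"
    have "B.conv (\<lambda>k. f (s k \<otimes>\<^bsub>A\<^esub> t k)) (g (A.cls s) \<otimes>\<^bsub>B\<^esub> g (A.cls t))"
      by (rule B.conv_cong[OF B.conv_mult[OF g[OF s] g[OF t]]]) (use s t in simp)
    then show "g (A.cls s \<otimes>\<^bsub>A.C\<^esub> A.cls t) = g (A.cls s) \<otimes>\<^bsub>B\<^esub> g (A.cls t)"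
      unfolding A.cls_ops[OF s t] by (rule B.conv_unique[OF g[OF A.mult_cauchy[OF s t]]])
    have "B.conv (\<lambda>k. f (s k \<oplus>\<^bsub>A\<^esub> t k)) (g (A.cls s) \<oplus>\<^bsub>B\<^esub> g (A.cls t))"
      by (rule B.conv_cong[OF B.conv_add[OF g[OF s] g[OF t]]]) (use s t in simp)
    then show "g (A.cls s \<oplus>\<^bsub>A.C\<^esub> A.cls t) = g (A.cls s) \<oplus>\<^bsub>B\<^esub> g (A.cls t)"
      unfolding A.cls_ops[OF s t] by (rule B.conv_unique[OF g[OF A.add_cauchy[OF s t]]])
  next
    fix s assume s: "s \<in> p_cauchy A p"
    show "g (A.cls s) \<in> carrier B" by (rule g_in[OF s])
    have "B.conv (\<lambda>k. f (star A (s k))) (star B (g (A.cls s)))"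
      by (rule B.conv_cong[OF B.conv_star[OF g[OF s]]]) (use s in simp)
    then show "g (star A.C (A.cls s)) = star B (g (A.cls s))"
      unfolding A.cls_ops[OF s s] by (rule B.conv_unique[OF g[OF A.star_cauchy[OF s]]])
    show "g (c \<odot>\<^bsub>A.C\<^esub> A.cls s) = c \<odot>\<^bsub>B\<^esub> g (A.cls s)" for c
    proof -
      have "B.conv (\<lambda>k. f (c \<odot>\<^bsub>A\<^esub> s k)) (c \<odot>\<^bsub>B\<^esub> g (A.cls s))"
        by (rule B.conv_cong[OF B.conv_smult[OF g[OF s]]]) (use s in simp)
      then show ?thesis
        unfolding A.cls_ops(3)[OF s s] by (rule B.conv_unique[OF g[OF A.smult_cauchy[OF s]]])
    qed
  next
    have "B.conv (\<lambda>k. f \<one>\<^bsub>A\<^esub>) \<one>\<^bsub>B\<^esub>" using B.conv_const[of "\<one>\<^bsub>B\<^esub>"] by simp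
    then show "g \<one>\<^bsub>A.C\<^esub> = \<one>\<^bsub>B\<^esub>"
      unfolding A.completion_simps(4) A.seqs_def
      using B.conv_unique[OF g[OF A.const_cauchy[OF A.one_closed]]] by simp
  qed
  moreover have "g (completion_emb A p a) = f a" if a: "a \<in> carrier A" for a
    unfolding completion_emb_def
    using B.conv_unique[OF g[OF A.const_cauchy[OF a]] B.conv_const[of "f a"]] a by simp
  ultimately show ?thesis by blast
qed


section \<open>The free *-algebra\<close>

definition word_elem :: "('g \<times> bool) list \<Rightarrow> 'g free" where
  "word_elem w = (\<lambda>v. if v = w then 1 else 0)"

abbreviation flip_word :: "('g \<times> bool) list \<Rightarrow> ('g \<times> bool) list" where
  "flip_word w \<equiv> rev (map (\<lambda>(g, b). (g, \<not> b)) w)"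

lemma flip_flip [simp]: "flip_word (flip_word w) = w"
  by (induction w) auto

lemma flip_word_lists: "w \<in> lists (G \<times> UNIV) \<Longrightarrow> flip_word w \<in> lists (G \<times> UNIV)"
  by (auto simp: in_lists_conv_set)

lemma flip_word_eq_iff: "flip_word v = w \<longleftrightarrow> v = flip_word w"
  by auto

definition convolution :: "'g free \<Rightarrow> 'g free \<Rightarrow> 'g free" where
  "convolution f g w = (\<Sum>k\<le>length w. f (take k w) * g (drop k w))"

lemma convolution_assoc:
  "convolution (convolution f g) h = convolution f (convolution g h)"
proof
  fix w :: "('a \<times> bool) list"
  let ?n = "length w"
  define F where "F j i = f (take j w) * g (take i (drop j w)) * h (drop (i + j) w)" for j i
  have "convolution (convolution f g) h w = (\<Sum>k\<le>?n. \<Sum>j\<le>k. F j (k - j))"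
    unfolding convolution_def
  proof (rule sum.cong[OF refl])
    fix k assume "k \<in> {..?n}"
    then have l: "length (take k w) = k" by simp
    show "(\<Sum>j\<le>length (take k w). f (take j (take k w)) * g (drop j (take k w))) * h (drop k w) = (\<Sum>j\<le>k. F j (k - j))"
      unfolding l sum_distrib_right
      by (rule sum.cong) (auto simp: F_def min_def drop_take)
  qed
  also have "\<dots> = (\<Sum>(j, i)\<in>{(j, i). j + i \<le> ?n}. F j i)" by (simp add: sum.triangle_reindex_eq)
  also have "{(j, i). j + i \<le> ?n} = (SIGMA j:{..?n}. {..?n - j})" by auto
  also have "(\<Sum>(j, i)\<in>(SIGMA j:{..?n}. {..?n - j}). F j i) = (\<Sum>j\<le>?n. \<Sum>i\<le>?n - j. F j i)"
    by (rule sum.Sigma[symmetric]) auto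
  also have "\<dots> = convolution f (convolution g h) w"
    unfolding convolution_def by (simp add: F_def sum_distrib_left mult.assoc)
  finally show "convolution (convolution f g) h w = convolution f (convolution g h) w" .
qed

lemma convolution_word_elem:
  "convolution (word_elem u) (word_elem v) = word_elem (u @ v)"
proof
  fix w :: "('a \<times> bool) list"
  have eq: "word_elem u (take k w) * word_elem v (drop k w)
      = (if k = length u then (if w = u @ v then 1 else 0) else 0)" if "k \<le> length w" for k
  proof -
    have iff: "take k w = u \<and> drop k w = v \<longleftrightarrow> k = length u \<and> w = u @ v"
      using that by (metis append_eq_conv_conj append_take_drop_id length_take min.absorb2)
    have "word_elem u (take k w) * word_elem v (drop k w) = (if take k w = u \<and> drop k w = v then 1 else 0)"
      by (simp add: word_elem_def)
    then show ?thesis unfolding iff by simp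
  qed
  have "convolution (word_elem u) (word_elem v) w
      = (\<Sum>k\<le>length w. if k = length u then (if w = u @ v then 1 else 0) else 0)"
    unfolding convolution_def by (rule sum.cong) (auto simp: eq)
  also have "\<dots> = word_elem (u @ v) w" by (simp add: word_elem_def)
  finally show "convolution (word_elem u) (word_elem v) w = word_elem (u @ v) w" .
qed

lemma convolution_one_left: "convolution (word_elem []) f = f"
proof
  fix w :: "('a \<times> bool) list"
  have "convolution (word_elem []) f w = (\<Sum>k\<le>length w. if k = 0 then f w else 0)"
    unfolding convolution_def by (rule sum.cong) (auto simp: word_elem_def)
  then show "convolution (word_elem []) f w = f w" by simp
qed

lemma convolution_one_right: "convolution f (word_elem []) = f"
proof
  fix w :: "('a \<times> bool) list"
  have "convolution f (word_elem []) w = (\<Sum>k\<le>length w. if k = length w then f w else 0)"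
    unfolding convolution_def by (rule sum.cong) (auto simp: word_elem_def)
  then show "convolution f (word_elem []) w = f w" by simp
qed

lemma convolution_star:
  "(\<lambda>w. cnj (convolution f g (flip_word w)))
    = convolution (\<lambda>w. cnj (g (flip_word w))) (\<lambda>w. cnj (f (flip_word w)))"
proof
  fix w :: "('a \<times> bool) list"
  let ?n = "length w"
  show "cnj (convolution f g (flip_word w))
    = convolution (\<lambda>w. cnj (g (flip_word w))) (\<lambda>w. cnj (f (flip_word w))) w"
    unfolding convolution_def cnj_sum
    by (rule sum.reindex_bij_witness[of _ "\<lambda>k. ?n - k" "\<lambda>k. ?n - k"])
      (auto simp: take_rev drop_rev take_map drop_map mult.commute)
qed

lemma support_convolution:
  "{w. convolution f g w \<noteq> 0} \<subseteq> (\<lambda>(u, v). u @ v) ` ({w. f w \<noteq> 0} \<times> {w. g w \<noteq> 0})"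
proof
  fix w assume "w \<in> {w. convolution f g w \<noteq> 0}"
  then obtain k where "f (take k w) * g (drop k w) \<noteq> 0"
    unfolding convolution_def by (auto elim: sum.not_neutral_contains_not_neutral)
  then have "(take k w, drop k w) \<in> {w. f w \<noteq> 0} \<times> {w. g w \<noteq> 0}" by auto
  then show "w \<in> (\<lambda>(u, v). u @ v) ` ({w. f w \<noteq> 0} \<times> {w. g w \<noteq> 0})"
    by (rule image_eqI[rotated]) simp
qed

lemma free_alg_sel:
  "carrier (free_alg G) = {f. finite {w. f w \<noteq> 0} \<and> {w. f w \<noteq> 0} \<subseteq> lists (G \<times> UNIV)}"
  "f \<otimes>\<^bsub>free_alg G\<^esub> g = convolution f g" "f \<oplus>\<^bsub>free_alg G\<^esub> g = (\<lambda>w. f w + g w)"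
  "\<one>\<^bsub>free_alg G\<^esub> = word_elem []" "\<zero>\<^bsub>free_alg G\<^esub> = (\<lambda>w. 0)"
  "c \<odot>\<^bsub>free_alg G\<^esub> f = (\<lambda>w. c * f w)" "star (free_alg G) f = (\<lambda>w. cnj (f (flip_word w)))"
  by (auto simp: free_alg_def convolution_def word_elem_def fun_eq_iff)

lemma free_carrierI:
  "\<lbrakk>finite S; S \<subseteq> lists (G \<times> UNIV); {w. f w \<noteq> 0} \<subseteq> S\<rbrakk> \<Longrightarrow> f \<in> carrier (free_alg G)"
  unfolding free_alg_sel(1) using finite_subset by blast

lemma convolution_closed:
  assumes "f \<in> carrier (free_alg G)" "g \<in> carrier (free_alg G)"
  shows "convolution f g \<in> carrier (free_alg G)"
proof -
  have "(\<lambda>(u, v). u @ v) ` ({w. f w \<noteq> 0} \<times> {w. g w \<noteq> 0}) \<subseteq> lists (G \<times> UNIV)"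
    using assms by (fastforce simp: free_alg_sel)
  moreover have "finite ((\<lambda>(u, v). u @ v) ` ({w. f w \<noteq> 0} \<times> {w. g w \<noteq> 0}))"
    using assms by (simp add: free_alg_sel)
  ultimately show ?thesis using support_convolution by (intro free_carrierI)
qed

lemma add_closed_free:
  assumes "f \<in> carrier (free_alg G)" "g \<in> carrier (free_alg G)"
  shows "(\<lambda>w. f w + g w) \<in> carrier (free_alg G)"
proof -
  have "{w. f w + g w \<noteq> 0} \<subseteq> {w. f w \<noteq> 0} \<union> {w. g w \<noteq> 0}" by auto
  then show ?thesis
    by (rule free_carrierI[rotated 2]) (use assms in \<open>simp_all add: free_alg_sel(1)\<close>)
qed

lemma smult_closed_free:
  "f \<in> carrier (free_alg G) \<Longrightarrow> (\<lambda>w. c * f w) \<in> carrier (free_alg G)"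
  by (auto simp: free_alg_sel(1) intro: finite_subset[of _ "{w. f w \<noteq> 0}"])

lemma star_closed_free:
  assumes "f \<in> carrier (free_alg G)" shows "(\<lambda>w. cnj (f (flip_word w))) \<in> carrier (free_alg G)"
proof -
  have eq: "{w. cnj (f (flip_word w)) \<noteq> 0} = flip_word ` {w. f w \<noteq> 0}"
    by (auto intro: image_eqI[of _ _ "flip_word _"])
  show ?thesis using assms flip_word_lists by (auto simp: free_alg_sel(1) eq simp del: complex_cnj_zero_iff)
qed

lemma word_elem_closed: "w \<in> lists (G \<times> UNIV) \<Longrightarrow> word_elem w \<in> carrier (free_alg G)"
  by (auto simp: free_alg_sel(1) word_elem_def intro: finite_subset[of _ "{w}"])

lemma free_alg_star_algebra: "star_algebra (free_alg G)"
proof -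
  interpret ring "free_alg G"
  proof (intro ringI abelian_groupI monoidI)
    fix f assume f: "f \<in> carrier (free_alg G)"
    have "(\<lambda>w. (-1) * f w) \<in> carrier (free_alg G)" by (rule smult_closed_free[OF f])
    moreover have "(\<lambda>w. (-1) * f w) \<oplus>\<^bsub>free_alg G\<^esub> f = \<zero>\<^bsub>free_alg G\<^esub>" by (simp add: free_alg_sel)
    ultimately show "\<exists>g\<in>carrier (free_alg G). g \<oplus>\<^bsub>free_alg G\<^esub> f = \<zero>\<^bsub>free_alg G\<^esub>" by blast
  qed (auto simp: free_alg_sel(2-) convolution_closed add_closed_free word_elem_closed
      convolution_assoc convolution_one_left convolution_one_right add.assoc add.commute,
      auto simp: free_alg_sel(1) convolution_def fun_eq_iff distrib_left distrib_right sum.distrib)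
  show ?thesis
    by unfold_locales
      (auto simp: free_alg_sel(2-) smult_closed_free star_closed_free convolution_star
        fun_eq_iff distrib_left distrib_right,
        auto simp: convolution_def sum_distrib_left mult.assoc mult.left_commute)
qed

lemma free_gen_word: "free_gen g = word_elem [(g, False)]"
  by (auto simp: free_gen_def word_elem_def fun_eq_iff)

lemma star_word_elem: "star (free_alg G) (word_elem w) = word_elem (flip_word w)"
  by (auto simp: free_alg_sel word_elem_def fun_eq_iff flip_word_eq_iff)

lemma free_basis_induct [consumes 1, case_names zero add]:
  assumes f: "f \<in> carrier (free_alg G)"
    and zero: "P \<zero>\<^bsub>free_alg G\<^esub>"
    and add: "\<And>c w x. \<lbrakk>w \<in> lists (G \<times> UNIV); x \<in> carrier (free_alg G); P x\<rbrakk>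
      \<Longrightarrow> P (c \<odot>\<^bsub>free_alg G\<^esub> word_elem w \<oplus>\<^bsub>free_alg G\<^esub> x)"
  shows "P f"
proof -
  have "P f" if "finite S" "S \<subseteq> lists (G \<times> UNIV)" "{w. f w \<noteq> 0} \<subseteq> S" for S f
    using that
  proof (induction S arbitrary: f rule: finite_induct)
    case empty
    then have "f = \<zero>\<^bsub>free_alg G\<^esub>" by (auto simp: free_alg_sel fun_eq_iff)
    then show ?case using zero by simp
  next
    case (insert w S)
    let ?x = "f(w := 0)"
    have "P ?x" by (rule insert.IH) (use insert.prems in auto)
    moreover have "?x \<in> carrier (free_alg G)"
      by (rule free_carrierI[OF insert.hyps(1)]) (use insert.prems in auto)
    ultimately have "P (f w \<odot>\<^bsub>free_alg G\<^esub> word_elem w \<oplus>\<^bsub>free_alg G\<^esub> ?x)" using add insert.prems by auto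
    also have "f w \<odot>\<^bsub>free_alg G\<^esub> word_elem w \<oplus>\<^bsub>free_alg G\<^esub> ?x = f"
      by (auto simp: free_alg_sel word_elem_def fun_eq_iff)
    finally show ?case .
  qed
  then show ?thesis using f by (auto simp: free_alg_sel(1))
qed

lemma free_induct [consumes 1, case_names one gen star smult add mult]:
  assumes f: "f \<in> carrier (free_alg G)"
    and one: "P \<one>\<^bsub>free_alg G\<^esub>" and gen: "\<And>g. g \<in> G \<Longrightarrow> P (free_gen g)"
    and star: "\<And>x. \<lbrakk>x \<in> carrier (free_alg G); P x\<rbrakk> \<Longrightarrow> P (star (free_alg G) x)"
    and smult: "\<And>c x. \<lbrakk>x \<in> carrier (free_alg G); P x\<rbrakk> \<Longrightarrow> P (c \<odot>\<^bsub>free_alg G\<^esub> x)"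
    and add: "\<And>x y. \<lbrakk>x \<in> carrier (free_alg G); y \<in> carrier (free_alg G); P x; P y\<rbrakk> \<Longrightarrow> P (x \<oplus>\<^bsub>free_alg G\<^esub> y)"
    and mult: "\<And>x y. \<lbrakk>x \<in> carrier (free_alg G); y \<in> carrier (free_alg G); P x; P y\<rbrakk> \<Longrightarrow> P (x \<otimes>\<^bsub>free_alg G\<^esub> y)"
  shows "P f"
proof -
  interpret F: star_algebra "free_alg G" by (rule free_alg_star_algebra)
  have word: "P (word_elem w)" if "w \<in> lists (G \<times> UNIV)" for w
    using that
  proof (induction w)
    case Nil
    then show ?case using one by (simp add: free_alg_sel)
  next
    case (Cons l w)
    obtain g b where l: "l = (g, b)" "g \<in> G" using Cons.hyps by (cases l) auto
    have gc: "free_gen g \<in> carrier (free_alg G)" using l by (simp add: free_gen_word word_elem_closed)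
    have w: "word_elem w \<in> carrier (free_alg G)" using Cons.hyps by (simp add: word_elem_closed)
    have s: "star (free_alg G) (free_gen g) = word_elem [(g, True)]"
      by (simp add: free_gen_word star_word_elem)
    have "word_elem [l] \<in> carrier (free_alg G) \<and> P (word_elem [l])"
    proof (cases b)
      case True
      then show ?thesis using star[OF gc gen[OF l(2)]] F.star_closed[OF gc] by (simp add: s l)
    next
      case False
      then show ?thesis using gc gen[OF l(2)] by (simp add: l free_gen_word)
    qed
    then have "P (word_elem [l] \<otimes>\<^bsub>free_alg G\<^esub> word_elem w)" using w Cons.IH by (intro mult) auto
    then show ?case by (simp add: free_alg_sel convolution_word_elem)
  qed
  show ?thesis
    using f
  proof (rule free_basis_induct)
    have "P (0 \<odot>\<^bsub>free_alg G\<^esub> \<one>\<^bsub>free_alg G\<^esub>)" using one by (intro smult) simp_all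
    then show "P \<zero>\<^bsub>free_alg G\<^esub>" by simp
  qed (intro add smult word; simp add: word_elem_closed)
qed

text \<open>The homomorphism from the free *-algebra that sends each generator \<open>g\<close> to \<open>c g\<close>.\<close>

locale free_evaluation = star_algebra A for A :: "('a, 'm) star_alg_scheme" (structure) +
  fixes G :: "'g set" and c :: "'g \<Rightarrow> 'a"
  assumes c_closed: "\<And>g. g \<in> G \<Longrightarrow> c g \<in> carrier A"
begin

sublocale F: star_algebra "free_alg G"
  by (rule free_alg_star_algebra)

definition letter :: "'g \<times> bool \<Rightarrow> 'a" where
  "letter l = (if snd l then star A (c (fst l)) else c (fst l))"

definition word_val :: "('g \<times> bool) list \<Rightarrow> 'a" where
  "word_val w = foldr (\<lambda>l x. letter l \<otimes> x) w \<one>"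

definition ev :: "'g free \<Rightarrow> 'a" where
  "ev f = (\<Oplus>w\<in>{w. f w \<noteq> 0}. f w \<odot> word_val w)"

lemma letter_closed [simp]: "l \<in> G \<times> UNIV \<Longrightarrow> letter l \<in> carrier A"
  by (auto simp: letter_def c_closed)

lemma word_val_closed [simp]: "w \<in> lists (G \<times> UNIV) \<Longrightarrow> word_val w \<in> carrier A"
  by (induction w) (auto simp: word_val_def)

lemma word_val_append:
  "\<lbrakk>u \<in> lists (G \<times> UNIV); v \<in> lists (G \<times> UNIV)\<rbrakk> \<Longrightarrow> word_val (u @ v) = word_val u \<otimes> word_val v"
proof (induction u)
  case (Cons l u)
  have "letter l \<in> carrier A" using Cons by (intro letter_closed) auto
  then show ?case
    using Cons word_val_closed[of u] word_val_closed[of v] by (simp add: word_val_def m_assoc)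
qed (simp_all add: word_val_def word_val_closed[unfolded word_val_def])

lemma word_val_flip: "w \<in> lists (G \<times> UNIV) \<Longrightarrow> word_val (flip_word w) = star A (word_val w)"
proof (induction w)
  case (Cons l w)
  obtain g b where l: "l = (g, b)" "g \<in> G" using Cons by (cases l) auto
  have "word_val (flip_word (l # w)) = word_val (flip_word w) \<otimes> word_val [(g, \<not> b)]"
    using Cons l flip_word_lists[of w G] by (simp add: word_val_append)
  also have "word_val [(g, \<not> b)] = star A (letter l)" using l by (simp add: word_val_def letter_def c_closed)
  also have "word_val (flip_word w) \<otimes> star A (letter l) = star A (letter l \<otimes> word_val w)"
    using Cons l by simp
  finally show ?case by (simp add: word_val_def)
qed (simp add: word_val_def)

text \<open>The supports of two elements differ; additivity compares both evaluations on a common finite set.\<close>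

lemma ev_superset:
  assumes "finite S" "S \<subseteq> lists (G \<times> UNIV)" "{w. f w \<noteq> 0} \<subseteq> S"
  shows "ev f = (\<Oplus>w\<in>S. f w \<odot> word_val w)"
  unfolding ev_def
proof (rule add.finprod_mono_neutral_cong_left)
  show "f w \<odot> word_val w = \<zero>" if "w \<in> S - {w. f w \<noteq> 0}" for w
  proof -
    have "word_val w \<in> carrier A" using that assms(2) by (intro word_val_closed) blast
    then show ?thesis using that by simp
  qed
  show "(\<lambda>w. f w \<odot> word_val w) \<in> S \<rightarrow> carrier A" using assms(2) by (blast intro: word_val_closed)
qed (use assms in auto)

lemma ev_zero: "ev \<zero>\<^bsub>free_alg G\<^esub> = \<zero>"
  by (simp add: ev_def free_alg_sel)

lemma ev_closed: "f \<in> carrier (free_alg G) \<Longrightarrow> ev f \<in> carrier A"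
  unfolding ev_def by (rule finsum_closed) (unfold free_alg_sel(1), blast intro: word_val_closed)

lemma ev_add:
  assumes f: "f \<in> carrier (free_alg G)" and g: "g \<in> carrier (free_alg G)"
  shows "ev (f \<oplus>\<^bsub>free_alg G\<^esub> g) = ev f \<oplus> ev g"
proof -
  let ?S = "{w. f w \<noteq> 0} \<union> {w. g w \<noteq> 0}"
  have S: "finite ?S" "?S \<subseteq> lists (G \<times> UNIV)" using f g by (auto simp: free_alg_sel(1))
  have wv: "word_val w \<in> carrier A" if "w \<in> ?S" for w using S that by (intro word_val_closed) blast
  have "ev (f \<oplus>\<^bsub>free_alg G\<^esub> g) = (\<Oplus>w\<in>?S. (f w + g w) \<odot> word_val w)"
    using S by (subst ev_superset[of ?S]) (auto simp: free_alg_sel)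
  also have "\<dots> = (\<Oplus>w\<in>?S. f w \<odot> word_val w \<oplus> g w \<odot> word_val w)"
    by (rule finsum_cong') (use wv in \<open>auto simp: smult_add_left\<close>)
  also have "\<dots> = (\<Oplus>w\<in>?S. f w \<odot> word_val w) \<oplus> (\<Oplus>w\<in>?S. g w \<odot> word_val w)"
    by (rule finsum_addf) (use wv in auto)
  also have "\<dots> = ev f \<oplus> ev g"
    using S by (subst (1 2) ev_superset[of ?S]) auto
  finally show ?thesis .
qed

lemma ev_smult:
  assumes f: "f \<in> carrier (free_alg G)"
  shows "ev (a \<odot>\<^bsub>free_alg G\<^esub> f) = a \<odot> ev f"
proof -
  let ?S = "{w. f w \<noteq> 0}"
  have S: "finite ?S" "?S \<subseteq> lists (G \<times> UNIV)" using f by (auto simp: free_alg_sel(1))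
  have wv: "word_val w \<in> carrier A" if "w \<in> ?S" for w using S that by (intro word_val_closed) blast
  have "ev (a \<odot>\<^bsub>free_alg G\<^esub> f) = (\<Oplus>w\<in>?S. (a * f w) \<odot> word_val w)"
    using S by (subst ev_superset[of ?S]) (auto simp: free_alg_sel)
  also have "\<dots> = (\<Oplus>w\<in>?S. a \<odot> (f w \<odot> word_val w))"
    by (rule finsum_cong') (use wv in auto)
  also have "\<dots> = a \<odot> ev f" unfolding ev_def by (rule smult_finsum[symmetric]) (use wv in auto)
  finally show ?thesis .
qed

lemma ev_word: "w \<in> lists (G \<times> UNIV) \<Longrightarrow> ev (word_elem w) = word_val w"
  by (subst ev_superset[of "{w}"]) (auto simp: word_elem_def)

lemma ev_word_add:
  "\<lbrakk>w \<in> lists (G \<times> UNIV); x \<in> carrier (free_alg G)\<rbrakk>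
    \<Longrightarrow> ev (a \<odot>\<^bsub>free_alg G\<^esub> word_elem w \<oplus>\<^bsub>free_alg G\<^esub> x) = a \<odot> word_val w \<oplus> ev x"
  by (simp add: ev_add ev_smult ev_word word_elem_closed)

lemma ev_star: "f \<in> carrier (free_alg G) \<Longrightarrow> ev (star (free_alg G) f) = star A (ev f)"
proof (induction rule: free_basis_induct)
  case zero
  then show ?case by (simp add: ev_zero)
next
  case (add a w x)
  have "word_elem w \<in> carrier (free_alg G)" using add by (simp add: word_elem_closed)
  then have "star (free_alg G) (a \<odot>\<^bsub>free_alg G\<^esub> word_elem w \<oplus>\<^bsub>free_alg G\<^esub> x)
      = cnj a \<odot>\<^bsub>free_alg G\<^esub> word_elem (flip_word w) \<oplus>\<^bsub>free_alg G\<^esub> star (free_alg G) x"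
    using add by (simp add: star_word_elem)
  then show ?case using add flip_word_lists[OF add(1)] by (simp add: ev_word_add word_val_flip ev_closed)
qed

lemma ev_mult:
  assumes f: "f \<in> carrier (free_alg G)" and g: "g \<in> carrier (free_alg G)"
  shows "ev (f \<otimes>\<^bsub>free_alg G\<^esub> g) = ev f \<otimes> ev g"
  using f
proof (induction rule: free_basis_induct)
  case zero
  then show ?case using g by (simp add: ev_zero ev_closed)
next
  case (add a u x)
  have u: "word_elem u \<in> carrier (free_alg G)" using add by (simp add: word_elem_closed)
  have word: "ev (word_elem u \<otimes>\<^bsub>free_alg G\<^esub> g) = word_val u \<otimes> ev g"
    using g
  proof (induction rule: free_basis_induct)
    case zero
    then show ?case using u add by (simp add: ev_zero)
  next
    case (add b v y)
    have v: "word_elem v \<in> carrier (free_alg G)" using add by (simp add: word_elem_closed)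
    have "word_elem u \<otimes>\<^bsub>free_alg G\<^esub> (b \<odot>\<^bsub>free_alg G\<^esub> word_elem v \<oplus>\<^bsub>free_alg G\<^esub> y)
        = b \<odot>\<^bsub>free_alg G\<^esub> word_elem (u @ v) \<oplus>\<^bsub>free_alg G\<^esub> word_elem u \<otimes>\<^bsub>free_alg G\<^esub> y"
      using u v add by (simp add: F.r_distr) (simp add: free_alg_sel convolution_word_elem)
    then have "ev (word_elem u \<otimes>\<^bsub>free_alg G\<^esub> (b \<odot>\<^bsub>free_alg G\<^esub> word_elem v \<oplus>\<^bsub>free_alg G\<^esub> y))
        = b \<odot> word_val (u @ v) \<oplus> word_val u \<otimes> ev y"
      using u add \<open>u \<in> lists (G \<times> UNIV)\<close> by (simp add: ev_word_add)
    then show ?case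
      using add \<open>u \<in> lists (G \<times> UNIV)\<close> by (simp add: ev_word_add word_val_append r_distr ev_closed)
  qed
  have "ev ((a \<odot>\<^bsub>free_alg G\<^esub> word_elem u \<oplus>\<^bsub>free_alg G\<^esub> x) \<otimes>\<^bsub>free_alg G\<^esub> g)
      = a \<odot> ev (word_elem u \<otimes>\<^bsub>free_alg G\<^esub> g) \<oplus> ev (x \<otimes>\<^bsub>free_alg G\<^esub> g)"
    using u add g by (simp add: F.l_distr ev_add ev_smult)
  then show ?case using u add g by (simp add: word ev_word_add l_distr ev_closed)
qed

lemma ev_hom: "star_hom (free_alg G) A ev"
  using ev_word[of "[]"]
  by (auto simp: star_hom_def ring_hom_def ev_add ev_smult ev_star ev_mult ev_closed)
    (simp add: free_alg_sel word_val_def)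

lemma ev_gen: "g \<in> G \<Longrightarrow> ev (free_gen g) = c g"
  by (simp add: free_gen_word ev_word word_val_def letter_def c_closed)

end


section \<open>Universal C*-algebras\<close>

text \<open>The two conditions under which the supremum of the admissible seminorms is taken over a nonempty set that is
bounded at every element.\<close>

locale universal =
  fixes G :: "'g set" and R :: "'g univ_elem cstar_alg \<Rightarrow> ('g \<Rightarrow> 'g univ_elem) \<Rightarrow> bool"
  assumes bounded: "g \<in> G \<Longrightarrow> \<exists>K. \<forall>p. admissible G R p \<longrightarrow> p (free_gen g) \<le> K"
    and zero_admissible: "admissible G R (\<lambda>_. 0)"
begin

abbreviation "F \<equiv> free_alg G"
abbreviation "N \<equiv> univ_norm G R"
abbreviation "U \<equiv> univ_cstar G R"
abbreviation "gen \<equiv> univ_gen G R"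

sublocale F: star_algebra F
  by (rule free_alg_star_algebra)

lemma gen_in_F: "g \<in> G \<Longrightarrow> free_gen g \<in> carrier F"
  by (simp add: free_gen_word word_elem_closed)

lemma admissible_seminormed: "admissible G R p \<Longrightarrow> cstar_seminormed F p"
  by unfold_locales (simp add: admissible_def)

lemma admissible_bounded:
  "f \<in> carrier F \<Longrightarrow> \<exists>K. \<forall>p. admissible G R p \<longrightarrow> p f \<le> K"
proof (induction rule: free_induct)
  case one
  then show ?case using cstar_seminormed.p_one_le[OF admissible_seminormed] by blast
next
  case (gen g)
  then show ?case by (rule bounded)
next
  case (star x)
  then show ?case using cstar_seminormed.p_star[OF admissible_seminormed] by metis
next
  case (smult c x)
  then obtain K where K: "\<And>p. admissible G R p \<Longrightarrow> p x \<le> K" by blast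
  have "p (c \<odot>\<^bsub>F\<^esub> x) \<le> cmod c * K" if p: "admissible G R p" for p
  proof -
    interpret cstar_seminormed F p by (rule admissible_seminormed[OF p])
    show ?thesis using smult(1) K[OF p] by (simp add: mult_left_mono)
  qed
  then show ?case by blast
next
  case (add x y)
  then obtain K L where KL: "\<And>p. admissible G R p \<Longrightarrow> p x \<le> K" "\<And>p. admissible G R p \<Longrightarrow> p y \<le> L" by blast
  have "p (x \<oplus>\<^bsub>F\<^esub> y) \<le> K + L" if p: "admissible G R p" for p
  proof -
    interpret cstar_seminormed F p by (rule admissible_seminormed[OF p])
    show ?thesis using p_add[OF add(1,2)] KL[OF p] by linarith
  qed
  then show ?case by blast
next
  case (mult x y)
  then obtain K L where KL: "\<And>p. admissible G R p \<Longrightarrow> p x \<le> K" "\<And>p. admissible G R p \<Longrightarrow> p y \<le> L" by blast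
  have "p (x \<otimes>\<^bsub>F\<^esub> y) \<le> K * L" if p: "admissible G R p" for p
  proof -
    interpret cstar_seminormed F p by (rule admissible_seminormed[OF p])
    have "p x * p y \<le> K * L"
      using KL[OF p] p_nonneg[OF mult(1)] p_nonneg[OF mult(2)] by (intro mult_mono) linarith+
    then show ?thesis using p_mult[OF mult(1,2)] by linarith
  qed
  then show ?case by blast
qed

lemma le_N: "\<lbrakk>admissible G R p; f \<in> carrier F\<rbrakk> \<Longrightarrow> p f \<le> N f"
  unfolding univ_norm_def using admissible_bounded[of f]
  by (intro cSUP_upper) (auto simp: bdd_above_def)

lemma N_le: "(\<And>p. admissible G R p \<Longrightarrow> p f \<le> r) \<Longrightarrow> N f \<le> r"
  unfolding univ_norm_def using zero_admissible by (intro cSUP_least) auto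

lemma N_approx:
  assumes "f \<in> carrier F" "0 < e" shows "\<exists>p. admissible G R p \<and> N f < p f + e"
proof (rule ccontr)
  assume "\<not> ?thesis"
  then have "N f \<le> N f - e" by (intro N_le) (auto simp: not_less algebra_simps)
  then show False using assms by simp
qed

lemma N_seminorm: "cstar_seminorm F N"
proof -
  have nn: "0 \<le> N f" if "f \<in> carrier F" for f using le_N[OF zero_admissible that] by simp
  have add: "N (x \<oplus>\<^bsub>F\<^esub> y) \<le> N x + N y" if x: "x \<in> carrier F" and y: "y \<in> carrier F" for x y
  proof (rule N_le)
    fix p assume p: "admissible G R p"
    then show "p (x \<oplus>\<^bsub>F\<^esub> y) \<le> N x + N y"
      using cstar_seminormed.p_add[OF admissible_seminormed[OF p] x y] le_N[OF p x] le_N[OF p y] by linarith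
  qed
  have mult: "N (x \<otimes>\<^bsub>F\<^esub> y) \<le> N x * N y" if x: "x \<in> carrier F" and y: "y \<in> carrier F" for x y
  proof (rule N_le)
    fix p assume p: "admissible G R p"
    interpret cstar_seminormed F p by (rule admissible_seminormed[OF p])
    have "p x * p y \<le> N x * N y" using le_N[OF p x] le_N[OF p y] x y nn by (intro mult_mono) auto
    then show "p (x \<otimes>\<^bsub>F\<^esub> y) \<le> N x * N y" using p_mult[OF x y] by linarith
  qed
  have smult_le: "N (c \<odot>\<^bsub>F\<^esub> x) \<le> cmod c * N x" if x: "x \<in> carrier F" for c x
  proof (rule N_le)
    fix p assume p: "admissible G R p"
    interpret cstar_seminormed F p by (rule admissible_seminormed[OF p])
    show "p (c \<odot>\<^bsub>F\<^esub> x) \<le> cmod c * N x" using x le_N[OF p x] by (simp add: mult_left_mono)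
  qed
  have smult: "N (c \<odot>\<^bsub>F\<^esub> x) = cmod c * N x" if x: "x \<in> carrier F" for c x
  proof (cases "c = 0")
    case True
    then show ?thesis using smult_le[OF x, of 0] nn[of "0 \<odot>\<^bsub>F\<^esub> x"] x by (intro antisym) simp_all
  next
    case False
    have "cmod c * N ((1 / c) \<odot>\<^bsub>F\<^esub> (c \<odot>\<^bsub>F\<^esub> x)) \<le> cmod c * (cmod (1 / c) * N (c \<odot>\<^bsub>F\<^esub> x))"
      using x by (intro mult_left_mono smult_le) simp_all
    then have "cmod c * N x \<le> N (c \<odot>\<^bsub>F\<^esub> x)" using False x by (simp add: norm_divide)
    then show ?thesis using smult_le[OF x, of c] by simp
  qed
  have sq: "N (star F x \<otimes>\<^bsub>F\<^esub> x) = (N x)\<^sup>2" if x: "x \<in> carrier F" for x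
  proof (rule antisym)
    have xx: "star F x \<otimes>\<^bsub>F\<^esub> x \<in> carrier F" using x by simp
    show "N (star F x \<otimes>\<^bsub>F\<^esub> x) \<le> (N x)\<^sup>2"
    proof (rule N_le)
      fix p assume p: "admissible G R p"
      interpret cstar_seminormed F p by (rule admissible_seminormed[OF p])
      show "p (star F x \<otimes>\<^bsub>F\<^esub> x) \<le> (N x)\<^sup>2" using x le_N[OF p x] by (simp add: p_star_mult power_mono)
    qed
    have "N x \<le> sqrt (N (star F x \<otimes>\<^bsub>F\<^esub> x))"
    proof (rule N_le)
      fix p assume p: "admissible G R p"
      interpret cstar_seminormed F p by (rule admissible_seminormed[OF p])
      have "(p x)\<^sup>2 \<le> N (star F x \<otimes>\<^bsub>F\<^esub> x)" using le_N[OF p xx] x by (simp add: p_star_mult)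
      then show "p x \<le> sqrt (N (star F x \<otimes>\<^bsub>F\<^esub> x))" by (rule real_le_rsqrt)
    qed
    then have "(N x)\<^sup>2 \<le> (sqrt (N (star F x \<otimes>\<^bsub>F\<^esub> x)))\<^sup>2" using nn[OF x] by (rule power_mono)
    then show "(N x)\<^sup>2 \<le> N (star F x \<otimes>\<^bsub>F\<^esub> x)" using nn[OF xx] by simp
  qed
  show ?thesis unfolding cstar_seminorm_def by (intro conjI ballI allI nn add mult smult sq)
qed

sublocale FN: cstar_seminormed F N
  by unfold_locales (rule N_seminorm)

lemma univ_cstar: "cstar_algebra U"
  unfolding univ_cstar_def by (rule FN.completion_cstar)

sublocale U: cstar_algebra U
  by (rule univ_cstar)

lemma gen_eq: "gen g = FN.emb (free_gen g)"
  by (simp add: univ_gen_def)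

lemma emb_hom: "star_hom F U FN.emb"
  unfolding univ_cstar_def by (rule FN.emb_hom)

sublocale emb: star_morphism F U FN.emb
  by unfold_locales (rule emb_hom)

lemma gen_closed [simp]: "g \<in> G \<Longrightarrow> gen g \<in> carrier U"
  by (simp add: gen_eq gen_in_F)

lemma univ_induct:
  assumes X: "X \<in> carrier U"
    and closed: "\<And>X. \<lbrakk>X \<in> carrier U; \<And>e. 0 < e \<Longrightarrow> \<exists>Y\<in>carrier U. P Y \<and> nrm U (X \<ominus>\<^bsub>U\<^esub> Y) < e\<rbrakk> \<Longrightarrow> P X"
    and one: "P \<one>\<^bsub>U\<^esub>" and gen: "\<And>g. g \<in> G \<Longrightarrow> P (gen g)"
    and star: "\<And>x. \<lbrakk>x \<in> carrier U; P x\<rbrakk> \<Longrightarrow> P (star U x)"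
    and smult: "\<And>c x. \<lbrakk>x \<in> carrier U; P x\<rbrakk> \<Longrightarrow> P (c \<odot>\<^bsub>U\<^esub> x)"
    and add: "\<And>x y. \<lbrakk>x \<in> carrier U; y \<in> carrier U; P x; P y\<rbrakk> \<Longrightarrow> P (x \<oplus>\<^bsub>U\<^esub> y)"
    and mult: "\<And>x y. \<lbrakk>x \<in> carrier U; y \<in> carrier U; P x; P y\<rbrakk> \<Longrightarrow> P (x \<otimes>\<^bsub>U\<^esub> y)"
  shows "P X"
proof -
  have "P (FN.emb f)" if "f \<in> carrier F" for f
    using that
  proof (induction rule: free_induct)
    case (gen g)
    then show ?case using assms(4) by (simp add: gen_eq)
  qed (simp_all add: one star smult add mult)
  then show ?thesis
    using FN.emb_dense[of X] X emb.hom_closed unfolding univ_cstar_def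
    by (intro closed[unfolded univ_cstar_def]) blast+
qed

text \<open>The norm of the universal algebra is the supremum of the norms of the images in the completions for
admissible seminorms, and in these the relations hold.\<close>

lemma univ_norming:
  assumes X: "X \<in> carrier U" and e: "0 < e"
  shows "\<exists>p f. admissible G R p \<and> star_hom U (completion F p) f \<and>
    (\<forall>g\<in>G. f (gen g) = completion_emb F p (free_gen g)) \<and> nrm U X < nrm (completion F p) (f X) + e"
proof -
  have "\<exists>a\<in>carrier F. nrm U (X \<ominus>\<^bsub>U\<^esub> FN.emb a) < e / 3"
    using FN.emb_dense[of X "e / 3"] X e by (simp add: univ_cstar_def)
  then obtain a where a: "a \<in> carrier F" "nrm U (X \<ominus>\<^bsub>U\<^esub> FN.emb a) < e / 3" by blast
  obtain p where p: "admissible G R p" "N a < p a + e / 3" using N_approx[OF a(1), of "e / 3"] e by auto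
  interpret P: cstar_seminormed F p by (rule admissible_seminormed[OF p(1)])
  interpret C: cstar_algebra P.C by (rule P.completion_cstar)
  obtain f where f: "star_hom U P.C f" "\<And>a. a \<in> carrier F \<Longrightarrow> f (FN.emb a) = P.emb a"
    using completion_extend[OF FN.cstar_seminormed_axioms P.completion_cstar P.emb_hom] le_N[OF p(1)] P.nrm_emb
    unfolding univ_cstar_def by metis
  interpret f: star_morphism U P.C f by unfold_locales (rule f(1))
  have "nrm U X \<le> nrm U (X \<ominus>\<^bsub>U\<^esub> FN.emb a) + nrm U (FN.emb a)"
    using X a by (intro U.p_le_diff) auto
  also have "nrm U (FN.emb a) = N a" unfolding univ_cstar_def by (rule FN.nrm_emb[OF a(1)])
  finally have 1: "nrm U X < p a + 2 * (e / 3)" using a p by simp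
  have "p a = nrm P.C (f (FN.emb a))" using a by (simp add: f P.nrm_emb)
  also have "\<dots> \<le> nrm P.C (f (FN.emb a) \<ominus>\<^bsub>P.C\<^esub> f X) + nrm P.C (f X)"
    using X a by (intro C.p_le_diff) auto
  also have "nrm P.C (f (FN.emb a) \<ominus>\<^bsub>P.C\<^esub> f X) = nrm P.C (f (X \<ominus>\<^bsub>U\<^esub> FN.emb a))"
    using X a C.p_diff_commute[of "f (FN.emb a)" "f X"] by simp
  also have "\<dots> \<le> nrm U (X \<ominus>\<^bsub>U\<^esub> FN.emb a)"
    using X a by (intro star_hom_contractive[OF univ_cstar C.cstar_seminormed_axioms f(1)]) auto
  finally have "nrm U X < nrm P.C (f X) + e" using 1 a by simp
  moreover have "\<forall>g\<in>G. f (gen g) = P.emb (free_gen g)" using f(2) gen_in_F by (simp add: gen_eq)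
  ultimately show ?thesis using p f(1) by blast
qed

text \<open>The universal property: elements \<open>b g\<close> of a C*-algebra define an admissible seminorm if
  relations can be pulled back along the isometric embedding of the completion.\<close>

lemma univ_hom_ex:
  assumes "cstar_algebra B" and b: "\<And>g. g \<in> G \<Longrightarrow> b g \<in> carrier B"
    and rel: "\<And>(C :: 'g univ_elem cstar_alg) x j. \<lbrakk>cstar_algebra C; \<And>g. g \<in> G \<Longrightarrow> x g \<in> carrier C; star_hom C B j;
      \<And>X. X \<in> carrier C \<Longrightarrow> nrm B (j X) = nrm C X; \<And>g. g \<in> G \<Longrightarrow> j (x g) = b g\<rbrakk> \<Longrightarrow> R C x"
  shows "\<exists>f. star_hom U B f \<and> (\<forall>g\<in>G. f (gen g) = b g)"
proof -
  interpret B: cstar_algebra B by fact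
  interpret E: free_evaluation B G b by unfold_locales (rule b)
  interpret ev: star_morphism F B E.ev by unfold_locales (rule E.ev_hom)
  define p where "p f = nrm B (E.ev f)" for f
  interpret P: cstar_seminormed F p
    by unfold_locales
      (simp add: cstar_seminorm_def p_def B.p_add B.p_mult B.p_star_mult)
  interpret C: cstar_algebra P.C by (rule P.completion_cstar)
  obtain j where j: "star_hom P.C B j" "\<And>a. a \<in> carrier F \<Longrightarrow> j (P.emb a) = E.ev a"
    using completion_extend[OF P.cstar_seminormed_axioms B.cstar_algebra_axioms E.ev_hom] by (auto simp: p_def)
  interpret j: star_morphism P.C B j by unfold_locales (rule j(1))
  interpret pe: star_morphism F P.C P.emb by unfold_locales (rule P.emb_hom)
  have iso: "nrm B (j X) = nrm P.C X" if X: "X \<in> carrier P.C" for X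
  proof (rule antisym)
    have contr: "nrm B (j Y) \<le> nrm P.C Y" if "Y \<in> carrier P.C" for Y
      by (rule star_hom_contractive[OF C.cstar_algebra_axioms B.cstar_seminormed_axioms j(1) that])
    show "nrm B (j X) \<le> nrm P.C X" by (rule contr[OF X])
    show "nrm P.C X \<le> nrm B (j X)"
    proof (rule field_le_epsilon)
      fix e :: real assume "0 < e"
      then obtain a where a: "a \<in> carrier F" "nrm P.C (X \<ominus>\<^bsub>P.C\<^esub> P.emb a) < e / 2"
        using P.emb_dense[OF X, of "e / 2"] by auto
      have "nrm P.C X \<le> nrm P.C (X \<ominus>\<^bsub>P.C\<^esub> P.emb a) + nrm P.C (P.emb a)"
        using X a by (intro C.p_le_diff) auto
      also have "nrm P.C (P.emb a) = nrm B (j (P.emb a))" using a by (simp add: P.nrm_emb p_def j)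
      also have "\<dots> \<le> nrm B (j (P.emb a) \<ominus>\<^bsub>B\<^esub> j X) + nrm B (j X)"
        using X a by (intro B.p_le_diff) auto
      also have "nrm B (j (P.emb a) \<ominus>\<^bsub>B\<^esub> j X) = nrm B (j (X \<ominus>\<^bsub>P.C\<^esub> P.emb a))"
        using X a B.p_diff_commute[of "j (P.emb a)" "j X"] by simp
      also have "\<dots> \<le> nrm P.C (X \<ominus>\<^bsub>P.C\<^esub> P.emb a)" using X a by (intro contr) auto
      finally show "nrm P.C X \<le> nrm B (j X) + e" using a by simp
    qed
  qed
  have "R P.C (\<lambda>g. P.emb (free_gen g))"
    by (rule rel[OF C.cstar_algebra_axioms _ j(1) iso]) (simp_all add: gen_in_F j(2) E.ev_gen)
  then have adm: "admissible G R p" using P.seminorm by (simp add: admissible_def)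
  obtain f where f: "star_hom U B f" "\<And>a. a \<in> carrier F \<Longrightarrow> f (FN.emb a) = E.ev a"
    using completion_extend[OF FN.cstar_seminormed_axioms B.cstar_algebra_axioms E.ev_hom] le_N[OF adm]
    unfolding univ_cstar_def p_def by blast
  then show ?thesis by (intro exI[of _ f]) (simp add: gen_eq gen_in_F E.ev_gen)
qed

end


section \<open>The relations of the quantum balls\<close>

definition sq_sum :: "('a, 'm) star_alg_scheme \<Rightarrow> (nat \<Rightarrow> 'a) \<Rightarrow> nat set \<Rightarrow> 'a" where
  "sq_sum A z S = (\<Oplus>\<^bsub>A\<^esub>j\<in>S. z j \<otimes>\<^bsub>A\<^esub> star A (z j))"

definition ball_rel :: "real \<Rightarrow> nat \<Rightarrow> nat \<Rightarrow> ('a, 'm) star_alg_scheme \<Rightarrow> (nat \<Rightarrow> 'a) \<Rightarrow> bool" where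
  "ball_rel q m n A z \<longleftrightarrow>
     (\<forall>i j. m \<le> i \<and> i < j \<and> j \<le> n \<longrightarrow>
        z i \<otimes>\<^bsub>A\<^esub> z j = complex_of_real (q powr (1/2)) \<odot>\<^bsub>A\<^esub> (z j \<otimes>\<^bsub>A\<^esub> z i) \<and>
        z i \<otimes>\<^bsub>A\<^esub> star A (z j) = complex_of_real (q powr (-1/2)) \<odot>\<^bsub>A\<^esub> (star A (z j) \<otimes>\<^bsub>A\<^esub> z i)) \<and>
     (\<forall>i \<in> {m..n}.
        star A (z i) \<otimes>\<^bsub>A\<^esub> z i \<ominus>\<^bsub>A\<^esub> complex_of_real q \<odot>\<^bsub>A\<^esub> (z i \<otimes>\<^bsub>A\<^esub> star A (z i)) =
        complex_of_real (1 - q) \<odot>\<^bsub>A\<^esub> (\<one>\<^bsub>A\<^esub> \<ominus>\<^bsub>A\<^esub> sq_sum A z {i+1..n}))"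

text \<open>In contrast to the given relations of the even ball, \<open>ball_rel\<close> starts at an index \<open>m\<close>. With \<open>m = 2\<close> it covers
the generators of the odd ball other than the self-adjoint \<open>x\<^sub>1\<close>.\<close>

lemma even_ball_rel_iff: "even_ball_rel q n A z \<longleftrightarrow> ball_rel q 1 n A z"
  by (simp add: even_ball_rel_def ball_rel_def sq_sum_def)

lemma odd_ball_rel_iff:
  "odd_ball_rel q n A x \<longleftrightarrow> star A (x 1) = x 1 \<and>
    (\<forall>j\<in>{2..n}. x 1 \<otimes>\<^bsub>A\<^esub> x j = complex_of_real (q powr (1/2)) \<odot>\<^bsub>A\<^esub> (x j \<otimes>\<^bsub>A\<^esub> x 1)) \<and>
    ball_rel q 2 n A x \<and>
    positive A (\<one>\<^bsub>A\<^esub> \<ominus>\<^bsub>A\<^esub> (x 1 \<otimes>\<^bsub>A\<^esub> x 1 \<oplus>\<^bsub>A\<^esub> sq_sum A x {2..n}))"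
proof -
  have split: "(\<forall>i j. 1 \<le> i \<and> i < j \<and> j \<le> n \<longrightarrow> P i j) \<longleftrightarrow>
      (\<forall>j\<in>{2..n}. P 1 j) \<and> (\<forall>i j. 2 \<le> i \<and> i < j \<and> j \<le> n \<longrightarrow> P i j)" for P :: "nat \<Rightarrow> nat \<Rightarrow> bool"
  proof (intro iffI conjI allI impI ballI)
    fix i j assume P: "(\<forall>j\<in>{2..n}. P 1 j) \<and> (\<forall>i j. 2 \<le> i \<and> i < j \<and> j \<le> n \<longrightarrow> P i j)"
      and ij: "1 \<le> i \<and> i < j \<and> j \<le> n"
    show "P i j" by (cases "i = 1") (use P ij in auto)
  qed auto
  show ?thesis
    unfolding odd_ball_rel_def ball_rel_def sq_sum_def star_le_def split by blast
qed

context star_algebra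
begin

lemma sq_sum_closed [simp]:
  "(\<And>j. j \<in> S \<Longrightarrow> z j \<in> carrier A) \<Longrightarrow> sq_sum A z S \<in> carrier A"
  unfolding sq_sum_def by (rule finsum_closed) auto

lemma sq_sum_star: "(\<And>j. j \<in> S \<Longrightarrow> z j \<in> carrier A) \<Longrightarrow> star A (sq_sum A z S) = sq_sum A z S"
  unfolding sq_sum_def by (subst star_finsum) (auto intro!: finsum_cong')

lemma sq_sum_empty [simp]: "sq_sum A z {} = \<zero>"
  by (simp add: sq_sum_def)

lemma sq_sum_insert:
  "\<lbrakk>finite S; k \<notin> S; z k \<in> carrier A; \<And>j. j \<in> S \<Longrightarrow> z j \<in> carrier A\<rbrakk>
    \<Longrightarrow> sq_sum A z (insert k S) = z k \<otimes> star A (z k) \<oplus> sq_sum A z S"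
  unfolding sq_sum_def by (subst finsum_insert) auto

lemma sq_sum_Suc:
  "\<lbrakk>k \<le> n; \<And>j. j \<in> {k..n} \<Longrightarrow> z j \<in> carrier A\<rbrakk>
    \<Longrightarrow> sq_sum A z {k..n} = z k \<otimes> star A (z k) \<oplus> sq_sum A z {Suc k..n}"
  by (subst atLeastAtMost_insertL[symmetric]) (auto intro!: sq_sum_insert)

lemma sq_sum_cong:
  "\<lbrakk>\<And>j. j \<in> S \<Longrightarrow> z j \<otimes> star A (z j) = z' j \<otimes> star A (z' j); \<And>j. j \<in> S \<Longrightarrow> z' j \<in> carrier A\<rbrakk>
    \<Longrightarrow> sq_sum A z S = sq_sum A z' S"
  unfolding sq_sum_def by (rule finsum_cong') auto

lemma ball_rel_cong:
  assumes z: "\<And>i. i \<in> {m..n} \<Longrightarrow> z i = z' i" and c: "\<And>i. i \<in> {m..n} \<Longrightarrow> z' i \<in> carrier A"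
    and rel: "ball_rel q m n A z'"
  shows "ball_rel q m n A z"
proof -
  have "sq_sum A z {i+1..n} = sq_sum A z' {i+1..n}" if "i \<in> {m..n}" for i
    by (rule sq_sum_cong) (use that z c in auto)
  then show ?thesis using rel z unfolding ball_rel_def by simp
qed

lemma ball_rel_phase:
  assumes c: "\<And>i. i \<in> {m..n} \<Longrightarrow> z i \<in> carrier A" and l: "\<And>i. i \<in> {m..n} \<Longrightarrow> cmod (l i) = 1"
    and rel: "ball_rel q m n A z"
  shows "ball_rel q m n A (\<lambda>i. l i \<odot> z i)"
proof -
  have l1: "l i * cnj (l i) = 1" "cnj (l i) * l i = 1" if "i \<in> {m..n}" for i
    using l[OF that] complex_norm_square[of "l i"] by (simp_all add: mult.commute)
  have s: "sq_sum A (\<lambda>i. l i \<odot> z i) {i+1..n} = sq_sum A z {i+1..n}" if "i \<in> {m..n}" for i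
    by (rule sq_sum_cong) (use that c l1 in auto)
  show ?thesis
    unfolding ball_rel_def
  proof (intro conjI allI impI ballI)
    fix i j assume ij: "m \<le> i \<and> i < j \<and> j \<le> n"
    then have [simp]: "z i \<in> carrier A" "z j \<in> carrier A" using c by auto
    have r: "z i \<otimes> z j = complex_of_real (q powr (1/2)) \<odot> (z j \<otimes> z i)"
        "z i \<otimes> star A (z j) = complex_of_real (q powr (-1/2)) \<odot> (star A (z j) \<otimes> z i)"
      using rel ij by (auto simp: ball_rel_def)
    show "l i \<odot> z i \<otimes> (l j \<odot> z j) = complex_of_real (q powr (1/2)) \<odot> (l j \<odot> z j \<otimes> (l i \<odot> z i))"
      "l i \<odot> z i \<otimes> star A (l j \<odot> z j) = complex_of_real (q powr (-1/2)) \<odot> (star A (l j \<odot> z j) \<otimes> (l i \<odot> z i))"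
      by (simp_all add: r ac_simps)
  next
    fix i assume i: "i \<in> {m..n}"
    then have [simp]: "z i \<in> carrier A" using c by auto
    show "star A (l i \<odot> z i) \<otimes> (l i \<odot> z i) \<ominus> complex_of_real q \<odot> (l i \<odot> z i \<otimes> star A (l i \<odot> z i)) =
        complex_of_real (1 - q) \<odot> (\<one> \<ominus> sq_sum A (\<lambda>i. l i \<odot> z i) {i+1..n})"
      unfolding s[OF i] using rel i by (simp add: ball_rel_def l1)
  qed
qed

end

context star_morphism
begin

lemma hom_sq_sum:
  "(\<And>j. j \<in> S \<Longrightarrow> z j \<in> carrier A) \<Longrightarrow> f (sq_sum A z S) = sq_sum B (\<lambda>j. f (z j)) S"
  unfolding sq_sum_def by (subst hom_sum) (auto intro!: cod.finsum_cong')

lemma ball_rel_hom: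
  assumes c: "\<And>i. i \<in> {m..n} \<Longrightarrow> z i \<in> carrier A" and rel: "ball_rel q m n A z"
  shows "ball_rel q m n B (\<lambda>i. f (z i))"
  unfolding ball_rel_def
proof (intro conjI allI impI ballI)
  fix i j assume ij: "m \<le> i \<and> i < j \<and> j \<le> n"
  then have [simp]: "z i \<in> carrier A" "z j \<in> carrier A" using c by auto
  have r: "z i \<otimes>\<^bsub>A\<^esub> z j = complex_of_real (q powr (1/2)) \<odot>\<^bsub>A\<^esub> (z j \<otimes>\<^bsub>A\<^esub> z i)"
      "z i \<otimes>\<^bsub>A\<^esub> star A (z j) = complex_of_real (q powr (-1/2)) \<odot>\<^bsub>A\<^esub> (star A (z j) \<otimes>\<^bsub>A\<^esub> z i)"
    using rel ij by (auto simp: ball_rel_def)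
  show "f (z i) \<otimes>\<^bsub>B\<^esub> f (z j) = complex_of_real (q powr (1/2)) \<odot>\<^bsub>B\<^esub> (f (z j) \<otimes>\<^bsub>B\<^esub> f (z i))"
    using arg_cong[OF r(1), of f] by simp
  show "f (z i) \<otimes>\<^bsub>B\<^esub> star B (f (z j)) = complex_of_real (q powr (-1/2)) \<odot>\<^bsub>B\<^esub> (star B (f (z j)) \<otimes>\<^bsub>B\<^esub> f (z i))"
    using arg_cong[OF r(2), of f] by simp
next
  fix i assume i: "i \<in> {m..n}"
  then have [simp]: "z i \<in> carrier A" and [simp]: "sq_sum A z {i+1..n} \<in> carrier A"
    using c by (auto intro!: dom.sq_sum_closed)
  have s: "f (sq_sum A z {i+1..n}) = sq_sum B (\<lambda>j. f (z j)) {i+1..n}"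
    by (rule hom_sq_sum) (use i c in auto)
  have "star A (z i) \<otimes>\<^bsub>A\<^esub> z i \<ominus>\<^bsub>A\<^esub> complex_of_real q \<odot>\<^bsub>A\<^esub> (z i \<otimes>\<^bsub>A\<^esub> star A (z i)) =
      complex_of_real (1 - q) \<odot>\<^bsub>A\<^esub> (\<one>\<^bsub>A\<^esub> \<ominus>\<^bsub>A\<^esub> sq_sum A z {i+1..n})" using rel i by (auto simp: ball_rel_def)
  from arg_cong[OF this, of f]
  show "star B (f (z i)) \<otimes>\<^bsub>B\<^esub> f (z i) \<ominus>\<^bsub>B\<^esub> complex_of_real q \<odot>\<^bsub>B\<^esub> (f (z i) \<otimes>\<^bsub>B\<^esub> star B (f (z i))) =
      complex_of_real (1 - q) \<odot>\<^bsub>B\<^esub> (\<one>\<^bsub>B\<^esub> \<ominus>\<^bsub>B\<^esub> sq_sum B (\<lambda>j. f (z j)) {i+1..n})"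
    using \<open>sq_sum A z {i+1..n} \<in> carrier A\<close> s by simp
qed

end

text \<open>The homomorphisms \<open>f\<close> with \<open>H B f\<close> determine the norm of \<open>A\<close>. Relations of the balls that hold for all images
\<open>f(z)\<close> then hold for \<open>z\<close>. This is used twice: for the universal algebra, with all completions for
admissible seminorms, and for a subalgebra, with the single isometric inclusion.\<close>

definition norming :: "('a, 'm) cstar_alg_scheme \<Rightarrow> (('b, 'n) cstar_alg_scheme \<Rightarrow> ('a \<Rightarrow> 'b) \<Rightarrow> bool) \<Rightarrow> bool" where
  "norming A H \<longleftrightarrow> (\<forall>X\<in>carrier A. \<forall>e>0. \<exists>B f. cstar_algebra B \<and> star_hom A B f \<and> H B f \<and>
     nrm A X < nrm B (f X) + e)"

lemma norming_eq:
  assumes "cstar_algebra A" "norming A H" and x: "x \<in> carrier A" and y: "y \<in> carrier A"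
    and eq: "\<And>B f. \<lbrakk>star_morphism A B f; H B f\<rbrakk> \<Longrightarrow> f x = f y"
  shows "x = y"
proof -
  interpret A: cstar_algebra A by fact
  have "nrm A (x \<ominus>\<^bsub>A\<^esub> y) \<le> 0 + e" if "0 < e" for e
  proof -
    have "x \<ominus>\<^bsub>A\<^esub> y \<in> carrier A" using x y by simp
    then obtain B f where B: "cstar_algebra B" and f: "star_hom A B f" "H B f"
      "nrm A (x \<ominus>\<^bsub>A\<^esub> y) < nrm B (f (x \<ominus>\<^bsub>A\<^esub> y)) + e"
      using assms(2) \<open>0 < e\<close> unfolding norming_def by blast
    interpret B: cstar_algebra B by fact
    interpret f: star_morphism A B f by unfold_locales fact
    have "f (x \<ominus>\<^bsub>A\<^esub> y) = \<zero>\<^bsub>B\<^esub>"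
      using eq[OF f.star_morphism_axioms f(2)] x y by (simp add: B.diff_0_iff)
    then show ?thesis using f(3) by simp
  qed
  then have "nrm A (x \<ominus>\<^bsub>A\<^esub> y) \<le> 0" by (rule field_le_epsilon)
  then show ?thesis using x y by (intro A.eqI_nrm antisym) simp_all
qed

text \<open>Positivity is the norm inequality \<open>\<parallel>M - a\<parallel> \<le> M\<close>, which can be tested in the images.\<close>

lemma norming_positive:
  assumes "cstar_algebra A" "norming A H" and a: "a \<in> carrier A" "star A a = a"
    and pos: "\<And>B f. \<lbrakk>star_morphism A B f; H B f\<rbrakk> \<Longrightarrow> positive B (f a)"
  shows "positive A a"
proof -
  interpret A: cstar_algebra A by fact
  let ?M = "nrm A a"
  let ?X = "complex_of_real ?M \<odot>\<^bsub>A\<^esub> \<one>\<^bsub>A\<^esub> \<ominus>\<^bsub>A\<^esub> a"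
  have X: "?X \<in> carrier A" using a by simp
  have "nrm A ?X \<le> ?M + e" if "0 < e" for e
  proof -
    obtain B f where B: "cstar_algebra B" and f: "star_hom A B f" "H B f" "nrm A ?X < nrm B (f ?X) + e"
      using assms(2) X \<open>0 < e\<close> unfolding norming_def by blast
    interpret B: cstar_algebra B by fact
    interpret f: star_morphism A B f by unfold_locales fact
    have "nrm B (f a) \<le> ?M"
      by (rule star_hom_contractive[OF assms(1) B.cstar_seminormed_axioms f(1) a(1)])
    then have "nrm B (complex_of_real ?M \<odot>\<^bsub>B\<^esub> \<one>\<^bsub>B\<^esub> \<ominus>\<^bsub>B\<^esub> f a) \<le> ?M"
      by (rule B.positive_norm_bound[OF pos[OF f.star_morphism_axioms f(2)]])
    then show ?thesis using f(3) a by simp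
  qed
  then have "nrm A ?X \<le> ?M" by (rule field_le_epsilon)
  then show ?thesis using a by (subst A.positive_iff_norm[of a ?M]) simp_all
qed

lemma norming_ball_rel:
  assumes "cstar_algebra A" "norming A H" and c: "\<And>i. i \<in> {m..n} \<Longrightarrow> z i \<in> carrier A"
    and rel: "\<And>B f. H B f \<Longrightarrow> ball_rel q m n B (\<lambda>i. f (z i))"
  shows "ball_rel q m n A z"
proof -
  interpret A: cstar_algebra A by fact
  note eqI = norming_eq[OF assms(1,2)]
  show ?thesis
    unfolding ball_rel_def
  proof (intro conjI allI impI ballI)
    fix i j assume ij: "m \<le> i \<and> i < j \<and> j \<le> n"
    then have [simp]: "z i \<in> carrier A" "z j \<in> carrier A" using c by auto
    show "z i \<otimes>\<^bsub>A\<^esub> z j = complex_of_real (q powr (1/2)) \<odot>\<^bsub>A\<^esub> (z j \<otimes>\<^bsub>A\<^esub> z i)"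
    proof (rule eqI)
      fix B f assume "star_morphism A B f" "H B f"
      then interpret f: star_morphism A B f by simp
      show "f (z i \<otimes>\<^bsub>A\<^esub> z j) = f (complex_of_real (q powr (1/2)) \<odot>\<^bsub>A\<^esub> (z j \<otimes>\<^bsub>A\<^esub> z i))"
        using rel[OF \<open>H B f\<close>] ij by (simp add: ball_rel_def)
    qed simp_all
    show "z i \<otimes>\<^bsub>A\<^esub> star A (z j) = complex_of_real (q powr (-1/2)) \<odot>\<^bsub>A\<^esub> (star A (z j) \<otimes>\<^bsub>A\<^esub> z i)"
    proof (rule eqI)
      fix B f assume "star_morphism A B f" "H B f"
      then interpret f: star_morphism A B f by simp
      show "f (z i \<otimes>\<^bsub>A\<^esub> star A (z j)) = f (complex_of_real (q powr (-1/2)) \<odot>\<^bsub>A\<^esub> (star A (z j) \<otimes>\<^bsub>A\<^esub> z i))"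
        using rel[OF \<open>H B f\<close>] ij by (simp add: ball_rel_def)
    qed simp_all
  next
    fix i assume i: "i \<in> {m..n}"
    then have [simp]: "z i \<in> carrier A" and [simp]: "sq_sum A z {i+1..n} \<in> carrier A"
      using c by (auto intro!: A.sq_sum_closed)
    show "star A (z i) \<otimes>\<^bsub>A\<^esub> z i \<ominus>\<^bsub>A\<^esub> complex_of_real q \<odot>\<^bsub>A\<^esub> (z i \<otimes>\<^bsub>A\<^esub> star A (z i)) =
        complex_of_real (1 - q) \<odot>\<^bsub>A\<^esub> (\<one>\<^bsub>A\<^esub> \<ominus>\<^bsub>A\<^esub> sq_sum A z {i+1..n})"
    proof (rule eqI)
      fix B f assume "star_morphism A B f" "H B f"
      then interpret f: star_morphism A B f by simp
      have s: "f (sq_sum A z {i+1..n}) = sq_sum B (\<lambda>j. f (z j)) {i+1..n}"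
        by (rule f.hom_sq_sum) (use i c in auto)
      show "f (star A (z i) \<otimes>\<^bsub>A\<^esub> z i \<ominus>\<^bsub>A\<^esub> complex_of_real q \<odot>\<^bsub>A\<^esub> (z i \<otimes>\<^bsub>A\<^esub> star A (z i))) =
          f (complex_of_real (1 - q) \<odot>\<^bsub>A\<^esub> (\<one>\<^bsub>A\<^esub> \<ominus>\<^bsub>A\<^esub> sq_sum A z {i+1..n}))"
        using rel[OF \<open>H B f\<close>] i \<open>sq_sum A z {i+1..n} \<in> carrier A\<close> s by (simp add: ball_rel_def)
    qed (use \<open>sq_sum A z {i+1..n} \<in> carrier A\<close> in simp_all)
  qed
qed

lemma odd_defect_hom:
  assumes "star_morphism A B f" "\<And>i. i \<in> {1..n} \<Longrightarrow> x i \<in> carrier A" "1 \<le> n"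
  shows "f (\<one>\<^bsub>A\<^esub> \<ominus>\<^bsub>A\<^esub> (x 1 \<otimes>\<^bsub>A\<^esub> x 1 \<oplus>\<^bsub>A\<^esub> sq_sum A x {2..n})) =
    \<one>\<^bsub>B\<^esub> \<ominus>\<^bsub>B\<^esub> (f (x 1) \<otimes>\<^bsub>B\<^esub> f (x 1) \<oplus>\<^bsub>B\<^esub> sq_sum B (\<lambda>i. f (x i)) {2..n})"
proof -
  interpret star_morphism A B f by fact
  have "sq_sum A x {2..n} \<in> carrier A" using assms(2) by (intro dom.sq_sum_closed) auto
  moreover have "f (sq_sum A x {2..n}) = sq_sum B (\<lambda>i. f (x i)) {2..n}"
    using assms(2) by (intro hom_sq_sum) auto
  ultimately show ?thesis using assms(2)[of 1] assms(3) by simp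
qed

lemma norming_odd_ball_rel:
  assumes "cstar_algebra A" "norming A H" and c: "\<And>i. i \<in> {1..n} \<Longrightarrow> x i \<in> carrier A" and n: "1 \<le> n"
    and rel: "\<And>B f. H B f \<Longrightarrow> odd_ball_rel q n B (\<lambda>i. f (x i))"
  shows "odd_ball_rel q n A x"
proof -
  interpret A: cstar_algebra A by fact
  note eqI = norming_eq[OF assms(1,2)]
  have [simp]: "x (Suc 0) \<in> carrier A" using c n by simp
  have x1: "star A (x 1) = x 1"
  proof (rule eqI)
    fix B f assume "star_morphism A B f" "H B f"
    then interpret f: star_morphism A B f by simp
    show "f (star A (x 1)) = f (x 1)" using rel[OF \<open>H B f\<close>] by (simp add: odd_ball_rel_iff)
  qed simp_all
  have S: "sq_sum A x {2..n} \<in> carrier A" "star A (sq_sum A x {2..n}) = sq_sum A x {2..n}"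
    using c by (auto intro!: A.sq_sum_closed A.sq_sum_star)
  show ?thesis
    unfolding odd_ball_rel_iff
  proof (intro conjI ballI)
    fix j assume j: "j \<in> {2..n}"
    then have [simp]: "x j \<in> carrier A" using c by simp
    show "x 1 \<otimes>\<^bsub>A\<^esub> x j = complex_of_real (q powr (1/2)) \<odot>\<^bsub>A\<^esub> (x j \<otimes>\<^bsub>A\<^esub> x 1)"
    proof (rule eqI)
      fix B f assume "star_morphism A B f" "H B f"
      then interpret f: star_morphism A B f by simp
      show "f (x 1 \<otimes>\<^bsub>A\<^esub> x j) = f (complex_of_real (q powr (1/2)) \<odot>\<^bsub>A\<^esub> (x j \<otimes>\<^bsub>A\<^esub> x 1))"
        using rel[OF \<open>H B f\<close>] j by (simp add: odd_ball_rel_iff)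
    qed simp_all
  next
    show "ball_rel q 2 n A x"
      by (rule norming_ball_rel[OF assms(1,2)]) (use c rel in \<open>auto simp: odd_ball_rel_iff\<close>)
    show "positive A (\<one>\<^bsub>A\<^esub> \<ominus>\<^bsub>A\<^esub> (x 1 \<otimes>\<^bsub>A\<^esub> x 1 \<oplus>\<^bsub>A\<^esub> sq_sum A x {2..n}))"
    proof (rule norming_positive[OF assms(1,2)])
      fix B f assume f: "star_morphism A B f" "H B f"
      have "f (\<one>\<^bsub>A\<^esub> \<ominus>\<^bsub>A\<^esub> (x 1 \<otimes>\<^bsub>A\<^esub> x 1 \<oplus>\<^bsub>A\<^esub> sq_sum A x {2..n})) =
          \<one>\<^bsub>B\<^esub> \<ominus>\<^bsub>B\<^esub> (f (x 1) \<otimes>\<^bsub>B\<^esub> f (x 1) \<oplus>\<^bsub>B\<^esub> sq_sum B (\<lambda>i. f (x i)) {2..n})"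
        by (rule odd_defect_hom[OF f(1) _ n]) (rule c)
      then show "positive B (f (\<one>\<^bsub>A\<^esub> \<ominus>\<^bsub>A\<^esub> (x 1 \<otimes>\<^bsub>A\<^esub> x 1 \<oplus>\<^bsub>A\<^esub> sq_sum A x {2..n})))"
        using rel[OF f(2)] unfolding odd_ball_rel_iff by metis
    qed (use S x1 in simp_all)
  qed (rule x1)
qed

lemma odd_ball_rel_cong:
  assumes "star_algebra A" and z: "\<And>i. i \<in> {1..n} \<Longrightarrow> x i = x' i" and c: "\<And>i. i \<in> {1..n} \<Longrightarrow> x' i \<in> carrier A"
    and n: "1 \<le> n" and rel: "odd_ball_rel q n A x'"
  shows "odd_ball_rel q n A x"
proof -
  interpret A: star_algebra A by fact
  have "sq_sum A x {2..n} = sq_sum A x' {2..n}" using z c by (intro A.sq_sum_cong) auto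
  moreover have "ball_rel q 2 n A x"
    by (rule A.ball_rel_cong[of _ _ _ x']) (use z c rel in \<open>auto simp: odd_ball_rel_iff\<close>)
  ultimately show ?thesis using rel z n by (simp add: odd_ball_rel_iff)
qed


section \<open>Commutation relations and norm bounds\<close>

text \<open>The partial defects \<open>D k\<close> organise the
computations: \<open>D k\<close> commutes with \<open>z i\<close> for \<open>i < k\<close> and commutes with it up to the factor \<open>q\<close> for \<open>i \<ge> k\<close>.\<close>

locale ball = star_algebra A for A :: "('a, 'm) star_alg_scheme" (structure) +
  fixes q :: real and m n :: nat and z :: "nat \<Rightarrow> 'a"
  assumes q: "0 < q" "q < 1"
    and z_closed [simp]: "i \<in> {m..n} \<Longrightarrow> z i \<in> carrier A"
    and ball_rel: "ball_rel q m n A z"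
begin

abbreviation r :: complex where "r \<equiv> complex_of_real (sqrt q)"
abbreviation P :: "nat \<Rightarrow> 'a" where "P j \<equiv> z j \<otimes> star A (z j)"
definition D :: "nat \<Rightarrow> 'a" where "D k = \<one> \<ominus> sq_sum A z {k..n}"

lemma r_simps: "r \<noteq> 0" "r * r = complex_of_real q"
    "complex_of_real (q powr (1/2)) = r" "complex_of_real (q powr (-1/2)) = 1 / r"
proof -
  have h: "q powr (1/2) = sqrt q" using q by (simp add: powr_half_sqrt)
  have "q powr (-1/2) = inverse (q powr (1/2))" using powr_minus[of q "1/2"] by simp
  then show "complex_of_real (q powr (-1/2)) = 1 / r" by (simp add: h inverse_eq_divide)
  show "complex_of_real (q powr (1/2)) = r" by (simp add: h)
  show "r \<noteq> 0" "r * r = complex_of_real q" using q by (simp_all flip: of_real_mult)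
qed

lemma zz: "\<lbrakk>m \<le> i; i < j; j \<le> n\<rbrakk> \<Longrightarrow> z i \<otimes> z j = r \<odot> (z j \<otimes> z i)"
  using ball_rel unfolding ball_rel_def r_simps by blast

lemma zz_star: "\<lbrakk>m \<le> i; i < j; j \<le> n\<rbrakk> \<Longrightarrow> z i \<otimes> star A (z j) = (1 / r) \<odot> (star A (z j) \<otimes> z i)"
  using ball_rel unfolding ball_rel_def r_simps by blast

lemma star_zz: "\<lbrakk>m \<le> i; i < j; j \<le> n\<rbrakk> \<Longrightarrow> star A (z j) \<otimes> z i = r \<odot> (z i \<otimes> star A (z j))"
  using r_simps(1) by (simp add: zz_star)

lemma z_star_z:
  assumes "i \<in> {m..n}"
  shows "star A (z i) \<otimes> z i = complex_of_real q \<odot> P i \<oplus> complex_of_real (1 - q) \<odot> D (Suc i)"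
proof -
  have [simp]: "z i \<in> carrier A" using assms by simp
  have "star A (z i) \<otimes> z i \<ominus> complex_of_real q \<odot> P i = complex_of_real (1 - q) \<odot> D (Suc i)"
    using ball_rel assms by (simp add: ball_rel_def D_def)
  moreover have "star A (z i) \<otimes> z i = complex_of_real q \<odot> P i \<oplus> (star A (z i) \<otimes> z i \<ominus> complex_of_real q \<odot> P i)"
    using m_closed[OF \<open>z i \<in> carrier A\<close> star_closed[OF \<open>z i \<in> carrier A\<close>], THEN smult_closed, of "complex_of_real q"]
      m_closed[OF star_closed[OF \<open>z i \<in> carrier A\<close>] \<open>z i \<in> carrier A\<close>] by algebra
  ultimately show ?thesis by simp
qed

lemma z_P: "\<lbrakk>m \<le> i; i < j; j \<le> n\<rbrakk> \<Longrightarrow> P j \<otimes> z i = z i \<otimes> P j"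
proof -
  assume ij: "m \<le> i" "i < j" "j \<le> n"
  then have [simp]: "z i \<in> carrier A" "z j \<in> carrier A" by auto
  have "P j \<otimes> z i = r \<odot> (z j \<otimes> z i \<otimes> star A (z j))" by (simp add: m_assoc star_zz[OF ij])
  also have "\<dots> = z i \<otimes> z j \<otimes> star A (z j)" by (simp add: zz[OF ij])
  finally show ?thesis by (simp add: m_assoc)
qed

lemma P_z: "\<lbrakk>m \<le> j; j < i; i \<le> n\<rbrakk> \<Longrightarrow> P j \<otimes> z i = complex_of_real q \<odot> (z i \<otimes> P j)"
proof -
  assume ij: "m \<le> j" "j < i" "i \<le> n"
  then have [simp]: "z i \<in> carrier A" "z j \<in> carrier A" by auto
  have "star A (z j \<otimes> star A (z i)) = star A ((1 / r) \<odot> (star A (z i) \<otimes> z j))" using zz_star[OF ij] by simp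
  then have "z i \<otimes> star A (z j) = (1 / r) \<odot> (star A (z j) \<otimes> z i)" by simp
  then have "star A (z j) \<otimes> z i = r \<odot> (z i \<otimes> star A (z j))" using r_simps(1) by simp
  then have "P j \<otimes> z i = r \<odot> (z j \<otimes> z i \<otimes> star A (z j))" by (simp add: m_assoc)
  also have "\<dots> = (r * r) \<odot> (z i \<otimes> P j)" by (simp add: zz[OF ij] m_assoc)
  finally show ?thesis by (simp only: r_simps)
qed

lemma D_closed [simp]: "m \<le> k \<Longrightarrow> D k \<in> carrier A"
  unfolding D_def by (intro minus_closed sq_sum_closed one_closed) auto

lemma D_star: "m \<le> k \<Longrightarrow> star A (D k) = D k"
  unfolding D_def using sq_sum_star[of "{k..n}" z] sq_sum_closed[of "{k..n}" z] by simp

lemma D_last: "D (Suc n) = \<one>"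
  by (simp add: D_def)

lemma D_step: assumes "k \<in> {m..n}" shows "D k = D (Suc k) \<ominus> P k"
proof -
  have c: "P k \<in> carrier A" "sq_sum A z {Suc k..n} \<in> carrier A" using assms by (auto intro!: sq_sum_closed)
  have "sq_sum A z {k..n} = P k \<oplus> sq_sum A z {Suc k..n}" using assms by (intro sq_sum_Suc) auto
  then show ?thesis unfolding D_def by (simp only:) (use c in algebra)
qed

text \<open>Downward induction on \<open>k\<close> from \<open>D (n + 1) = 1\<close>. Only the step with \<open>i = k\<close> uses the relation for \<open>z\<^sub>i\<^sup>*z\<^sub>i\<close>.\<close>

lemma D_commute:
  assumes "m \<le> k" "k \<le> Suc n" "i \<in> {m..n}"
  shows "D k \<otimes> z i = (if i < k then z i \<otimes> D k else complex_of_real q \<odot> (z i \<otimes> D k))"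
  using assms(2,1)
proof (induction k rule: inc_induct)
  case base
  then show ?case using assms(3) by (simp add: D_last)
next
  case (step k)
  have k: "k \<in> {m..n}" using step by simp
  have [simp]: "z i \<in> carrier A" "z k \<in> carrier A" "D (Suc k) \<in> carrier A" using assms(3) k by auto
  have IH: "D (Suc k) \<otimes> z i = (if i < Suc k then z i \<otimes> D (Suc k) else complex_of_real q \<odot> (z i \<otimes> D (Suc k)))"
    using step by simp
  have Dk: "D k \<otimes> z i = D (Suc k) \<otimes> z i \<ominus> P k \<otimes> z i" "z i \<otimes> D k = z i \<otimes> D (Suc k) \<ominus> z i \<otimes> P k"
    unfolding D_step[OF k] by (simp_all add: l_diff_distr r_diff_distr)
  consider "i < k" | "k < i" | "i = k" by linarith
  then show ?case
  proof cases
    case 1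
    then show ?thesis unfolding Dk using IH z_P[of i k] assms(3) k by simp
  next
    case 2
    then show ?thesis unfolding Dk using IH P_z[of k i] assms(3) k by (simp add: smult_diff)
  next
    case 3
    have "P k \<otimes> z k = z k \<otimes> (star A (z k) \<otimes> z k)" by (simp add: m_assoc)
    also have "\<dots> = complex_of_real q \<odot> (z k \<otimes> P k) \<oplus> complex_of_real (1 - q) \<odot> (z k \<otimes> D (Suc k))"
      by (simp add: z_star_z[OF k] r_distr)
    finally have "D k \<otimes> z k = z k \<otimes> D (Suc k) \<ominus> (complex_of_real q \<odot> (z k \<otimes> P k) \<oplus> complex_of_real (1 - q) \<odot> (z k \<otimes> D (Suc k)))"
      using Dk(1) IH 3 by simp
    also have "complex_of_real (1 - q) \<odot> (z k \<otimes> D (Suc k)) = z k \<otimes> D (Suc k) \<ominus> complex_of_real q \<odot> (z k \<otimes> D (Suc k))"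
      using smult_diff_left[of "z k \<otimes> D (Suc k)" 1 "complex_of_real q"] by simp
    also have "z k \<otimes> D (Suc k) \<ominus> (complex_of_real q \<odot> (z k \<otimes> P k) \<oplus> (z k \<otimes> D (Suc k) \<ominus> complex_of_real q \<odot> (z k \<otimes> D (Suc k))))
        = complex_of_real q \<odot> (z k \<otimes> D (Suc k)) \<ominus> complex_of_real q \<odot> (z k \<otimes> P k)"
    proof -
      have *: "a \<ominus> (b \<oplus> (a \<ominus> c)) = c \<ominus> b" if "a \<in> carrier A" "b \<in> carrier A" "c \<in> carrier A" for a b c
        using that by algebra
      show ?thesis by (rule *) simp_all
    qed
    finally show ?thesis using Dk(2) 3 by (simp add: smult_diff)
  qed
qed

lemma D_star_commute:
  assumes "m \<le> k" "k \<le> i" "i \<le> n"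
  shows "star A (z i) \<otimes> D k = complex_of_real q \<odot> (D k \<otimes> star A (z i))"
proof -
  have "star A (D k \<otimes> z i) = star A (complex_of_real q \<odot> (z i \<otimes> D k))" using D_commute[of k i] assms by simp
  then show ?thesis using assms D_star[of k] by simp
qed

end

locale cstar_ball = ball A q m n z + cstar_algebra A for A :: "('a, 'm) cstar_alg_scheme" (structure) and q m n z
begin

text \<open>The relation for \<open>z\<^sub>i\<^sup>*z\<^sub>i\<close> gives \<open>\<parallel>z\<^sub>i\<parallel>\<^sup>2 \<le> q\<parallel>z\<^sub>i\<parallel>\<^sup>2 + (1 - q)\<parallel>D (i + 1)\<parallel>\<close>, and \<open>q < 1\<close>.\<close>

lemma z_norm_sq:
  assumes i: "i \<in> {m..n}" shows "(nrm A (z i))\<^sup>2 \<le> nrm A (D (Suc i))"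
proof -
  have [simp]: "z i \<in> carrier A" "D (Suc i) \<in> carrier A" using i by auto
  have "(nrm A (z i))\<^sup>2 = nrm A (star A (z i) \<otimes> z i)" by (simp add: p_star_mult)
  also have "\<dots> \<le> nrm A (complex_of_real q \<odot> P i) + nrm A (complex_of_real (1 - q) \<odot> D (Suc i))"
    unfolding z_star_z[OF i] by (rule p_add) simp_all
  also have "\<dots> = q * nrm A (P i) + (1 - q) * nrm A (D (Suc i))" using q by (simp del: of_real_diff)
  also have "\<dots> \<le> q * (nrm A (z i))\<^sup>2 + (1 - q) * nrm A (D (Suc i))"
    using q p_mult[of "z i" "star A (z i)"] by (intro add_right_mono mult_left_mono) (simp_all add: power2_eq_square)
  finally have "(1 - q) * (nrm A (z i))\<^sup>2 \<le> (1 - q) * nrm A (D (Suc i))" by (simp add: left_diff_distrib)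
  then show ?thesis using q by simp
qed

text \<open>These crude bounds serve to show that the relations bound the norms of the generators. From one index to the
next, \<open>\<parallel>D\<parallel>\<close> at most doubles, because \<open>D k = D (k + 1) - z\<^sub>kz\<^sub>k\<^sup>*\<close>.\<close>

lemma norm_bounds:
  assumes "k \<le> Suc n - m" "m \<le> Suc n"
  shows "nrm A (D (Suc n - k)) \<le> 2 ^ k"
  using assms(1)
proof (induction k)
  case 0
  then show ?case using p_one_le by (simp add: D_last)
next
  case (Suc k)
  define i where "i = n - k"
  have i: "i \<in> {m..n}" "Suc n - k = Suc i" "Suc n - Suc k = i" using Suc by (auto simp: i_def)
  have [simp]: "z i \<in> carrier A" "D (Suc i) \<in> carrier A" using i by auto
  have IH: "nrm A (D (Suc i)) \<le> 2 ^ k" using Suc i by simp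
  have b: "(nrm A (z i))\<^sup>2 \<le> nrm A (D (Suc i))" by (rule z_norm_sq[OF i(1)])
  have "nrm A (D i) \<le> nrm A (D (Suc i)) + nrm A (P i)" unfolding D_step[OF i(1)] by (rule p_diff) simp_all
  also have "nrm A (P i) \<le> (nrm A (z i))\<^sup>2" using p_mult[of "z i" "star A (z i)"] by (simp add: power2_eq_square)
  finally show ?case using IH b i by simp
qed

end


section \<open>Even and odd balls as universal C*-algebras\<close>

locale odd_elements = cstar_algebra A for A :: "'a cstar_alg" (structure) +
  fixes q :: real and n :: nat and x :: "nat \<Rightarrow> 'a"
  assumes q: "0 < q" "q < 1" and n: "1 \<le> n"
    and x_closed: "i \<in> {1..n} \<Longrightarrow> x i \<in> carrier A"
    and odd_rel: "odd_ball_rel q n A x"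

sublocale odd_elements \<subseteq> cstar_ball A q 2 n x
  by unfold_locales (use q x_closed odd_rel in \<open>auto simp: odd_ball_rel_iff\<close>)

context odd_elements
begin

definition h :: 'a where "h = x 1"
definition defect :: 'a where "defect = \<one> \<ominus> (x 1 \<otimes> x 1 \<oplus> sq_sum A x {2..n})"
definition s :: 'a where "s = pos_sqrt A defect"

lemma h_closed [simp]: "h \<in> carrier A" and h_star: "star A h = h"
  using x_closed[of 1] n odd_rel by (simp_all add: h_def odd_ball_rel_iff)

lemma h_x: "j \<in> {2..n} \<Longrightarrow> h \<otimes> x j = r \<odot> (x j \<otimes> h)"
  using odd_rel unfolding h_def odd_ball_rel_iff r_simps by blast

lemma x_star_h: assumes "j \<in> {2..n}" shows "star A (x j) \<otimes> h = r \<odot> (h \<otimes> star A (x j))"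
proof -
  have "star A (h \<otimes> x j) = star A (r \<odot> (x j \<otimes> h))" using h_x[OF assms] by simp
  then show ?thesis using assms by (simp add: h_star)
qed

lemma P_h: assumes j: "j \<in> {2..n}" shows "P j \<otimes> h = h \<otimes> P j"
proof -
  have [simp]: "x j \<in> carrier A" using j by simp
  have "P j \<otimes> h = r \<odot> (x j \<otimes> h \<otimes> star A (x j))" by (simp add: m_assoc x_star_h[OF j])
  also have "\<dots> = h \<otimes> x j \<otimes> star A (x j)" by (simp add: h_x[OF j])
  finally show ?thesis by (simp add: m_assoc)
qed

lemma D2_h: "D 2 \<otimes> h = h \<otimes> D 2"
proof -
  have S: "sq_sum A x {2..n} \<in> carrier A" by (rule sq_sum_closed) simp
  have "sq_sum A x {2..n} \<otimes> h = (\<Oplus>j\<in>{2..n}. P j \<otimes> h)"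
    unfolding sq_sum_def by (rule finsum_ldistr) auto
  also have "\<dots> = (\<Oplus>j\<in>{2..n}. h \<otimes> P j)" by (rule finsum_cong') (auto simp: P_h)
  also have "\<dots> = h \<otimes> sq_sum A x {2..n}"
    unfolding sq_sum_def by (rule finsum_rdistr[symmetric]) auto
  finally show ?thesis using S by (simp add: D_def l_diff_distr r_diff_distr)
qed

lemma defect_eq: "defect = D 2 \<ominus> h \<otimes> h"
proof -
  have S: "sq_sum A x {2..n} \<in> carrier A" by (rule sq_sum_closed) simp
  show ?thesis
    unfolding defect_def D_def h_def[symmetric] using S h_closed by algebra
qed

lemma defect_positive: "positive A defect"
  using odd_rel by (simp add: defect_def odd_ball_rel_iff)

lemma defect_closed [simp]: "defect \<in> carrier A" and defect_star: "star A defect = defect"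
  using positiveD[OF defect_positive] by simp_all

lemma hh_x: assumes j: "j \<in> {2..n}" shows "h \<otimes> h \<otimes> x j = complex_of_real q \<odot> (x j \<otimes> (h \<otimes> h))"
proof -
  have [simp]: "x j \<in> carrier A" using j by simp
  have "h \<otimes> h \<otimes> x j = h \<otimes> (h \<otimes> x j)" by (simp add: m_assoc)
  also have "\<dots> = r \<odot> (h \<otimes> (x j \<otimes> h))" by (simp add: h_x[OF j])
  also have "\<dots> = r \<odot> (h \<otimes> x j \<otimes> h)" by (simp add: m_assoc)
  also have "\<dots> = (r * r) \<odot> (x j \<otimes> (h \<otimes> h))" by (simp add: h_x[OF j]) (simp add: m_assoc)
  finally show ?thesis by (simp only: r_simps)
qed

lemma defect_x: assumes j: "j \<in> {2..n}" shows "defect \<otimes> x j = complex_of_real q \<odot> (x j \<otimes> defect)"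
proof -
  have [simp]: "x j \<in> carrier A" using j by simp
  show ?thesis
    using D_commute[of 2 j] j by (simp add: defect_eq l_diff_distr r_diff_distr hh_x smult_diff)
qed

lemma defect_h: "defect \<otimes> h = h \<otimes> defect"
  by (simp add: defect_eq l_diff_distr r_diff_distr D2_h m_assoc)

lemma s_positive: "positive A s" and s_square: "s \<otimes> s = defect"
  unfolding s_def using pos_sqrt[OF defect_positive] by simp_all

lemma s_closed [simp]: "s \<in> carrier A" and s_star: "star A s = s"
  using positiveD[OF s_positive] by simp_all

lemma s_x: "j \<in> {2..n} \<Longrightarrow> s \<otimes> x j = r \<odot> (x j \<otimes> s)"
  unfolding s_def using q by (intro pos_sqrt_intertwine defect_positive defect_x) auto

lemma s_h: "s \<otimes> h = h \<otimes> s"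
  unfolding s_def by (rule pos_sqrt_commute[OF defect_positive h_closed defect_h])

text \<open>The relations of the odd ball bound \<open>x\<^sub>1\<close> through their inequality: \<open>x\<^sub>1\<^sup>2 + s\<^sup>2 = D 2\<close> with \<open>s\<close> the root of the
defect.\<close>

lemma h_norm_sq: "(nrm A h)\<^sup>2 \<le> nrm A (D 2)"
proof -
  have "(nrm A h)\<^sup>2 \<le> nrm A (h \<otimes> h \<oplus> s \<otimes> s)"
    by (rule p_square_le_sum) (simp_all add: h_star s_star s_h)
  also have "h \<otimes> h \<oplus> s \<otimes> s = D 2"
    unfolding s_square defect_eq using h_closed D_closed[OF order_refl] by algebra
  finally show ?thesis .
qed

end

text \<open>In the zero algebra all relations hold, so the zero seminorm is admissible.\<close>

lemma trivial_ball_rel: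
  assumes "star_algebra A" and triv: "\<And>x y. \<lbrakk>x \<in> carrier A; y \<in> carrier A\<rbrakk> \<Longrightarrow> x = y"
    and z: "\<And>i. i \<in> {m..n} \<Longrightarrow> z i \<in> carrier A"
  shows "ball_rel q m n A z"
proof -
  interpret A: star_algebra A by fact
  show ?thesis unfolding ball_rel_def
  proof (intro conjI allI impI ballI)
    fix i assume i: "i \<in> {m..n}"
    have "sq_sum A z {i+1..n} \<in> carrier A" by (rule A.sq_sum_closed) (use z i in auto)
    then show "star A (z i) \<otimes>\<^bsub>A\<^esub> z i \<ominus>\<^bsub>A\<^esub> complex_of_real q \<odot>\<^bsub>A\<^esub> (z i \<otimes>\<^bsub>A\<^esub> star A (z i)) =
        complex_of_real (1 - q) \<odot>\<^bsub>A\<^esub> (\<one>\<^bsub>A\<^esub> \<ominus>\<^bsub>A\<^esub> sq_sum A z {i+1..n})"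
      using z[OF i] by (intro triv) auto
  qed (rule triv; use z in auto)+
qed

lemma trivial_odd_ball_rel:
  assumes "star_algebra A" and triv: "\<And>x y. \<lbrakk>x \<in> carrier A; y \<in> carrier A\<rbrakk> \<Longrightarrow> x = y"
    and z: "\<And>i. i \<in> {1..n} \<Longrightarrow> z i \<in> carrier A" and n: "1 \<le> n"
  shows "odd_ball_rel q n A z"
proof -
  interpret A: star_algebra A by fact
  have z1: "z 1 \<in> carrier A" using z n by simp
  have S: "sq_sum A z {2..n} \<in> carrier A" using z by (intro A.sq_sum_closed) auto
  have pos: "positive A a" if a: "a \<in> carrier A" for a
  proof -
    have "z \<odot>\<^bsub>A\<^esub> \<one>\<^bsub>A\<^esub> \<ominus>\<^bsub>A\<^esub> a \<in> Units A" for z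
      using triv[of "z \<odot>\<^bsub>A\<^esub> \<one>\<^bsub>A\<^esub> \<ominus>\<^bsub>A\<^esub> a" "\<one>\<^bsub>A\<^esub>"] a by simp
    then have "spectrum A a = {}" by (simp add: spectrum_def)
    then show ?thesis using triv[of "star A a" a] a by (simp add: positive_def)
  qed
  show ?thesis
    unfolding odd_ball_rel_iff
  proof (intro conjI ballI)
    show "star A (z 1) = z 1" using z1 by (intro triv) auto
    show "z 1 \<otimes>\<^bsub>A\<^esub> z j = complex_of_real (q powr (1/2)) \<odot>\<^bsub>A\<^esub> (z j \<otimes>\<^bsub>A\<^esub> z 1)" if "j \<in> {2..n}" for j
      using z1 z[of j] that by (intro triv) auto
    show "ball_rel q 2 n A z" by (rule trivial_ball_rel[OF assms(1) triv]) (use z in auto)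
  qed (use z1 S in \<open>intro pos; simp\<close>)
qed

lemma zero_seminorm_trivial:
  fixes G :: "'g set"
  defines "C \<equiv> completion (free_alg G) (\<lambda>_. 0)"
  shows "cstar_seminorm (free_alg G) (\<lambda>_. 0)" "star_algebra C"
    "\<lbrakk>x \<in> carrier C; y \<in> carrier C\<rbrakk> \<Longrightarrow> x = y"
    "g \<in> G \<Longrightarrow> completion_emb (free_alg G) (\<lambda>_. 0) (free_gen g) \<in> carrier C"
proof -
  show sn: "cstar_seminorm (free_alg G) (\<lambda>_. 0)" by (simp add: cstar_seminorm_def)
  interpret F: star_algebra "free_alg G" by (rule free_alg_star_algebra)
  interpret F: cstar_seminormed "free_alg G" "\<lambda>_. 0" by unfold_locales (rule sn)
  interpret C: cstar_algebra C unfolding C_def by (rule F.completion_cstar)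
  show "star_algebra C" by (rule C.star_algebra_axioms)
  have "x = \<zero>\<^bsub>C\<^esub>" if x: "x \<in> carrier C" for x :: "'g univ_elem"
  proof -
    obtain s where s: "s \<in> p_cauchy (free_alg G) (\<lambda>_. 0)" "x = F.cls s"
      using F.completion_cases x unfolding C_def by blast
    have "(\<lambda>k::nat. 0) \<longlonglongrightarrow> nrm C x" unfolding C_def s(2) by (rule F.nrm_cls[OF s(1)])
    then have "nrm C x = 0" by (simp only: LIMSEQ_const_iff)
    then show ?thesis by (rule C.nrm_definite[OF x])
  qed
  note zero = this
  show "x = y" if x: "x \<in> carrier C" and y: "y \<in> carrier C"
    unfolding zero[OF x] by (rule zero[OF y, symmetric])
  interpret e: star_morphism "free_alg G" C "F.emb"
    by unfold_locales (unfold C_def, rule F.emb_hom)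
  show "F.emb (free_gen g) \<in> carrier C" if "g \<in> G"
    using that by (intro e.hom_closed) (simp add: free_gen_word word_elem_closed)
qed

text \<open>By \<open>univ_norming\<close>, the homomorphisms for which the images of the generators satisfy \<open>R\<close> form a norming
family.\<close>

lemma (in universal) univ_relations:
  assumes refl: "\<And>H. \<lbrakk>norming U H; \<And>(B :: 'g univ_elem cstar_alg) f. H B f \<Longrightarrow> R B (\<lambda>g. f (gen g))\<rbrakk> \<Longrightarrow> R U gen"
    and cong: "\<And>C y y'. \<lbrakk>star_algebra C; \<And>g. g \<in> G \<Longrightarrow> y g = y' g; \<And>g. g \<in> G \<Longrightarrow> y' g \<in> carrier C; R C y'\<rbrakk> \<Longrightarrow> R C y"
  shows "R U gen"
proof (rule refl[of "\<lambda>B f. R B (\<lambda>g. f (gen g))"])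
  show "norming U (\<lambda>B f. R B (\<lambda>g. f (gen g)))"
    unfolding norming_def
  proof (intro ballI allI impI)
    fix X and e :: real assume X: "X \<in> carrier U" and e: "0 < e"
    from univ_norming[OF X e] obtain p f where p: "admissible G R p" and f: "star_hom U (completion F p) f"
      "\<forall>g\<in>G. f (gen g) = completion_emb F p (free_gen g)" "nrm U X < nrm (completion F p) (f X) + e"
      by (elim exE conjE)
    interpret P: cstar_seminormed F p by (rule admissible_seminormed[OF p])
    interpret C: cstar_algebra P.C by (rule P.completion_cstar)
    interpret e: star_morphism F P.C P.emb by unfold_locales (rule P.emb_hom)
    have "R P.C (\<lambda>g. f (gen g))"
      by (rule cong[of _ _ "\<lambda>g. P.emb (free_gen g)"])
        (use p f in \<open>simp_all add: admissible_def gen_in_F C.star_algebra_axioms\<close>)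
    then show "\<exists>B f. cstar_algebra B \<and> star_hom U B f \<and> R B (\<lambda>g. f (gen g)) \<and> nrm U X < nrm B (f X) + e"
      using C.cstar_algebra_axioms f by blast
  qed
qed

lemma even_ball_rel_cong:
  assumes "star_algebra A" and "\<And>i. i \<in> {1..n} \<Longrightarrow> z i = z' i" "\<And>i. i \<in> {1..n} \<Longrightarrow> z' i \<in> carrier A"
    and "even_ball_rel q n A z'"
  shows "even_ball_rel q n A z"
proof -
  interpret star_algebra A by fact
  show ?thesis using ball_rel_cong[of 1 n z z' q] assms(2-4) by (simp add: even_ball_rel_iff)
qed

lemma isometric_norming:
  assumes "cstar_algebra B" "star_hom C B j" "\<And>X. X \<in> carrier C \<Longrightarrow> nrm B (j X) = nrm C X"
  shows "norming C (\<lambda>B' f. B' = B \<and> f = j)"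
  using assms unfolding norming_def by auto

lemma even_universal:
  assumes q: "0 < q" "q < 1" and n: "1 \<le> n"
  shows "universal {1..n} (even_ball_rel q n)"
proof
  fix g assume g: "g \<in> {1..n}"
  have "p (free_gen g) \<le> 2 ^ n" if adm: "admissible {1..n} (even_ball_rel q n) p" for p
  proof -
    interpret F: star_algebra "free_alg {1..n}" by (rule free_alg_star_algebra)
    interpret P: cstar_seminormed "free_alg {1..n}" p
      by unfold_locales (use adm in \<open>simp add: admissible_def\<close>)
    interpret C: cstar_algebra P.C by (rule P.completion_cstar)
    interpret e: star_morphism "free_alg {1..n}" P.C P.emb by unfold_locales (rule P.emb_hom)
    have gc: "free_gen i \<in> carrier (free_alg {1..n})" if "i \<in> {1..n}" for i
      using that by (simp add: free_gen_word word_elem_closed)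
    have zc: "P.emb (free_gen i) \<in> carrier P.C" if "i \<in> {1..n}" for i by (rule e.hom_closed[OF gc[OF that]])
    have rel: "ball_rel q 1 n P.C (\<lambda>g. P.emb (free_gen g))"
      using adm unfolding admissible_def even_ball_rel_iff by (rule conjunct2)
    interpret cstar_ball P.C q 1 n "\<lambda>g. P.emb (free_gen g)"
      by unfold_locales (rule q rel zc; assumption?)+
    have "(nrm P.C (P.emb (free_gen g)))\<^sup>2 \<le> nrm P.C (D (Suc n - (n - g)))"
      using z_norm_sq[OF g] g by (simp add: Suc_diff_le)
    also have "\<dots> \<le> 2 ^ (n - g)" by (rule norm_bounds) (use g in auto)
    also have "\<dots> \<le> (2 ^ n)\<^sup>2"
      unfolding power_mult[symmetric] by (rule power_increasing) auto
    finally have "nrm P.C (P.emb (free_gen g)) \<le> 2 ^ n" by (rule power2_le_imp_le) simp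
    then show ?thesis unfolding P.nrm_emb[OF gc[OF g]] .
  qed
  then show "\<exists>K. \<forall>p. admissible {1..n} (even_ball_rel q n) p \<longrightarrow> p (free_gen g) \<le> K" by blast
next
  show "admissible {1..n} (even_ball_rel q n) (\<lambda>_. 0)"
    unfolding admissible_def even_ball_rel_iff
    by (intro conjI zero_seminorm_trivial trivial_ball_rel)
qed

lemma odd_universal:
  assumes q: "0 < q" "q < 1" and n: "1 \<le> n"
  shows "universal {1..n} (odd_ball_rel q n)"
proof
  fix g assume g: "g \<in> {1..n}"
  have "p (free_gen g) \<le> 2 ^ n" if adm: "admissible {1..n} (odd_ball_rel q n) p" for p
  proof -
    interpret F: star_algebra "free_alg {1..n}" by (rule free_alg_star_algebra)
    interpret P: cstar_seminormed "free_alg {1..n}" p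
      by unfold_locales (use adm in \<open>simp add: admissible_def\<close>)
    interpret C: cstar_algebra P.C by (rule P.completion_cstar)
    interpret e: star_morphism "free_alg {1..n}" P.C P.emb by unfold_locales (rule P.emb_hom)
    have gc: "free_gen i \<in> carrier (free_alg {1..n})" if "i \<in> {1..n}" for i
      using that by (simp add: free_gen_word word_elem_closed)
    have zc: "P.emb (free_gen i) \<in> carrier P.C" if "i \<in> {1..n}" for i by (rule e.hom_closed[OF gc[OF that]])
    have rel: "odd_ball_rel q n P.C (\<lambda>g. P.emb (free_gen g))"
      using adm unfolding admissible_def by (rule conjunct2)
    interpret odd_elements P.C q n "\<lambda>g. P.emb (free_gen g)"
      by unfold_locales (rule q n rel zc; assumption?)+
    have "(nrm P.C (P.emb (free_gen g)))\<^sup>2 \<le> 2 ^ n"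
    proof (cases "g = 1")
      case True
      have "(nrm P.C (P.emb (free_gen g)))\<^sup>2 \<le> nrm P.C (D (Suc n - (n - 1)))"
      proof -
        have e: "Suc n - (n - 1) = 2" using n by simp
        have h: "h = P.emb (free_gen g)" by (simp only: h_def True)
        show ?thesis unfolding e using h_norm_sq unfolding h .
      qed
      also have "\<dots> \<le> 2 ^ (n - 1)" by (rule norm_bounds) (use n in auto)
      also have "\<dots> \<le> 2 ^ n" by (rule power_increasing) auto
      finally show ?thesis .
    next
      case False
      then have g2: "g \<in> {2..n}" using g by auto
      have "(nrm P.C (P.emb (free_gen g)))\<^sup>2 \<le> nrm P.C (D (Suc n - (n - g)))"
        using z_norm_sq[OF g2] g2 by (simp add: Suc_diff_le)
      also have "\<dots> \<le> 2 ^ (n - g)" by (rule norm_bounds) (use g2 in auto)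
      also have "\<dots> \<le> 2 ^ n" by (rule power_increasing) auto
      finally show ?thesis .
    qed
    also have "2 ^ n \<le> (2 ^ n :: real)\<^sup>2"
      unfolding power_mult[symmetric] by (rule power_increasing) auto
    finally have "nrm P.C (P.emb (free_gen g)) \<le> 2 ^ n" by (rule power2_le_imp_le) simp
    then show ?thesis unfolding P.nrm_emb[OF gc[OF g]] .
  qed
  then show "\<exists>K. \<forall>p. admissible {1..n} (odd_ball_rel q n) p \<longrightarrow> p (free_gen g) \<le> K" by blast
next
  show "admissible {1..n} (odd_ball_rel q n) (\<lambda>_. 0)"
    unfolding admissible_def
    by (intro conjI zero_seminorm_trivial trivial_odd_ball_rel n)
qed

lemma even_ball_universal:
  assumes q: "0 < q" "q < 1" and n: "1 \<le> n"
  shows "even_ball_rel q n (even_ball q n) (z_gen q n)"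
    and "\<lbrakk>cstar_algebra B; \<And>i. i \<in> {1..n} \<Longrightarrow> b i \<in> carrier B; even_ball_rel q n B b\<rbrakk>
      \<Longrightarrow> \<exists>f. star_hom (even_ball q n) B f \<and> (\<forall>i\<in>{1..n}. f (z_gen q n i) = b i)"
proof -
  interpret E: universal "{1..n}" "even_ball_rel q n" by (rule even_universal[OF assms])
  have "even_ball_rel q n E.U E.gen"
  proof (rule E.univ_relations)
    fix H assume H: "norming E.U H"
      and rel: "\<And>(B :: nat univ_elem cstar_alg) f. H B f \<Longrightarrow> even_ball_rel q n B (\<lambda>g. f (E.gen g))"
    show "even_ball_rel q n E.U E.gen"
      by (rule even_ball_rel_iff[THEN iffD2], rule norming_ball_rel[OF E.univ_cstar H E.gen_closed])
        (assumption, rule even_ball_rel_iff[THEN iffD1, OF rel])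
  qed (rule even_ball_rel_cong)
  then show "even_ball_rel q n (even_ball q n) (z_gen q n)" by (simp add: even_ball_def z_gen_def)
  assume B: "cstar_algebra B" and b: "\<And>i. i \<in> {1..n} \<Longrightarrow> b i \<in> carrier B" and rel: "even_ball_rel q n B b"
  interpret B: cstar_algebra B by fact
  have "\<exists>f. star_hom E.U B f \<and> (\<forall>g\<in>{1..n}. f (E.gen g) = b g)"
  proof (rule E.univ_hom_ex[OF B b])
    fix C :: "nat univ_elem cstar_alg" and x j
    assume C: "cstar_algebra C" and x: "\<And>g. g \<in> {1..n} \<Longrightarrow> x g \<in> carrier C" and j: "star_hom C B j"
      "\<And>X. X \<in> carrier C \<Longrightarrow> nrm B (j X) = nrm C X" and jx: "\<And>g. g \<in> {1..n} \<Longrightarrow> j (x g) = b g"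
    have "even_ball_rel q n B (\<lambda>g. j (x g))"
      by (rule even_ball_rel_cong[OF B.star_algebra_axioms jx b rel])
    then show "even_ball_rel q n C x"
      unfolding even_ball_rel_iff
      by (intro norming_ball_rel[OF C isometric_norming[OF B j]]) (use x in auto)
  qed
  then show "\<exists>f. star_hom (even_ball q n) B f \<and> (\<forall>i\<in>{1..n}. f (z_gen q n i) = b i)"
    by (simp add: even_ball_def z_gen_def)
qed

lemma odd_ball_universal:
  assumes q: "0 < q" "q < 1" and n: "1 \<le> n"
  shows "odd_ball_rel q n (odd_ball q n) (x_gen q n)"
    and "\<lbrakk>cstar_algebra B; \<And>i. i \<in> {1..n} \<Longrightarrow> b i \<in> carrier B; odd_ball_rel q n B b\<rbrakk>
      \<Longrightarrow> \<exists>f. star_hom (odd_ball q n) B f \<and> (\<forall>i\<in>{1..n}. f (x_gen q n i) = b i)"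
proof -
  interpret E: universal "{1..n}" "odd_ball_rel q n" by (rule odd_universal[OF assms])
  have "odd_ball_rel q n E.U E.gen"
  proof (rule E.univ_relations)
    fix H assume H: "norming E.U H"
      and rel: "\<And>(B :: nat univ_elem cstar_alg) f. H B f \<Longrightarrow> odd_ball_rel q n B (\<lambda>g. f (E.gen g))"
    show "odd_ball_rel q n E.U E.gen"
      by (rule norming_odd_ball_rel[OF E.univ_cstar H E.gen_closed n]) (assumption, rule rel)
  qed (rule odd_ball_rel_cong[OF _ _ _ n])
  then show "odd_ball_rel q n (odd_ball q n) (x_gen q n)" by (simp add: odd_ball_def x_gen_def)
  assume B: "cstar_algebra B" and b: "\<And>i. i \<in> {1..n} \<Longrightarrow> b i \<in> carrier B" and rel: "odd_ball_rel q n B b"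
  interpret B: cstar_algebra B by fact
  have "\<exists>f. star_hom E.U B f \<and> (\<forall>g\<in>{1..n}. f (E.gen g) = b g)"
  proof (rule E.univ_hom_ex[OF B b])
    fix C :: "nat univ_elem cstar_alg" and x j
    assume C: "cstar_algebra C" and x: "\<And>g. g \<in> {1..n} \<Longrightarrow> x g \<in> carrier C" and j: "star_hom C B j"
      "\<And>X. X \<in> carrier C \<Longrightarrow> nrm B (j X) = nrm C X" and jx: "\<And>g. g \<in> {1..n} \<Longrightarrow> j (x g) = b g"
    have "odd_ball_rel q n B (\<lambda>g. j (x g))"
      by (rule odd_ball_rel_cong[OF B.star_algebra_axioms jx b n rel])
    then show "odd_ball_rel q n C x"
      by (intro norming_odd_ball_rel[OF C isometric_norming[OF B j] _ n]) (use x in auto)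
  qed
  then show "\<exists>f. star_hom (odd_ball q n) B f \<and> (\<forall>i\<in>{1..n}. f (x_gen q n i) = b i)"
    by (simp add: odd_ball_def x_gen_def)
qed


section \<open>Generators of C*-algebras and of closed ideals\<close>

text \<open>The C*-algebra generated by \<open>X\<close> is all of \<open>A\<close>. Quantifying over predicates \<open>P\<close>, in place of closed
*-subalgebras, makes the definition an induction principle.\<close>

definition generated_by :: "('a, 'm) cstar_alg_scheme \<Rightarrow> 'a set \<Rightarrow> bool" where
  "generated_by A X \<longleftrightarrow> X \<subseteq> carrier A \<and> (\<forall>P.
    (\<forall>x\<in>carrier A. (\<forall>e>0. \<exists>y\<in>carrier A. P y \<and> nrm A (x \<ominus>\<^bsub>A\<^esub> y) < e) \<longrightarrow> P x) \<longrightarrow>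
    P \<one>\<^bsub>A\<^esub> \<longrightarrow> (\<forall>x\<in>X. P x) \<longrightarrow>
    (\<forall>x\<in>carrier A. P x \<longrightarrow> P (star A x)) \<longrightarrow>
    (\<forall>c. \<forall>x\<in>carrier A. P x \<longrightarrow> P (c \<odot>\<^bsub>A\<^esub> x)) \<longrightarrow>
    (\<forall>x\<in>carrier A. \<forall>y\<in>carrier A. P x \<longrightarrow> P y \<longrightarrow> P (x \<oplus>\<^bsub>A\<^esub> y)) \<longrightarrow>
    (\<forall>x\<in>carrier A. \<forall>y\<in>carrier A. P x \<longrightarrow> P y \<longrightarrow> P (x \<otimes>\<^bsub>A\<^esub> y)) \<longrightarrow>
    (\<forall>x\<in>carrier A. P x))"

lemma generated_induct [consumes 2, case_names limit one gen star smult add mult]: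
  assumes "generated_by A X" "x \<in> carrier A"
    and "\<And>x. \<lbrakk>x \<in> carrier A; \<And>e. 0 < e \<Longrightarrow> \<exists>y\<in>carrier A. P y \<and> nrm A (x \<ominus>\<^bsub>A\<^esub> y) < e\<rbrakk> \<Longrightarrow> P x"
    and "P \<one>\<^bsub>A\<^esub>" "\<And>x. x \<in> X \<Longrightarrow> P x"
    and "\<And>x. \<lbrakk>x \<in> carrier A; P x\<rbrakk> \<Longrightarrow> P (star A x)"
    and "\<And>c x. \<lbrakk>x \<in> carrier A; P x\<rbrakk> \<Longrightarrow> P (c \<odot>\<^bsub>A\<^esub> x)"
    and "\<And>x y. \<lbrakk>x \<in> carrier A; y \<in> carrier A; P x; P y\<rbrakk> \<Longrightarrow> P (x \<oplus>\<^bsub>A\<^esub> y)"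
    and "\<And>x y. \<lbrakk>x \<in> carrier A; y \<in> carrier A; P x; P y\<rbrakk> \<Longrightarrow> P (x \<otimes>\<^bsub>A\<^esub> y)"
  shows "P x"
proof -
  note gen = assms(1)[unfolded generated_by_def, THEN conjunct2, THEN spec[of _ P],
      THEN mp, THEN mp, THEN mp, THEN mp, THEN mp, THEN mp, THEN mp]
  have "\<forall>x\<in>carrier A. P x"
  proof (rule gen)
    show "\<forall>x\<in>carrier A. (\<forall>e>0. \<exists>y\<in>carrier A. P y \<and> nrm A (x \<ominus>\<^bsub>A\<^esub> y) < e) \<longrightarrow> P x"
      by (intro ballI impI, rule assms(3)) simp_all
    show "P \<one>\<^bsub>A\<^esub>" by (rule assms(4))
    show "\<forall>x\<in>X. P x" by (intro ballI assms(5))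
    show "\<forall>x\<in>carrier A. P x \<longrightarrow> P (star A x)" by (intro ballI impI assms(6))
    show "\<forall>c. \<forall>x\<in>carrier A. P x \<longrightarrow> P (c \<odot>\<^bsub>A\<^esub> x)" by (intro allI ballI impI assms(7))
    show "\<forall>x\<in>carrier A. \<forall>y\<in>carrier A. P x \<longrightarrow> P y \<longrightarrow> P (x \<oplus>\<^bsub>A\<^esub> y)" by (intro ballI impI assms(8))
    show "\<forall>x\<in>carrier A. \<forall>y\<in>carrier A. P x \<longrightarrow> P y \<longrightarrow> P (x \<otimes>\<^bsub>A\<^esub> y)" by (intro ballI impI assms(9))
  qed
  then show ?thesis using assms(2) by simp
qed

lemma (in universal) univ_generated: "generated_by U (gen ` G)"
  unfolding generated_by_def
proof (intro conjI allI impI ballI)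
  show "gen ` G \<subseteq> carrier U" using gen_closed by blast
  fix P x assume lim: "\<forall>x\<in>carrier U. (\<forall>e>0. \<exists>y\<in>carrier U. P y \<and> nrm U (x \<ominus>\<^bsub>U\<^esub> y) < e) \<longrightarrow> P x"
    and one: "P \<one>\<^bsub>U\<^esub>" and gen: "\<forall>x\<in>gen ` G. P x"
    and star: "\<forall>x\<in>carrier U. P x \<longrightarrow> P (star U x)"
    and smult: "\<forall>c. \<forall>x\<in>carrier U. P x \<longrightarrow> P (c \<odot>\<^bsub>U\<^esub> x)"
    and add: "\<forall>x\<in>carrier U. \<forall>y\<in>carrier U. P x \<longrightarrow> P y \<longrightarrow> P (x \<oplus>\<^bsub>U\<^esub> y)"
    and mult: "\<forall>x\<in>carrier U. \<forall>y\<in>carrier U. P x \<longrightarrow> P y \<longrightarrow> P (x \<otimes>\<^bsub>U\<^esub> y)"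
    and x: "x \<in> carrier U"
  show "P x"
    using x
  proof (rule univ_induct)
    show "P X" if "X \<in> carrier U" "\<And>e. 0 < e \<Longrightarrow> \<exists>Y\<in>carrier U. P Y \<and> nrm U (X \<ominus>\<^bsub>U\<^esub> Y) < e" for X
      using lim that by blast
  qed (use one gen star smult add mult in simp_all)
qed

lemma generated_hom_eq:
  assumes "generated_by A X" "cstar_algebra A" "cstar_algebra B" and f: "star_hom A B f" and h: "star_hom A B h"
    and eq: "\<And>x. x \<in> X \<Longrightarrow> f x = h x" and x: "x \<in> carrier A"
  shows "f x = h x"
proof -
  interpret A: cstar_algebra A by fact
  interpret B: cstar_algebra B by fact
  interpret f: star_morphism A B f by unfold_locales fact
  interpret h: star_morphism A B h by unfold_locales fact
  note contr = star_hom_contractive[OF assms(2) B.cstar_seminormed_axioms]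
  show ?thesis
    using assms(1) x
  proof (induction rule: generated_induct)
    case (limit x)
    have "nrm B (f x \<ominus>\<^bsub>B\<^esub> h x) \<le> 0 + e" if "0 < e" for e
    proof -
      obtain y where y: "y \<in> carrier A" "f y = h y" "nrm A (x \<ominus>\<^bsub>A\<^esub> y) < e / 2"
        using limit(2)[of "e / 2"] \<open>0 < e\<close> by auto
      have "nrm B (f x \<ominus>\<^bsub>B\<^esub> f y) \<le> nrm A (x \<ominus>\<^bsub>A\<^esub> y)" "nrm B (h x \<ominus>\<^bsub>B\<^esub> h y) \<le> nrm A (x \<ominus>\<^bsub>A\<^esub> y)"
        using contr[OF f, of "x \<ominus>\<^bsub>A\<^esub> y"] contr[OF h, of "x \<ominus>\<^bsub>A\<^esub> y"] limit(1) y by simp_all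
      moreover have "nrm B (h y \<ominus>\<^bsub>B\<^esub> h x) = nrm B (h x \<ominus>\<^bsub>B\<^esub> h y)"
        using limit(1) y by (intro B.p_diff_commute) auto
      ultimately show ?thesis using B.p_triangle[of "f x" "f y" "h x"] limit(1) y by simp
    qed
    then have "nrm B (f x \<ominus>\<^bsub>B\<^esub> h x) \<le> 0" by (rule field_le_epsilon)
    then show ?case using limit(1) by (intro B.eqI_nrm antisym) simp_all
  qed (simp_all add: eq)
qed

text \<open>If \<open>d\<close> passes through the generators and their adjoints, then it passes through everything up to
approximation. The induction hypothesis includes the adjoint, as the property itself is not symmetric.\<close>

lemma normal_generatorI:
  assumes "cstar_algebra A" "generated_by A X" and d: "d \<in> carrier A" "star A d = d"
    and gen: "\<And>x. x \<in> X \<Longrightarrow> \<exists>y\<in>carrier A. d \<otimes>\<^bsub>A\<^esub> x = y \<otimes>\<^bsub>A\<^esub> d"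
    and gen_star: "\<And>x. x \<in> X \<Longrightarrow> \<exists>y\<in>carrier A. d \<otimes>\<^bsub>A\<^esub> star A x = y \<otimes>\<^bsub>A\<^esub> d"
  shows "normal_generator A d"
proof -
  interpret A: cstar_algebra A by fact
  note [simp] = d(1)
  note L = A.left_span_right_mult[OF d(1)]
  have key: "d \<otimes>\<^bsub>A\<^esub> b \<in> A.left_span d \<and> d \<otimes>\<^bsub>A\<^esub> star A b \<in> A.left_span d" if "b \<in> carrier A" for b
    using assms(2) that
  proof (induction rule: generated_induct)
    case (limit x)
    have lim: "d \<otimes>\<^bsub>A\<^esub> g x \<in> A.left_span d"
      if g: "\<And>y. y \<in> carrier A \<Longrightarrow> g y \<in> carrier A" "\<And>y. y \<in> carrier A \<Longrightarrow> nrm A (g x \<ominus>\<^bsub>A\<^esub> g y) = nrm A (x \<ominus>\<^bsub>A\<^esub> y)"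
        and ap: "\<And>e. 0 < e \<Longrightarrow> \<exists>y\<in>carrier A. d \<otimes>\<^bsub>A\<^esub> g y \<in> A.left_span d \<and> nrm A (x \<ominus>\<^bsub>A\<^esub> y) < e" for g
    proof (rule A.left_span_limit[OF d(1)])
      show "d \<otimes>\<^bsub>A\<^esub> g x \<in> carrier A" using g(1)[OF limit(1)] by simp
      fix e :: real assume "0 < e"
      have N: "0 < nrm A d + 1" using A.p_nonneg[OF d(1)] by (simp add: add_nonneg_pos)
      then obtain y where y: "y \<in> carrier A" "d \<otimes>\<^bsub>A\<^esub> g y \<in> A.left_span d" "nrm A (x \<ominus>\<^bsub>A\<^esub> y) < e / (nrm A d + 1)"
        using ap[of "e / (nrm A d + 1)"] \<open>0 < e\<close> by auto
      have "nrm A (d \<otimes>\<^bsub>A\<^esub> g x \<ominus>\<^bsub>A\<^esub> d \<otimes>\<^bsub>A\<^esub> g y) = nrm A (d \<otimes>\<^bsub>A\<^esub> (g x \<ominus>\<^bsub>A\<^esub> g y))"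
        using g(1) limit(1) y(1) by (simp add: A.r_diff_distr)
      also have "\<dots> \<le> nrm A d * nrm A (g x \<ominus>\<^bsub>A\<^esub> g y)" using g(1) limit(1) y(1) by (intro A.p_mult) auto
      also have "\<dots> \<le> (nrm A d + 1) * nrm A (x \<ominus>\<^bsub>A\<^esub> y)"
        unfolding g(2)[OF y(1)] using limit(1) y(1) by (intro mult_right_mono) auto
      also have "\<dots> < e" using y(3) by (simp only: pos_less_divide_eq[OF N] mult.commute)
      finally show "\<exists>c\<in>A.left_span d. nrm A (d \<otimes>\<^bsub>A\<^esub> g x \<ominus>\<^bsub>A\<^esub> c) < e" using y(2) by blast
    qed
    have "d \<otimes>\<^bsub>A\<^esub> x \<in> A.left_span d"
    proof (rule lim[of "\<lambda>x. x"])
      show "\<exists>y\<in>carrier A. d \<otimes>\<^bsub>A\<^esub> y \<in> A.left_span d \<and> nrm A (x \<ominus>\<^bsub>A\<^esub> y) < e" if "0 < e" for e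
        using limit(2)[OF that] by blast
    qed simp_all
    moreover have "d \<otimes>\<^bsub>A\<^esub> star A x \<in> A.left_span d"
    proof (rule lim[of "star A"])
      show "nrm A (star A x \<ominus>\<^bsub>A\<^esub> star A y) = nrm A (x \<ominus>\<^bsub>A\<^esub> y)" if "y \<in> carrier A" for y
        using limit(1) that by (simp flip: A.star_diff)
      show "\<exists>y\<in>carrier A. d \<otimes>\<^bsub>A\<^esub> star A y \<in> A.left_span d \<and> nrm A (x \<ominus>\<^bsub>A\<^esub> y) < e" if "0 < e" for e
        using limit(2)[OF that] by blast
    qed simp
    ultimately show ?case by simp
  next
    case one
    then show ?case using A.left_span_mult_self[of "\<one>\<^bsub>A\<^esub>" d] by simp
  next
    case (gen x)
    have "d \<otimes>\<^bsub>A\<^esub> x \<in> A.left_span d" using assms(5)[OF gen] A.left_span_mult_self by auto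
    moreover have "d \<otimes>\<^bsub>A\<^esub> star A x \<in> A.left_span d" using gen_star[OF gen] A.left_span_mult_self by auto
    ultimately show ?case by simp
  next
    case (smult c x)
    have "d \<otimes>\<^bsub>A\<^esub> (c \<odot>\<^bsub>A\<^esub> x) = (c \<odot>\<^bsub>A\<^esub> \<one>\<^bsub>A\<^esub>) \<otimes>\<^bsub>A\<^esub> (d \<otimes>\<^bsub>A\<^esub> x)"
      "d \<otimes>\<^bsub>A\<^esub> star A (c \<odot>\<^bsub>A\<^esub> x) = (cnj c \<odot>\<^bsub>A\<^esub> \<one>\<^bsub>A\<^esub>) \<otimes>\<^bsub>A\<^esub> (d \<otimes>\<^bsub>A\<^esub> star A x)" using smult(1) by simp_all
    then show ?case using smult(2) A.left_span_left_mult[OF d(1)] A.smult_closed[OF A.one_closed] by metis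
  next
    case (add x y)
    then show ?case using A.left_span_add[OF d(1)] by (simp add: A.r_distr)
  next
    case (mult x y)
    have "d \<otimes>\<^bsub>A\<^esub> x \<otimes>\<^bsub>A\<^esub> y \<in> A.left_span d" by (rule L) (use mult in simp_all)
    moreover have "d \<otimes>\<^bsub>A\<^esub> star A y \<otimes>\<^bsub>A\<^esub> star A x \<in> A.left_span d" by (rule L) (use mult in simp_all)
    ultimately show ?case using mult by (simp add: A.m_assoc)
  qed (simp_all)
  show ?thesis
    by unfold_locales (use d key in auto)
qed

lemma (in normal_generator) quot_hom_ex:
  assumes "cstar_algebra B" "star_hom A B f" and fd: "f d = \<zero>\<^bsub>B\<^esub>"
  shows "\<exists>F. star_hom Q B F \<and> (\<forall>x\<in>carrier A. F (\<pi> x) = f x)"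
proof -
  interpret B: cstar_algebra B by fact
  interpret f: star_morphism A B f by unfold_locales fact
  have "J \<subseteq> {x \<in> carrier A. f x = \<zero>\<^bsub>B\<^esub>}"
  proof (rule closed_ideal_gen_least)
    show "ideal {x \<in> carrier A. f x = \<zero>\<^bsub>B\<^esub>} A" by (rule ideal_of_closed) auto
    have "f a = \<zero>\<^bsub>B\<^esub>" if a: "a \<in> carrier A" and ap: "\<And>e. 0 < e \<Longrightarrow> \<exists>b\<in>{x \<in> carrier A. f x = \<zero>\<^bsub>B\<^esub>}. nrm A (a \<ominus> b) < e" for a
    proof -
      have "nrm B (f a) \<le> 0 + e" if e: "0 < e" for e
      proof -
        obtain b where b: "b \<in> carrier A" "f b = \<zero>\<^bsub>B\<^esub>" "nrm A (a \<ominus> b) < e" using ap[OF e] by blast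
        have "nrm B (f (a \<ominus> b)) \<le> nrm A (a \<ominus> b)"
          by (rule star_hom_contractive[OF cstar_algebra_axioms B.cstar_seminormed_axioms assms(2)]) (use a b in simp)
        then show ?thesis using a b by simp
      qed
      then have "nrm B (f a) \<le> 0" by (rule field_le_epsilon)
      then have "nrm B (f a) = 0" using a by (intro antisym) simp_all
      then show ?thesis using a by (simp add: B.nrm_0_iff)
    qed
    then show "norm_closed A {x \<in> carrier A. f x = \<zero>\<^bsub>B\<^esub>}" by (auto simp: norm_closed_def)
    show "d \<in> {x \<in> carrier A. f x = \<zero>\<^bsub>B\<^esub>}" using fd by simp
  qed
  then have J0: "f j = \<zero>\<^bsub>B\<^esub>" if "j \<in> J" for j using that by blast
  define F where "F X = f (SOME x. x \<in> carrier A \<and> \<pi> x = X)" for X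
  have F: "F (\<pi> x) = f x" if x: "x \<in> carrier A" for x
  proof -
    let ?y = "SOME y. y \<in> carrier A \<and> \<pi> y = \<pi> x"
    have y: "?y \<in> carrier A \<and> \<pi> ?y = \<pi> x" by (rule someI[of _ x]) (use x in simp)
    then have "?y \<ominus> x \<in> J" using pi_eq_iff x by blast
    then have "f (?y \<ominus> x) = \<zero>\<^bsub>B\<^esub>" by (rule J0)
    then show ?thesis unfolding F_def using x y by (simp add: B.diff_0_iff)
  qed
  have "star_hom Q B F"
    unfolding star_hom_def ring_hom_def by (auto simp: quot_simps F)
  then show ?thesis using F by blast
qed

lemma (in normal_generator) quot_generated:
  assumes "generated_by A X" shows "generated_by Q (\<pi> ` X)"
proof -
  interpret Q: cstar_algebra Q by (rule quot_cstar)
  interpret pi: star_morphism A Q \<pi> by unfold_locales (rule pi_hom)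
  have X: "X \<subseteq> carrier A" using assms by (simp add: generated_by_def)
  show ?thesis
    unfolding generated_by_def
  proof (intro conjI allI impI ballI)
    show "\<pi> ` X \<subseteq> carrier Q" using X pi.hom_closed by blast
    fix P Y assume lim: "\<forall>x\<in>carrier Q. (\<forall>e>0. \<exists>y\<in>carrier Q. P y \<and> nrm Q (x \<ominus>\<^bsub>Q\<^esub> y) < e) \<longrightarrow> P x"
      and one: "P \<one>\<^bsub>Q\<^esub>" and gen: "\<forall>x\<in>\<pi> ` X. P x"
      and star: "\<forall>x\<in>carrier Q. P x \<longrightarrow> P (star Q x)"
      and smult: "\<forall>c. \<forall>x\<in>carrier Q. P x \<longrightarrow> P (c \<odot>\<^bsub>Q\<^esub> x)"
      and add: "\<forall>x\<in>carrier Q. \<forall>y\<in>carrier Q. P x \<longrightarrow> P y \<longrightarrow> P (x \<oplus>\<^bsub>Q\<^esub> y)"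
      and mult: "\<forall>x\<in>carrier Q. \<forall>y\<in>carrier Q. P x \<longrightarrow> P y \<longrightarrow> P (x \<otimes>\<^bsub>Q\<^esub> y)"
      and Y: "Y \<in> carrier Q"
    obtain y where y: "y \<in> carrier A" "Y = \<pi> y" using Y by (auto simp: quot_simps)
    have "P (\<pi> y)"
      using assms y(1)
    proof (induction rule: generated_induct)
      case (limit x)
      have "\<exists>Y\<in>carrier Q. P Y \<and> nrm Q (\<pi> x \<ominus>\<^bsub>Q\<^esub> Y) < e" if e: "0 < e" for e
      proof -
        obtain y where y: "y \<in> carrier A" "P (\<pi> y)" "nrm A (x \<ominus> y) < e" using limit(2)[OF e] by blast
        have "nrm Q (\<pi> (x \<ominus> y)) \<le> nrm A (x \<ominus> y)" by (rule nrm_pi_le') (use limit(1) y in simp)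
        then have "nrm Q (\<pi> x \<ominus>\<^bsub>Q\<^esub> \<pi> y) < e" using pi.hom_minus[OF limit(1) y(1)] y(3) by simp
        then show ?thesis using y pi.hom_closed by blast
      qed
      then show ?case using lim pi.hom_closed[OF limit(1)] by blast
    next
      case one
      then show ?case using \<open>P \<one>\<^bsub>Q\<^esub>\<close> pi.hom_one by simp
    next
      case (gen x)
      then show ?case using \<open>\<forall>x\<in>\<pi> ` X. P x\<close> by blast
    next
      case (star x)
      then show ?case using \<open>\<forall>x\<in>carrier Q. P x \<longrightarrow> P (star Q x)\<close> pi.hom_closed by (simp add: pi.hom_star)
    next
      case (smult c x)
      then show ?case using \<open>\<forall>c. \<forall>x\<in>carrier Q. P x \<longrightarrow> P (c \<odot>\<^bsub>Q\<^esub> x)\<close> pi.hom_closed by simp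
    next
      case (add x y)
      then show ?case using \<open>\<forall>x\<in>carrier Q. \<forall>y\<in>carrier Q. P x \<longrightarrow> P y \<longrightarrow> P (x \<oplus>\<^bsub>Q\<^esub> y)\<close> pi.hom_closed by simp
    next
      case (mult x y)
      then show ?case using \<open>\<forall>x\<in>carrier Q. \<forall>y\<in>carrier Q. P x \<longrightarrow> P y \<longrightarrow> P (x \<otimes>\<^bsub>Q\<^esub> y)\<close> pi.hom_closed by simp
    qed
    then show "P Y" by (simp add: y)
  qed
qed

text \<open>From \<open>uAv = 0\<close> one first passes to \<open>cAv = 0\<close> for \<open>c\<close> in the ideal of \<open>u\<close>, since these \<open>c\<close> form a closed ideal, and
then in the same way to \<open>cAc' = 0\<close>.\<close>

lemma (in cstar_algebra) ideal_products_zero: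
  assumes u: "u \<in> carrier A" and v: "v \<in> carrier A" and uv: "\<And>y. y \<in> carrier A \<Longrightarrow> u \<otimes> y \<otimes> v = \<zero>"
    and c: "c \<in> closed_ideal_gen A u" and c': "c' \<in> closed_ideal_gen A v"
  shows "c \<otimes> c' = \<zero>"
proof -
  \<comment> \<open>Left annihilators are closed.\<close>
  have lim: "a \<otimes> t = \<zero>" if a: "a \<in> carrier A" and t: "t \<in> carrier A"
    and ap: "\<And>e. 0 < e \<Longrightarrow> \<exists>b\<in>carrier A. b \<otimes> t = \<zero> \<and> nrm A (a \<ominus> b) < e" for a t
  proof -
    have "nrm A (a \<otimes> t) \<le> 0 + e" if "0 < e" for e
    proof -
      have N: "0 < nrm A t + 1" using p_nonneg[OF t] by (simp add: add_nonneg_pos)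
      then obtain b where b: "b \<in> carrier A" "b \<otimes> t = \<zero>" "nrm A (a \<ominus> b) < e / (nrm A t + 1)"
        using ap[of "e / (nrm A t + 1)"] \<open>0 < e\<close> by auto
      have "a \<otimes> t = (a \<ominus> b) \<otimes> t" using a t b by (simp add: l_diff_distr)
      then have "nrm A (a \<otimes> t) \<le> nrm A (a \<ominus> b) * nrm A t" using a t b p_mult[of "a \<ominus> b" t] by simp
      also have "\<dots> \<le> nrm A (a \<ominus> b) * (nrm A t + 1)" using a b by (intro mult_left_mono) auto
      also have "\<dots> < e" using b(3) by (simp only: pos_less_divide_eq[OF N])
      finally show ?thesis by simp
    qed
    then have "nrm A (a \<otimes> t) \<le> 0" by (rule field_le_epsilon)
    then have "nrm A (a \<otimes> t) = 0" using a t by (intro antisym) simp_all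
    then show ?thesis using a t by (simp add: nrm_0_iff)
  qed
  let ?I = "{c \<in> carrier A. \<forall>y\<in>carrier A. c \<otimes> y \<otimes> v = \<zero>}"
  have "closed_ideal_gen A u \<subseteq> ?I"
  proof (rule closed_ideal_gen_least)
    show "ideal ?I A"
    proof (rule ideal_of_closed)
      fix x y assume x: "x \<in> ?I" and y: "y \<in> carrier A"
      have "y \<otimes> x \<otimes> t \<otimes> v = y \<otimes> (x \<otimes> t \<otimes> v)" "x \<otimes> y \<otimes> t \<otimes> v = x \<otimes> (y \<otimes> t) \<otimes> v" if "t \<in> carrier A" for t
        using that x y v by (auto simp: m_assoc)
      then show "y \<otimes> x \<in> ?I" "x \<otimes> y \<in> ?I" using x y by auto
    qed (use v in \<open>auto simp: l_distr\<close>)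
    have "a \<otimes> y \<otimes> v = \<zero>" if a: "a \<in> carrier A" and y: "y \<in> carrier A"
      and ap: "\<And>e. 0 < e \<Longrightarrow> \<exists>b\<in>?I. nrm A (a \<ominus> b) < e" for a y
    proof -
      have "a \<otimes> (y \<otimes> v) = \<zero>"
      proof (rule lim)
        fix e :: real assume "0 < e"
        then obtain b where b: "b \<in> ?I" "nrm A (a \<ominus> b) < e" using ap by blast
        then have "b \<otimes> y \<otimes> v = \<zero>" using y by simp
        then have "b \<otimes> (y \<otimes> v) = \<zero>" using b y v by (simp add: m_assoc)
        then show "\<exists>b\<in>carrier A. b \<otimes> (y \<otimes> v) = \<zero> \<and> nrm A (a \<ominus> b) < e" using b by blast
      qed (use a y v in simp_all)
      then show ?thesis using a y v by (simp add: m_assoc)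
    qed
    then show "norm_closed A ?I" by (auto simp: norm_closed_def)
    show "u \<in> ?I" using u uv by simp
  qed
  then have cI: "c \<in> carrier A" "\<And>y. y \<in> carrier A \<Longrightarrow> c \<otimes> y \<otimes> v = \<zero>" using c by auto
  let ?I' = "{c' \<in> carrier A. \<forall>y\<in>carrier A. c \<otimes> y \<otimes> c' = \<zero>}"
  have "closed_ideal_gen A v \<subseteq> ?I'"
  proof (rule closed_ideal_gen_least)
    show "ideal ?I' A"
    proof (rule ideal_of_closed)
      fix x y assume x: "x \<in> ?I'" and y: "y \<in> carrier A"
      have "c \<otimes> t \<otimes> (y \<otimes> x) = c \<otimes> (t \<otimes> y) \<otimes> x" "c \<otimes> t \<otimes> (x \<otimes> y) = c \<otimes> t \<otimes> x \<otimes> y" if "t \<in> carrier A" for t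
        using that x y cI(1) by (auto simp: m_assoc)
      then show "y \<otimes> x \<in> ?I'" "x \<otimes> y \<in> ?I'" using x y by auto
    qed (use cI(1) in \<open>auto simp: r_distr\<close>)
    have "c \<otimes> y \<otimes> a = \<zero>" if a: "a \<in> carrier A" and y: "y \<in> carrier A"
      and ap: "\<And>e. 0 < e \<Longrightarrow> \<exists>b\<in>?I'. nrm A (a \<ominus> b) < e" for a y
    proof -
      have "star A a \<otimes> star A (c \<otimes> y) = \<zero>"
      proof (rule lim)
        fix e :: real assume "0 < e"
        then obtain b where b: "b \<in> ?I'" "nrm A (a \<ominus> b) < e" using ap by blast
        have z: "c \<otimes> y \<otimes> b = \<zero>" using b y by simp
        have "star A b \<otimes> star A (c \<otimes> y) = star A (c \<otimes> y \<otimes> b)"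
          by (rule star_mult[symmetric]) (use b cI(1) y in auto)
        also have "\<dots> = \<zero>" unfolding z by (rule star_zero)
        finally have "star A b \<otimes> star A (c \<otimes> y) = \<zero>" .
        moreover have "nrm A (star A a \<ominus> star A b) < e" using a b by (simp flip: star_diff)
        ultimately show "\<exists>b\<in>carrier A. b \<otimes> star A (c \<otimes> y) = \<zero> \<and> nrm A (star A a \<ominus> b) < e"
          using b(1) by blast
      qed (use a y cI(1) in simp_all)
      then have "star A (star A a \<otimes> star A (c \<otimes> y)) = \<zero>" by (simp only: star_zero)
      then show ?thesis using a y cI(1) by (simp add: m_assoc)
    qed
    then show "norm_closed A ?I'" by (auto simp: norm_closed_def)
    show "v \<in> ?I'" using v cI(2) by simp
  qed
  then show ?thesis using c' cI(1) by (auto dest!: bspec[of _ _ \<one>])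
qed


section \<open>From the ball to the sphere and back\<close>

lemma (in star_algebra) ball_rel_extend:
  assumes rel: "ball_rel q 2 n A z"
    and comm: "\<And>j. j \<in> {2..n} \<Longrightarrow> z 1 \<otimes> z j = complex_of_real (q powr (1/2)) \<odot> (z j \<otimes> z 1)"
      "\<And>j. j \<in> {2..n} \<Longrightarrow> z 1 \<otimes> star A (z j) = complex_of_real (q powr (-1/2)) \<odot> (star A (z j) \<otimes> z 1)"
    and first: "star A (z 1) \<otimes> z 1 \<ominus> complex_of_real q \<odot> (z 1 \<otimes> star A (z 1)) =
        complex_of_real (1 - q) \<odot> (\<one> \<ominus> sq_sum A z {2..n})"
  shows "ball_rel q 1 n A z"
  unfolding ball_rel_def
proof (intro conjI allI impI ballI)
  fix i j assume ij: "1 \<le> i \<and> i < j \<and> j \<le> n"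
  show "z i \<otimes> z j = complex_of_real (q powr (1/2)) \<odot> (z j \<otimes> z i)"
  proof (cases "i = 1")
    case True
    then show ?thesis using comm(1)[of j] ij by simp
  next
    case False
    then show ?thesis using rel ij unfolding ball_rel_def by auto
  qed
  show "z i \<otimes> star A (z j) = complex_of_real (q powr (-1/2)) \<odot> (star A (z j) \<otimes> z i)"
  proof (cases "i = 1")
    case True
    then show ?thesis using comm(2)[of j] ij by simp
  next
    case False
    then show ?thesis using rel ij unfolding ball_rel_def by auto
  qed
next
  fix i assume i: "i \<in> {1..n}"
  show "star A (z i) \<otimes> z i \<ominus> complex_of_real q \<odot> (z i \<otimes> star A (z i)) =
      complex_of_real (1 - q) \<odot> (\<one> \<ominus> sq_sum A z {i+1..n})"
  proof (cases "i = 1")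
    case True
    then show ?thesis using first by (simp add: numeral_2_eq_2)
  next
    case False
    then have "i \<in> {2..n}" using i by auto
    then show ?thesis using rel unfolding ball_rel_def by blast
  qed
qed

lemma ball_rel_mono: "\<lbrakk>ball_rel q m n A z; m \<le> m'\<rbrakk> \<Longrightarrow> ball_rel q m' n A z"
  unfolding ball_rel_def by auto

context odd_elements
begin

lemma x_star_s: assumes j: "j \<in> {2..n}" shows "star A (x j) \<otimes> s = r \<odot> (s \<otimes> star A (x j))"
proof -
  have "star A (s \<otimes> x j) = star A (r \<odot> (x j \<otimes> s))" using s_x[OF j] by simp
  then show ?thesis using j by (simp add: s_star)
qed

definition sphere_first :: "complex \<Rightarrow> complex \<Rightarrow> 'a" where
  "sphere_first \<sigma> \<epsilon> = \<sigma> \<odot> s \<oplus> \<i> \<odot> (\<epsilon> \<odot> h)"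

definition sphere_tuple :: "complex \<Rightarrow> complex \<Rightarrow> (nat \<Rightarrow> complex) \<Rightarrow> nat \<Rightarrow> 'a" where
  "sphere_tuple \<sigma> \<epsilon> l j = (if j = 1 then sphere_first \<sigma> \<epsilon> else l j \<odot> x j)"

lemma sphere_first_closed [simp]: "sphere_first \<sigma> \<epsilon> \<in> carrier A"
  by (simp add: sphere_first_def)

lemma sphere_tuple_closed: "i \<in> {1..n} \<Longrightarrow> sphere_tuple \<sigma> \<epsilon> l i \<in> carrier A"
  using x_closed by (simp add: sphere_tuple_def)

lemma sphere_first_star:
  assumes "\<sigma> = 1 \<or> \<sigma> = -1" "\<epsilon> = 1 \<or> \<epsilon> = -1"
  shows "star A (sphere_first \<sigma> \<epsilon>) = \<sigma> \<odot> s \<ominus> \<i> \<odot> (\<epsilon> \<odot> h)"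
  using assms by (auto simp: sphere_first_def s_star h_star diff_smult)

text \<open>\<open>\<sigma>s + \<i>\<epsilon>x\<^sub>1\<close> is normal with \<open>s\<^sup>2 + x\<^sub>1\<^sup>2 = D 2\<close>. For a normal \<open>w\<^sub>1\<close> the relation
\<open>w\<^sub>1\<^sup>*w\<^sub>1 - q w\<^sub>1w\<^sub>1\<^sup>* = (1 - q) D 2\<close> of the even ball and the sphere relation both say \<open>w\<^sub>1w\<^sub>1\<^sup>* = D 2\<close>.\<close>

lemma sphere_first_normal:
  assumes "\<sigma> = 1 \<or> \<sigma> = -1" "\<epsilon> = 1 \<or> \<epsilon> = -1"
  shows "star A (sphere_first \<sigma> \<epsilon>) \<otimes> sphere_first \<sigma> \<epsilon> = D 2"
    and "sphere_first \<sigma> \<epsilon> \<otimes> star A (sphere_first \<sigma> \<epsilon>) = D 2"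
proof -
  have sq: "\<sigma> * \<sigma> = 1" "\<epsilon> * \<epsilon> = 1" "cnj \<sigma> = \<sigma>" "cnj \<epsilon> = \<epsilon>" using assms by auto
  have "(\<sigma> \<odot> s) \<otimes> (\<sigma> \<odot> s) \<oplus> (\<epsilon> \<odot> h) \<otimes> (\<epsilon> \<odot> h) = defect \<oplus> h \<otimes> h" by (simp add: sq s_square)
  also have "\<dots> = D 2"
    unfolding defect_eq using h_closed D_closed[OF order_refl] by algebra
  finally have e: "(\<sigma> \<odot> s) \<otimes> (\<sigma> \<odot> s) \<oplus> (\<epsilon> \<odot> h) \<otimes> (\<epsilon> \<odot> h) = D 2" .
  show "star A (sphere_first \<sigma> \<epsilon>) \<otimes> sphere_first \<sigma> \<epsilon> = D 2"
    "sphere_first \<sigma> \<epsilon> \<otimes> star A (sphere_first \<sigma> \<epsilon>) = D 2"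
    unfolding sphere_first_def e[symmetric]
    by (rule normal_square; simp add: sq s_star h_star s_h mult.commute)+
qed

lemma sphere_first_x:
  assumes j: "j \<in> {2..n}"
  shows "sphere_first \<sigma> \<epsilon> \<otimes> x j = r \<odot> (x j \<otimes> sphere_first \<sigma> \<epsilon>)"
    and "sphere_first \<sigma> \<epsilon> \<otimes> star A (x j) = (1 / r) \<odot> (star A (x j) \<otimes> sphere_first \<sigma> \<epsilon>)"
proof -
  have [simp]: "x j \<in> carrier A" using j by simp
  show "sphere_first \<sigma> \<epsilon> \<otimes> x j = r \<odot> (x j \<otimes> sphere_first \<sigma> \<epsilon>)"
    by (simp add: sphere_first_def l_distr r_distr smult_add_right s_x[OF j] h_x[OF j] mult.commute mult.left_commute)
  have "star A (x j) \<otimes> sphere_first \<sigma> \<epsilon> = r \<odot> (sphere_first \<sigma> \<epsilon> \<otimes> star A (x j))"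
    by (simp add: sphere_first_def l_distr r_distr smult_add_right x_star_s[OF j] x_star_h[OF j] mult.commute mult.left_commute)
  then show "sphere_first \<sigma> \<epsilon> \<otimes> star A (x j) = (1 / r) \<odot> (star A (x j) \<otimes> sphere_first \<sigma> \<epsilon>)"
    using r_simps(1) by simp
qed

text \<open>Over an odd ball, \<open>\<plusminus>\<surd>(1 - x\<^sub>1\<^sup>2 - \<dots>) \<plusminus> \<i>x\<^sub>1\<close> together with \<open>x\<^sub>2, \<dots>, x\<^sub>n\<close> satisfies the relations
  of the sphere: the two signs of the square root are the two hemispheres.\<close>

lemma sphere_tuple_rel:
  assumes sg: "\<sigma> = 1 \<or> \<sigma> = -1" "\<epsilon> = 1 \<or> \<epsilon> = -1" and l: "\<And>j. j \<in> {2..n} \<Longrightarrow> cmod (l j) = 1"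
  shows "even_ball_rel q n A (sphere_tuple \<sigma> \<epsilon> l)"
    and "sq_sum A (sphere_tuple \<sigma> \<epsilon> l) {1..n} = \<one>"
proof -
  let ?z = "sphere_tuple \<sigma> \<epsilon> l"
  have l1: "cnj (l j) * l j = 1" if "j \<in> {2..n}" for j
    using l[OF that] complex_norm_square[of "l j"] by (simp add: mult.commute)
  have rel2: "ball_rel q 2 n A ?z"
    by (rule ball_rel_cong[OF _ _ ball_rel_phase[OF z_closed l ball_rel]]) (auto simp: sphere_tuple_def)
  have s2: "sq_sum A ?z {2..n} = sq_sum A x {2..n}"
    by (rule sq_sum_cong) (auto simp: sphere_tuple_def l1)
  then have D2: "\<one> \<ominus> sq_sum A ?z {2..n} = D 2" by (simp add: D_def)
  show "even_ball_rel q n A ?z"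
    unfolding even_ball_rel_iff
  proof (rule ball_rel_extend[OF rel2])
    fix j assume j: "j \<in> {2..n}"
    then have zj: "?z j = l j \<odot> x j" "?z 1 = sphere_first \<sigma> \<epsilon>" and [simp]: "x j \<in> carrier A" by (auto simp: sphere_tuple_def)
    show "?z 1 \<otimes> ?z j = complex_of_real (q powr (1/2)) \<odot> (?z j \<otimes> ?z 1)"
      unfolding r_simps zj by (simp add: sphere_first_x[OF j] mult.commute)
    show "?z 1 \<otimes> star A (?z j) = complex_of_real (q powr (-1/2)) \<odot> (star A (?z j) \<otimes> ?z 1)"
      unfolding r_simps zj by (simp add: sphere_first_x[OF j] mult.commute)
  next
    have z1: "?z 1 = sphere_first \<sigma> \<epsilon>" by (simp add: sphere_tuple_def)
    show "star A (?z 1) \<otimes> ?z 1 \<ominus> complex_of_real q \<odot> (?z 1 \<otimes> star A (?z 1)) =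
        complex_of_real (1 - q) \<odot> (\<one> \<ominus> sq_sum A ?z {2..n})"
      unfolding D2 z1 sphere_first_normal[OF sg] by (simp add: smult_diff_left)
  qed
  have "sq_sum A ?z {1..n} = ?z 1 \<otimes> star A (?z 1) \<oplus> sq_sum A ?z {Suc 1..n}"
    by (rule sq_sum_Suc) (use n sphere_tuple_closed in auto)
  also have "?z 1 \<otimes> star A (?z 1) = D 2"
    using sphere_first_normal(2)[OF sg] by (simp add: sphere_tuple_def)
  also have "D 2 \<oplus> sq_sum A ?z {Suc 1..n} = (\<one> \<ominus> sq_sum A x {2..n}) \<oplus> sq_sum A x {2..n}"
    using s2 by (simp add: D_def numeral_2_eq_2)
  also have "\<dots> = \<one>" using sq_sum_closed[of "{2..n}" x, OF z_closed] by algebra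
  finally show "sq_sum A ?z {1..n} = \<one>" .
qed

end

locale sphere_elements = cstar_ball A q 1 n w for A :: "'a cstar_alg" (structure) and q n w +
  assumes n: "1 \<le> n" and sphere: "sq_sum A w {1..n} = \<one>"
begin

definition W :: 'a where "W = w 1"
definition a :: 'a where "a = (1/2) \<odot> (W \<oplus> star A W)"
definition b :: 'a where "b = (- \<i> / 2) \<odot> (W \<ominus> star A W)"

lemma W_closed [simp]: "W \<in> carrier A"
  using z_closed[of 1] n by (simp add: W_def)

lemma a_closed' [simp]: "a \<in> carrier A" and a_star: "star A a = a"
  by (simp_all add: a_def a_comm)

lemma b_closed [simp]: "b \<in> carrier A" and b_star: "star A b = b"
proof -
  show "b \<in> carrier A" by (simp add: b_def)
  have "star A b = (\<i> / 2) \<odot> (star A W \<ominus> W)" by (simp add: b_def)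
  also have "star A W \<ominus> W = (-1) \<odot> (W \<ominus> star A W)" by (simp add: diff_smult smult_add_right a_comm)
  finally show "star A b = b" by (simp add: b_def)
qed

lemma W_eq: "W = a \<oplus> \<i> \<odot> b"
proof -
  have "a \<oplus> \<i> \<odot> b = (1/2) \<odot> ((W \<oplus> star A W) \<oplus> (W \<ominus> star A W))" by (simp add: a_def b_def smult_add_right)
  also have "(W \<oplus> star A W) \<oplus> (W \<ominus> star A W) = W \<oplus> W"
    using W_closed star_closed[OF W_closed] by algebra
  also have "\<dots> = 2 \<odot> W" using smult_add_left[of W 1 1] by simp
  finally show ?thesis by simp
qed

lemma D2_closed [simp]: "D 2 \<in> carrier A"
  by simp

text \<open>On the sphere the first generator is normal, because \<open>D 1 = 0\<close> turns its relation into \<open>w\<^sub>1\<^sup>*w\<^sub>1 = q D 2 + (1 - q) D 2\<close>.\<close>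

lemma W_normal: "W \<otimes> star A W = D 2" "star A W \<otimes> W = D 2"
proof -
  have 1: "1 \<in> {1..n}" using n by simp
  have S1: "Suc 1 = 2" by simp
  have "\<zero> = D 1" using sphere by (simp add: D_def minus_eq r_neg)
  also have "\<dots> = D 2 \<ominus> W \<otimes> star A W" using D_step[OF 1] unfolding W_def[symmetric] S1 .
  finally show WW: "W \<otimes> star A W = D 2" using diff_0_iff[of "D 2" "W \<otimes> star A W"] by simp
  have "star A W \<otimes> W = complex_of_real q \<odot> (W \<otimes> star A W) \<oplus> complex_of_real (1 - q) \<odot> D 2"
    using z_star_z[OF 1] unfolding W_def[symmetric] S1 .
  also have "\<dots> = (complex_of_real q + complex_of_real (1 - q)) \<odot> D 2" unfolding WW by (rule smult_add_left[symmetric]) simp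
  finally show "star A W \<otimes> W = D 2" by simp
qed

lemma ab: "a \<otimes> b = b \<otimes> a"
proof -
  have "(W \<oplus> star A W) \<otimes> (W \<ominus> star A W) = W \<otimes> W \<ominus> W \<otimes> star A W \<oplus> star A W \<otimes> W \<ominus> star A W \<otimes> star A W"
    "(W \<ominus> star A W) \<otimes> (W \<oplus> star A W) = W \<otimes> W \<oplus> W \<otimes> star A W \<ominus> star A W \<otimes> W \<ominus> star A W \<otimes> star A W"
    using W_closed star_closed[OF W_closed] by algebra+
  moreover have "W \<otimes> W \<ominus> D 2 \<oplus> D 2 \<ominus> star A W \<otimes> star A W = W \<otimes> W \<oplus> D 2 \<ominus> D 2 \<ominus> star A W \<otimes> star A W"
    using W_closed star_closed[OF W_closed] D2_closed by algebra
  ultimately have "(W \<oplus> star A W) \<otimes> (W \<ominus> star A W) = (W \<ominus> star A W) \<otimes> (W \<oplus> star A W)"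
    by (simp only: W_normal)
  then show ?thesis by (simp add: a_def b_def)
qed

lemma aa_bb: "a \<otimes> a \<oplus> b \<otimes> b = D 2"
  using normal_square(1)[OF a_closed' b_closed a_star b_star ab] unfolding W_eq[symmetric] W_normal by simp

lemma W_w:
  assumes j: "j \<in> {2..n}"
  shows "W \<otimes> w j = r \<odot> (w j \<otimes> W)" "star A W \<otimes> w j = r \<odot> (w j \<otimes> star A W)"
proof -
  have c [simp]: "w j \<in> carrier A" using j by simp
  show "W \<otimes> w j = r \<odot> (w j \<otimes> W)" unfolding W_def by (rule zz) (use j in auto)
  have "W \<otimes> star A (w j) = (1 / r) \<odot> (star A (w j) \<otimes> W)" unfolding W_def by (rule zz_star) (use j in auto)
  then have "star A (W \<otimes> star A (w j)) = star A ((1 / r) \<odot> (star A (w j) \<otimes> W))" by simp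
  then have "w j \<otimes> star A W = (1 / r) \<odot> (star A W \<otimes> w j)" by simp
  then show "star A W \<otimes> w j = r \<odot> (w j \<otimes> star A W)" using r_simps(1) by simp
qed

lemma ab_w:
  assumes j: "j \<in> {2..n}"
  shows "a \<otimes> w j = r \<odot> (w j \<otimes> a)" "b \<otimes> w j = r \<odot> (w j \<otimes> b)"
proof -
  have c [simp]: "w j \<in> carrier A" using j by simp
  show "a \<otimes> w j = r \<odot> (w j \<otimes> a)"
    by (simp add: a_def l_distr r_distr smult_add_right W_w[OF j] mult.commute)
  show "b \<otimes> w j = r \<odot> (w j \<otimes> b)"
    by (simp add: b_def l_diff_distr r_diff_distr smult_diff W_w[OF j] mult.commute)
qed

definition ball_tuple :: "complex \<Rightarrow> (nat \<Rightarrow> complex) \<Rightarrow> nat \<Rightarrow> 'a" where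
  "ball_tuple \<epsilon> l j = (if j = 1 then \<epsilon> \<odot> b else l j \<odot> w j)"

lemma ball_tuple_closed: "i \<in> {1..n} \<Longrightarrow> ball_tuple \<epsilon> l i \<in> carrier A"
  by (simp add: ball_tuple_def)

text \<open>Conversely the imaginary part of \<open>w\<^sub>1\<close> together with \<open>w\<^sub>2, \<dots>, w\<^sub>n\<close> satisfies the relations of the
  odd ball: this is the folding map of the sphere onto the ball. The defect is the square of the
  real part of \<open>w\<^sub>1\<close>.\<close>

lemma ball_tuple_rel:
  assumes sg: "\<epsilon> = 1 \<or> \<epsilon> = -1" and l: "\<And>j. j \<in> {2..n} \<Longrightarrow> cmod (l j) = 1"
  shows "\<one> \<ominus> (ball_tuple \<epsilon> l 1 \<otimes> ball_tuple \<epsilon> l 1 \<oplus> sq_sum A (ball_tuple \<epsilon> l) {2..n}) = a \<otimes> a"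
    and "odd_ball_rel q n A (ball_tuple \<epsilon> l)"
proof -
  let ?x = "ball_tuple \<epsilon> l"
  have l1: "cnj (l j) * l j = 1" if "j \<in> {2..n}" for j
    using l[OF that] complex_norm_square[of "l j"] by (simp add: mult.commute)
  have c: "w j \<in> carrier A" if "j \<in> {2..n}" for j using that by simp
  have sq: "\<epsilon> * \<epsilon> = 1" "cnj \<epsilon> = \<epsilon>" using sg by auto
  have x1: "?x 1 = \<epsilon> \<odot> b" by (simp add: ball_tuple_def)
  have s2: "sq_sum A ?x {2..n} = sq_sum A w {2..n}"
    by (rule sq_sum_cong) (auto simp: ball_tuple_def l1)
  have S: "sq_sum A w {2..n} \<in> carrier A" by (rule sq_sum_closed) (rule c)
  have xx: "?x 1 \<otimes> ?x 1 = b \<otimes> b" unfolding x1 by (simp add: sq)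
  have "\<one> \<ominus> (?x 1 \<otimes> ?x 1 \<oplus> sq_sum A ?x {2..n}) = D 2 \<ominus> b \<otimes> b"
    unfolding xx s2 D_def using S b_closed by algebra
  also have "\<dots> = a \<otimes> a" unfolding aa_bb[symmetric] using a_closed' b_closed by algebra
  finally show def: "\<one> \<ominus> (?x 1 \<otimes> ?x 1 \<oplus> sq_sum A ?x {2..n}) = a \<otimes> a" .
  show "odd_ball_rel q n A ?x"
    unfolding odd_ball_rel_iff
  proof (intro conjI ballI)
    show "star A (?x 1) = ?x 1" unfolding x1 by (simp add: b_star sq)
    show "?x 1 \<otimes> ?x j = complex_of_real (q powr (1/2)) \<odot> (?x j \<otimes> ?x 1)" if j: "j \<in> {2..n}" for j
    proof -
      have xj: "?x j = l j \<odot> w j" using j by (simp add: ball_tuple_def)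
      show ?thesis unfolding r_simps x1 xj using c[OF j] by (simp add: ab_w[OF j] mult.commute mult.left_commute)
    qed
    have rel2: "ball_rel q 2 n A w" using ball_rel by (rule ball_rel_mono) simp
    show "ball_rel q 2 n A ?x"
      by (rule ball_rel_cong[OF _ _ ball_rel_phase[OF c l rel2]]) (auto simp: ball_tuple_def)
    show "positive A (\<one> \<ominus> (?x 1 \<otimes> ?x 1 \<oplus> sq_sum A ?x {2..n}))"
      unfolding def by (rule positive_square[OF a_closed' a_star])
  qed
qed

definition abs_a :: 'a where "abs_a = pos_sqrt A (a \<otimes> a)"

lemma aa_positive: "positive A (a \<otimes> a)"
  by (rule positive_square[OF a_closed' a_star])

lemma abs_a_positive: "positive A abs_a" and abs_a_square: "abs_a \<otimes> abs_a = a \<otimes> a"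
  unfolding abs_a_def using pos_sqrt[OF aa_positive] by simp_all

lemma abs_a_closed [simp]: "abs_a \<in> carrier A" and abs_a_star: "star A abs_a = abs_a"
  using positiveD[OF abs_a_positive] by simp_all

lemma abs_a_a: "abs_a \<otimes> a = a \<otimes> abs_a" and abs_a_b: "abs_a \<otimes> b = b \<otimes> abs_a"
proof -
  show "abs_a \<otimes> a = a \<otimes> abs_a"
    unfolding abs_a_def by (rule pos_sqrt_commute[OF aa_positive]) (simp_all add: m_assoc)
  have "a \<otimes> a \<otimes> b = a \<otimes> (b \<otimes> a)" by (simp add: m_assoc ab)
  also have "\<dots> = b \<otimes> (a \<otimes> a)" by (simp add: ab flip: m_assoc)
  finally show "abs_a \<otimes> b = b \<otimes> abs_a"
    unfolding abs_a_def by (intro pos_sqrt_commute[OF aa_positive]) simp_all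
qed

lemma abs_a_w: assumes j: "j \<in> {2..n}" shows "abs_a \<otimes> w j = r \<odot> (w j \<otimes> abs_a)"
proof -
  have c [simp]: "w j \<in> carrier A" using j by simp
  have "a \<otimes> a \<otimes> w j = a \<otimes> (a \<otimes> w j)" by (simp add: m_assoc)
  also have "\<dots> = r \<odot> (a \<otimes> w j \<otimes> a)" by (simp add: ab_w[OF j] m_assoc[symmetric])
  also have "\<dots> = (r * r) \<odot> (w j \<otimes> (a \<otimes> a))" by (simp add: ab_w[OF j]) (simp add: m_assoc)
  finally have "a \<otimes> a \<otimes> w j = complex_of_real q \<odot> (w j \<otimes> (a \<otimes> a))" unfolding r_simps .
  then show ?thesis
    unfolding abs_a_def using q by (intro pos_sqrt_intertwine[OF aa_positive]) simp_all
qed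

text \<open>\<open>\<bar>a\<bar> + a\<close> and \<open>\<bar>a\<bar> - a\<close> are twice the positive and negative parts of \<open>a\<close>. They commute with \<open>w\<^sub>1\<close>
and, up to powers of \<open>\<surd>q\<close>, with the other generators and their adjoints.\<close>

lemma parts_normal:
  assumes gen: "generated_by A (w ` {1..n})" and t: "t = 1 \<or> t = -1"
  shows "normal_generator A (abs_a \<oplus> t \<odot> a)"
proof -
  let ?d = "abs_a \<oplus> t \<odot> a"
  have dW: "?d \<otimes> W = W \<otimes> ?d" "?d \<otimes> star A W = star A W \<otimes> ?d"
  proof -
    have sW: "star A W = a \<oplus> (- \<i>) \<odot> b" using arg_cong[OF W_eq, of "star A"] by (simp add: a_star b_star)
    show "?d \<otimes> W = W \<otimes> ?d" unfolding W_eq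
      by (simp add: l_distr r_distr smult_add_right abs_a_a abs_a_b ab a_ac mult.commute)
    show "?d \<otimes> star A W = star A W \<otimes> ?d" unfolding sW
      by (simp add: l_distr r_distr smult_add_right abs_a_a abs_a_b ab a_ac mult.commute)
  qed
  have dw: "?d \<otimes> w j = r \<odot> (w j \<otimes> ?d)" if j: "j \<in> {2..n}" for j
  proof -
    have c [simp]: "w j \<in> carrier A" using j by simp
    show ?thesis by (simp add: l_distr r_distr smult_add_right abs_a_w[OF j] ab_w[OF j] mult.commute)
  qed
  have d: "?d \<in> carrier A" "star A ?d = ?d" using t by (auto simp: abs_a_star a_star)
  have dws: "?d \<otimes> star A (w j) = (1 / r) \<odot> (star A (w j) \<otimes> ?d)" if j: "j \<in> {2..n}" for j
  proof -
    have c [simp]: "w j \<in> carrier A" using j by simp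
    have "star A (?d \<otimes> w j) = star A (r \<odot> (w j \<otimes> ?d))" using dw[OF j] by simp
    then have "star A (w j) \<otimes> ?d = r \<odot> (?d \<otimes> star A (w j))"
      using d star_mult[OF d(1) c] star_mult[OF c d(1)] star_smult[OF m_closed[OF c d(1)], of r] by simp
    then show ?thesis using r_simps(1) d(1) by simp
  qed
  show ?thesis
  proof (rule normal_generatorI[OF cstar_algebra_axioms gen d])
    fix y assume "y \<in> w ` {1..n}"
    then obtain j where j: "j \<in> {1..n}" "y = w j" by blast
    have c: "w j \<in> carrier A" using j by simp
    consider "y = W" | "j \<in> {2..n}" using j by (cases "j = 1") (auto simp: W_def)
    then have "(\<exists>z\<in>carrier A. ?d \<otimes> y = z \<otimes> ?d) \<and> (\<exists>z\<in>carrier A. ?d \<otimes> star A y = z \<otimes> ?d)"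
    proof cases
      case 1
      then show ?thesis using dW by auto
    next
      case 2
      have "?d \<otimes> y = (r \<odot> w j) \<otimes> ?d" "?d \<otimes> star A y = ((1 / r) \<odot> star A (w j)) \<otimes> ?d"
        using dw[OF 2] dws[OF 2] j(2) c d(1) by simp_all
      then show ?thesis using c by blast
    qed
    then show "\<exists>z\<in>carrier A. ?d \<otimes> y = z \<otimes> ?d" "\<exists>z\<in>carrier A. ?d \<otimes> star A y = z \<otimes> ?d"
      by blast+
  qed
qed

text \<open>\<open>(\<bar>a\<bar> - a)y\<close> lies in the closure of \<open>A(\<bar>a\<bar> - a)\<close>, and \<open>(\<bar>a\<bar> - a)(\<bar>a\<bar> + a) = \<bar>a\<bar>\<^sup>2 - a\<^sup>2 = 0\<close>.\<close>

lemma parts_annihilate: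
  assumes gen: "generated_by A (w ` {1..n})" and y: "y \<in> carrier A"
  shows "(abs_a \<ominus> a) \<otimes> y \<otimes> (abs_a \<oplus> a) = \<zero>"
proof -
  let ?u = "abs_a \<ominus> a" and ?v = "abs_a \<oplus> a"
  have u_eq: "?u = abs_a \<oplus> (-1) \<odot> a" by (simp add: diff_smult)
  interpret N: normal_generator A ?u unfolding u_eq by (rule parts_normal[OF gen]) simp
  have "?u \<otimes> ?v = abs_a \<otimes> abs_a \<oplus> abs_a \<otimes> a \<ominus> a \<otimes> abs_a \<ominus> a \<otimes> a"
    using abs_a_closed a_closed' by algebra
  also have "\<dots> = a \<otimes> a \<oplus> a \<otimes> abs_a \<ominus> a \<otimes> abs_a \<ominus> a \<otimes> a" by (simp only: abs_a_square abs_a_a)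
  also have "\<dots> = \<zero>" using abs_a_closed a_closed' by algebra
  finally have uv: "?u \<otimes> ?v = \<zero>" .
  have "nrm A (?u \<otimes> y \<otimes> ?v) \<le> 0 + e" if "0 < e" for e
  proof -
    have M: "0 < nrm A ?v + 1" using p_nonneg[of ?v] by (simp add: add_nonneg_pos)
    obtain y' where y': "y' \<in> carrier A" "nrm A (?u \<otimes> y \<ominus> y' \<otimes> ?u) < e / (nrm A ?v + 1)"
      using left_span_approx[OF N.normal[OF y], of "e / (nrm A ?v + 1)"] \<open>0 < e\<close> M by auto
    have "y' \<otimes> ?u \<otimes> ?v = \<zero>" using y'(1) uv by (simp add: m_assoc)
    then have "?u \<otimes> y \<otimes> ?v = (?u \<otimes> y \<ominus> y' \<otimes> ?u) \<otimes> ?v"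
      using y y'(1) by (simp add: l_diff_distr[of "?u \<otimes> y" "y' \<otimes> ?u" ?v])
    then have "nrm A (?u \<otimes> y \<otimes> ?v) \<le> nrm A (?u \<otimes> y \<ominus> y' \<otimes> ?u) * nrm A ?v"
      using y y'(1) p_mult[of "?u \<otimes> y \<ominus> y' \<otimes> ?u" ?v] by simp
    also have "\<dots> \<le> nrm A (?u \<otimes> y \<ominus> y' \<otimes> ?u) * (nrm A ?v + 1)" using y y'(1) by (intro mult_left_mono) auto
    also have "\<dots> < e" using y'(2) by (simp only: pos_less_divide_eq[OF M])
    finally show ?thesis by simp
  qed
  then have "nrm A (?u \<otimes> y \<otimes> ?v) \<le> 0" by (rule field_le_epsilon)
  then have "nrm A (?u \<otimes> y \<otimes> ?v) = 0" using y by (intro antisym) simp_all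
  then show ?thesis using y by (simp add: nrm_0_iff)
qed

end


section \<open>The two hemispheres\<close>

lemma star_hom_comp:
  assumes "star_hom A B f" "star_hom B C g" shows "star_hom A C (\<lambda>x. g (f x))"
  using assms by (auto simp: star_hom_def ring_hom_def Pi_iff)

lemma star_hom_id: "star_hom A A (\<lambda>x. x)"
  by (simp add: star_hom_def ring_hom_def)

locale quantum_balls =
  fixes q :: real and n :: nat
  assumes q: "0 < q" "q < 1" and n: "1 \<le> n"
begin

abbreviation "B \<equiv> odd_ball q n"
abbreviation "x \<equiv> x_gen q n"
abbreviation "A \<equiv> even_ball q n"
abbreviation "E \<equiv> even_boundary q n"
abbreviation "w \<equiv> w_gen q n"

lemma B_cstar: "cstar_algebra B" and x_closed: "i \<in> {1..n} \<Longrightarrow> x i \<in> carrier B"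
  and B_generated: "generated_by B (x ` {1..n})"
proof -
  interpret universal "{1..n}" "odd_ball_rel q n" by (rule odd_universal[OF q n])
  show "cstar_algebra B" unfolding odd_ball_def by (rule univ_cstar)
  show "i \<in> {1..n} \<Longrightarrow> x i \<in> carrier B" unfolding odd_ball_def x_gen_def by (rule gen_closed)
  show "generated_by B (x ` {1..n})" unfolding odd_ball_def x_gen_def by (rule univ_generated)
qed

lemma A_cstar: "cstar_algebra A" and z_closed: "i \<in> {1..n} \<Longrightarrow> z_gen q n i \<in> carrier A"
  and A_generated: "generated_by A (z_gen q n ` {1..n})"
proof -
  interpret universal "{1..n}" "even_ball_rel q n" by (rule even_universal[OF q n])
  show "cstar_algebra A" unfolding even_ball_def by (rule univ_cstar)
  show "i \<in> {1..n} \<Longrightarrow> z_gen q n i \<in> carrier A" unfolding even_ball_def z_gen_def by (rule gen_closed)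
  show "generated_by A (z_gen q n ` {1..n})" unfolding even_ball_def z_gen_def by (rule univ_generated)
qed

sublocale X: odd_elements B q n x
  by (intro odd_elements.intro B_cstar odd_elements_axioms.intro q n x_closed odd_ball_universal(1))

sublocale I: normal_generator B X.defect
proof (rule normal_generatorI[OF B_cstar B_generated X.defect_closed X.defect_star])
  fix y assume "y \<in> x ` {1..n}"
  then obtain j where j: "j \<in> {1..n}" "y = x j" by blast
  consider "y = X.h" | "j \<in> {2..n}" using j by (cases "j = 1") (auto simp: X.h_def)
  then have "(\<exists>z\<in>carrier B. X.defect \<otimes>\<^bsub>B\<^esub> y = z \<otimes>\<^bsub>B\<^esub> X.defect) \<and>
      (\<exists>z\<in>carrier B. X.defect \<otimes>\<^bsub>B\<^esub> star B y = z \<otimes>\<^bsub>B\<^esub> X.defect)"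
  proof cases
    case 1
    then show ?thesis using X.defect_h X.h_star X.h_closed by metis
  next
    case 2
    then have c: "x j \<in> carrier B" by simp
    have 1: "X.defect \<otimes>\<^bsub>B\<^esub> y = (complex_of_real q \<odot>\<^bsub>B\<^esub> x j) \<otimes>\<^bsub>B\<^esub> X.defect"
      using X.defect_x[OF 2] j c by simp
    have "star B (X.defect \<otimes>\<^bsub>B\<^esub> x j) = star B (complex_of_real q \<odot>\<^bsub>B\<^esub> (x j \<otimes>\<^bsub>B\<^esub> X.defect))"
      by (simp only: X.defect_x[OF 2])
    then have "star B (x j) \<otimes>\<^bsub>B\<^esub> X.defect = complex_of_real q \<odot>\<^bsub>B\<^esub> (X.defect \<otimes>\<^bsub>B\<^esub> star B (x j))"
      using c by (simp add: X.defect_star)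
    then have "X.defect \<otimes>\<^bsub>B\<^esub> star B y = (complex_of_real (1 / q) \<odot>\<^bsub>B\<^esub> star B (x j)) \<otimes>\<^bsub>B\<^esub> X.defect"
      using q c j by simp
    then show ?thesis using 1 c by blast
  qed
  then show "\<exists>z\<in>carrier B. X.defect \<otimes>\<^bsub>B\<^esub> y = z \<otimes>\<^bsub>B\<^esub> X.defect"
    "\<exists>z\<in>carrier B. X.defect \<otimes>\<^bsub>B\<^esub> star B y = z \<otimes>\<^bsub>B\<^esub> X.defect" by blast+
qed

lemma odd_defect_eq: "odd_defect q n = X.defect"
proof -
  have S: "sq_sum B x {2..n} \<in> carrier B" by (rule X.sq_sum_closed) simp
  have "odd_defect q n = \<one>\<^bsub>B\<^esub> \<ominus>\<^bsub>B\<^esub> X.h \<otimes>\<^bsub>B\<^esub> X.h \<ominus>\<^bsub>B\<^esub> sq_sum B x {2..n}"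
    unfolding odd_defect_def Let_def X.h_def sq_sum_def ..
  also have "\<dots> = X.defect"
    unfolding X.defect_def X.h_def[symmetric] using S X.h_closed by algebra
  finally show ?thesis .
qed

lemma odd_boundary_eq: "odd_boundary q n = I.Q" and odd_proj_eq: "odd_proj q n y = I.\<pi> y"
  and t_gen_eq: "t_gen q n i = I.\<pi> (x i)"
  by (simp_all add: odd_boundary_def odd_proj_def t_gen_def odd_ideal_def odd_defect_eq)

lemma pi_s: "I.\<pi> X.s = \<zero>\<^bsub>I.Q\<^esub>"
proof -
  interpret Q: cstar_algebra I.Q by (rule I.quot_cstar)
  interpret pi: star_morphism B I.Q I.\<pi> by unfold_locales (rule I.pi_hom)
  have c: "I.\<pi> X.s \<in> carrier I.Q" by (rule pi.hom_closed[OF X.s_closed])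
  have "I.\<pi> X.defect = \<zero>\<^bsub>I.Q\<^esub>"
    using I.pi_zero_iff[OF X.defect_closed] X.closed_ideal_gen_props(3)[OF X.defect_closed] by blast
  then have "I.\<pi> X.s \<otimes>\<^bsub>I.Q\<^esub> I.\<pi> X.s = \<zero>\<^bsub>I.Q\<^esub>"
    using pi.hom_mult[OF X.s_closed X.s_closed] unfolding X.s_square by metis
  moreover have "star I.Q (I.\<pi> X.s) = I.\<pi> X.s"
    using pi.hom_star[OF X.s_closed] unfolding X.s_star by (rule sym)
  ultimately have "(nrm I.Q (I.\<pi> X.s))\<^sup>2 = 0" using Q.p_square[OF c] by simp
  then show ?thesis using Q.nrm_definite[OF c] by simp
qed

sublocale Z: cstar_ball A q 1 n "z_gen q n"
proof (rule cstar_ball.intro)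
  interpret cstar_algebra A by (rule A_cstar)
  show "ball A q 1 n (z_gen q n)"
    using even_ball_universal(1)[OF q n] unfolding even_ball_rel_iff
    by unfold_locales (rule q z_closed; assumption?)+
qed (rule A_cstar)

sublocale K: normal_generator A "Z.D 1"
proof (rule normal_generatorI[OF A_cstar A_generated])
  have m: "(1::nat) \<le> 1" by simp
  show "Z.D 1 \<in> carrier A" by (rule Z.D_closed[OF m])
  show "star A (Z.D 1) = Z.D 1" by (rule Z.D_star[OF m])
  fix y assume "y \<in> z_gen q n ` {1..n}"
  then obtain j where j: "j \<in> {1..n}" "y = z_gen q n j" by blast
  then have c: "y \<in> carrier A" using z_closed by blast
  have 1: "Z.D 1 \<otimes>\<^bsub>A\<^esub> y = complex_of_real q \<odot>\<^bsub>A\<^esub> (y \<otimes>\<^bsub>A\<^esub> Z.D 1)"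
    using Z.D_commute[OF m _ j(1)] n j by (simp split: if_splits)
  then show "\<exists>z\<in>carrier A. Z.D 1 \<otimes>\<^bsub>A\<^esub> y = z \<otimes>\<^bsub>A\<^esub> Z.D 1"
    using c Z.D_closed[OF m] by (intro bexI[of _ "complex_of_real q \<odot>\<^bsub>A\<^esub> y"]) simp_all
  have "star A y \<otimes>\<^bsub>A\<^esub> Z.D 1 = complex_of_real q \<odot>\<^bsub>A\<^esub> (Z.D 1 \<otimes>\<^bsub>A\<^esub> star A y)"
    using Z.D_star_commute[OF m, of j] j by simp
  then have "Z.D 1 \<otimes>\<^bsub>A\<^esub> star A y = (complex_of_real (1 / q) \<odot>\<^bsub>A\<^esub> star A y) \<otimes>\<^bsub>A\<^esub> Z.D 1"
    using q c Z.D_closed[OF m] by simp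
  then show "\<exists>z\<in>carrier A. Z.D 1 \<otimes>\<^bsub>A\<^esub> star A y = z \<otimes>\<^bsub>A\<^esub> Z.D 1"
    using c by (intro bexI[of _ "complex_of_real (1 / q) \<odot>\<^bsub>A\<^esub> star A y"]) simp_all
qed

lemma even_ideal_eq: "even_ideal q n = K.J"
  by (simp only: even_ideal_def Let_def Z.D_def sq_sum_def)

lemma E_eq: "E = K.Q" and w_eq: "w i = K.\<pi> (z_gen q n i)"
  by (simp_all only: even_boundary_def w_gen_def even_ideal_eq)

lemma E_cstar: "cstar_algebra E"
  unfolding E_eq by (rule K.quot_cstar)

lemma pi_E_hom: "star_hom A E K.\<pi>"
  unfolding E_eq by (rule K.pi_hom)

lemma w_closed: "i \<in> {1..n} \<Longrightarrow> w i \<in> carrier E"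
  using z_closed[of i] pi_E_hom unfolding w_eq by (auto simp: star_hom_def ring_hom_def)

lemma E_generated: "generated_by E (w ` {1..n})"
  using K.quot_generated[OF A_generated] unfolding E_eq by (simp add: image_image w_eq)

lemma w_rel: "even_ball_rel q n E w" and w_sum: "sq_sum E w {1..n} = \<one>\<^bsub>E\<^esub>"
proof -
  interpret E: cstar_algebra E by (rule E_cstar)
  interpret pi: star_morphism A E K.\<pi> by unfold_locales (rule pi_E_hom)
  have ww: "w = (\<lambda>i. K.\<pi> (z_gen q n i))" by (rule ext) (rule w_eq)
  show "even_ball_rel q n E w"
    unfolding even_ball_rel_iff ww by (rule pi.ball_rel_hom[OF z_closed Z.ball_rel])
  have S: "sq_sum A (z_gen q n) {1..n} \<in> carrier A" by (rule Z.sq_sum_closed) (rule z_closed)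
  have "K.\<pi> (Z.D 1) = \<zero>\<^bsub>E\<^esub>"
    using K.pi_zero_iff[OF K.d_closed] Z.closed_ideal_gen_props(3)[OF K.d_closed] unfolding E_eq by blast
  moreover have "K.\<pi> (Z.D 1) = K.\<pi> (\<one>\<^bsub>A\<^esub> \<ominus>\<^bsub>A\<^esub> sq_sum A (z_gen q n) {1..n})"
    by (rule arg_cong[of _ _ K.\<pi>]) (rule Z.D_def)
  ultimately have "\<one>\<^bsub>E\<^esub> \<ominus>\<^bsub>E\<^esub> K.\<pi> (sq_sum A (z_gen q n) {1..n}) = \<zero>\<^bsub>E\<^esub>"
    using pi.hom_minus[OF Z.one_closed S] pi.hom_one by metis
  then have "\<one>\<^bsub>E\<^esub> = K.\<pi> (sq_sum A (z_gen q n) {1..n})"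
    using E.diff_0_iff[OF E.one_closed pi.hom_closed[OF S]] by blast
  also have "\<dots> = sq_sum E w {1..n}" unfolding ww by (rule pi.hom_sq_sum) (rule z_closed)
  finally show "sq_sum E w {1..n} = \<one>\<^bsub>E\<^esub>" by simp
qed

sublocale S: sphere_elements E q n w
proof -
  interpret E: cstar_algebra E by (rule E_cstar)
  show "sphere_elements E q n w"
  proof unfold_locales
    show "0 < q" "q < 1" "1 \<le> n" by (rule q n)+
    show "w i \<in> carrier E" if "i \<in> {1..n}" for i by (rule w_closed[OF that])
    show "ball_rel q 1 n E w" using w_rel unfolding even_ball_rel_iff .
    show "sq_sum E w {1..n} = \<one>\<^bsub>E\<^esub>" by (rule w_sum)
  qed
qed

text \<open>The universal property of the even ball, with the sphere relation taking care of the quotient.\<close>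

lemma sphere_hom_ex:
  assumes C: "cstar_algebra C" and b: "\<And>i. i \<in> {1..n} \<Longrightarrow> b i \<in> carrier C"
    and rel: "even_ball_rel q n C b" and sum: "sq_sum C b {1..n} = \<one>\<^bsub>C\<^esub>"
  shows "\<exists>F. star_hom E C F \<and> (\<forall>i\<in>{1..n}. F (w i) = b i)"
proof -
  interpret C: cstar_algebra C by (rule C)
  obtain f where f: "star_hom A C f" "\<And>i. i \<in> {1..n} \<Longrightarrow> f (z_gen q n i) = b i"
    using even_ball_universal(2)[OF q n C b rel] by blast
  interpret f: star_morphism A C f by unfold_locales (rule f(1))
  have S: "sq_sum A (z_gen q n) {1..n} \<in> carrier A" by (rule Z.sq_sum_closed) (rule z_closed)
  have "f (sq_sum A (z_gen q n) {1..n}) = sq_sum C (\<lambda>i. f (z_gen q n i)) {1..n}"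
    by (rule f.hom_sq_sum) (rule z_closed)
  also have "\<dots> = sq_sum C b {1..n}" by (rule C.sq_sum_cong) (simp_all only: f(2) b)
  finally have "f (Z.D 1) = \<zero>\<^bsub>C\<^esub>"
    unfolding Z.D_def f.hom_minus[OF Z.one_closed S] sum f.hom_one by (simp add: C.minus_eq C.r_neg)
  from K.quot_hom_ex[OF C f(1) this] obtain F where F: "star_hom E C F" "\<And>y. y \<in> carrier A \<Longrightarrow> F (K.\<pi> y) = f y"
    unfolding E_eq by blast
  then show ?thesis using f(2) z_closed by (intro exI[of _ F]) (simp add: w_eq)
qed

end

text \<open>One hemisphere: the homomorphism \<open>F\<close> restricts the sphere to a ball, and \<open>\<psi>\<close>, which folds the
  sphere onto the ball, is a right inverse of it.\<close>

locale hemisphere = quantum_balls +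
  fixes \<sigma> \<epsilon> :: complex and l :: "nat \<Rightarrow> complex"
    and F :: "nat univ_elem set \<Rightarrow> nat univ_elem" and \<psi> :: "nat univ_elem \<Rightarrow> nat univ_elem set"
  assumes signs: "\<sigma> = 1 \<or> \<sigma> = -1" "\<epsilon> = 1 \<or> \<epsilon> = -1"
    and phases: "\<And>j. j \<in> {2..n} \<Longrightarrow> cmod (l j) = 1"
    and F_hom: "star_hom E B F" and F_w: "\<And>i. i \<in> {1..n} \<Longrightarrow> F (w i) = X.sphere_tuple \<sigma> \<epsilon> l i"
    and psi_hom: "star_hom B E \<psi>"
    and psi_x: "\<And>i. i \<in> {1..n} \<Longrightarrow> \<psi> (x i) = S.ball_tuple \<epsilon> (\<lambda>j. cnj (l j)) i"
begin

sublocale F: star_morphism E B F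
  by unfold_locales (rule F_hom)

sublocale psi: star_morphism B E \<psi>
  by unfold_locales (rule psi_hom)

lemma sign_simps: "\<sigma> * \<sigma> = 1" "\<epsilon> * \<epsilon> = 1" "cnj \<sigma> = \<sigma>" "cnj \<epsilon> = \<epsilon>"
  using signs by auto

lemma phase_simps: "j \<in> {2..n} \<Longrightarrow> l j * cnj (l j) = 1" "j \<in> {2..n} \<Longrightarrow> cnj (l j) * l j = 1"
  using phases complex_norm_square[of "l j"] by (simp_all add: mult.commute)

lemma F_W: "F S.W = X.sphere_first \<sigma> \<epsilon>"
  using F_w[of 1] n by (simp add: S.W_def X.sphere_tuple_def)

lemma F_a: "F S.a = \<sigma> \<odot>\<^bsub>B\<^esub> X.s"
proof -
  let ?u = "\<sigma> \<odot>\<^bsub>B\<^esub> X.s" and ?v = "\<i> \<odot>\<^bsub>B\<^esub> (\<epsilon> \<odot>\<^bsub>B\<^esub> X.h)"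
  have c: "?u \<in> carrier B" "?v \<in> carrier B" by simp_all
  have "F S.a = (1/2) \<odot>\<^bsub>B\<^esub> ((?u \<oplus>\<^bsub>B\<^esub> ?v) \<oplus>\<^bsub>B\<^esub> (?u \<ominus>\<^bsub>B\<^esub> ?v))"
    using X.sphere_first_star[OF signs] by (simp add: S.a_def F_W) (simp add: X.sphere_first_def)
  also have "(?u \<oplus>\<^bsub>B\<^esub> ?v) \<oplus>\<^bsub>B\<^esub> (?u \<ominus>\<^bsub>B\<^esub> ?v) = ?u \<oplus>\<^bsub>B\<^esub> ?u" using c by algebra
  also have "\<dots> = 2 \<odot>\<^bsub>B\<^esub> ?u" using X.smult_add_left[of ?u 1 1] by simp
  finally show ?thesis by simp
qed

lemma F_b: "F S.b = \<epsilon> \<odot>\<^bsub>B\<^esub> X.h"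
proof -
  let ?u = "\<sigma> \<odot>\<^bsub>B\<^esub> X.s" and ?v = "\<i> \<odot>\<^bsub>B\<^esub> (\<epsilon> \<odot>\<^bsub>B\<^esub> X.h)"
  have c: "?u \<in> carrier B" "?v \<in> carrier B" by simp_all
  have "F S.b = (- \<i> / 2) \<odot>\<^bsub>B\<^esub> ((?u \<oplus>\<^bsub>B\<^esub> ?v) \<ominus>\<^bsub>B\<^esub> (?u \<ominus>\<^bsub>B\<^esub> ?v))"
    using X.sphere_first_star[OF signs] by (simp add: S.b_def F_W) (simp add: X.sphere_first_def)
  also have "(?u \<oplus>\<^bsub>B\<^esub> ?v) \<ominus>\<^bsub>B\<^esub> (?u \<ominus>\<^bsub>B\<^esub> ?v) = ?v \<oplus>\<^bsub>B\<^esub> ?v" using c by algebra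
  also have "\<dots> = 2 \<odot>\<^bsub>B\<^esub> ?v" using X.smult_add_left[of ?v 1 1] by simp
  finally show ?thesis by simp
qed

lemma F_psi: assumes "y \<in> carrier B" shows "F (\<psi> y) = y"
proof (rule generated_hom_eq[OF B_generated B_cstar B_cstar star_hom_comp[OF psi_hom F_hom] star_hom_id _ assms])
  fix y assume "y \<in> x ` {1..n}"
  then obtain j where j: "j \<in> {1..n}" "y = x j" by blast
  show "F (\<psi> y) = y"
  proof (cases "j = 1")
    case True
    have "X.h \<in> carrier B" by simp
    then have "F (\<epsilon> \<odot>\<^bsub>E\<^esub> S.b) = X.h" by (simp add: F_b sign_simps)
    then show ?thesis using True j(2) psi_x[OF j(1)] unfolding S.ball_tuple_def X.h_def by (simp only: if_True simp_thms)
  next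
    case False
    then have j2: "j \<in> {2..n}" using j by auto
    have wc: "w j \<in> carrier E" by (rule w_closed[OF j(1)])
    have "\<psi> y = cnj (l j) \<odot>\<^bsub>E\<^esub> w j" using psi_x[OF j(1)] False j by (simp add: S.ball_tuple_def)
    then have "F (\<psi> y) = cnj (l j) \<odot>\<^bsub>B\<^esub> F (w j)" using wc by simp
    also have "F (w j) = l j \<odot>\<^bsub>B\<^esub> x j" using F_w[OF j(1)] False by (simp add: X.sphere_tuple_def)
    finally show ?thesis using j2 j(2) phase_simps(2)[OF j2] by simp
  qed
qed

lemma psi_defect: "\<psi> X.defect = S.a \<otimes>\<^bsub>E\<^esub> S.a"
proof -
  let ?t = "S.ball_tuple \<epsilon> (\<lambda>j. cnj (l j))"
  have 1: "1 \<in> {1..n}" using n by simp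
  have "\<psi> X.defect = \<one>\<^bsub>E\<^esub> \<ominus>\<^bsub>E\<^esub> (\<psi> (x 1) \<otimes>\<^bsub>E\<^esub> \<psi> (x 1) \<oplus>\<^bsub>E\<^esub> sq_sum E (\<lambda>i. \<psi> (x i)) {2..n})"
    unfolding X.defect_def by (rule odd_defect_hom[OF psi.star_morphism_axioms _ n]) (rule x_closed)
  also have "sq_sum E (\<lambda>i. \<psi> (x i)) {2..n} = sq_sum E ?t {2..n}"
    by (rule S.sq_sum_cong) (use psi_x S.ball_tuple_closed in auto)
  also have "\<psi> (x 1) = ?t 1" by (rule psi_x[OF 1])
  also have "\<one>\<^bsub>E\<^esub> \<ominus>\<^bsub>E\<^esub> (?t 1 \<otimes>\<^bsub>E\<^esub> ?t 1 \<oplus>\<^bsub>E\<^esub> sq_sum E ?t {2..n}) = S.a \<otimes>\<^bsub>E\<^esub> S.a"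
    by (rule S.ball_tuple_rel(1)[OF signs(2)]) (simp add: phases)
  finally show ?thesis .
qed

text \<open>\<open>\<psi>\<close> maps the root of the defect to a positive root of \<open>a\<^sup>2\<close>; positivity is preserved because positive elements
are squares.\<close>

lemma psi_s: "\<psi> X.s = S.abs_a"
proof -
  obtain t where t: "positive B t" "t \<otimes>\<^bsub>B\<^esub> t = X.s" using X.positive_sqrt_ex[OF X.s_positive] by blast
  note tc = X.positiveD[OF t(1)]
  have "positive E (\<psi> t \<otimes>\<^bsub>E\<^esub> \<psi> t)"
    by (rule S.positive_square) (use tc psi.hom_star[of t] in simp_all)
  then have "positive E (\<psi> X.s)" using psi.hom_mult[OF tc(1) tc(1)] t(2) by simp
  moreover have "\<psi> X.s \<otimes>\<^bsub>E\<^esub> \<psi> X.s = S.a \<otimes>\<^bsub>E\<^esub> S.a"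
    using psi.hom_mult[OF X.s_closed X.s_closed] by (simp add: X.s_square psi_defect)
  ultimately show ?thesis unfolding S.abs_a_def by (rule S.pos_sqrt_eq[symmetric])
qed

lemma F_abs_a: "F S.abs_a = X.s"
  using F_psi[OF X.s_closed] by (simp add: psi_s)

text \<open>The function \<open>\<bar>a\<bar> - \<sigma>a\<close> vanishes on the hemisphere where \<open>\<sigma>a \<ge> 0\<close>.\<close>

abbreviation "k \<equiv> S.abs_a \<oplus>\<^bsub>E\<^esub> (- \<sigma>) \<odot>\<^bsub>E\<^esub> S.a"
abbreviation "Jk \<equiv> closed_ideal_gen E k"

lemma k_closed: "k \<in> carrier E" and k_star: "star E k = k"
  by (simp_all add: S.abs_a_star S.a_star sign_simps)

lemma psi_F_W: "S.W \<ominus>\<^bsub>E\<^esub> \<psi> (F S.W) = (- \<sigma>) \<odot>\<^bsub>E\<^esub> k"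
proof -
  have "\<psi> X.h = \<epsilon> \<odot>\<^bsub>E\<^esub> S.b" using psi_x[of 1] n by (simp add: X.h_def S.ball_tuple_def)
  then have "\<psi> (F S.W) = \<sigma> \<odot>\<^bsub>E\<^esub> S.abs_a \<oplus>\<^bsub>E\<^esub> \<i> \<odot>\<^bsub>E\<^esub> S.b"
    by (simp add: F_W X.sphere_first_def psi_s sign_simps mult.assoc)
  then have "S.W \<ominus>\<^bsub>E\<^esub> \<psi> (F S.W) = (S.a \<oplus>\<^bsub>E\<^esub> \<i> \<odot>\<^bsub>E\<^esub> S.b) \<ominus>\<^bsub>E\<^esub> (\<sigma> \<odot>\<^bsub>E\<^esub> S.abs_a \<oplus>\<^bsub>E\<^esub> \<i> \<odot>\<^bsub>E\<^esub> S.b)"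
    unfolding S.W_eq[symmetric] by simp
  also have "\<dots> = S.a \<ominus>\<^bsub>E\<^esub> \<sigma> \<odot>\<^bsub>E\<^esub> S.abs_a"
    using S.a_closed' S.smult_closed[OF S.b_closed] S.smult_closed[OF S.abs_a_closed] by algebra
  also have "\<dots> = (- \<sigma>) \<odot>\<^bsub>E\<^esub> k"
    by (simp add: S.diff_smult S.smult_add_right sign_simps S.a_comm)
  finally show ?thesis .
qed

text \<open>Restricting and folding back changes \<open>w\<^sub>1\<close> by a multiple of \<open>\<bar>a\<bar> - \<sigma>a\<close> and fixes the other generators, so it is
the identity modulo the closed ideal of \<open>\<bar>a\<bar> - \<sigma>a\<close>.\<close>

lemma retract_ideal:
  assumes "c \<in> carrier E" shows "c \<ominus>\<^bsub>E\<^esub> \<psi> (F c) \<in> Jk"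
proof -
  interpret J: ideal Jk E by (rule S.closed_ideal_gen_props(1)[OF k_closed])
  define g where "g c = \<psi> (F c)" for c
  have gh: "star_hom E E g" unfolding g_def by (rule star_hom_comp[OF F_hom psi_hom])
  interpret g: star_morphism E E g by unfold_locales (rule gh)
  have "c \<ominus>\<^bsub>E\<^esub> g c \<in> Jk"
    using E_generated assms
  proof (induction rule: generated_induct)
    case (limit c)
    have "\<exists>j\<in>Jk. nrm E ((c \<ominus>\<^bsub>E\<^esub> g c) \<ominus>\<^bsub>E\<^esub> j) < e" if e: "0 < e" for e
    proof -
      obtain y where y: "y \<in> carrier E" "y \<ominus>\<^bsub>E\<^esub> g y \<in> Jk" "nrm E (c \<ominus>\<^bsub>E\<^esub> y) < e / 2"
        using limit(2)[of "e / 2"] e by auto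
      have "nrm E (g (c \<ominus>\<^bsub>E\<^esub> y)) \<le> nrm E (c \<ominus>\<^bsub>E\<^esub> y)"
        by (rule star_hom_contractive[OF E_cstar S.cstar_seminormed_axioms gh]) (use limit(1) y in simp)
      moreover have "(c \<ominus>\<^bsub>E\<^esub> g c) \<ominus>\<^bsub>E\<^esub> (y \<ominus>\<^bsub>E\<^esub> g y) = (c \<ominus>\<^bsub>E\<^esub> y) \<ominus>\<^bsub>E\<^esub> (g c \<ominus>\<^bsub>E\<^esub> g y)"
        using limit(1) y(1) g.hom_closed[OF limit(1)] g.hom_closed[OF y(1)] by algebra
      moreover have "nrm E ((c \<ominus>\<^bsub>E\<^esub> y) \<ominus>\<^bsub>E\<^esub> (g c \<ominus>\<^bsub>E\<^esub> g y)) \<le> nrm E (c \<ominus>\<^bsub>E\<^esub> y) + nrm E (g c \<ominus>\<^bsub>E\<^esub> g y)"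
        using limit(1) y(1) by (intro S.p_diff) auto
      ultimately have "nrm E ((c \<ominus>\<^bsub>E\<^esub> g c) \<ominus>\<^bsub>E\<^esub> (y \<ominus>\<^bsub>E\<^esub> g y)) < e"
        using y(3) limit(1) y(1) by simp
      then show ?thesis using y(2) by blast
    qed
    then show ?case
      using S.closed_ideal_gen_props(2)[OF k_closed] limit(1) by (auto simp: norm_closed_def)
  next
    case one
    then show ?case by (simp add: S.minus_eq S.r_neg)
  next
    case (gen y)
    then obtain j where j: "j \<in> {1..n}" "y = w j" by blast
    show ?case
    proof (cases "j = 1")
      case True
      then have "y = S.W" using j by (simp add: S.W_def)
      then show ?thesis
        using psi_F_W S.ideal_smult[OF J.is_ideal S.closed_ideal_gen_props(3)[OF k_closed]] by (simp add: g_def)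
    next
      case False
      then have j2: "j \<in> {2..n}" using j by auto
      have wc: "w j \<in> carrier E" by (rule w_closed[OF j(1)])
      have xc: "x j \<in> carrier B" by (rule x_closed[OF j(1)])
      have "F y = l j \<odot>\<^bsub>B\<^esub> x j" using F_w[OF j(1)] False j by (simp add: X.sphere_tuple_def)
      then have "g y = l j \<odot>\<^bsub>E\<^esub> \<psi> (x j)" using xc by (simp add: g_def)
      also have "\<psi> (x j) = cnj (l j) \<odot>\<^bsub>E\<^esub> w j" using psi_x[OF j(1)] False by (simp add: S.ball_tuple_def)
      finally have "g y = y" using wc j(2) phase_simps(1)[OF j2] by simp
      then show ?thesis using wc j(2) by (simp add: S.minus_eq S.r_neg)
    qed
  next
    case (star y)
    have "star E (y \<ominus>\<^bsub>E\<^esub> g y) \<in> Jk" by (rule S.closed_ideal_gen_star[OF k_closed k_star star(2)])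
    then show ?case using star(1) by simp
  next
    case (smult t y)
    have "t \<odot>\<^bsub>E\<^esub> (y \<ominus>\<^bsub>E\<^esub> g y) \<in> Jk" by (rule S.ideal_smult[OF J.is_ideal smult(2)])
    then show ?case using smult(1) by (simp add: S.smult_diff)
  next
    case (add y z)
    have "(y \<oplus>\<^bsub>E\<^esub> z) \<ominus>\<^bsub>E\<^esub> (g y \<oplus>\<^bsub>E\<^esub> g z) = (y \<ominus>\<^bsub>E\<^esub> g y) \<oplus>\<^bsub>E\<^esub> (z \<ominus>\<^bsub>E\<^esub> g z)"
      using add(1,2) g.hom_closed[OF add(1)] g.hom_closed[OF add(2)] by algebra
    then show ?case using add J.a_closed by simp
  next
    case (mult y z)
    have "y \<otimes>\<^bsub>E\<^esub> z \<ominus>\<^bsub>E\<^esub> g y \<otimes>\<^bsub>E\<^esub> g z = (y \<ominus>\<^bsub>E\<^esub> g y) \<otimes>\<^bsub>E\<^esub> z \<oplus>\<^bsub>E\<^esub> g y \<otimes>\<^bsub>E\<^esub> (z \<ominus>\<^bsub>E\<^esub> g z)"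
      using mult(1,2) g.hom_closed[OF mult(1)] g.hom_closed[OF mult(2)] by algebra
    moreover have "(y \<ominus>\<^bsub>E\<^esub> g y) \<otimes>\<^bsub>E\<^esub> z \<oplus>\<^bsub>E\<^esub> g y \<otimes>\<^bsub>E\<^esub> (z \<ominus>\<^bsub>E\<^esub> g z) \<in> Jk"
      using mult g.hom_closed[OF mult(1)] by (intro J.a_closed J.I_l_closed J.I_r_closed)
    ultimately show ?case using mult(1,2) by simp
  qed
  then show ?thesis by (simp add: g_def)
qed

end

lemma (in quantum_balls) hemisphere_ex:
  assumes signs: "\<sigma> = 1 \<or> \<sigma> = -1" "\<epsilon> = 1 \<or> \<epsilon> = -1" and l: "\<And>j. j \<in> {2..n} \<Longrightarrow> cmod (l j) = 1"
  shows "\<exists>F \<psi>. hemisphere q n \<sigma> \<epsilon> l F \<psi>"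
proof -
  have r: "even_ball_rel q n B (X.sphere_tuple \<sigma> \<epsilon> l)" "sq_sum B (X.sphere_tuple \<sigma> \<epsilon> l) {1..n} = \<one>\<^bsub>B\<^esub>"
    by (rule X.sphere_tuple_rel[OF signs], rule l, assumption)+
  obtain F where F: "star_hom E B F" "\<forall>i\<in>{1..n}. F (w i) = X.sphere_tuple \<sigma> \<epsilon> l i"
    using sphere_hom_ex[OF B_cstar _ r] X.sphere_tuple_closed by blast
  have t: "odd_ball_rel q n E (S.ball_tuple \<epsilon> (\<lambda>j. cnj (l j)))"
    by (rule S.ball_tuple_rel(2)[OF signs(2)]) (simp add: l)
  obtain \<psi> where \<psi>: "star_hom B E \<psi>" "\<forall>i\<in>{1..n}. \<psi> (x i) = S.ball_tuple \<epsilon> (\<lambda>j. cnj (l j)) i"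
    using odd_ball_universal(2)[OF q n E_cstar _ t] S.ball_tuple_closed by blast
  have "hemisphere q n \<sigma> \<epsilon> l F \<psi>"
    by unfold_locales (use signs l F \<psi> in blast)+
  then show ?thesis by blast
qed


section \<open>Gluing the hemispheres\<close>

text \<open>The gluing automorphism is absorbed into the first hemisphere, whose sign \<open>\<epsilon>\<close> and phases \<open>l\<close> are those of \<open>\<beta>\<close>; the
second one is standard.\<close>

locale two_hemispheres = quantum_balls +
  fixes \<epsilon> l F\<^sub>1 \<psi>\<^sub>1 F\<^sub>2 \<psi>\<^sub>2
  assumes up: "hemisphere q n 1 \<epsilon> l F\<^sub>1 \<psi>\<^sub>1" and down: "hemisphere q n (-1) 1 (\<lambda>_. 1) F\<^sub>2 \<psi>\<^sub>2"
begin

sublocale U: hemisphere q n 1 \<epsilon> l F\<^sub>1 \<psi>\<^sub>1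
  by (rule up)

sublocale L: hemisphere q n "-1" 1 "\<lambda>_. 1" F\<^sub>2 \<psi>\<^sub>2
  by (rule down)

text \<open>If both restrictions of \<open>c\<close> vanish, then \<open>c\<close>, and with it \<open>c\<^sup>*\<close>, lies in the ideals of \<open>\<bar>a\<bar> - a\<close> and of \<open>\<bar>a\<bar> + a\<close>, whose
product is zero; so \<open>c\<^sup>*c = 0\<close>.\<close>

lemma hemispheres_injective:
  assumes c: "c \<in> carrier E" and 0: "F\<^sub>1 c = \<zero>\<^bsub>B\<^esub>" "F\<^sub>2 c = \<zero>\<^bsub>B\<^esub>"
  shows "c = \<zero>\<^bsub>E\<^esub>"
proof -
  have k1: "U.k = S.abs_a \<ominus>\<^bsub>E\<^esub> S.a" by (simp add: S.diff_smult)
  have k2: "L.k = S.abs_a \<oplus>\<^bsub>E\<^esub> S.a" by simp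
  have kc: "S.abs_a \<ominus>\<^bsub>E\<^esub> S.a \<in> carrier E" "S.abs_a \<oplus>\<^bsub>E\<^esub> S.a \<in> carrier E" by simp_all
  have ks: "star E (S.abs_a \<ominus>\<^bsub>E\<^esub> S.a) = S.abs_a \<ominus>\<^bsub>E\<^esub> S.a" by (simp add: S.abs_a_star S.a_star)
  have m: "c \<ominus>\<^bsub>E\<^esub> \<zero>\<^bsub>E\<^esub> = c" using c by algebra
  have "c \<in> closed_ideal_gen E (S.abs_a \<ominus>\<^bsub>E\<^esub> S.a)"
    using U.retract_ideal[OF c] unfolding k1 0 U.psi.hom_zero m .
  then have 1: "star E c \<in> closed_ideal_gen E (S.abs_a \<ominus>\<^bsub>E\<^esub> S.a)"
    by (rule S.closed_ideal_gen_star[OF kc(1) ks])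
  have 2: "c \<in> closed_ideal_gen E (S.abs_a \<oplus>\<^bsub>E\<^esub> S.a)"
    using L.retract_ideal[OF c] unfolding k2 0 L.psi.hom_zero m .
  have "star E c \<otimes>\<^bsub>E\<^esub> c = \<zero>\<^bsub>E\<^esub>"
    by (rule S.ideal_products_zero[OF kc _ 1 2]) (rule S.parts_annihilate[OF E_generated])
  then have "(nrm E c)\<^sup>2 = 0" using S.p_star_mult[OF c] by simp
  then show ?thesis using S.nrm_definite[OF c] by simp
qed

lemma hemispheres_isometric:
  assumes c: "c \<in> carrier E" and r: "nrm B (F\<^sub>1 c) \<le> r" "nrm B (F\<^sub>2 c) \<le> r" "0 \<le> r"
  shows "nrm E c \<le> r"
proof (rule jointly_injective_isometric[OF E_cstar B_cstar, of "{F\<^sub>1, F\<^sub>2}" "\<lambda>f. f"])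
  show "star_hom E B f" if "f \<in> {F\<^sub>1, F\<^sub>2}" for f using that U.F_hom L.F_hom by blast
  show "a = \<zero>\<^bsub>E\<^esub>" if "a \<in> carrier E" "\<And>f. f \<in> {F\<^sub>1, F\<^sub>2} \<Longrightarrow> f a = \<zero>\<^bsub>B\<^esub>" for a
    using hemispheres_injective that by blast
qed (use c r in auto)

text \<open>It suffices to compare generators. Over the boundary \<open>s = 0\<close>, so \<open>w\<^sub>1\<close> restricts to \<open>\<i>\<epsilon>x\<^sub>1\<close> on one hemisphere and to
\<open>\<i>x\<^sub>1\<close> on the other.\<close>

lemma boundary_agrees:
  assumes \<beta>: "star_hom I.Q I.Q \<beta>" and c: "c \<in> carrier E"
    and first: "\<beta> (I.\<pi> X.h) = \<epsilon> \<odot>\<^bsub>I.Q\<^esub> I.\<pi> X.h"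
    and rest: "\<And>j. j \<in> {2..n} \<Longrightarrow> \<beta> (I.\<pi> (x j)) = l j \<odot>\<^bsub>I.Q\<^esub> I.\<pi> (x j)"
  shows "I.\<pi> (F\<^sub>1 c) = \<beta> (I.\<pi> (F\<^sub>2 c))"
proof -
  interpret Q: cstar_algebra I.Q by (rule I.quot_cstar)
  interpret pi: star_morphism B I.Q I.\<pi> by unfold_locales (rule I.pi_hom)
  interpret be: star_morphism I.Q I.Q \<beta> by unfold_locales (rule \<beta>)
  show ?thesis
  proof (rule generated_hom_eq[OF E_generated E_cstar I.quot_cstar star_hom_comp[OF U.F_hom I.pi_hom]
        star_hom_comp[OF star_hom_comp[OF L.F_hom I.pi_hom] \<beta>] _ c])
    fix y assume "y \<in> w ` {1..n}"
    then obtain j where j: "j \<in> {1..n}" "y = w j" by blast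
    show "I.\<pi> (F\<^sub>1 y) = \<beta> (I.\<pi> (F\<^sub>2 y))"
    proof (cases "j = 1")
      case True
      then have y: "y = S.W" using j by (simp add: S.W_def)
      have h: "I.\<pi> X.h \<in> carrier I.Q" by (rule pi.hom_closed[OF X.h_closed])
      have e: "I.\<pi> (X.sphere_first \<sigma> t) = (\<i> * t) \<odot>\<^bsub>I.Q\<^esub> I.\<pi> X.h" for \<sigma> t
      proof -
        have "I.\<pi> (X.sphere_first \<sigma> t) = \<sigma> \<odot>\<^bsub>I.Q\<^esub> I.\<pi> X.s \<oplus>\<^bsub>I.Q\<^esub> \<i> \<odot>\<^bsub>I.Q\<^esub> (t \<odot>\<^bsub>I.Q\<^esub> I.\<pi> X.h)"
          unfolding X.sphere_first_def
          by (simp only: pi.hom_add pi.hom_smult X.smult_closed X.s_closed X.h_closed)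
        also have "\<dots> = (\<i> * t) \<odot>\<^bsub>I.Q\<^esub> I.\<pi> X.h" using h by (simp add: pi_s)
        finally show ?thesis .
      qed
      show ?thesis
        unfolding y U.F_W L.F_W e be.hom_smult[OF h] first using h by (simp add: mult.commute)
    next
      case False
      then have j2: "j \<in> {2..n}" using j by auto
      have xc: "x j \<in> carrier B" by (rule x_closed[OF j(1)])
      have "F\<^sub>1 y = l j \<odot>\<^bsub>B\<^esub> x j" "F\<^sub>2 y = x j"
        using U.F_w[OF j(1)] L.F_w[OF j(1)] False j xc by (simp_all add: X.sphere_tuple_def)
      then show ?thesis using rest[OF j2] pi.hom_smult[OF xc] by simp
    qed
  qed
qed

text \<open>The positive part \<open>v = (\<bar>a\<bar> + a)/2\<close> restricts to \<open>s\<close> on the first hemisphere and to \<open>0\<close> on the second.\<close>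

lemma lift_defect_ideal:
  assumes b: "b \<in> carrier B"
  shows "\<exists>c\<in>carrier E. F\<^sub>1 c = b \<otimes>\<^bsub>B\<^esub> X.defect \<and> F\<^sub>2 c = \<zero>\<^bsub>B\<^esub>"
proof
  let ?v = "(1/2) \<odot>\<^bsub>E\<^esub> (S.abs_a \<oplus>\<^bsub>E\<^esub> S.a)"
  let ?c = "\<psi>\<^sub>1 b \<otimes>\<^bsub>E\<^esub> (?v \<otimes>\<^bsub>E\<^esub> ?v)"
  have v: "?v \<in> carrier E" by simp
  have "X.s \<oplus>\<^bsub>B\<^esub> X.s = 2 \<odot>\<^bsub>B\<^esub> X.s" using X.smult_add_left[of X.s 1 1] by simp
  then have v1: "F\<^sub>1 ?v = X.s" by (simp add: U.F_abs_a U.F_a)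
  have "X.s \<oplus>\<^bsub>B\<^esub> (-1) \<odot>\<^bsub>B\<^esub> X.s = X.s \<ominus>\<^bsub>B\<^esub> X.s" by (simp add: X.diff_smult)
  also have "\<dots> = \<zero>\<^bsub>B\<^esub>" by (simp add: X.minus_eq X.r_neg)
  finally have v2: "F\<^sub>2 ?v = \<zero>\<^bsub>B\<^esub>" by (simp add: L.F_abs_a L.F_a)
  show "?c \<in> carrier E" using b by simp
  have 1: "F\<^sub>1 ?c = F\<^sub>1 (\<psi>\<^sub>1 b) \<otimes>\<^bsub>B\<^esub> (F\<^sub>1 ?v \<otimes>\<^bsub>B\<^esub> F\<^sub>1 ?v)"
    by (simp only: U.F.hom_mult v S.m_closed U.psi.hom_closed b)
  have 2: "F\<^sub>2 ?c = F\<^sub>2 (\<psi>\<^sub>1 b) \<otimes>\<^bsub>B\<^esub> (F\<^sub>2 ?v \<otimes>\<^bsub>B\<^esub> F\<^sub>2 ?v)"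
    by (simp only: L.F.hom_mult v S.m_closed U.psi.hom_closed b)
  have "F\<^sub>2 (\<psi>\<^sub>1 b) \<in> carrier B" using b by simp
  then show "F\<^sub>1 ?c = b \<otimes>\<^bsub>B\<^esub> X.defect \<and> F\<^sub>2 ?c = \<zero>\<^bsub>B\<^esub>"
    unfolding 1 2 v1 v2 U.F_psi[OF b] X.s_square by simp
qed

text \<open>The defect ideal consists of limits of elements \<open>b s\<^sup>2\<close>. Their lifts form a Cauchy sequence, because the pair of
restrictions is isometric.\<close>

lemma lift_boundary_zero:
  assumes y: "y \<in> carrier B" "I.\<pi> y = \<zero>\<^bsub>I.Q\<^esub>"
  shows "\<exists>c\<in>carrier E. F\<^sub>1 c = y \<and> F\<^sub>2 c = \<zero>\<^bsub>B\<^esub>"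
proof -
  have "\<exists>b\<in>carrier B. nrm B (y \<ominus>\<^bsub>B\<^esub> b \<otimes>\<^bsub>B\<^esub> X.defect) < (1/2) ^ m" for m :: nat
    using I.J_approx[of y "(1/2) ^ m"] y I.pi_zero_iff[OF y(1)] by auto
  then obtain b where b: "\<And>m. b m \<in> carrier B" "\<And>m. nrm B (y \<ominus>\<^bsub>B\<^esub> b m \<otimes>\<^bsub>B\<^esub> X.defect) < (1/2) ^ m"
    by metis
  obtain c where c: "\<And>m. c m \<in> carrier E" "\<And>m. F\<^sub>1 (c m) = b m \<otimes>\<^bsub>B\<^esub> X.defect" "\<And>m. F\<^sub>2 (c m) = \<zero>\<^bsub>B\<^esub>"
    using lift_defect_ideal[OF b(1)] by metis
  have cauchy: "\<exists>M. \<forall>i\<ge>M. \<forall>j\<ge>M. nrm E (c i \<ominus>\<^bsub>E\<^esub> c j) < e" if e: "0 < e" for e :: real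
  proof -
    obtain M :: nat where M: "(1/2::real) ^ M < e / 4"
      using real_arch_pow_inv[of "e / 4" "1/2"] e by auto
    have "nrm E (c i \<ominus>\<^bsub>E\<^esub> c j) < e" if ij: "M \<le> i" "M \<le> j" for i j
    proof -
      let ?d = "\<lambda>m. b m \<otimes>\<^bsub>B\<^esub> X.defect"
      have d: "?d m \<in> carrier B" for m using b(1) by simp
      have small: "nrm B (y \<ominus>\<^bsub>B\<^esub> ?d m) < e / 4" if "M \<le> m" for m
      proof -
        have "(1/2::real) ^ m \<le> (1/2) ^ M" by (rule power_decreasing[OF that]) simp_all
        then show ?thesis using b(2)[of m] M by linarith
      qed
      have "nrm B (?d i \<ominus>\<^bsub>B\<^esub> ?d j) \<le> nrm B (?d i \<ominus>\<^bsub>B\<^esub> y) + nrm B (y \<ominus>\<^bsub>B\<^esub> ?d j)"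
        by (rule X.p_triangle[OF d y(1) d])
      then have "nrm B (?d i \<ominus>\<^bsub>B\<^esub> ?d j) \<le> e / 2"
        using small[OF ij(1)] small[OF ij(2)] X.p_diff_commute[OF d y(1), of i] by simp
      moreover have "F\<^sub>1 (c i \<ominus>\<^bsub>E\<^esub> c j) = ?d i \<ominus>\<^bsub>B\<^esub> ?d j" "F\<^sub>2 (c i \<ominus>\<^bsub>E\<^esub> c j) = \<zero>\<^bsub>B\<^esub>"
        using c by (simp_all add: X.minus_eq X.r_neg)
      ultimately have "nrm E (c i \<ominus>\<^bsub>E\<^esub> c j) \<le> e / 2"
        using c(1) e by (intro hemispheres_isometric) simp_all
      then show ?thesis using e by simp
    qed
    then show ?thesis by blast
  qed
  obtain z where z: "S.conv c z" using S.conv_of_cauchy[OF c(1) cauchy] by blast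
  have zc: "z \<in> carrier E" by (rule S.convD(2)[OF z])
  have conv_hom: "X.conv (\<lambda>m. F (c m)) (F z)" if F: "star_hom E B F" for F
  proof -
    interpret F: star_morphism E B F by unfold_locales (rule F)
    have "nrm B (F (c m) \<ominus>\<^bsub>B\<^esub> F z) \<le> nrm E (c m \<ominus>\<^bsub>E\<^esub> z)" for m
      using star_hom_contractive[OF E_cstar X.cstar_seminormed_axioms F, of "c m \<ominus>\<^bsub>E\<^esub> z"] c(1) zc by simp
    then have "(\<lambda>m. nrm B (F (c m) \<ominus>\<^bsub>B\<^esub> F z)) \<longlonglongrightarrow> 0"
      by (intro tendsto_0_le[OF S.convD(3)[OF z]]) (use c(1) zc in auto)
    then show ?thesis using c(1) zc by (simp add: X.conv_def)
  qed
  have "(\<lambda>m. nrm B (y \<ominus>\<^bsub>B\<^esub> b m \<otimes>\<^bsub>B\<^esub> X.defect)) \<longlonglongrightarrow> 0"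
    by (rule tendsto_0_le[OF LIMSEQ_realpow_zero[of "1/2"]]) (use b y(1) in \<open>auto intro: less_imp_le\<close>)
  then have "X.conv (\<lambda>m. F\<^sub>1 (c m)) y"
    unfolding c(2) X.conv_def using b(1) y(1) X.p_diff_commute[OF y(1)] by simp
  then have "F\<^sub>1 z = y" by (rule X.conv_unique[OF conv_hom[OF U.F_hom]])
  moreover have "X.conv (\<lambda>m. F\<^sub>2 (c m)) \<zero>\<^bsub>B\<^esub>" unfolding c(3) by (rule X.conv_const) simp
  then have "F\<^sub>2 z = \<zero>\<^bsub>B\<^esub>" by (rule X.conv_unique[OF conv_hom[OF L.F_hom]])
  ultimately show ?thesis using zc by blast
qed

text \<open>Two elements of the ball that are compatible over the boundary come from the sphere: after
  subtracting the fold of the second one, the first lies in the defect ideal.\<close>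

lemma hemispheres_surjective:
  assumes \<beta>: "star_hom I.Q I.Q \<beta>" and first: "\<beta> (I.\<pi> X.h) = \<epsilon> \<odot>\<^bsub>I.Q\<^esub> I.\<pi> X.h"
    and rest: "\<And>j. j \<in> {2..n} \<Longrightarrow> \<beta> (I.\<pi> (x j)) = l j \<odot>\<^bsub>I.Q\<^esub> I.\<pi> (x j)"
    and y: "y \<in> carrier B" and y': "y' \<in> carrier B" and match: "I.\<pi> y = \<beta> (I.\<pi> y')"
  shows "\<exists>c\<in>carrier E. F\<^sub>1 c = y \<and> F\<^sub>2 c = y'"
proof -
  interpret Q: cstar_algebra I.Q by (rule I.quot_cstar)
  interpret pi: star_morphism B I.Q I.\<pi> by unfold_locales (rule I.pi_hom)
  define g where "g = \<psi>\<^sub>2 y'"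
  have gc: "g \<in> carrier E" and F2g: "F\<^sub>2 g = y'" using y' L.F_psi[OF y'] by (simp_all add: g_def)
  have c1: "F\<^sub>1 g \<in> carrier B" using gc by simp
  have "I.\<pi> (F\<^sub>1 g) = I.\<pi> y" using boundary_agrees[OF \<beta> gc first rest] by (simp add: F2g match)
  then have "I.\<pi> (y \<ominus>\<^bsub>B\<^esub> F\<^sub>1 g) = \<zero>\<^bsub>I.Q\<^esub>"
    using pi.hom_minus[OF y c1] pi.hom_closed[OF y] by (simp add: Q.minus_eq Q.r_neg)
  then obtain c where c: "c \<in> carrier E" "F\<^sub>1 c = y \<ominus>\<^bsub>B\<^esub> F\<^sub>1 g" "F\<^sub>2 c = \<zero>\<^bsub>B\<^esub>"
    using lift_boundary_zero[of "y \<ominus>\<^bsub>B\<^esub> F\<^sub>1 g"] y c1 by auto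
  have "(y \<ominus>\<^bsub>B\<^esub> F\<^sub>1 g) \<oplus>\<^bsub>B\<^esub> F\<^sub>1 g = y" using y c1 by algebra
  then have "F\<^sub>1 (c \<oplus>\<^bsub>E\<^esub> g) = y" "F\<^sub>2 (c \<oplus>\<^bsub>E\<^esub> g) = y'" using c gc y' by (simp_all add: F2g)
  then show ?thesis using c(1) gc by (intro bexI[of _ "c \<oplus>\<^bsub>E\<^esub> g"]) simp_all
qed

lemma glued_iso:
  assumes \<beta>: "star_hom I.Q I.Q \<beta>" and first: "\<beta> (I.\<pi> X.h) = \<epsilon> \<odot>\<^bsub>I.Q\<^esub> I.\<pi> X.h"
    and rest: "\<And>j. j \<in> {2..n} \<Longrightarrow> \<beta> (I.\<pi> (x j)) = l j \<odot>\<^bsub>I.Q\<^esub> I.\<pi> (x j)"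
  shows "star_iso E (glued_sphere q n \<beta>) (\<lambda>c. (F\<^sub>1 c, F\<^sub>2 c))"
proof -
  let ?\<phi> = "\<lambda>c. (F\<^sub>1 c, F\<^sub>2 c)"
  have car: "carrier (glued_sphere q n \<beta>) =
      {(y, y'). y \<in> carrier B \<and> y' \<in> carrier B \<and> I.\<pi> y = \<beta> (I.\<pi> y')}"
    by (simp add: glued_sphere_def odd_proj_eq)
  have into: "?\<phi> c \<in> carrier (glued_sphere q n \<beta>)" if c: "c \<in> carrier E" for c
    unfolding car using boundary_agrees[OF \<beta> c first rest] c by simp
  have "star_hom E (glued_sphere q n \<beta>) ?\<phi>"
    unfolding star_hom_def ring_hom_def using into
    by (auto simp: glued_sphere_def cstar_sum_def)
  moreover have "inj_on ?\<phi> (carrier E)"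
  proof (rule inj_onI)
    fix c d assume cd: "c \<in> carrier E" "d \<in> carrier E" and eq: "?\<phi> c = ?\<phi> d"
    have "F\<^sub>1 (c \<ominus>\<^bsub>E\<^esub> d) = \<zero>\<^bsub>B\<^esub>" "F\<^sub>2 (c \<ominus>\<^bsub>E\<^esub> d) = \<zero>\<^bsub>B\<^esub>" using cd eq by (simp_all add: X.diff_0_iff)
    then have "c \<ominus>\<^bsub>E\<^esub> d = \<zero>\<^bsub>E\<^esub>" using cd by (intro hemispheres_injective) simp_all
    then show "c = d" using cd by (simp add: S.diff_0_iff)
  qed
  moreover have "carrier (glued_sphere q n \<beta>) \<subseteq> ?\<phi> ` carrier E"
  proof
    fix p assume "p \<in> carrier (glued_sphere q n \<beta>)"
    then obtain y y' where p: "p = (y, y')" and y: "y \<in> carrier B" "y' \<in> carrier B" "I.\<pi> y = \<beta> (I.\<pi> y')"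
      unfolding car by blast
    obtain c where c: "c \<in> carrier E" "F\<^sub>1 c = y" "F\<^sub>2 c = y'" using hemispheres_surjective[OF \<beta> first rest y] by blast
    show "p \<in> ?\<phi> ` carrier E" by (rule image_eqI[OF _ c(1)]) (simp add: p c)
  qed
  ultimately show ?thesis unfolding star_iso_def bij_betw_def using into by blast
qed

end

theorem proposition6p1:
  fixes q :: real and n :: nat and l :: "nat \<Rightarrow> complex"
    and \<beta> :: "nat univ_elem set \<Rightarrow> nat univ_elem set"
  assumes "0 < q" and "q < 1" and "1 \<le> n"
    and "\<forall>j \<in> {2..n}. cmod (l j) = 1"
    and "star_iso (odd_boundary q n) (odd_boundary q n) \<beta>"
    and "(form_A q n l \<beta> \<and> f1 = f_one_A q n) \<or> (form_B q n l \<beta> \<and> f1 = f_one_B q n)"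
  shows "\<exists>\<phi>. star_iso (even_boundary q n) (glued_sphere q n \<beta>) \<phi> \<and>
    \<phi> (w_gen q n 1) = f_zero q n \<oplus>\<^bsub>glued_sphere q n \<beta>\<^esub> (\<i> \<odot>\<^bsub>glued_sphere q n \<beta>\<^esub> f1) \<and>
    (\<forall>k \<in> {2..n}. \<phi> (w_gen q n k) = f_gen q n l k)"
proof -
  interpret quantum_balls q n by unfold_locales fact+
  interpret Q: cstar_algebra I.Q by (rule I.quot_cstar)
  interpret pi: star_morphism B I.Q I.\<pi> by unfold_locales (rule I.pi_hom)
  have h: "I.\<pi> X.h \<in> carrier I.Q" by (rule pi.hom_closed[OF X.h_closed])
  have \<beta>: "star_hom I.Q I.Q \<beta>" using assms(5) by (simp add: star_iso_def odd_boundary_eq)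
  have rest: "\<beta> (I.\<pi> (x j)) = l j \<odot>\<^bsub>I.Q\<^esub> I.\<pi> (x j)" if "j \<in> {2..n}" for j
    using assms(6) that by (auto simp: form_A_def form_B_def t_gen_eq odd_boundary_eq)
  have "\<exists>\<epsilon>. (\<epsilon> = 1 \<or> \<epsilon> = -1) \<and> \<beta> (I.\<pi> X.h) = \<epsilon> \<odot>\<^bsub>I.Q\<^esub> I.\<pi> X.h \<and> f1 = (\<epsilon> \<odot>\<^bsub>B\<^esub> X.h, X.h)"
    using assms(6)
  proof
    assume "form_A q n l \<beta> \<and> f1 = f_one_A q n"
    then show ?thesis
      using h X.h_closed
      by (intro exI[of _ 1]) (simp add: form_A_def f_one_A_def t_gen_eq X.h_def)
  next
    assume "form_B q n l \<beta> \<and> f1 = f_one_B q n"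
    then show ?thesis
      using h X.h_closed
      by (intro exI[of _ "-1"]) (simp add: form_B_def f_one_B_def t_gen_eq odd_boundary_eq
          Q.minus_smult X.minus_smult X.h_def)
  qed
  then obtain \<epsilon> where \<epsilon>: "\<epsilon> = 1 \<or> \<epsilon> = -1" "\<beta> (I.\<pi> X.h) = \<epsilon> \<odot>\<^bsub>I.Q\<^esub> I.\<pi> X.h" "f1 = (\<epsilon> \<odot>\<^bsub>B\<^esub> X.h, X.h)"
    by blast
  obtain F\<^sub>1 \<psi>\<^sub>1 where up: "hemisphere q n 1 \<epsilon> l F\<^sub>1 \<psi>\<^sub>1"
    using hemisphere_ex[of 1 \<epsilon> l] \<epsilon>(1) assms(4) by blast
  obtain F\<^sub>2 \<psi>\<^sub>2 where down: "hemisphere q n (-1) 1 (\<lambda>_. 1) F\<^sub>2 \<psi>\<^sub>2"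
    using hemisphere_ex[of "-1" 1 "\<lambda>_. 1"] by auto
  interpret two_hemispheres q n \<epsilon> l F\<^sub>1 \<psi>\<^sub>1 F\<^sub>2 \<psi>\<^sub>2
    by (rule two_hemispheres.intro[OF quantum_balls_axioms two_hemispheres_axioms.intro[OF up down]])
  let ?\<phi> = "\<lambda>c. (F\<^sub>1 c, F\<^sub>2 c)"
  have "star_iso E (glued_sphere q n \<beta>) ?\<phi>" by (rule glued_iso[OF \<beta> \<epsilon>(2) rest])
  moreover have "?\<phi> (w 1) = f_zero q n \<oplus>\<^bsub>glued_sphere q n \<beta>\<^esub> (\<i> \<odot>\<^bsub>glued_sphere q n \<beta>\<^esub> f1)"
  proof -
    have "f_zero q n = (X.s, (-1) \<odot>\<^bsub>B\<^esub> X.s)"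
      by (simp add: f_zero_def Let_def odd_defect_eq X.minus_smult flip: X.s_def)
    then have "f_zero q n \<oplus>\<^bsub>glued_sphere q n \<beta>\<^esub> (\<i> \<odot>\<^bsub>glued_sphere q n \<beta>\<^esub> f1) =
        (X.sphere_first 1 \<epsilon>, X.sphere_first (-1) 1)"
      by (simp add: \<epsilon>(3) glued_sphere_def cstar_sum_def X.sphere_first_def)
    then show ?thesis using U.F_W L.F_W unfolding S.W_def by simp
  qed
  moreover have "?\<phi> (w k) = f_gen q n l k" if k: "k \<in> {2..n}" for k
  proof -
    have "k \<in> {1..n}" "x k \<in> carrier B" using k x_closed by auto
    then show ?thesis using U.F_w[of k] L.F_w[of k] k by (simp add: X.sphere_tuple_def f_gen_def)
  qed
  ultimately show ?thesis by blast
qed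

end
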